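(* Suppose Assumptions 1 and 2 (stated in the context) hold and $\mathbb{E}[|Y_i|^{2+\delta}\mid X_i]$ is bounded almost surely for some $\delta>0$. Let $\hat\mu_{\mathrm d}(x)$ be the debiased Mondrian random forest estimator of debiasing order $J\ge0$ with base lifetime $\lambda=\lambda_n$ and $B=B_n$ trees in each forest, and let $\tilde\Sigma_{\mathrm d}(x)=\frac{n}{\lambda^d}\mathrm{Var}[\hat\mu_{\mathrm d}(x)\mid\mathbf{X},\mathbf{T}]$. Then $$\sup_{t\in\mathbb{R}}\left|\mathbb{P}\left(\sqrt{\frac{n}{\lambda^d}}\,\frac{\hat\mu_{\mathrm d}(x)-\mathbb{E}[\hat\mu_{\mathrm d}(x)\mid\mathbf{X},\mathbf{T}]}{\sqrt{\tilde\Sigma_{\mathrm d}(x)}}\le t\right)-\Phi(t)\right|\lesssim\left(\frac{\lambda^d}{n}\right)^{\frac{1\wedge\delta}{2}}+\frac1B,$$ where $\Phi$ is the standard normal distribution function and $0/0=0$ on the event $\tilde\Sigma_{\mathrm d}(x)=0$.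
   Context: Notation. $\mathbb{N}=\{0,1,2,\dots\}$; $a\wedge b$ and $a\vee b$ are minimum and maximum. For non-negative sequences, $a_n\lesssim b_n$ (equivalently $b_n\gtrsim a_n$) means $a_n/b_n$ is bounded over $n\ge1$ (the bound may depend on fixed quantities such as $d$, $x$, $J$, $a_r$, $\delta$, the law of the data and the sequences $\lambda_n,B_n$, but not on $n$). $\mathbb{I}$ denotes an indicator. Hölder classes. For $\beta>0$ let $\underline{\beta}=\lceil\beta-1\rceil$ be the largest integer strictly less than $\beta$. Write $g\in\mathcal{H}^\beta$ if $g:[0,1]^d\to\mathbb{R}$ is $\underline\beta$ times differentiable and, for some $C>0$, $\max_{|\nu|=\underline\beta}|\partial^\nu g(x)-\partial^\nu g(x')|\le C\|x-x'\|_2^{\beta-\underline\beta}$ for all $x,x'\in[0,1]^d$ ($\nu\in\mathbb{N}^d$ a multi-index). Assumption 1 (data). Fix $d\ge1$. $(X_i,Y_i)$, $1\le i\le n$, are i.i.d. from a distribution on $\mathbb{R}^d\times\mathbb{R}$; $\mathbf{X}=(X_1,\dots,X_n)$. $X_i$ has a Lebesgue density $f$ on $[0,1]^d$, bounded away from zero, with $f\in\mathcal{H}^{\beta_f}$ for some $\beta_f>0$. $\mathbb{E}[Y_i^2\mid X_i]$ is bounded, $\mu(X_i)=\mathbb{E}[Y_i\mid X_i]$ with $\mu\in\mathcal{H}^{\beta_\mu}$, $\beta_\mu>0$. With $\varepsilon_i=Y_i-\mu(X_i)$, $\sigma^2(X_i)=\mathbb{E}[\varepsilon_i^2\mid X_i]$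 is bounded away from zero with $\sigma^2\in\mathcal{H}^{\beta_\sigma}$, $\beta_\sigma>0$. Set $\beta=\beta_\mu\wedge(\beta_f+1)$. Mondrian process $\mathcal{M}([0,1]^d,\lambda)$. For a rectangle $D=\prod_j[l_j,u_j]\subseteq[0,1]^d$ let $|D_j|=u_j-l_j$, $|D|=\prod_j|D_j|$, $|D|_1=\sum_j|D_j|$. Start at time $0$ with the trivial partition of $[0,1]^d$. For each cell $D$, formed at time $t_D$, sample $E_D\sim\mathrm{Exp}(|D|_1)$ (rate $|D|_1$) independently. If $t_D+E_D\le\lambda$, split $D$: choose coordinate $K$ with $\mathbb{P}(K=j)=|D_j|/|D|_1$ and location $S\sim\mathrm{Unif}[l_K,u_K]$, producing cells $\{x\in D:x_K\le S\}$ and $\{x\in D:x_K>S\}$, each formed at time $t_D+E_D$. The output $T$ is the partition consisting of the cells not split (those with $t_D+E_D>\lambda$); $T(x)$ is the cell containing $x$. Debiased Mondrian random forest. Fix an integer $J\ge0$ and distinct constants $a_0,\dots,a_J>0$ (not depending on $n$). Let $\omega_0,\dots,\omega_J\in\mathbb{R}$ be the unique solution of $\sum_{r=0}^J\omega_r=1$ and $\sum_{r=0}^J\omega_ra_r^{-2s}=0$ for $1\le s\le J$. Let $T_{br}\sim\mathcal{M}([0,1]^d,a_r\lambda)$, $1\le b\le B$, $0\le r\le J$, be mutually independent and independent of the data; $\mathbf{T}$ is the collection of all these trees. With $N_{br}(x)=\sum_{i=1}^n\mathbb{I}\{X_i\in T_{br}(x)\}$ and $0/0=0$, $\hat\mu_{\mathrm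 d}(x)=\sum_{r=0}^J\omega_r\frac1B\sum_{b=1}^B\frac{\sum_{i=1}^nY_i\,\mathbb{I}\{X_i\in T_{br}(x)\}}{N_{br}(x)}$. Assumption 2 (estimator). $x\in(0,1)^d$ is a fixed point; $\lambda=\lambda_n>0$ and $B=B_n\ge1$ satisfy $\lambda\gtrsim(\log n)^3$, $n/\lambda^d\to\infty$, and $B\gtrsim(\log n)^d$. The dimension $d$ does not depend on $n$. *)

theory Defs
  imports "HOL-Probability.Probability" "HOL-Probability.Tree_Space"
begin

(* Quantifying over n >= 1 rather than asking for an eventual bound makes this differ from
   membership in O(b). The form a \<le> C b is the boundedness of a / b wherever b > 0. *)
definition lesssim :: "(nat \<Rightarrow> real) \<Rightarrow> (nat \<Rightarrow> real) \<Rightarrow> bool" where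
  "lesssim a b \<longleftrightarrow> (\<exists>C. \<forall>n\<ge>1. a n \<le> C * b n)"

(* D \<nu> is the partial derivative of g for the multi-index \<nu>. Derivatives are taken within
   the cube, hence are one-sided on its boundary; they are unique there, so D is determined
   by g on the cube for every order up to k. *)
definition holder_class :: "real \<Rightarrow> (real ^ 'd \<Rightarrow> real) \<Rightarrow> bool" where
  "holder_class \<beta> g \<longleftrightarrow> (let k = nat \<lceil>\<beta> - 1\<rceil> in
     \<exists>D :: ('d \<Rightarrow> nat) \<Rightarrow> real ^ 'd \<Rightarrow> real.
       (\<forall>x\<in>cbox 0 1. D (\<lambda>_. 0) x = g x) \<and>
       (\<forall>\<nu>. sum \<nu> UNIV < k \<longrightarrow> (\<forall>x\<in>cbox 0 1.
          (D \<nu> has_derivative (\<lambda>h. \<Sum>j\<in>UNIV. D (\<nu>(j := Suc (\<nu> j))) x * h $ j)) (at x within cbox 0 1))) \<and>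
       (\<exists>C>0. \<forall>\<nu>. sum \<nu> UNIV = k \<longrightarrow> (\<forall>x\<in>cbox 0 1. \<forall>x'\<in>cbox 0 1.
          \<bar>D \<nu> x - D \<nu> x'\<bar> \<le> C * norm (x - x') powr (\<beta> - real k))))"

definition cond_var :: "'a measure \<Rightarrow> 'a measure \<Rightarrow> ('a \<Rightarrow> real) \<Rightarrow> 'a \<Rightarrow> real" where
  "cond_var M F Z = real_cond_exp M F (\<lambda>\<omega>. (Z \<omega> - real_cond_exp M F Z \<omega>)\<^sup>2)"


(* P is the law of a pair (X, Y). Bounds on conditional moments are stated with nn_cond_exp,
   which is meaningful without presupposing integrability. *)

abbreviation covariate_algebra :: "((real ^ 'd) \<times> real) measure \<Rightarrow> ((real ^ 'd) \<times> real) measure" where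
  "covariate_algebra P \<equiv> vimage_algebra (space P) fst borel"

definition cond_abs_moment_bounded :: "((real ^ 'd) \<times> real) measure \<Rightarrow> real \<Rightarrow> bool" where
  "cond_abs_moment_bounded P p \<longleftrightarrow>
     (\<exists>C::real. AE z in P. nn_cond_exp P (covariate_algebra P) (\<lambda>z. ennreal (\<bar>snd z\<bar> powr p)) z \<le> ennreal C)"

definition regression_law ::
  "((real ^ 'd) \<times> real) measure \<Rightarrow> (real ^ 'd \<Rightarrow> real) \<Rightarrow> (real ^ 'd \<Rightarrow> real) \<Rightarrow> (real ^ 'd \<Rightarrow> real) \<Rightarrow>
   real \<Rightarrow> real \<Rightarrow> real \<Rightarrow> bool" where
  "regression_law P f \<mu> \<sigma>2 \<beta>\<^sub>f \<beta>\<^sub>\<mu> \<beta>\<^sub>\<sigma> \<longleftrightarrow>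
     prob_space P \<and> sets P = sets borel \<and>
     distributed P lborel fst (\<lambda>x. ennreal (f x) * indicator (cbox 0 1) x) \<and>
     (\<exists>c>0. \<forall>x\<in>cbox 0 1. c \<le> f x) \<and> \<beta>\<^sub>f > 0 \<and> holder_class \<beta>\<^sub>f f \<and>
     cond_abs_moment_bounded P 2 \<and>
     (AE z in P. real_cond_exp P (covariate_algebra P) snd z = \<mu> (fst z)) \<and>
     \<beta>\<^sub>\<mu> > 0 \<and> holder_class \<beta>\<^sub>\<mu> \<mu> \<and>
     (AE z in P. real_cond_exp P (covariate_algebra P) (\<lambda>z. (snd z - \<mu> (fst z))\<^sup>2) z = \<sigma>2 (fst z)) \<and>
     (\<exists>c>0. \<forall>x\<in>cbox 0 1. c \<le> \<sigma>2 x) \<and> \<beta>\<^sub>\<sigma> > 0 \<and> holder_class \<beta>\<^sub>\<sigma> \<sigma>2"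


(* A realisation of the Mondrian process is stored as the finite tree of its splits: a node
   labelled (k, s) splits its cell at location s along coordinate k, and leaves are the cells
   of the output partition. *)

type_synonym 'd mondrian_tree = "('d \<times> real) tree"

abbreviation tree_space :: "'d mondrian_tree measure" where
  "tree_space \<equiv> tree_sigma (count_space UNIV \<Otimes>\<^sub>M borel)"

fun tree_cell :: "(real ^ 'd) set \<Rightarrow> 'd mondrian_tree \<Rightarrow> real ^ 'd \<Rightarrow> (real ^ 'd) set" where
  "tree_cell D Leaf x = D"
| "tree_cell D (Node L (k, s) R) x =
     (if x $ k \<le> s then tree_cell {y \<in> D. y $ k \<le> s} L x else tree_cell {y \<in> D. y $ k > s} R x)"

(* The cell has corners l, u. Truncation at 0 only matters for split locations outside the
   support of the uniform law, where it keeps the kernels below sub-probabilities. *)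
definition side_length :: "real ^ 'd \<Rightarrow> real ^ 'd \<Rightarrow> 'd \<Rightarrow> real" where
  "side_length l u j = max 0 (u $ j - l $ j)"

definition total_length :: "real ^ 'd \<Rightarrow> real ^ 'd \<Rightarrow> real" where
  "total_length l u = (\<Sum>j\<in>UNIV. side_length l u j)"

definition set_coord :: "real ^ 'd \<Rightarrow> 'd \<Rightarrow> real \<Rightarrow> real ^ 'd" where
  "set_coord v k s = (\<chi> j. if j = k then s else v $ j)"

(* Law of the tree grown inside the cell with corners l, u formed at time t, restricted to
   the event that this tree has height less than m: a sub-probability that increases with m.
   Only finitely many splits occur before any fixed time almost surely, so the supremum
   over m is a probability measure. *)
primrec mondrian_upto :: "real \<Rightarrow> nat \<Rightarrow> real ^ 'd \<Rightarrow> real ^ 'd \<Rightarrow> real \<Rightarrow> 'd mondrian_tree measure" where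
  "mondrian_upto lam 0 l u t = null_measure tree_space"
| "mondrian_upto lam (Suc m) l u t =
     do {
       e \<leftarrow> density lborel (\<lambda>e. ennreal (exponential_density (total_length l u) e));
       if t + e \<le> lam then
         do {
           k \<leftarrow> density (count_space UNIV) (\<lambda>k. ennreal (side_length l u k / total_length l u));
           s \<leftarrow> uniform_measure lborel {l $ k..u $ k};
           L \<leftarrow> mondrian_upto lam m l (set_coord u k s) (t + e);
           R \<leftarrow> mondrian_upto lam m (set_coord l k s) u (t + e);
           return tree_space (Node L (k, s) R)
         }
       else return tree_space Leaf
     }"

definition mondrian :: "real \<Rightarrow> ('d::finite) mondrian_tree measure" where
  "mondrian lam = (SUP m. mondrian_upto lam m 0 1 0)"


definition tree_estimator ::
  "nat \<Rightarrow> (nat \<Rightarrow> real ^ 'd) \<Rightarrow> (nat \<Rightarrow> real) \<Rightarrow> 'd mondrian_tree \<Rightarrow> real ^ 'd \<Rightarrow> real" where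
  "tree_estimator n X Y T x =
     (\<Sum>i=1..n. Y i * indicator (tree_cell (cbox 0 1) T x) (X i)) /
     (\<Sum>i=1..n. indicator (tree_cell (cbox 0 1) T x) (X i))"

definition debiased_forest ::
  "nat \<Rightarrow> nat \<Rightarrow> nat \<Rightarrow> (nat \<Rightarrow> real) \<Rightarrow> (nat \<Rightarrow> real ^ 'd) \<Rightarrow> (nat \<Rightarrow> real) \<Rightarrow>
   (nat \<Rightarrow> nat \<Rightarrow> 'd mondrian_tree) \<Rightarrow> real ^ 'd \<Rightarrow> real" where
  "debiased_forest n B J w X Y T x =
     (\<Sum>r=0..J. w r * ((1 / real B) * (\<Sum>b=1..B. tree_estimator n X Y (T b r) x)))"

definition debiasing_weights :: "nat \<Rightarrow> (nat \<Rightarrow> real) \<Rightarrow> (nat \<Rightarrow> real) \<Rightarrow> bool" where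
  "debiasing_weights J a w \<longleftrightarrow>
     (\<Sum>r=0..J. w r) = 1 \<and> (\<forall>s\<in>{1..J}. (\<Sum>r=0..J. w r * a r powi (- 2 * int s)) = 0)"

abbreviation tree_tuple_space :: "nat \<Rightarrow> nat \<Rightarrow> (nat \<times> nat \<Rightarrow> 'd mondrian_tree) measure" where
  "tree_tuple_space B J \<equiv> PiM ({1..B} \<times> {0..J}) (\<lambda>_. tree_space)"

definition tree_tuple ::
  "nat \<Rightarrow> nat \<Rightarrow> (nat \<Rightarrow> nat \<Rightarrow> 'w \<Rightarrow> 'd mondrian_tree) \<Rightarrow> 'w \<Rightarrow> (nat \<times> nat \<Rightarrow> 'd mondrian_tree)" where
  "tree_tuple B J T \<omega> = (\<lambda>(b, r)\<in>{1..B} \<times> {0..J}. T b r \<omega>)"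

definition forest_sample ::
  "'w measure \<Rightarrow> ((real ^ 'd) \<times> real) measure \<Rightarrow> nat \<Rightarrow> nat \<Rightarrow> nat \<Rightarrow> (nat \<Rightarrow> real) \<Rightarrow> real \<Rightarrow>
   (nat \<Rightarrow> 'w \<Rightarrow> real ^ 'd) \<Rightarrow> (nat \<Rightarrow> 'w \<Rightarrow> real) \<Rightarrow> (nat \<Rightarrow> nat \<Rightarrow> 'w \<Rightarrow> 'd mondrian_tree) \<Rightarrow> bool" where
  "forest_sample M P n B J a lam X Y T \<longleftrightarrow>
     prob_space M \<and>
     (\<forall>i\<in>{1..n}. distr M borel (\<lambda>\<omega>. (X i \<omega>, Y i \<omega>)) = P) \<and>
     prob_space.indep_vars M (\<lambda>_. borel) (\<lambda>i \<omega>. (X i \<omega>, Y i \<omega>)) {1..n} \<and>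
     (\<forall>b\<in>{1..B}. \<forall>r\<in>{0..J}. distr M tree_space (T b r) = mondrian (a r * lam)) \<and>
     prob_space.indep_vars M (\<lambda>_. tree_space) (\<lambda>(b, r). T b r) ({1..B} \<times> {0..J}) \<and>
     prob_space.indep_set M
       (sets (vimage_algebra (space M) (\<lambda>\<omega>. \<lambda>i\<in>{1..n}. (X i \<omega>, Y i \<omega>)) (PiM {1..n} (\<lambda>_. borel))))
       (sets (vimage_algebra (space M) (tree_tuple B J T) (tree_tuple_space B J)))"

definition design_algebra ::
  "'w measure \<Rightarrow> nat \<Rightarrow> nat \<Rightarrow> nat \<Rightarrow> (nat \<Rightarrow> 'w \<Rightarrow> real ^ 'd) \<Rightarrow>
   (nat \<Rightarrow> nat \<Rightarrow> 'w \<Rightarrow> 'd mondrian_tree) \<Rightarrow> 'w measure" where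
  "design_algebra M n B J X T =
     vimage_algebra (space M) (\<lambda>\<omega>. (\<lambda>i\<in>{1..n}. X i \<omega>, tree_tuple B J T \<omega>))
       (PiM {1..n} (\<lambda>_. borel) \<Otimes>\<^sub>M tree_tuple_space B J)"

end

(* Conditionally on covariates and trees the centred estimator is a weighted sum of independent
   residuals, which can be realised as functions of independent uniform variables by conditional
   quantiles. Exchanging the summands one by one for Gaussians, with an induction on the number of
   summands to control the distance already accumulated, gives a Berry-Esseen bound for it of order
   (max |S_i| / sqrt (sum S_i^2))^d with d = min 1 delta, where S_i are the weights.

   Put r = lam^D / n. Every weight is at most the average W of 1 / max 1 N over the trees, N being the
   number of covariates in the cell of x. Chebyshev's inequality gives E W <= C r, once the expected
   inverse volume of the cell is known to be O(lam^D). This follows from the joint Laplace transform of the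
   distances of x to the faces of its cell, bounded by the backward equation of the Mondrian process.
   The sum of S_i^2 is bounded below by Cauchy-Schwarz on a cube of side K / lam around x, since the
   weights sum to 1 up to the trees with an empty cell and the trees whose cell leaves the cube.
   Chebyshev's inequality for the number of the latter is the source of the term 1 / B. *)
theory Submission
  imports Defs "HOL-Real_Asymp.Real_Asymp"
begin

section \<open>Mondrian trees\<close>

text \<open>Both W and the sum of squares are of order r, so the Berry-Esseen ratio is of order sqrt
  r; this is the origin of the power \<open>d / 2\<close>. As d <= 1, the d-th power of W / r is at
  most 1 + W / r, and a bound for the expectation of W is enough. The debiasing weights may be
  negative, so trees with a large cell could cancel the mass of the others. A constant H is
  therefore taken so large that a tree leaves the cube of half-side H / lam with probability at most
  1 / (8 * sum |w r|). Outside a rare event at least half of the total weight then lies in the cube.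
  Conditional expectations given the design are determined only up to null sets. Writing the
  responses as functions of the design and of independent uniform variables turns them into
  integrals that make sense at each fixed design, where the Berry-Esseen bound applies. For the
  Mondrian process all estimates are upper bounds of integrals of nonnegative functions, so they can
  be proved for trees of bounded height and passed to the supremum. If r > 1, the claimed bound
  exceeds 1 and is trivial.\<close>

lemma exponential_kernel_measurable:
  "(\<lambda>L. density lborel (\<lambda>e. ennreal (exponential_density L e))) \<in> borel \<rightarrow>\<^sub>M subprob_algebra borel"
proof (rule measurable_subprob_algebra)
  fix L :: real
  show "subprob_space (density lborel (\<lambda>e. ennreal (exponential_density L e)))"
  proof (cases "L > 0")
    case True
    then show ?thesis by (intro prob_space_imp_subprob_space prob_space_exponential_density)
  next
    case False
    \<comment> \<open>For a rate L <= 0 the density is nonpositive, \<open>ennreal\<close> truncates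
      it to 0 and the kernel is the null measure. This makes it a sub-probability kernel on all of
      the real line.\<close>
    then have "ennreal (exponential_density L e) = 0" for e
      by (auto simp: exponential_density_def ennreal_neg mult_nonpos_nonneg)
    then show ?thesis by (intro subprob_spaceI) (auto simp: emeasure_density)
  qed
next
  fix A :: "real set" assume [measurable]: "A \<in> sets borel"
  have "(\<lambda>L. \<integral>\<^sup>+e. ennreal (exponential_density L e) * indicator A e \<partial>lborel) \<in> borel_measurable borel"
    unfolding exponential_density_def by measurable
  then show "(\<lambda>L. emeasure (density lborel (\<lambda>e. ennreal (exponential_density L e))) A) \<in> borel_measurable borel"
    by (simp add: emeasure_density exponential_density_def)
qed simp

lemma uniform_kernel_measurable:
  "(\<lambda>(a::real, b). uniform_measure lborel {a..b}) \<in> borel \<Otimes>\<^sub>M borel \<rightarrow>\<^sub>M subprob_algebra borel"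
proof (rule measurable_subprob_algebra)
  fix p :: "real \<times> real"
  show "subprob_space (case p of (a, b) \<Rightarrow> uniform_measure lborel {a..b})"
  proof (cases "fst p < snd p")
    case True
    then show ?thesis
      by (intro prob_space_imp_subprob_space) (auto simp: split_beta intro!: prob_space_uniform_measure)
  next
    case False
    \<comment> \<open>An empty or one-point interval gives the density indicator / 0, which is
      infinite on a null set at most; the kernel is again the null measure.\<close>
    then have "emeasure lborel {fst p..snd p} = 0" by (cases "fst p = snd p") auto
    then show ?thesis
      by (intro subprob_spaceI) (auto simp: split_beta uniform_measure_def emeasure_density
          nn_integral_cmult_indicator mult.commute[of _ "\<top>"] divide_ennreal_def)
  qed
next
  fix A :: "real set" assume [measurable]: "A \<in> sets borel"
  have "(\<lambda>p. \<integral>\<^sup>+s. (if fst p \<le> s \<and> s \<le> snd p then inverse (ennreal (snd p - fst p)) else 0) * indicator A s \<partial>lborel)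
     \<in> borel_measurable (borel \<Otimes>\<^sub>M borel)"
    by measurable
  moreover have "(if a \<le> s \<and> s \<le> b then inverse (ennreal (b - a)) else 0) = indicator {a..b} s / emeasure lborel {a..b}" for a b s :: real
    by (auto simp: divide_ennreal_def)
  ultimately show "(\<lambda>p. emeasure (case p of (a, b) \<Rightarrow> uniform_measure lborel {a..b}) A) \<in> borel_measurable (borel \<Otimes>\<^sub>M borel)"
    by (simp add: uniform_measure_def emeasure_density split_beta)
qed auto

lemma side_length_nonneg: "0 \<le> side_length l u k"
  by (simp add: side_length_def)

lemma total_length_nonneg: "0 \<le> total_length l u"
  by (simp add: total_length_def sum_nonneg side_length_nonneg)

lemma measurable_vec_nth [measurable (raw)]:
  assumes "f \<in> N \<rightarrow>\<^sub>M borel"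
  shows "(\<lambda>z. f z $ (k :: 'd :: finite) :: real) \<in> borel_measurable N"
  using measurable_compose[OF assms borel_measurable_continuous_onI[OF continuous_on_component[OF continuous_on_id]]]
  by simp

lemma measurable_side_length [measurable (raw)]:
  assumes [measurable]: "f \<in> N \<rightarrow>\<^sub>M borel" "g \<in> N \<rightarrow>\<^sub>M borel"
  shows "(\<lambda>z. side_length (f z) (g z) k) \<in> borel_measurable N"
  unfolding side_length_def by measurable

lemma measurable_total_length [measurable (raw)]:
  assumes [measurable]: "f \<in> N \<rightarrow>\<^sub>M borel" "g \<in> N \<rightarrow>\<^sub>M borel"
  shows "(\<lambda>z. total_length (f z) (g z)) \<in> borel_measurable N"
  unfolding total_length_def by measurable

lemma set_coord_measurable [measurable]:
  "(\<lambda>(v, s). set_coord v k s) \<in> borel \<Otimes>\<^sub>M borel \<rightarrow>\<^sub>M borel"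
proof -
  have "(\<lambda>(v, s). set_coord v k s) = (\<lambda>(v, s). v + (s - v $ k) *\<^sub>R axis k 1)"
    by (auto simp: fun_eq_iff set_coord_def vec_eq_iff axis_def)
  also have "\<dots> \<in> borel \<Otimes>\<^sub>M borel \<rightarrow>\<^sub>M borel" by measurable
  finally show ?thesis .
qed

lemma coord_kernel_measurable:
  "(\<lambda>(l, u). density (count_space UNIV) (\<lambda>k. ennreal (side_length l u k / total_length l u)))
     \<in> borel \<Otimes>\<^sub>M borel \<rightarrow>\<^sub>M subprob_algebra (count_space UNIV)"
proof (rule measurable_subprob_algebra)
  fix p :: "(real ^ 'd) \<times> (real ^ 'd)"
  obtain l u where p: "p = (l, u)" by force
  \<comment> \<open>The sum is 1 unless the total length is 0; division by zero then makes all the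
    terms 0.\<close>
  have "(\<Sum>k\<in>UNIV. side_length l u k / total_length l u) \<le> 1"
    using total_length_nonneg[of l u] by (simp flip: sum_divide_distrib add: total_length_def)
  then have "(\<Sum>k\<in>UNIV. ennreal (side_length l u k / total_length l u)) \<le> 1"
    by (simp add: side_length_nonneg total_length_nonneg)
  then show "subprob_space (case p of (l, u) \<Rightarrow> density (count_space UNIV) (\<lambda>k. ennreal (side_length l u k / total_length l u)))"
    by (intro subprob_spaceI) (auto simp: p emeasure_density nn_integral_count_space_finite)
next
  fix A :: "'d :: finite set"
  have "(\<lambda>p. \<Sum>k\<in>UNIV. ennreal (side_length (fst p) (snd p) k / total_length (fst p) (snd p)) * indicator A k)
     \<in> borel_measurable (borel \<Otimes>\<^sub>M borel)"
    by measurable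
  moreover have "emeasure (case p of (l, u) \<Rightarrow> density (count_space UNIV) (\<lambda>k. ennreal (side_length l u k / total_length l u))) A
     = (\<Sum>k\<in>UNIV. ennreal (side_length (fst p) (snd p) k / total_length (fst p) (snd p)) * indicator A k)" for p
    by (cases p) (simp add: emeasure_density nn_integral_count_space_finite)
  ultimately show "(\<lambda>p. emeasure (case p of (l, u) \<Rightarrow> density (count_space UNIV) (\<lambda>k. ennreal (side_length l u k / total_length l u))) A)
     \<in> borel_measurable (borel \<Otimes>\<^sub>M borel)"
    by (simp only:)
qed (case_tac a, simp only: prod.case sets_density)

lemma kernel_exp [measurable (raw)]:
  "f \<in> borel_measurable N \<Longrightarrow>
    (\<lambda>z. density lborel (\<lambda>e. ennreal (exponential_density (f z) e))) \<in> N \<rightarrow>\<^sub>M subprob_algebra borel"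
  by (rule measurable_compose[OF _ exponential_kernel_measurable])

lemma kernel_uniform [measurable (raw)]:
  assumes [measurable]: "f \<in> borel_measurable N" "g \<in> borel_measurable N"
  shows "(\<lambda>z. uniform_measure lborel {f z..g z :: real}) \<in> N \<rightarrow>\<^sub>M subprob_algebra borel"
  using measurable_compose[OF measurable_Pair[OF assms] uniform_kernel_measurable] by (simp only: prod.case)

lemma kernel_coord [measurable (raw)]:
  assumes [measurable]: "f \<in> N \<rightarrow>\<^sub>M borel" "g \<in> N \<rightarrow>\<^sub>M borel"
  shows "(\<lambda>z. density (count_space UNIV) (\<lambda>k. ennreal (side_length (f z) (g z) k / total_length (f z) (g z))))
    \<in> N \<rightarrow>\<^sub>M subprob_algebra (count_space UNIV)"
  using measurable_compose[OF measurable_Pair[OF assms] coord_kernel_measurable] by (simp only: prod.case)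

lemma measurable_set_coord [measurable (raw)]:
  assumes [measurable]: "f \<in> N \<rightarrow>\<^sub>M borel" "k \<in> N \<rightarrow>\<^sub>M count_space UNIV" "g \<in> borel_measurable N"
  shows "(\<lambda>z. set_coord (f z) (k z) (g z)) \<in> N \<rightarrow>\<^sub>M (borel :: (real ^ 'd) measure)"
proof -
  have "(\<lambda>z. set_coord (f z) (i :: 'd) (g z)) \<in> N \<rightarrow>\<^sub>M borel" for i
    using measurable_compose[OF _ set_coord_measurable, of "\<lambda>z. (f z, g z)" N] by simp
  then show ?thesis
    by (rule measurable_compose_countable) simp_all
qed

lemma measurable_vec_nth_var [measurable (raw)]:
  assumes [measurable]: "f \<in> N \<rightarrow>\<^sub>M borel" "k \<in> N \<rightarrow>\<^sub>M count_space UNIV"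
  shows "(\<lambda>z. f z $ (k z :: 'd :: finite) :: real) \<in> borel_measurable N"
  by (rule measurable_compose_countable[where f="\<lambda>i z. f z $ i"]) auto

lemma uniform_in_subprob: "uniform_measure lborel {a..b :: real} \<in> space (subprob_algebra borel)"
  using measurable_space[OF uniform_kernel_measurable, of "(a, b)"] by (simp add: space_pair_measure)

lemma coord_in_subprob:
  "density (count_space UNIV) (\<lambda>k. ennreal (side_length l u k / total_length l u)) \<in> space (subprob_algebra (count_space UNIV))"
  using measurable_space[OF coord_kernel_measurable, of "(l, u)"] by (simp add: space_pair_measure)

lemma measurable_kernel_compose3:
  assumes "(\<lambda>(l, u, t). K l u t) \<in> borel \<Otimes>\<^sub>M borel \<Otimes>\<^sub>M borel \<rightarrow>\<^sub>M R"
    and "l \<in> N \<rightarrow>\<^sub>M borel" "u \<in> N \<rightarrow>\<^sub>M borel" "t \<in> N \<rightarrow>\<^sub>M borel"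
  shows "(\<lambda>z. K (l z) (u z) (t z)) \<in> N \<rightarrow>\<^sub>M R"
  using measurable_compose[OF measurable_Pair[OF assms(2) measurable_Pair[OF assms(3,4)]] assms(1)]
  by (simp only: prod.case)

text \<open>The recursive calls are evaluated at a random corner and a random time, so the induction
  needs measurability jointly in both corners and the time, with values in the space of
  sub-probabilities.\<close>

lemma mondrian_upto_measurable:
  "(\<lambda>(l, u, t). mondrian_upto lam m l u t) \<in> borel \<Otimes>\<^sub>M borel \<Otimes>\<^sub>M borel \<rightarrow>\<^sub>M subprob_algebra tree_space"
proof (induction m)
  case 0
  have "null_measure tree_space \<in> space (subprob_algebra tree_space)"
    by (auto simp: space_subprob_algebra subprob_space_null_measure_iff space_tree_sigma)
  then show ?case unfolding mondrian_upto.simps split_beta by (rule measurable_const)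
next
  case (Suc m)
  note IH = measurable_kernel_compose3[OF Suc]
  show ?case
    unfolding mondrian_upto.simps split_beta'
    apply (rule measurable_bind[where N=borel])
     apply measurable[1]
    apply (rule measurable_If)
      apply (rule measurable_bind[where N="count_space UNIV"])
       apply measurable[1]
      apply (rule measurable_bind[where N=borel])
       apply measurable[1]
      apply (rule measurable_bind[where N=tree_space])
       apply (rule IH; measurable)
      apply (rule measurable_bind[where N=tree_space])
       apply (rule IH; measurable)
      apply measurable[1]
     apply (simp add: space_subprob_algebra subprob_space_return)
    apply measurable
    done
qed

lemma measurable_mondrian_upto [measurable (raw)]:
  assumes "l \<in> N \<rightarrow>\<^sub>M borel" "u \<in> N \<rightarrow>\<^sub>M borel" "t \<in> N \<rightarrow>\<^sub>M borel"
  shows "(\<lambda>z. mondrian_upto lam m (l z) (u z) (t z)) \<in> N \<rightarrow>\<^sub>M subprob_algebra tree_space"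
  by (rule measurable_kernel_compose3[OF mondrian_upto_measurable assms])

lemma mondrian_upto_kernel:
  "mondrian_upto lam m l u t \<in> space (subprob_algebra tree_space)"
  using measurable_space[OF mondrian_upto_measurable, of "(l, u, t)" lam m] by (simp add: space_pair_measure)

lemma sets_mondrian_upto [simp, measurable_cong]: "sets (mondrian_upto lam m l u t) = sets tree_space"
  and subprob_mondrian_upto: "subprob_space (mondrian_upto lam m l u t)"
  using mondrian_upto_kernel[of lam m l u t] by (auto simp: space_subprob_algebra)

section \<open>Integrals against the law of a tree\<close>

lemma measurable_Node_tree_space [measurable (raw)]:
  assumes [measurable]: "L \<in> N \<rightarrow>\<^sub>M tree_space" "k \<in> N \<rightarrow>\<^sub>M count_space UNIV" "s \<in> N \<rightarrow>\<^sub>M borel" "R \<in> N \<rightarrow>\<^sub>M tree_space"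
  shows "(\<lambda>z. Node (L z) (k z, s z) (R z)) \<in> N \<rightarrow>\<^sub>M tree_space"
  by measurable

text \<open>Each monadic bind becomes an iterated integral. The kernels \<open>K1\<close> to
  \<open>K4\<close> are the tails of the program from the inside out, and their measurability is the
  side condition of \<open>nn_integral_bind\<close>. Later arguments unfold the process by this
  equation only, which is why the defining equation leaves the simpset afterwards.\<close>

lemma nn_integral_mondrian_upto_Suc:
  assumes f [measurable]: "f \<in> borel_measurable tree_space"
  shows "(\<integral>\<^sup>+T. f T \<partial>mondrian_upto lam (Suc m) l u t) =
    (\<integral>\<^sup>+e. ennreal (exponential_density (total_length l u) e) * (if t + e \<le> lam then
        (\<Sum>k\<in>UNIV. ennreal (side_length l u k / total_length l u) *
          (\<integral>\<^sup>+s. (\<integral>\<^sup>+L. (\<integral>\<^sup>+R. f (Node L (k, s) R) \<partial>mondrian_upto lam m (set_coord l k s) u (t + e))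
                \<partial>mondrian_upto lam m l (set_coord u k s) (t + e)) \<partial>uniform_measure lborel {l $ k..u $ k}))
      else f Leaf) \<partial>lborel)"
proof -
  have space_R: "space (mondrian_upto lam m l u t) \<noteq> {}" for l u :: "real ^ 'd" and t
    using sets_eq_imp_space_eq[OF sets_mondrian_upto[of lam m l u t]] by (auto simp: space_tree_sigma)
  define K1 where "K1 e k s L = mondrian_upto lam m (set_coord l k s) u (t + e) \<bind> (\<lambda>R. return tree_space (Node L (k, s) R))"
    for e k s L
  define K2 where "K2 e k s = mondrian_upto lam m l (set_coord u k s) (t + e) \<bind> K1 e k s" for e k s
  define K3 where "K3 e k = uniform_measure lborel {l $ k..u $ k} \<bind> K2 e k" for e k
  define K4 where "K4 e = (if t + e \<le> lam then density (count_space UNIV) (\<lambda>k. ennreal (side_length l u k / total_length l u)) \<bind> K3 e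
     else return tree_space Leaf)" for e
  have K1 [measurable (raw)]: "(\<lambda>z. K1 (e z) (k z) (s z) (L z)) \<in> N \<rightarrow>\<^sub>M subprob_algebra tree_space"
    if [measurable]: "e \<in> N \<rightarrow>\<^sub>M borel" "k \<in> N \<rightarrow>\<^sub>M count_space UNIV" "s \<in> N \<rightarrow>\<^sub>M borel" "L \<in> N \<rightarrow>\<^sub>M tree_space"
    for e k s L and N :: "'z measure"
    unfolding K1_def by (rule measurable_bind[where N=tree_space]; measurable)
  have K1': "K1 e k s \<in> tree_space \<rightarrow>\<^sub>M subprob_algebra tree_space" for e k s
    unfolding K1_def by (rule measurable_bind[where N=tree_space]; measurable)
  have K2': "K2 e k \<in> borel \<rightarrow>\<^sub>M subprob_algebra tree_space" for e k
    unfolding K2_def K1_def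
    apply (rule measurable_bind[where N=tree_space])
     apply measurable[1]
    apply (rule measurable_bind[where N=tree_space])
     apply measurable
    done
  have K3': "K3 e \<in> count_space UNIV \<rightarrow>\<^sub>M subprob_algebra tree_space" for e
    unfolding K3_def
  proof (rule measurable_count_space_eq1[THEN iffD2], rule)
    fix k
    have "K2 e k \<in> uniform_measure lborel {l $ k..u $ k} \<rightarrow>\<^sub>M subprob_algebra tree_space"
      using K2' by simp
    from subprob_space_bind[OF _ this] show "uniform_measure lborel {l $ k..u $ k} \<bind> K2 e k \<in> space (subprob_algebra tree_space)"
      using uniform_in_subprob by (auto simp: space_subprob_algebra sets_kernel[OF K2'])
  qed
  have K4': "K4 \<in> borel \<rightarrow>\<^sub>M subprob_algebra tree_space"
    unfolding K4_def K3_def K2_def K1_def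
    apply (rule measurable_If)
      apply (rule measurable_bind[where N="count_space UNIV"])
       apply (rule measurable_const, rule coord_in_subprob)
      apply (rule measurable_bind[where N=borel])
       apply measurable[1]
      apply (rule measurable_bind[where N=tree_space])
       apply measurable[1]
      apply (rule measurable_bind[where N=tree_space])
       apply measurable[1]
      apply measurable[1]
     apply (simp add: space_subprob_algebra subprob_space_return)
    apply measurable
    done
  have 1: "integral\<^sup>N (K1 e k s L) f = (\<integral>\<^sup>+R. f (Node L (k, s) R) \<partial>mondrian_upto lam m (set_coord l k s) u (t + e))"
    if L: "L \<in> space tree_space" for e k s L
    unfolding K1_def
  proof (subst nn_integral_bind[OF f])
    have [measurable]: "(\<lambda>_. L) \<in> tree_space \<rightarrow>\<^sub>M tree_space" using L by simp
    show "(\<lambda>R. return tree_space (Node L (k, s) R)) \<in> mondrian_upto lam m (set_coord l k s) u (t + e) \<rightarrow>\<^sub>M subprob_algebra tree_space"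
      by measurable
  qed (use L in \<open>auto intro!: nn_integral_cong nn_integral_return f
      simp: sets_eq_imp_space_eq[OF sets_mondrian_upto] space_tree_sigma space_pair_measure\<close>)
  have 2: "integral\<^sup>N (K2 e k s) f = (\<integral>\<^sup>+L. (\<integral>\<^sup>+R. f (Node L (k, s) R) \<partial>mondrian_upto lam m (set_coord l k s) u (t + e))
      \<partial>mondrian_upto lam m l (set_coord u k s) (t + e))" for e k s
    unfolding K2_def
    by (subst nn_integral_bind[OF f]) (auto intro!: nn_integral_cong 1 K1' simp: sets_eq_imp_space_eq[OF sets_mondrian_upto])
  have 3: "integral\<^sup>N (K3 e k) f = (\<integral>\<^sup>+s. integral\<^sup>N (K2 e k s) f \<partial>uniform_measure lborel {l $ k..u $ k})" for e k
    unfolding K3_def by (rule nn_integral_bind[OF f]) (use K2' in simp)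
  have 4: "integral\<^sup>N (K4 e) f = (if t + e \<le> lam then
        (\<Sum>k\<in>UNIV. ennreal (side_length l u k / total_length l u) * integral\<^sup>N (K3 e k) f) else f Leaf)" for e
    unfolding K4_def
    by (simp add: nn_integral_bind[OF f, of "K3 e" "density (count_space UNIV) _"] K3'[simplified] nn_integral_density nn_integral_count_space_finite
        nn_integral_return f)
  have "integral\<^sup>N (mondrian_upto lam (Suc m) l u t) f =
    integral\<^sup>N (density lborel (\<lambda>e. ennreal (exponential_density (total_length l u) e)) \<bind> K4) f"
    unfolding K4_def K3_def K2_def K1_def mondrian_upto.simps ..
  also have "\<dots> = (\<integral>\<^sup>+e. integral\<^sup>N (K4 e) f \<partial>density lborel (\<lambda>e. ennreal (exponential_density (total_length l u) e)))"
    by (rule nn_integral_bind[OF f]) (use K4' in simp)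
  also have "\<dots> = (\<integral>\<^sup>+e. ennreal (exponential_density (total_length l u) e) * integral\<^sup>N (K4 e) f \<partial>lborel)"
    by (rule nn_integral_density)
       (auto intro!: measurable_compose[OF K4' nn_integral_measurable_subprob_algebra] simp: exponential_density_def)
  finally show ?thesis
    unfolding 4 3 2 .
qed

declare mondrian_upto.simps(2) [simp del]

text \<open>The recursion is monotone in the laws of both subtrees, and these are exchanged one
  after the other. The claim is about integrals instead of sets because the induction step
  integrates functions of a subtree.\<close>

lemma nn_integral_mondrian_upto_mono:
  assumes "f \<in> borel_measurable tree_space"
  shows "(\<integral>\<^sup>+T. f T \<partial>mondrian_upto lam m l u t) \<le> (\<integral>\<^sup>+T. f T \<partial>mondrian_upto lam (Suc m) l u t)"
  using assms
proof (induction m arbitrary: f l u t)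
  case 0
  then show ?case by simp
next
  case (Suc m)
  note f [measurable] = Suc.prems
  have inner: "(\<integral>\<^sup>+L. (\<integral>\<^sup>+R. f (Node L (k, s) R) \<partial>mondrian_upto lam m l1 u1 t1) \<partial>mondrian_upto lam m l2 u2 t2)
     \<le> (\<integral>\<^sup>+L. (\<integral>\<^sup>+R. f (Node L (k, s) R) \<partial>mondrian_upto lam (Suc m) l1 u1 t1) \<partial>mondrian_upto lam (Suc m) l2 u2 t2)"
    for k s l1 u1 t1 l2 u2 t2
  proof -
    have "(\<integral>\<^sup>+L. (\<integral>\<^sup>+R. f (Node L (k, s) R) \<partial>mondrian_upto lam m l1 u1 t1) \<partial>mondrian_upto lam m l2 u2 t2)
      \<le> (\<integral>\<^sup>+L. (\<integral>\<^sup>+R. f (Node L (k, s) R) \<partial>mondrian_upto lam (Suc m) l1 u1 t1) \<partial>mondrian_upto lam m l2 u2 t2)"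
    proof (intro nn_integral_mono Suc.IH)
      fix L assume "L \<in> space (mondrian_upto lam m l2 u2 t2)"
      then have [measurable]: "(\<lambda>_. L) \<in> tree_space \<rightarrow>\<^sub>M tree_space"
        by (simp add: sets_eq_imp_space_eq[OF sets_mondrian_upto])
      show "(\<lambda>R. f (Node L (k, s) R)) \<in> borel_measurable tree_space" by measurable
    qed
    also have "\<dots> \<le> (\<integral>\<^sup>+L. (\<integral>\<^sup>+R. f (Node L (k, s) R) \<partial>mondrian_upto lam (Suc m) l1 u1 t1) \<partial>mondrian_upto lam (Suc m) l2 u2 t2)"
    proof (rule Suc.IH)
      show "(\<lambda>L. \<integral>\<^sup>+R. f (Node L (k, s) R) \<partial>mondrian_upto lam (Suc m) l1 u1 t1) \<in> borel_measurable tree_space"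
        by (rule nn_integral_measurable_subprob_algebra2[where N=tree_space])
           (simp_all add: split_beta measurable_Node_tree_space measurable_compose[OF _ f] mondrian_upto_kernel measurable_const)
    qed
    finally show ?thesis .
  qed
  show ?case
    unfolding nn_integral_mondrian_upto_Suc[OF f]
    by (intro nn_integral_mono mult_left_mono) (auto intro!: sum_mono mult_left_mono nn_integral_mono inner)
qed

lemma mondrian_upto_mono: "m \<le> m' \<Longrightarrow> mondrian_upto lam m l u t \<le> mondrian_upto lam m' l u t"
proof (rule lift_Suc_mono_le)
  fix n
  show "mondrian_upto lam n l u t \<le> mondrian_upto lam (Suc n) l u t"
    using nn_integral_mondrian_upto_mono[of "indicator A" lam n l u t for A]
    by (subst le_measure) (auto simp flip: nn_integral_indicator)
qed auto

text \<open>Monotone convergence in the measure instead of the integrand. For an increasing sequence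
  the lattice supremum of measures is the supremum on each set; the rest is induction over
  nonnegative measurable functions, with an exchange of two suprema at the limit step.\<close>

lemma nn_integral_SUP_measure:
  fixes M :: "nat \<Rightarrow> 'a measure"
  assumes sets: "\<And>i. sets (M i) = sets N" and mono: "mono M" and f: "f \<in> borel_measurable N"
  shows "(\<integral>\<^sup>+x. f x \<partial>(SUP i. M i)) = (SUP i. \<integral>\<^sup>+x. f x \<partial>M i)"
  using f
proof (induction rule: borel_measurable_induct)
  case (cong f g)
  have "space (M i) = space N" "space (SUP i. M i) = space N" for i
    using sets_eq_imp_space_eq[OF sets] sets_eq_imp_space_eq[OF sets_SUP[where I=UNIV and M=M, OF sets]] by auto
  then have "integral\<^sup>N (SUP i. M i) f = integral\<^sup>N (SUP i. M i) g" "integral\<^sup>N (M i) f = integral\<^sup>N (M i) g" for i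
    using cong(3) by (auto intro!: nn_integral_cong)
  then show ?case using cong(4) by simp
next
  case (set A)
  have "Complete_Partial_Order.chain (\<le>) (M ` UNIV)"
    using mono by (auto simp: Complete_Partial_Order.chain_def mono_def) (meson linear)
  then show ?case
    using set sets_SUP[where I=UNIV and M=M, OF sets] by (simp add: emeasure_SUP_chain[OF sets] sets)
next
  case (mult u c)
  have "u \<in> borel_measurable (SUP i. M i)" "u \<in> borel_measurable (M i)" for i
    using mult sets_SUP[where I=UNIV and M=M, OF sets] sets by (auto cong: measurable_cong_sets)
  then show ?case using mult by (simp add: nn_integral_cmult SUP_mult_left_ennreal)
next
  case (add u v)
  have m: "f \<in> borel_measurable (SUP i. M i)" "f \<in> borel_measurable (M i)" if "f \<in> borel_measurable N" for i and f :: "'a \<Rightarrow> ennreal"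
    using that sets_SUP[where I=UNIV and M=M, OF sets] sets by (auto cong: measurable_cong_sets)
  have inc: "incseq (\<lambda>i. \<integral>\<^sup>+x. f x \<partial>M i)" if "f \<in> borel_measurable N" for f
  proof (rule incseq_SucI, rule nn_integral_mono_measure)
    fix i show "M i \<le> M (Suc i)" using mono by (simp add: monoD)
  qed (simp add: sets)
  show ?case
    using add by (simp add: nn_integral_add m ennreal_SUP_add[OF inc inc])
next
  case (seq U)
  have m: "f \<in> borel_measurable (SUP i. M i)" "f \<in> borel_measurable (M i)" if "f \<in> borel_measurable N" for i and f :: "'a \<Rightarrow> ennreal"
    using that sets_SUP[where I=UNIV and M=M, OF sets] sets by (auto cong: measurable_cong_sets)
  have "(\<integral>\<^sup>+x. (SUP j. U j) x \<partial>(SUP i. M i)) = (SUP j. \<integral>\<^sup>+x. U j x \<partial>(SUP i. M i))"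
    using seq by (simp add: nn_integral_monotone_convergence_SUP m image_comp)
  also have "\<dots> = (SUP i. SUP j. \<integral>\<^sup>+x. U j x \<partial>M i)"
    unfolding seq.IH by (rule SUP_commute)
  also have "\<dots> = (SUP i. \<integral>\<^sup>+x. (SUP j. U j) x \<partial>M i)"
    using seq by (simp add: nn_integral_monotone_convergence_SUP m image_comp)
  finally show ?case .
qed

lemma sets_mondrian [simp, measurable_cong]: "sets (mondrian lam) = sets tree_space"
  unfolding mondrian_def by (rule sets_SUP) auto

text \<open>The passage from trees of bounded height to the process: a bound that is uniform in the
  height survives the supremum.\<close>

lemma nn_integral_mondrian_le:
  assumes f: "f \<in> borel_measurable tree_space"
    and "\<And>m. (\<integral>\<^sup>+T. f T \<partial>mondrian_upto lam m 0 1 0) \<le> C"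
  shows "(\<integral>\<^sup>+T. f T \<partial>mondrian lam) \<le> C"
  unfolding mondrian_def
  by (subst nn_integral_SUP_measure[OF _ _ f]) (auto simp: mono_def mondrian_upto_mono assms intro!: SUP_least)

section \<open>Corners of the cell and the backward equation\<close>

text \<open>The corners of the cell containing \<open>x\<close>. Every recursive call starts again from the unit cube and the
  enclosing split is taken into account afterwards, so that the corners are functions of the tree alone.\<close>

primrec cell_lo :: "real ^ 'd \<Rightarrow> 'd \<Rightarrow> 'd mondrian_tree \<Rightarrow> real" where
  "cell_lo x j Leaf = 0"
| "cell_lo x j (Node L v R) =
     (if x $ fst v \<le> snd v then cell_lo x j L
      else if fst v = j then max (snd v) (cell_lo x j R) else cell_lo x j R)"

primrec cell_hi :: "real ^ 'd \<Rightarrow> 'd \<Rightarrow> 'd mondrian_tree \<Rightarrow> real" where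
  "cell_hi x j Leaf = 1"
| "cell_hi x j (Node L v R) =
     (if x $ fst v \<le> snd v then if fst v = j then min (snd v) (cell_hi x j L) else cell_hi x j L
      else cell_hi x j R)"

text \<open>Both functions are rewritten with the recursor \<open>rec_tree\<close>, for which a
  measurability rule exists on the tree space.\<close>

lemma cell_lo_measurable [measurable]: "cell_lo x j \<in> borel_measurable tree_space"
  and cell_hi_measurable [measurable]: "cell_hi x j \<in> borel_measurable tree_space"
proof -
  have rec_lo: "cell_lo x j = (\<lambda>T. rec_tree 0 (\<lambda>L v R a b. if x $ fst v \<le> snd v then a else if fst v = j then max (snd v) b else b) T)"
  proof
    show "cell_lo x j T = rec_tree 0 (\<lambda>L v R a b. if x $ fst v \<le> snd v then a else if fst v = j then max (snd v) b else b) T" for T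
      by (induction T) auto
  qed
  have rec_hi: "cell_hi x j = (\<lambda>T. rec_tree 1 (\<lambda>L v R a b. if x $ fst v \<le> snd v then if fst v = j then min (snd v) a else a else b) T)"
  proof
    show "cell_hi x j T = rec_tree 1 (\<lambda>L v R a b. if x $ fst v \<le> snd v then if fst v = j then min (snd v) a else a else b) T" for T
      by (induction T) auto
  qed
  have "(\<lambda>T. rec_tree 0 (\<lambda>L v R a b. if x $ fst v \<le> snd v then a else if fst v = j then max (snd v) b else b) T)
    \<in> borel_measurable tree_space"
    by measurable
  then show "cell_lo x j \<in> borel_measurable tree_space"
    by (simp add: rec_lo)
  have "(\<lambda>T. rec_tree 1 (\<lambda>L v R a b. if x $ fst v \<le> snd v then if fst v = j then min (snd v) a else a else b) T)
    \<in> borel_measurable tree_space"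
    by measurable
  then show "cell_hi x j \<in> borel_measurable tree_space"
    by (simp add: rec_hi)
qed

text \<open>A point on a split goes to the left cell. Hence \<open>x\<close> may lie on the upper
  face of its cell, but never on the lower one, and every side has positive length.\<close>

lemma cell_lo_bounds:
  assumes "x \<in> box 0 (1 :: real ^ 'd)"
  shows "0 \<le> cell_lo x j T" "cell_lo x j T < x $ j" "x $ j \<le> cell_hi x j T" "cell_hi x j T \<le> 1"
proof -
  have "0 < x $ j" "x $ j < 1" using assms by (auto simp: mem_box_cart)
  then show "0 \<le> cell_lo x j T" "cell_lo x j T < x $ j" "x $ j \<le> cell_hi x j T" "cell_hi x j T \<le> 1"
    by (induction T) (auto simp: max_def min_def)
qed

text \<open>Think of \<open>h l u \<tau>\<close> as the factor contributed by a side \<open>[l, u]\<close> around \<open>z\<close> when the time \<open>\<tau>\<close> is left. The integral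
  condition is the balance between the splits of this side and the growth of \<open>h\<close>: summed over the coordinates
  it makes the product of such factors a solution of the backward equation of the Mondrian process.\<close>

definition backward_solution :: "real \<Rightarrow> (real \<Rightarrow> real \<Rightarrow> real \<Rightarrow> real) \<Rightarrow> (real \<Rightarrow> real \<Rightarrow> real \<Rightarrow> real) \<Rightarrow> bool" where
  "backward_solution z h h' \<longleftrightarrow>
     (\<forall>l u \<tau>. l \<le> z \<longrightarrow> z \<le> u \<longrightarrow> 0 \<le> \<tau> \<longrightarrow>
        0 \<le> h l u \<tau> \<and> 0 \<le> (u - l) * h l u \<tau> + h' l u \<tau> \<and>
        (h l u has_real_derivative h' l u \<tau>) (at \<tau>) \<and>
        (\<integral>\<^sup>+s. ennreal (if z \<le> s then h l s \<tau> else h s u \<tau>) * indicator {l..u} s \<partial>lborel)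
          = ennreal ((u - l) * h l u \<tau> + h' l u \<tau>)) \<and>
     (\<forall>\<tau>. (\<lambda>(l, u). h l u \<tau>) \<in> borel_measurable (borel \<Otimes>\<^sub>M borel)) \<and>
     (\<forall>l u. h l u \<in> borel_measurable borel \<and> h' l u \<in> borel_measurable borel)"

lemma backward_solutionD:
  assumes "backward_solution z h h'"
  shows "l \<le> z \<Longrightarrow> z \<le> u \<Longrightarrow> 0 \<le> \<tau> \<Longrightarrow> 0 \<le> h l u \<tau>"
    and "l \<le> z \<Longrightarrow> z \<le> u \<Longrightarrow> 0 \<le> \<tau> \<Longrightarrow> 0 \<le> (u - l) * h l u \<tau> + h' l u \<tau>"
    and "l \<le> z \<Longrightarrow> z \<le> u \<Longrightarrow> 0 \<le> \<tau> \<Longrightarrow> (h l u has_real_derivative h' l u \<tau>) (at \<tau>)"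
    and "l \<le> z \<Longrightarrow> z \<le> u \<Longrightarrow> 0 \<le> \<tau> \<Longrightarrow>
      (\<integral>\<^sup>+s. ennreal (if z \<le> s then h l s \<tau> else h s u \<tau>) * indicator {l..u} s \<partial>lborel)
          = ennreal ((u - l) * h l u \<tau> + h' l u \<tau>)"
    and "(\<lambda>(l, u). h l u \<tau>) \<in> borel_measurable (borel \<Otimes>\<^sub>M borel)"
    and "h l u \<in> borel_measurable borel" "h' l u \<in> borel_measurable borel"
  using assms unfolding backward_solution_def by blast+

lemma set_coord_nth: "set_coord v k s $ j = (if j = k then s else v $ j)"
  by (simp add: set_coord_def)

text \<open>The tree knows its corners relative to the unit cube only. Clipping them to
  \<open>l\<close> and \<open>u\<close> gives the cell of \<open>x\<close> when the tree is grown
  inside the cell with these corners. The last argument 0 of \<open>h\<close> says that no time is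
  left.\<close>

definition cell_prod where
  "cell_prod h x l u T = (\<Prod>j\<in>UNIV. h j (max (l $ j) (cell_lo x j T)) (min (u $ j) (cell_hi x j T)) 0)"

lemma cell_prod_measurable [measurable]:
  assumes "\<And>j. backward_solution (x $ j) (h j) (h' j)"
  shows "cell_prod h x l u \<in> borel_measurable tree_space"
proof -
  have "(\<lambda>T. h j (max (l $ j) (cell_lo x j T)) (min (u $ j) (cell_hi x j T)) 0) \<in> borel_measurable tree_space" for j
    using measurable_compose[OF _ backward_solutionD(5)[OF assms], of
       "\<lambda>T. (max (l $ j) (cell_lo x j T), min (u $ j) (cell_hi x j T))" tree_space j 0] by simp
  then show ?thesis unfolding cell_prod_def by measurable
qed

text \<open>Only the child that contains \<open>x\<close> matters, and passing to it moves one
  corner of the enclosing cell. This is why the expectation of \<open>cell_prod\<close> satisfies a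
  closed recursion.\<close>

lemma cell_prod_Node:
  assumes "\<And>j. l $ j \<le> x $ j" "\<And>j. x $ j \<le> u $ j" "l $ k \<le> s" "s \<le> u $ k"
  shows "cell_prod h x l u (Node L (k, s) R) =
    (if x $ k \<le> s then cell_prod h x l (set_coord u k s) L else cell_prod h x (set_coord l k s) u R)"
proof (cases "x $ k \<le> s")
  case True
  have "max (l $ j) (cell_lo x j (Node L (k, s) R)) = max (l $ j) (cell_lo x j L)"
    "min (u $ j) (cell_hi x j (Node L (k, s) R)) = min (set_coord u k s $ j) (cell_hi x j L)" for j
    using True assms by (auto simp: set_coord_nth)
  then show ?thesis using True by (simp only: cell_prod_def if_True)
next
  case False
  have "max (l $ j) (cell_lo x j (Node L (k, s) R)) = max (set_coord l k s $ j) (cell_lo x j R)"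
    "min (u $ j) (cell_hi x j (Node L (k, s) R)) = min (u $ j) (cell_hi x j R)" for j
    using False assms by (auto simp: set_coord_nth)
  then show ?thesis using False by (simp only: cell_prod_def if_False)
qed

lemma (in subprob_space) nn_integral_const_le: "(\<integral>\<^sup>+_. c \<partial>M) \<le> (c :: ennreal)"
  using mult_left_mono[OF subprob_emeasure_le_1[of "space M"], of c] by simp

text \<open>Write H for the product of the factors and A for the total side length. Conditioning on
  a first split after the time e, the integral conditions add up to the integrand exp (- e A) (A H +
  H') (lam - t - e), which is the derivative in e of - exp (- e A) H (lam - t - e). Integration
  leaves H (lam - t) - exp (- (lam - t) A) H 0, and the event without a split supplies the
  subtracted term. There is only an inequality because trees of height \<open>m\<close> or more are
  missing.\<close>

lemma mondrian_upto_backward: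
  fixes x :: "real ^ 'd"
  assumes h: "\<And>j. backward_solution (x $ j) (h j) (h' j)"
    and "\<And>j. 0 \<le> l $ j" "\<And>j. l $ j \<le> x $ j" "\<And>j. x $ j \<le> u $ j" "\<And>j. u $ j \<le> 1" "t \<le> lam"
  shows "(\<integral>\<^sup>+T. ennreal (cell_prod h x l u T) \<partial>mondrian_upto lam m l u t)
    \<le> ennreal (\<Prod>j\<in>UNIV. h j (l $ j) (u $ j) (lam - t))"
  using assms(2-)
proof (induction m arbitrary: l u t)
  case 0
  then show ?case by simp
next
  case (Suc m)
  note hD = backward_solutionD[OF h]
  note [simp] = Suc.prems(2,3)
  define A where "A = total_length l u"
  define H where "H \<tau> = (\<Prod>j\<in>UNIV. h j (l $ j) (u $ j) \<tau>)" for \<tau>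
  define H' where "H' \<tau> = (\<Sum>k\<in>UNIV. h' k (l $ k) (u $ k) \<tau> * (\<Prod>i\<in>UNIV - {k}. h i (l $ i) (u $ i) \<tau>))" for \<tau>
  have A: "A = (\<Sum>k\<in>UNIV. u $ k - l $ k)" "0 \<le> A"
    using order.trans[OF Suc.prems(2,3)]
    by (auto simp: A_def total_length_def side_length_def max_def intro!: sum.cong sum_nonneg)
  have side: "side_length l u k = u $ k - l $ k" for k
    using order.trans[OF Suc.prems(2,3)] by (auto simp: side_length_def)
  have le: "l $ k \<le> u $ k" for k using order.trans[OF Suc.prems(2,3)] .
  have H0: "0 \<le> \<tau> \<Longrightarrow> 0 \<le> (\<Prod>i\<in>K. h i (l $ i) (u $ i) \<tau>)" for K \<tau>
    by (intro prod_nonneg) (auto intro: hD(1))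
  \<comment> \<open>A split of the side k leaves the factors of the other sides alone, so the
    derivatives \<open>h' k\<close> assemble to H' by the product rule and the lengths to A.\<close>
  have Hsum: "(\<Sum>k\<in>UNIV. (\<Prod>i\<in>UNIV - {k}. h i (l $ i) (u $ i) \<tau>) * ((u $ k - l $ k) * h k (l $ k) (u $ k) \<tau> + h' k (l $ k) (u $ k) \<tau>))
      = A * H \<tau> + H' \<tau>" for \<tau>
  proof -
    have "H \<tau> = h k (l $ k) (u $ k) \<tau> * (\<Prod>i\<in>UNIV - {k}. h i (l $ i) (u $ i) \<tau>)" for k
      unfolding H_def by (rule prod.remove) auto
    then show ?thesis
      unfolding A(1) H'_def sum_distrib_right sum.distrib[symmetric]
      by (intro sum.cong refl) (simp add: algebra_simps)
  qed
  have AH0: "0 \<le> \<tau> \<Longrightarrow> 0 \<le> A * H \<tau> + H' \<tau>" for \<tau>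
    unfolding Hsum[symmetric] by (intro sum_nonneg mult_nonneg_nonneg H0 hD(2)) auto
  have G [measurable]: "cell_prod h x l u \<in> borel_measurable tree_space" for l u
    by (rule cell_prod_measurable[OF h])
  \<comment> \<open>The subtree without \<open>x\<close> does not enter the integrand, and its law
    has mass at most 1; the induction hypothesis is applied to the other subtree.\<close>
  have step: "(\<integral>\<^sup>+L. (\<integral>\<^sup>+R. ennreal (cell_prod h x l u (Node L (k, s) R)) \<partial>mondrian_upto lam m (set_coord l k s) u (t + e))
                \<partial>mondrian_upto lam m l (set_coord u k s) (t + e))
      \<le> ennreal (\<Prod>i\<in>UNIV - {k}. h i (l $ i) (u $ i) (lam - (t + e))) * ennreal (if x $ k \<le> s then h k (l $ k) s (lam - (t + e)) else h k s (u $ k) (lam - (t + e)))"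
    if "l $ k \<le> s" "s \<le> u $ k" "t + e \<le> lam" for k s e
  proof (cases "x $ k \<le> s")
    case True
    have "(\<integral>\<^sup>+L. (\<integral>\<^sup>+R. ennreal (cell_prod h x l u (Node L (k, s) R)) \<partial>mondrian_upto lam m (set_coord l k s) u (t + e))
                \<partial>mondrian_upto lam m l (set_coord u k s) (t + e))
       \<le> (\<integral>\<^sup>+L. ennreal (cell_prod h x l (set_coord u k s) L) \<partial>mondrian_upto lam m l (set_coord u k s) (t + e))"
      using True that
      by (intro nn_integral_mono) (simp only: cell_prod_Node[OF Suc.prems(2,3)] if_True
            subprob_space.nn_integral_const_le[OF subprob_mondrian_upto])
    also have "\<dots> \<le> ennreal (\<Prod>j\<in>UNIV. h j (l $ j) (set_coord u k s $ j) (lam - (t + e)))"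
      using True that Suc.prems by (intro Suc.IH) (auto simp: set_coord_nth intro: order.trans)
    also have "(\<Prod>j\<in>UNIV. h j (l $ j) (set_coord u k s $ j) (lam - (t + e))) =
       h k (l $ k) s (lam - (t + e)) * (\<Prod>i\<in>UNIV - {k}. h i (l $ i) (u $ i) (lam - (t + e)))"
      by (subst prod.remove[where x=k]) (auto simp: set_coord_nth intro!: prod.cong)
    finally show ?thesis
      using True that by (simp add: ennreal_mult'[symmetric] ennreal_mult''[symmetric] H0 mult.commute)
  next
    case False
    have "(\<integral>\<^sup>+L. (\<integral>\<^sup>+R. ennreal (cell_prod h x l u (Node L (k, s) R)) \<partial>mondrian_upto lam m (set_coord l k s) u (t + e))
                \<partial>mondrian_upto lam m l (set_coord u k s) (t + e))
       \<le> (\<integral>\<^sup>+R. ennreal (cell_prod h x (set_coord l k s) u R) \<partial>mondrian_upto lam m (set_coord l k s) u (t + e))"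
      using False that
      by (simp only: cell_prod_Node[OF Suc.prems(2,3)] if_False
            subprob_space.nn_integral_const_le[OF subprob_mondrian_upto])
    also have "\<dots> \<le> ennreal (\<Prod>j\<in>UNIV. h j (set_coord l k s $ j) (u $ j) (lam - (t + e)))"
      using False that Suc.prems by (intro Suc.IH) (auto simp: set_coord_nth intro: order.trans)
    also have "(\<Prod>j\<in>UNIV. h j (set_coord l k s $ j) (u $ j) (lam - (t + e))) =
       h k s (u $ k) (lam - (t + e)) * (\<Prod>i\<in>UNIV - {k}. h i (l $ i) (u $ i) (lam - (t + e)))"
      by (subst prod.remove[where x=k]) (auto simp: set_coord_nth intro!: prod.cong)
    finally show ?thesis
      using False that by (simp add: ennreal_mult'[symmetric] ennreal_mult''[symmetric] H0 mult.commute)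
  qed
  have inner: "ennreal (exponential_density A e) * (\<Sum>k\<in>UNIV. ennreal (side_length l u k / A) *
          (\<integral>\<^sup>+s. (\<integral>\<^sup>+L. (\<integral>\<^sup>+R. ennreal (cell_prod h x l u (Node L (k, s) R)) \<partial>mondrian_upto lam m (set_coord l k s) u (t + e))
                \<partial>mondrian_upto lam m l (set_coord u k s) (t + e)) \<partial>uniform_measure lborel {l $ k..u $ k}))
     \<le> ennreal (exp (- e * A) * (A * H (lam - t - e) + H' (lam - t - e)))" (is "_ * (\<Sum>k\<in>UNIV. _ * ?I k) \<le> _")
    if e: "0 \<le> e" "t + e \<le> lam" for e
  \<comment> \<open>With A = 0 the exponential density vanishes and the left-hand side is 0.\<close>
  proof (cases "A = 0")
    case True
    then show ?thesis by (simp add: exponential_density_def)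
  next
    case False
    with A have "0 < A" by simp
    define \<tau> where "\<tau> = lam - (t + e)"
    have \<tau>: "0 \<le> \<tau>" using e by (simp add: \<tau>_def)
    let ?Q = "\<lambda>k. \<Prod>i\<in>UNIV - {k}. h i (l $ i) (u $ i) \<tau>"
    have "ennreal (side_length l u k / A) * ?I k \<le>
        ennreal (1 / A * (?Q k * ((u $ k - l $ k) * h k (l $ k) (u $ k) \<tau> + h' k (l $ k) (u $ k) \<tau>)))" for k
    \<comment> \<open>On a flat side there is no uniform law, but such a side is chosen with
      probability 0.\<close>
    proof (cases "l $ k = u $ k")
      case True
      then show ?thesis by (simp add: side)
    next
      case False
      with le[of k] have lt: "l $ k < u $ k" by simp
      have m: "(\<lambda>s. if x $ k \<le> s then h k (l $ k) s \<tau> else h k s (u $ k) \<tau>) \<in> borel_measurable borel"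
        using measurable_compose[OF _ hD(5), of "\<lambda>s. (l $ k, s)" borel k \<tau>]
          measurable_compose[OF _ hD(5), of "\<lambda>s. (s, u $ k)" borel k \<tau>] by simp
      note [measurable] = m
      have ae: "AE s in uniform_measure lborel {l $ k..u $ k}. l $ k \<le> s \<and> s \<le> u $ k"
        using lt by (intro AE_uniform_measureI) auto
      have "?I k \<le> (\<integral>\<^sup>+s. ennreal (?Q k) * ennreal (if x $ k \<le> s then h k (l $ k) s \<tau> else h k s (u $ k) \<tau>)
             \<partial>uniform_measure lborel {l $ k..u $ k})"
      proof (rule nn_integral_mono_AE)
        show "AE s in uniform_measure lborel {l $ k..u $ k}.
          (\<integral>\<^sup>+L. (\<integral>\<^sup>+R. ennreal (cell_prod h x l u (Node L (k, s) R)) \<partial>mondrian_upto lam m (set_coord l k s) u (t + e))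
                \<partial>mondrian_upto lam m l (set_coord u k s) (t + e))
          \<le> ennreal (?Q k) * ennreal (if x $ k \<le> s then h k (l $ k) s \<tau> else h k s (u $ k) \<tau>)"
          using ae by eventually_elim (unfold \<tau>_def, rule step, use e in auto)
      qed
      also have "\<dots> = ennreal (?Q k) * (ennreal ((u $ k - l $ k) * h k (l $ k) (u $ k) \<tau> + h' k (l $ k) (u $ k) \<tau>) / ennreal (u $ k - l $ k))"
        using lt \<tau> by (simp add: nn_integral_cmult nn_integral_uniform_measure hD(4))
      also have "\<dots> = ennreal (?Q k * (((u $ k - l $ k) * h k (l $ k) (u $ k) \<tau> + h' k (l $ k) (u $ k) \<tau>) / (u $ k - l $ k)))"
        using lt \<tau> by (simp add: divide_ennreal hD(2) H0 flip: ennreal_mult')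
      finally have "ennreal (side_length l u k / A) * ?I k \<le> ennreal (side_length l u k / A) *
          ennreal (?Q k * (((u $ k - l $ k) * h k (l $ k) (u $ k) \<tau> + h' k (l $ k) (u $ k) \<tau>) / (u $ k - l $ k)))"
        by (rule mult_left_mono) simp
      also have "\<dots> = ennreal (1 / A * (?Q k * ((u $ k - l $ k) * h k (l $ k) (u $ k) \<tau> + h' k (l $ k) (u $ k) \<tau>)))"
        using lt \<open>0 < A\<close> by (subst ennreal_mult'[symmetric]) (auto simp: side)
      finally show ?thesis .
    qed
    then have "(\<Sum>k\<in>UNIV. ennreal (side_length l u k / A) * ?I k) \<le>
      (\<Sum>k\<in>UNIV. ennreal (1 / A * (?Q k * ((u $ k - l $ k) * h k (l $ k) (u $ k) \<tau> + h' k (l $ k) (u $ k) \<tau>))))"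
      by (rule sum_mono)
    also have "\<dots> = ennreal (\<Sum>k\<in>UNIV. 1 / A * (?Q k * ((u $ k - l $ k) * h k (l $ k) (u $ k) \<tau> + h' k (l $ k) (u $ k) \<tau>)))"
      using \<open>0 < A\<close> \<tau> by (intro sum_ennreal mult_nonneg_nonneg H0 hD(2)) auto
    also have "\<dots> = ennreal (1 / A * (A * H \<tau> + H' \<tau>))"
      unfolding sum_distrib_left[symmetric] Hsum ..
    finally have "ennreal (exponential_density A e) * (\<Sum>k\<in>UNIV. ennreal (side_length l u k / A) * ?I k)
       \<le> ennreal (exponential_density A e) * ennreal (1 / A * (A * H \<tau> + H' \<tau>))"
      by (rule mult_left_mono) simp
    also have "\<dots> = ennreal (exp (- e * A) * (A * H \<tau> + H' \<tau>))"
      using e \<open>0 < A\<close> by (subst ennreal_mult'[symmetric]) (auto simp: exponential_density_def)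
    also have "\<tau> = lam - t - e" by (simp add: \<tau>_def)
    finally show ?thesis .
  qed
  have [measurable]: "H \<in> borel_measurable borel" "H' \<in> borel_measurable borel"
    unfolding H_def[abs_def] H'_def[abs_def] using hD(6,7) by measurable
  have leaf: "cell_prod h x l u Leaf = H 0"
    unfolding cell_prod_def H_def using Suc.prems(1,4) by (simp add: max_absorb1 min_absorb1)
  have "0 \<le> H 0" unfolding H_def by (rule H0) simp
  have F: "((\<lambda>e. - exp (- e * A) * H (lam - t - e)) has_real_derivative
      exp (- e * A) * (A * H (lam - t - e) + H' (lam - t - e))) (at e)"
      "0 \<le> exp (- e * A) * (A * H (lam - t - e) + H' (lam - t - e))"
    if e: "0 \<le> e" "e \<le> lam - t" for e
  proof -
    have "(H has_real_derivative H' (lam - t - e)) (at (lam - t - e))"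
      unfolding H_def[abs_def] H'_def using e by (intro has_field_derivative_prod hD(3)) auto
    then have "((\<lambda>e. H (lam - t - e)) has_real_derivative - H' (lam - t - e)) (at e)"
      by (rule DERIV_chain2[where Db="-1", simplified]) (auto intro!: derivative_eq_intros)
    then have "((\<lambda>e. - exp (- e * A) * H (lam - t - e)) has_real_derivative
      exp (- e * A) * (A * H (lam - t - e) + H' (lam - t - e))) (at e)"
      by (auto intro!: derivative_eq_intros simp: algebra_simps)
    then show "((\<lambda>e. - exp (- e * A) * H (lam - t - e)) has_real_derivative
      exp (- e * A) * (A * H (lam - t - e) + H' (lam - t - e))) (at e)" .
    show "0 \<le> exp (- e * A) * (A * H (lam - t - e) + H' (lam - t - e))"
      using e by (intro mult_nonneg_nonneg AH0) auto
  qed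
  \<comment> \<open>The first summand is the event of a split before the time \<open>lam\<close>,
    the second the event of none. Both indicators include the end point, which only enlarges the
    right-hand side.\<close>
  have "(\<integral>\<^sup>+T. ennreal (cell_prod h x l u T) \<partial>mondrian_upto lam (Suc m) l u t)
    \<le> (\<integral>\<^sup>+e. ennreal (exp (- e * A) * (A * H (lam - t - e) + H' (lam - t - e))) * indicator {0..lam - t} e
          + ennreal (H 0) * (ennreal (A * exp (- e * A)) * indicator {lam - t..} e) \<partial>lborel)"
    unfolding nn_integral_mondrian_upto_Suc[OF measurable_compose[OF G measurable_ennreal]] A_def[symmetric]
  proof (intro nn_integral_mono, goal_cases)
    case (1 e)
    show ?case
    proof (cases "e < 0")
      case True
      then show ?thesis by (simp add: exponential_density_def)
    next
      case False
      show ?thesis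
      proof (cases "t + e \<le> lam")
        case True
        then show ?thesis
          using inner[of e] False by (auto intro!: add_increasing2)
      next
        case 2: False
        then show ?thesis
          using False by (simp add: leaf exponential_density_def mult.commute)
      qed
    qed
  qed
  also have "\<dots> = (\<integral>\<^sup>+e. ennreal (exp (- e * A) * (A * H (lam - t - e) + H' (lam - t - e))) * indicator {0..lam - t} e \<partial>lborel)
     + ennreal (H 0) * (\<integral>\<^sup>+e. ennreal (A * exp (- e * A)) * indicator {lam - t..} e \<partial>lborel)"
    by (simp add: nn_integral_add nn_integral_cmult)
  also have "(\<integral>\<^sup>+e. ennreal (exp (- e * A) * (A * H (lam - t - e) + H' (lam - t - e))) * indicator {0..lam - t} e \<partial>lborel)
     = - exp (- (lam - t) * A) * H (lam - t - (lam - t)) - - exp (- 0 * A) * H (lam - t - 0)"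
  proof (rule nn_integral_FTC_Icc)
    fix e assume "e \<in> {0..lam - t}"
    then have "0 \<le> e" "e \<le> lam - t" by auto
    from F[OF this] show "((\<lambda>e. - exp (- e * A) * H (lam - t - e)) has_real_derivative
      exp (- e * A) * (A * H (lam - t - e) + H' (lam - t - e))) (at e)"
      "0 \<le> exp (- e * A) * (A * H (lam - t - e) + H' (lam - t - e))" .
  qed (use Suc.prems in auto)
  also have "ennreal (- exp (- (lam - t) * A) * H (lam - t - (lam - t)) - - exp (- 0 * A) * H (lam - t - 0))
      + ennreal (H 0) * (\<integral>\<^sup>+e. ennreal (A * exp (- e * A)) * indicator {lam - t..} e \<partial>lborel)
    \<le> ennreal (- exp (- (lam - t) * A) * H (lam - t - (lam - t)) - - exp (- 0 * A) * H (lam - t - 0))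
      + ennreal (H 0) * ennreal (exp (- (lam - t) * A))"
  \<comment> \<open>For A = 0 the waiting time has the null measure as its law instead of a point
    mass at infinity, so mass is lost and the inequality holds for a trivial reason.\<close>
  proof (cases "A = 0")
    case True
    then show ?thesis by (simp add: add_increasing2)
  next
    case False
    with A have "0 < A" by simp
    then have "((\<lambda>e. - exp (- e * A)) \<longlongrightarrow> 0) at_top"
      by real_asymp
    then have "(\<integral>\<^sup>+e. ennreal (A * exp (- e * A)) * indicator {lam - t..} e \<partial>lborel) = 0 - - exp (- (lam - t) * A)"
      using A(2) by (intro nn_integral_FTC_atLeast) (auto intro!: derivative_eq_intros)
    then show ?thesis by simp
  qed
  also have "\<dots> = ennreal (H (lam - t))"
  proof -
    \<comment> \<open>The difference is nonnegative, so \<open>ennreal\<close> does not truncate it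
      and the two terms with \<open>H 0\<close> cancel.\<close>
    have mono: "exp (- (lam - t) * A) * H 0 \<le> H (lam - t)"
      using DERIV_nonneg_imp_nondecreasing[of 0 "lam - t" "\<lambda>e. - exp (- e * A) * H (lam - t - e)"] F Suc.prems(5)
      by force
    then show ?thesis
      using \<open>0 \<le> H 0\<close> by (subst ennreal_mult'[symmetric]) (auto simp flip: ennreal_plus simp: mult.commute)
  qed
  finally show ?case
    by (simp add: H_def)
qed

section \<open>Faces of the cell and their Laplace transforms\<close>

text \<open>The balance condition of \<open>backward_solution\<close> for a single face at the
  distance alpha from the point: a split between the two moves the face to a distance y in
  [0, alpha].\<close>

definition one_sided :: "(real \<Rightarrow> real \<Rightarrow> real) \<Rightarrow> (real \<Rightarrow> real \<Rightarrow> real) \<Rightarrow> bool" where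
  "one_sided p p' \<longleftrightarrow>
     (\<forall>\<alpha> \<tau>. 0 \<le> \<alpha> \<longrightarrow> 0 \<le> \<tau> \<longrightarrow>
        0 \<le> p \<alpha> \<tau> \<and> 0 \<le> \<alpha> * p \<alpha> \<tau> + p' \<alpha> \<tau> \<and> (p \<alpha> has_real_derivative p' \<alpha> \<tau>) (at \<tau>) \<and>
        (\<integral>\<^sup>+y. ennreal (p y \<tau>) * indicator {0..\<alpha>} y \<partial>lborel) = ennreal (\<alpha> * p \<alpha> \<tau> + p' \<alpha> \<tau>)) \<and>
     (\<forall>\<tau>. (\<lambda>\<alpha>. p \<alpha> \<tau>) \<in> borel_measurable borel) \<and>
     (\<forall>\<alpha>. p \<alpha> \<in> borel_measurable borel \<and> p' \<alpha> \<in> borel_measurable borel)"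

text \<open>A split of the side falls below or above \<open>z\<close> and moves only one of the
  faces. The integral over the split location thus separates into the two one-sided conditions, each
  multiplied by the factor of the other face, and the derivatives combine by the product
  rule.\<close>

lemma backward_solution_product:
  assumes p: "one_sided p p'" and q: "one_sided q q'"
  shows "backward_solution z (\<lambda>l u \<tau>. p (z - l) \<tau> * q (u - z) \<tau>)
    (\<lambda>l u \<tau>. p' (z - l) \<tau> * q (u - z) \<tau> + p (z - l) \<tau> * q' (u - z) \<tau>)"
  unfolding backward_solution_def
proof (intro conjI allI impI, goal_cases)
  case (1 l u \<tau>)
  then show ?case using p q by (simp add: one_sided_def)
next
  case (2 l u \<tau>)
  then have "0 \<le> q (u - z) \<tau> * ((z - l) * p (z - l) \<tau> + p' (z - l) \<tau>)" "0 \<le> p (z - l) \<tau> * ((u - z) * q (u - z) \<tau> + q' (u - z) \<tau>)"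
    using p q by (simp_all add: one_sided_def)
  then show ?case by (simp add: algebra_simps)
next
  case (3 l u \<tau>)
  then have "(p (z - l) has_real_derivative p' (z - l) \<tau>) (at \<tau>)" "(q (u - z) has_real_derivative q' (u - z) \<tau>) (at \<tau>)"
    using p q by (simp_all add: one_sided_def)
  from DERIV_mult[OF this] show ?case by (simp add: algebra_simps)
next
  case (4 l u \<tau>)
  have m [measurable]: "(\<lambda>y. p y \<tau>) \<in> borel_measurable borel" "(\<lambda>y. q y \<tau>) \<in> borel_measurable borel"
    using p q by (simp_all add: one_sided_def)
  have nn: "0 \<le> p (z - l) \<tau>" "0 \<le> q (u - z) \<tau>"
      "0 \<le> (z - l) * p (z - l) \<tau> + p' (z - l) \<tau>" "0 \<le> (u - z) * q (u - z) \<tau> + q' (u - z) \<tau>"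
    using p q 4 by (simp_all add: one_sided_def)
  have P: "(\<integral>\<^sup>+s. ennreal (p (z - s) \<tau>) * indicator {l..z} s \<partial>lborel) = ennreal ((z - l) * p (z - l) \<tau> + p' (z - l) \<tau>)"
  proof -
    have "(\<integral>\<^sup>+s. ennreal (p (z - s) \<tau>) * indicator {l..z} s \<partial>lborel) =
      (\<integral>\<^sup>+y. ennreal (p y \<tau>) * indicator {0..z - l} y \<partial>lborel)"
      by (subst nn_integral_real_affine[where c="-1" and t=z]) (auto intro!: nn_integral_cong simp: indicator_def)
    then show ?thesis using p 4 by (simp add: one_sided_def)
  qed
  have Q: "(\<integral>\<^sup>+s. ennreal (q (s - z) \<tau>) * indicator {z..u} s \<partial>lborel) = ennreal ((u - z) * q (u - z) \<tau> + q' (u - z) \<tau>)"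
  proof -
    have "(\<integral>\<^sup>+s. ennreal (q (s - z) \<tau>) * indicator {z..u} s \<partial>lborel) =
      (\<integral>\<^sup>+y. ennreal (q y \<tau>) * indicator {0..u - z} y \<partial>lborel)"
      by (subst nn_integral_real_affine[where c="1" and t=z]) (auto intro!: nn_integral_cong simp: indicator_def)
    then show ?thesis using q 4 by (simp add: one_sided_def)
  qed
  have "(\<integral>\<^sup>+s. ennreal (if z \<le> s then p (z - l) \<tau> * q (s - z) \<tau> else p (z - s) \<tau> * q (u - z) \<tau>) * indicator {l..u} s \<partial>lborel)
    = (\<integral>\<^sup>+s. ennreal (p (z - l) \<tau>) * (ennreal (q (s - z) \<tau>) * indicator {z..u} s) +
          ennreal (q (u - z) \<tau>) * (ennreal (p (z - s) \<tau>) * indicator {l..z} s) \<partial>lborel)"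
    \<comment> \<open>The location \<open>z\<close> itself belongs to both intervals on the right,
      so the identity of the integrands holds almost everywhere only.\<close>
    using AE_lborel_singleton[of z]
    by (intro nn_integral_cong_AE, eventually_elim)
       (use 4 nn in \<open>auto simp: indicator_def ennreal_mult' ennreal_mult'' mult.commute\<close>)
  also have "\<dots> = ennreal (p (z - l) \<tau>) * ennreal ((u - z) * q (u - z) \<tau> + q' (u - z) \<tau>)
      + ennreal (q (u - z) \<tau>) * ennreal ((z - l) * p (z - l) \<tau> + p' (z - l) \<tau>)"
    by (subst nn_integral_add) (auto simp: nn_integral_cmult P Q)
  also have "\<dots> = ennreal (p (z - l) \<tau> * ((u - z) * q (u - z) \<tau> + q' (u - z) \<tau>)
      + q (u - z) \<tau> * ((z - l) * p (z - l) \<tau> + p' (z - l) \<tau>))"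
    using nn by (simp add: ennreal_plus ennreal_mult')
  finally show ?case by (simp add: algebra_simps)
next
  case (5 \<tau>)
  have [measurable]: "(\<lambda>y. p y \<tau>) \<in> borel_measurable borel" "(\<lambda>y. q y \<tau>) \<in> borel_measurable borel"
    using p q by (simp_all add: one_sided_def)
  show ?case by measurable
next
  case (6 l u)
  have [measurable]: "p (z - l) \<in> borel_measurable borel" "q (u - z) \<in> borel_measurable borel"
    using p q by (simp_all add: one_sided_def)
  show ?case by measurable
next
  case (7 l u)
  have [measurable]: "p (z - l) \<in> borel_measurable borel" "q (u - z) \<in> borel_measurable borel"
    "p' (z - l) \<in> borel_measurable borel" "q' (u - z) \<in> borel_measurable borel"
    using p q by (simp_all add: one_sided_def)
  show ?case by measurable
qed

lemma one_sided_const: "one_sided (\<lambda>_ _. 1) (\<lambda>_ _. 0)"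
  by (simp add: one_sided_def ennreal_indicator)

text \<open>The Laplace transform at \<open>s\<close> of the minimum of \<open>\<alpha>\<close> and an exponential variable of rate \<open>\<tau>\<close>, which is the
  distance from a point to a face of its cell if that face starts at distance \<open>\<alpha>\<close>.\<close>

definition laplace_side :: "real \<Rightarrow> real \<Rightarrow> real \<Rightarrow> real" where
  "laplace_side s \<alpha> \<tau> = (s * exp (- (\<tau> + s) * \<alpha>) + \<tau>) / (\<tau> + s)"

definition laplace_side_deriv :: "real \<Rightarrow> real \<Rightarrow> real \<Rightarrow> real" where
  "laplace_side_deriv s \<alpha> \<tau> = s * (1 - exp (- (\<tau> + s) * \<alpha>)) / (\<tau> + s)\<^sup>2 - \<alpha> * s * exp (- (\<tau> + s) * \<alpha>) / (\<tau> + s)"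

lemma laplace_side_bounds:
  assumes "0 < s" "0 \<le> \<alpha>" "0 \<le> \<tau>"
  shows "0 \<le> laplace_side s \<alpha> \<tau>" "laplace_side s \<alpha> \<tau> \<le> 1"
proof -
  have "exp (- (\<tau> + s) * \<alpha>) \<le> 1" using assms by (simp add: mult_nonpos_nonneg)
  then have "s * exp (- (\<tau> + s) * \<alpha>) \<le> s" using assms by simp
  then show "0 \<le> laplace_side s \<alpha> \<tau>" "laplace_side s \<alpha> \<tau> \<le> 1"
    using assms by (auto simp: laplace_side_def divide_simps)
qed

lemma laplace_side_deriv:
  assumes "0 < s" "0 \<le> \<tau>"
  shows "(laplace_side s \<alpha> has_real_derivative laplace_side_deriv s \<alpha> \<tau>) (at \<tau>)"
proof -
  define E c where "E = exp (- (\<tau> + s) * \<alpha>)" and "c = \<tau> + s"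
  have "((\<lambda>\<tau>. s * exp (- (\<tau> + s) * \<alpha>) + \<tau>) has_real_derivative s * (- \<alpha> * E) + 1) (at \<tau>)"
    unfolding E_def by (auto intro!: derivative_eq_intros)
  moreover have "((\<lambda>\<tau>. \<tau> + s) has_real_derivative 1) (at \<tau>)"
    by (auto intro!: derivative_eq_intros)
  ultimately have "(laplace_side s \<alpha> has_real_derivative ((s * (- \<alpha> * E) + 1) * c - (s * E + \<tau>) * 1) / (c * c)) (at \<tau>)"
    unfolding laplace_side_def[abs_def] E_def c_def using assms by (intro DERIV_divide) auto
  also have "((s * (- \<alpha> * E) + 1) * c - (s * E + \<tau>) * 1) / (c * c) = s * (1 - E) / c\<^sup>2 - \<alpha> * s * E / c"
    using assms by (simp add: c_def divide_simps power2_eq_square) algebra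
  finally show ?thesis
    by (simp add: laplace_side_deriv_def E_def c_def)
qed

text \<open>This is the integral condition of \<open>one_sided\<close>, differentiated in alpha.
  With c = tau + s the terms alpha * exp (- c alpha) cancel and the function is tau alpha / c + s (1
  - exp (- c alpha)) / c^2, which vanishes at alpha = 0.\<close>

lemma laplace_side_antideriv:
  assumes "0 < s" "0 \<le> \<tau>"
  shows "((\<lambda>\<alpha>. \<alpha> * laplace_side s \<alpha> \<tau> + laplace_side_deriv s \<alpha> \<tau>) has_real_derivative laplace_side s \<alpha> \<tau>) (at \<alpha>)"
proof -
  define c where "c = \<tau> + s"
  have c: "0 < c" using assms by (simp add: c_def)
  have "\<alpha> * laplace_side s \<alpha> \<tau> + laplace_side_deriv s \<alpha> \<tau> = \<tau> / c * \<alpha> + s / c\<^sup>2 * (1 - exp (- c * \<alpha>))" for \<alpha>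
    unfolding laplace_side_def laplace_side_deriv_def c_def[symmetric] using c
    by (simp add: divide_simps power2_eq_square) algebra
  moreover have "((\<lambda>\<alpha>. \<tau> / c * \<alpha> + s / c\<^sup>2 * (1 - exp (- c * \<alpha>))) has_real_derivative \<tau> / c * 1 + s / c\<^sup>2 * (0 - exp (- c * \<alpha>) * (- c))) (at \<alpha>)"
  proof -
    have "((\<lambda>\<alpha>. - c * \<alpha>) has_real_derivative - c) (at \<alpha>)"
      by (rule DERIV_cmult_Id)
    then show ?thesis
      by (intro DERIV_add DERIV_cmult DERIV_diff DERIV_ident DERIV_const DERIV_fun_exp)
  qed
  moreover have "\<tau> / c * 1 + s / c\<^sup>2 * (0 - exp (- c * \<alpha>) * (- c)) = laplace_side s \<alpha> \<tau>"
    unfolding laplace_side_def c_def[symmetric] using c by (simp add: power2_eq_square add_divide_distrib)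
  ultimately show ?thesis by simp
qed

text \<open>The equations are linear and have the constant solution 1, so the complement of a
  Laplace transform solves them as well. The transforms serve for the inverse volume, the
  complements for tail bounds.\<close>

lemma one_sided_laplace:
  assumes s: "0 < s"
  shows "one_sided (laplace_side s) (laplace_side_deriv s)"
    and "one_sided (\<lambda>\<alpha> \<tau>. 1 - laplace_side s \<alpha> \<tau>) (\<lambda>\<alpha> \<tau>. - laplace_side_deriv s \<alpha> \<tau>)"
proof -
  have [measurable]: "(\<lambda>\<alpha>. laplace_side s \<alpha> \<tau>) \<in> borel_measurable borel" "laplace_side s \<alpha> \<in> borel_measurable borel"
    "laplace_side_deriv s \<alpha> \<in> borel_measurable borel" for \<alpha> \<tau>
    unfolding laplace_side_def[abs_def] laplace_side_deriv_def[abs_def] by measurable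
  define F where "F \<tau> \<alpha> = \<alpha> * laplace_side s \<alpha> \<tau> + laplace_side_deriv s \<alpha> \<tau>" for \<alpha> \<tau>
  have F: "(F \<tau> has_real_derivative laplace_side s \<alpha> \<tau>) (at \<alpha>)" if "0 \<le> \<tau>" for \<alpha> \<tau>
    unfolding F_def using laplace_side_antideriv[OF s that] .
  have F0: "F \<tau> 0 = 0" for \<tau> by (simp add: F_def laplace_side_deriv_def)
  have F_nonneg: "0 \<le> F \<tau> \<alpha>" "F \<tau> \<alpha> \<le> \<alpha>" if "0 \<le> \<alpha>" "0 \<le> \<tau>" for \<alpha> \<tau>
  proof -
    show "0 \<le> F \<tau> \<alpha>"
      using DERIV_nonneg_imp_nondecreasing[of 0 \<alpha> "F \<tau>"] F[OF that(2)] that laplace_side_bounds(1)[OF s _ that(2)] F0[of \<tau>]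
      by force
    have "((\<lambda>\<alpha>. \<alpha> - F \<tau> \<alpha>) has_real_derivative 1 - laplace_side s y \<tau>) (at y)" for y
      using F[OF that(2)] by (auto intro!: derivative_eq_intros)
    then show "F \<tau> \<alpha> \<le> \<alpha>"
      using DERIV_nonneg_imp_nondecreasing[of 0 \<alpha> "\<lambda>\<alpha>. \<alpha> - F \<tau> \<alpha>"] that laplace_side_bounds(2)[OF s _ that(2)] F0[of \<tau>]
      by force
  qed
  have int1: "(\<integral>\<^sup>+y. ennreal (laplace_side s y \<tau>) * indicator {0..\<alpha>} y \<partial>lborel) = ennreal (F \<tau> \<alpha>)" if "0 \<le> \<alpha>" "0 \<le> \<tau>" for \<alpha> \<tau>
    using nn_integral_FTC_Icc[of "\<lambda>y. laplace_side s y \<tau>" 0 \<alpha> "F \<tau>"] F[OF that(2)] that laplace_side_bounds(1)[OF s _ that(2)] F0[of \<tau>]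
    by auto
  have int2: "(\<integral>\<^sup>+y. ennreal (1 - laplace_side s y \<tau>) * indicator {0..\<alpha>} y \<partial>lborel) = ennreal (\<alpha> - F \<tau> \<alpha>)" if "0 \<le> \<alpha>" "0 \<le> \<tau>" for \<alpha> \<tau>
  proof -
    have "(\<integral>\<^sup>+y. ennreal (1 - laplace_side s y \<tau>) * indicator {0..\<alpha>} y \<partial>lborel) = ennreal ((\<alpha> - F \<tau> \<alpha>) - (0 - F \<tau> 0))"
      using that laplace_side_bounds(2)[OF s _ that(2)] F[OF that(2)]
      by (intro nn_integral_FTC_Icc) (auto intro!: derivative_eq_intros)
    then show ?thesis by (simp add: F0)
  qed
  show "one_sided (laplace_side s) (laplace_side_deriv s)"
    unfolding one_sided_def
    using laplace_side_bounds(1)[OF s] laplace_side_deriv[OF s] int1 F_nonneg(1) by (simp add: F_def)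
  show "one_sided (\<lambda>\<alpha> \<tau>. 1 - laplace_side s \<alpha> \<tau>) (\<lambda>\<alpha> \<tau>. - laplace_side_deriv s \<alpha> \<tau>)"
    unfolding one_sided_def
    using laplace_side_bounds(2)[OF s] laplace_side_deriv[OF s] int2 F_nonneg(2)
    by (auto simp: F_def algebra_simps intro!: derivative_eq_intros)
qed

section \<open>Inverse volume and extent of the cell\<close>

text \<open>The right-hand side is the value for independent distances of \<open>x\<close> to the
  faces, each the minimum of an exponential variable of rate \<open>lam\<close> and the distance to
  the boundary of the cube. The factors may be chosen face by face.\<close>

lemma mondrian_backward:
  fixes x :: "real ^ 'd"
  assumes x: "x \<in> box 0 1" and "0 \<le> lam"
    and p: "\<And>j. one_sided (p j) (p' j)" and q: "\<And>j. one_sided (q j) (q' j)"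
  shows "(\<integral>\<^sup>+T. ennreal (\<Prod>j\<in>UNIV. p j (x $ j - cell_lo x j T) 0 * q j (cell_hi x j T - x $ j) 0) \<partial>mondrian lam)
    \<le> ennreal (\<Prod>j\<in>UNIV. p j (x $ j) lam * q j (1 - x $ j) lam)"
proof (rule nn_integral_mondrian_le)
  let ?h = "\<lambda>j l u \<tau>. p j (x $ j - l) \<tau> * q j (u - x $ j) \<tau>"
  have bs: "backward_solution (x $ j) (?h j) (\<lambda>l u \<tau>. p' j (x $ j - l) \<tau> * q j (u - x $ j) \<tau> + p j (x $ j - l) \<tau> * q' j (u - x $ j) \<tau>)" for j
    by (rule backward_solution_product[OF p q])
  have eq: "cell_prod ?h x 0 1 T = (\<Prod>j\<in>UNIV. p j (x $ j - cell_lo x j T) 0 * q j (cell_hi x j T - x $ j) 0)" for T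
    using cell_lo_bounds[OF x, of _ T] by (simp add: cell_prod_def max_absorb2 min_absorb2)
  show "(\<lambda>T. ennreal (\<Prod>j\<in>UNIV. p j (x $ j - cell_lo x j T) 0 * q j (cell_hi x j T - x $ j) 0)) \<in> borel_measurable tree_space"
    unfolding eq[symmetric] using cell_prod_measurable[OF bs, of 0 1] by measurable
  show "(\<integral>\<^sup>+T. ennreal (\<Prod>j\<in>UNIV. p j (x $ j - cell_lo x j T) 0 * q j (cell_hi x j T - x $ j) 0) \<partial>mondrian_upto lam m 0 1 0)
    \<le> ennreal (\<Prod>j\<in>UNIV. p j (x $ j) lam * q j (1 - x $ j) lam)" for m
    using mondrian_upto_backward[OF bs, of 0 1 0 lam m] x \<open>0 \<le> lam\<close>
    unfolding eq by (simp add: mem_box_cart less_imp_le)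
qed

lemma emeasure_mondrian_le_1: "emeasure (mondrian lam) (space (mondrian lam)) \<le> 1"
proof -
  have "(\<integral>\<^sup>+T. 1 \<partial>mondrian lam) \<le> 1"
    by (rule nn_integral_mondrian_le) (auto simp: subprob_space.emeasure_space_le_1 subprob_mondrian_upto)
  then show ?thesis by simp
qed

lemma finite_measure_mondrian: "finite_measure (mondrian lam)"
proof (rule finite_measureI)
  show "emeasure (mondrian lam) (space (mondrian lam)) \<noteq> \<infinity>"
    using emeasure_mondrian_le_1 by (metis ennreal_one_neq_top infinity_ennreal_def top.extremum_uniqueI)
qed

lemma laplace_side_0: "0 < s \<Longrightarrow> laplace_side s \<alpha> 0 = exp (- s * \<alpha>)"
  by (simp add: laplace_side_def)

text \<open>Each factor is at most exp (- s a) + tau / (tau + s), and also at most 1. Expanding the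
  product leaves two exponentials, which contribute the distances to the boundary, and the square of
  tau / (tau + s), whose integral is tau. This last term is the one of the order of the
  lifetime.\<close>

lemma nn_integral_laplace_side_product:
  assumes "0 < \<alpha>" "0 < \<beta>" "0 < \<tau>"
  shows "(\<integral>\<^sup>+s. indicator {0<..} s * ennreal (laplace_side s \<alpha> \<tau> * laplace_side s \<beta> \<tau>) \<partial>lborel)
    \<le> ennreal (1 / \<alpha> + 1 / \<beta> + \<tau>)"
proof -
  have exp_int: "(\<integral>\<^sup>+s. ennreal (exp (- s * a)) * indicator {0..} s \<partial>lborel) = ennreal (1 / a)" if "0 < a" for a :: real
  proof -
    have "((\<lambda>s. - exp (- s * a) / a) \<longlongrightarrow> 0) at_top" using that by real_asymp
    then have "(\<integral>\<^sup>+s. ennreal (exp (- s * a)) * indicator {0..} s \<partial>lborel) = ennreal (0 - (- exp (- 0 * a) / a))"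
      using that by (intro nn_integral_FTC_atLeast) (auto intro!: derivative_eq_intros)
    then show ?thesis by simp
  qed
  have sq_int: "(\<integral>\<^sup>+s. ennreal (\<tau>\<^sup>2 / (\<tau> + s)\<^sup>2) * indicator {0..} s \<partial>lborel) = ennreal \<tau>"
  proof -
    have "((\<lambda>s. - \<tau>\<^sup>2 / (\<tau> + s)) \<longlongrightarrow> 0) at_top" using assms by real_asymp
    then have "(\<integral>\<^sup>+s. ennreal (\<tau>\<^sup>2 / (\<tau> + s)\<^sup>2) * indicator {0..} s \<partial>lborel) = ennreal (0 - (- \<tau>\<^sup>2 / (\<tau> + 0)))"
      using assms by (intro nn_integral_FTC_atLeast) (auto intro!: derivative_eq_intros simp: power2_eq_square)
    then show ?thesis using assms by (simp add: power2_eq_square)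
  qed
  have "(\<integral>\<^sup>+s. indicator {0<..} s * ennreal (laplace_side s \<alpha> \<tau> * laplace_side s \<beta> \<tau>) \<partial>lborel)
    \<le> (\<integral>\<^sup>+s. ennreal (exp (- s * \<alpha>)) * indicator {0..} s + ennreal (exp (- s * \<beta>)) * indicator {0..} s
         + ennreal (\<tau>\<^sup>2 / (\<tau> + s)\<^sup>2) * indicator {0..} s \<partial>lborel)"
  proof (intro nn_integral_mono, goal_cases)
    case (1 s)
    show ?case
    proof (cases "0 < s")
      case True
      have le: "laplace_side s a \<tau> \<le> exp (- s * a) + \<tau> / (\<tau> + s)" if "0 < a" for a
      proof -
        have "s / (\<tau> + s) * exp (- (\<tau> + s) * a) \<le> 1 * exp (- s * a)"
          using True assms that by (intro mult_mono) (auto simp: divide_simps algebra_simps)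
        then show ?thesis by (simp add: laplace_side_def add_divide_distrib)
      qed
      note b = laplace_side_bounds[OF True _ less_imp_le[OF assms(3)]]
      have "laplace_side s \<alpha> \<tau> * laplace_side s \<beta> \<tau> \<le> exp (- s * \<alpha>) * laplace_side s \<beta> \<tau> + \<tau> / (\<tau> + s) * laplace_side s \<beta> \<tau>"
        using mult_right_mono[OF le[OF assms(1)] b(1)[of \<beta>]] assms by (simp add: distrib_right)
      also have "\<dots> \<le> exp (- s * \<alpha>) * 1 + \<tau> / (\<tau> + s) * (exp (- s * \<beta>) + \<tau> / (\<tau> + s))"
        using assms True le[OF assms(2)] b(2)[of \<beta>] by (intro add_mono mult_left_mono) auto
      also have "\<tau> / (\<tau> + s) * (exp (- s * \<beta>) + \<tau> / (\<tau> + s)) \<le> exp (- s * \<beta>) + \<tau>\<^sup>2 / (\<tau> + s)\<^sup>2"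
      proof -
        have "\<tau> / (\<tau> + s) * exp (- s * \<beta>) \<le> 1 * exp (- s * \<beta>)"
          using True assms by (intro mult_right_mono) (auto simp: divide_simps)
        then show ?thesis by (simp add: distrib_left power2_eq_square)
      qed
      finally have "ennreal (laplace_side s \<alpha> \<tau> * laplace_side s \<beta> \<tau>) \<le> ennreal (exp (- s * \<alpha>) + exp (- s * \<beta>) + \<tau>\<^sup>2 / (\<tau> + s)\<^sup>2)"
        by (intro ennreal_leI) simp
      then show ?thesis using True by (simp add: ennreal_plus[symmetric] del: ennreal_plus)
    qed simp
  qed
  also have "\<dots> = ennreal (1 / \<alpha>) + ennreal (1 / \<beta>) + ennreal \<tau>"
    using exp_int[of \<alpha>] exp_int[of \<beta>] sq_int assms by (subst nn_integral_add, simp, simp)+ simp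
  also have "\<dots> = ennreal (1 / \<alpha> + 1 / \<beta> + \<tau>)"
    using assms by (simp add: ennreal_plus)
  finally show ?thesis .
qed

lemma inverse_eq_nn_integral_exp:
  assumes "0 < (a :: real)"
  shows "(\<integral>\<^sup>+s. indicator {0<..} s * ennreal (exp (- s * a)) \<partial>lborel) = ennreal (1 / a)"
proof -
  have "((\<lambda>s. - exp (- s * a) / a) \<longlongrightarrow> 0) at_top" using assms by real_asymp
  then have "(\<integral>\<^sup>+s. ennreal (exp (- s * a)) * indicator {0..} s \<partial>lborel) = ennreal (0 - (- exp (- 0 * a) / a))"
    using assms by (intro nn_integral_FTC_atLeast) (auto intro!: derivative_eq_intros)
  moreover have "(\<integral>\<^sup>+s. ennreal (exp (- s * a)) * indicator {0..} s \<partial>lborel) =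
     (\<integral>\<^sup>+s. indicator {0<..} s * ennreal (exp (- s * a)) \<partial>lborel)"
    using AE_lborel_singleton[of 0]
    by (intro nn_integral_cong_AE, eventually_elim) (auto simp: indicator_def)
  ultimately show ?thesis by simp
qed

lemma prod_mono_ennreal:
  fixes f g :: "'a \<Rightarrow> ennreal"
  assumes "\<And>i. i \<in> A \<Longrightarrow> f i \<le> g i"
  shows "prod f A \<le> prod g A"
  using assms by (induction A rule: infinite_finite_induct) (auto intro!: mult_mono)

text \<open>Since 1 / a is the integral of exp (- s a) over s > 0, the inverse volume is an integral
  over one Laplace variable for each coordinate. Exchanging it with the expectation leaves the joint
  transform of the distances to the faces, both faces of a side sharing their variable; after
  \<open>mondrian_backward\<close> the integral factorises over the coordinates.\<close>

lemma mondrian_inverse_volume: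
  fixes x :: "real ^ 'd"
  assumes x: "x \<in> box 0 1" and lam: "0 < lam"
  shows "(\<integral>\<^sup>+T. ennreal (\<Prod>j\<in>UNIV. 1 / (cell_hi x j T - cell_lo x j T)) \<partial>mondrian lam)
    \<le> ennreal (\<Prod>j\<in>UNIV. 1 / (x $ j) + 1 / (1 - x $ j) + lam)"
proof -
  interpret L: product_sigma_finite "\<lambda>_ :: 'd. lborel :: real measure" ..
  interpret M: finite_measure "mondrian lam" by (rule finite_measure_mondrian)
  let ?V = "PiM (UNIV :: 'd set) (\<lambda>_. lborel :: real measure)"
  interpret V: sigma_finite_measure ?V by (rule L.sigma_finite) simp
  interpret MV: pair_sigma_finite "mondrian lam" ?V ..
  let ?s = "\<lambda>T j. cell_hi x j T - cell_lo x j T"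
  have pos: "0 < ?s T j" for T j using cell_lo_bounds[OF x, of j T] by simp
  have xj: "0 < x $ j" "x $ j < 1" for j using x by (auto simp: mem_box_cart)
  have [measurable]: "(\<lambda>y. y j) \<in> ?V \<rightarrow>\<^sub>M borel" for j
    by (rule measurable_compose[OF measurable_component_singleton]) auto
  have "(\<integral>\<^sup>+T. ennreal (\<Prod>j\<in>UNIV. 1 / ?s T j) \<partial>mondrian lam)
    = (\<integral>\<^sup>+T. (\<Prod>j\<in>UNIV. (\<integral>\<^sup>+s. indicator {0<..} s * ennreal (exp (- s * ?s T j)) \<partial>lborel)) \<partial>mondrian lam)"
    unfolding inverse_eq_nn_integral_exp[OF pos] using pos by (simp only: prod_ennreal less_imp_le divide_nonneg_nonneg zero_le_one)
  also have "\<dots> = (\<integral>\<^sup>+T. (\<integral>\<^sup>+v. (\<Prod>j\<in>UNIV. indicator {0<..} (v j) * ennreal (exp (- v j * ?s T j))) \<partial>?V) \<partial>mondrian lam)"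
    by (subst L.product_nn_integral_prod) auto
  also have "\<dots> = (\<integral>\<^sup>+v. (\<integral>\<^sup>+T. (\<Prod>j\<in>UNIV. indicator {0<..} (v j) * ennreal (exp (- v j * ?s T j))) \<partial>mondrian lam) \<partial>?V)"
    by (rule MV.Fubini'[symmetric]) measurable
  also have "\<dots> \<le> (\<integral>\<^sup>+v. (\<Prod>j\<in>UNIV. indicator {0<..} (v j) * ennreal (laplace_side (v j) (x $ j) lam * laplace_side (v j) (1 - x $ j) lam)) \<partial>?V)"
  proof (intro nn_integral_mono, goal_cases)
    case (1 v)
    show ?case
    proof (cases "\<forall>j. 0 < v j")
      case True
      have "(\<integral>\<^sup>+T. (\<Prod>j\<in>UNIV. indicator {0<..} (v j) * ennreal (exp (- v j * ?s T j))) \<partial>mondrian lam)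
        = (\<integral>\<^sup>+T. ennreal (\<Prod>j\<in>UNIV. laplace_side (v j) (x $ j - cell_lo x j T) 0 * laplace_side (v j) (cell_hi x j T - x $ j) 0) \<partial>mondrian lam)"
      proof (intro nn_integral_cong, goal_cases)
        case (1 T)
        have e: "exp (- v j * ?s T j) = laplace_side (v j) (x $ j - cell_lo x j T) 0 * laplace_side (v j) (cell_hi x j T - x $ j) 0" for j
          using True by (simp add: laplace_side_0 algebra_simps flip: exp_add)
        then show ?case using True by (simp add: prod_ennreal flip: e)
      qed
      also have "\<dots> \<le> ennreal (\<Prod>j\<in>UNIV. laplace_side (v j) (x $ j) lam * laplace_side (v j) (1 - x $ j) lam)"
        using True lam by (intro mondrian_backward[OF x, where p'="\<lambda>j. laplace_side_deriv (v j)" and q'="\<lambda>j. laplace_side_deriv (v j)"]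
            one_sided_laplace) auto
      finally show ?thesis
        using True lam xj by (simp add: prod_ennreal laplace_side_bounds less_imp_le)
    next
      case False
      then obtain j where "indicator {0<..} (v j) = (0 :: ennreal)" by (auto simp: indicator_def)
      then have z: "(\<Prod>j\<in>UNIV. indicator {0<..} (v j) * f j) = (0 :: ennreal)" for f :: "'d \<Rightarrow> ennreal"
        by (intro prod_zero) (auto intro!: bexI[of _ j])
      show ?thesis unfolding z by simp
    qed
  qed
  also have "\<dots> = (\<Prod>j\<in>UNIV. \<integral>\<^sup>+s. indicator {0<..} s * ennreal (laplace_side s (x $ j) lam * laplace_side s (1 - x $ j) lam) \<partial>lborel)"
    by (subst L.product_nn_integral_prod) (auto simp: laplace_side_def)
  also have "\<dots> \<le> (\<Prod>j\<in>UNIV. ennreal (1 / (x $ j) + 1 / (1 - x $ j) + lam))"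
    using xj lam by (intro prod_mono_ennreal nn_integral_laplace_side_product) auto
  also have "\<dots> = ennreal (\<Prod>j\<in>UNIV. 1 / (x $ j) + 1 / (1 - x $ j) + lam)"
    using xj lam by (intro prod_ennreal) (simp add: less_imp_le)
  finally show ?thesis .
qed

text \<open>Markov's inequality for 1 - exp (- s a) with s = lam / K: this is at least 1 / 2 for a >
  K / lam, and its expectation is at most s / lam = 1 / K.\<close>

lemma mondrian_side_tail:
  fixes x :: "real ^ 'd"
  assumes x: "x \<in> box 0 1" and lam: "0 < lam" and K: "0 < K"
  shows "emeasure (mondrian lam) {T \<in> space tree_space. x $ j - cell_lo x j T > K / lam} \<le> ennreal (2 / K)"
    and "emeasure (mondrian lam) {T \<in> space tree_space. cell_hi x j T - x $ j > K / lam} \<le> ennreal (2 / K)"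
proof -
  define s where "s = lam / K"
  have s: "0 < s" using lam K by (simp add: s_def)
  have half: "ennreal (1 / 2) \<le> ennreal (1 - exp (- s * a))" if "a > K / lam" for a
  proof -
    have "s * a > s * (K / lam)" using that s by (rule mult_strict_left_mono)
    then have "s * a \<ge> 1" using K lam by (simp add: s_def)
    then have "exp (- s * a) \<le> exp (- 1)" by simp
    also have "exp (- 1 :: real) \<le> 1 / 2"
      using exp_ge_add_one_self[of 1] by (simp add: exp_minus divide_simps)
    finally show ?thesis by (intro ennreal_leI) simp
  qed
  have up: "1 - laplace_side s a lam \<le> 1 / K" if "0 \<le> a" for a
  proof -
    have "1 - laplace_side s a lam = (s - s * exp (- (lam + s) * a)) / (lam + s)"
      using lam s by (simp add: laplace_side_def divide_simps)
    also have "\<dots> \<le> s / lam" using lam s by (intro frac_le) auto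
    finally show ?thesis using lam K by (simp add: s_def)
  qed
  \<comment> \<open>Only the face under consideration is tested; every other face gets the constant
    factor 1.\<close>
  let ?p = "\<lambda>i \<alpha> \<tau>. if i = j then 1 - laplace_side s \<alpha> \<tau> else 1"
  let ?p' = "\<lambda>i \<alpha> \<tau>. if i = j then - laplace_side_deriv s \<alpha> \<tau> else 0"
  have os: "one_sided (?p i) (?p' i)" for i
    using one_sided_laplace(2)[OF s] one_sided_const by (cases "i = j") simp_all
  have bound: "ennreal (1 / 2) * emeasure (mondrian lam) {T \<in> space tree_space. a T > K / lam}
     \<le> (\<integral>\<^sup>+T. ennreal (1 - laplace_side s (a T) 0) \<partial>mondrian lam)"
    if [measurable]: "a \<in> borel_measurable tree_space" for a
  proof -
    have "ennreal (1 / 2) * emeasure (mondrian lam) {T \<in> space tree_space. a T > K / lam} =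
      (\<integral>\<^sup>+T. ennreal (1 / 2) * indicator {T \<in> space tree_space. a T > K / lam} T \<partial>mondrian lam)"
      by (simp add: nn_integral_cmult_indicator)
    also have "\<dots> \<le> (\<integral>\<^sup>+T. ennreal (1 - laplace_side s (a T) 0) \<partial>mondrian lam)"
      using half by (intro nn_integral_mono) (auto simp: indicator_def laplace_side_0[OF s])
    finally show ?thesis .
  qed
  have fin: "E \<le> ennreal (2 / K)" if "ennreal (1 / 2) * E \<le> ennreal (1 / K)" for E
  proof -
    have "E = ennreal 2 * (ennreal (1 / 2) * E)"
      unfolding mult.assoc[symmetric] by (subst ennreal_mult'[symmetric]) auto
    also have "\<dots> \<le> ennreal 2 * ennreal (1 / K)" by (rule mult_left_mono[OF that]) simp
    also have "\<dots> = ennreal (2 / K)" by (subst ennreal_mult'[symmetric]) auto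
    finally show ?thesis .
  qed
  have prod_single: "(\<Prod>i\<in>UNIV. if i = j then f i else 1) = f j" for f :: "'d \<Rightarrow> real"
    by (simp add: prod.delta)
  have xj: "0 < x $ j" "x $ j < 1" using x by (auto simp: mem_box_cart)
  have "(\<integral>\<^sup>+T. ennreal (1 - laplace_side s (x $ j - cell_lo x j T) 0) \<partial>mondrian lam) \<le> ennreal (1 - laplace_side s (x $ j) lam)"
    using mondrian_backward[where p="?p" and p'="?p'", OF x less_imp_le[OF lam] os one_sided_const] by (simp add: prod_single)
  note order.trans[OF order.trans[OF bound this], rotated]
  from this[OF ennreal_leI[OF up]] show "emeasure (mondrian lam) {T \<in> space tree_space. x $ j - cell_lo x j T > K / lam} \<le> ennreal (2 / K)"
    using xj by (intro fin) (simp only: TrueI less_imp_le borel_measurable_diff borel_measurable_const cell_lo_measurable cell_hi_measurable diff_ge_0_iff_ge)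
  have "(\<integral>\<^sup>+T. ennreal (1 - laplace_side s (cell_hi x j T - x $ j) 0) \<partial>mondrian lam) \<le> ennreal (1 - laplace_side s (1 - x $ j) lam)"
    using mondrian_backward[where q="?p" and q'="?p'", OF x less_imp_le[OF lam] one_sided_const os] by (simp add: prod_single)
  note order.trans[OF order.trans[OF bound this], rotated]
  from this[OF ennreal_leI[OF up]] show "emeasure (mondrian lam) {T \<in> space tree_space. cell_hi x j T - x $ j > K / lam} \<le> ennreal (2 / K)"
    using xj by (intro fin) (simp only: TrueI less_imp_le borel_measurable_diff borel_measurable_const cell_lo_measurable cell_hi_measurable diff_ge_0_iff_ge)
qed

section \<open>Conditional quantiles\<close>

text \<open>Its density with respect to the marginal of the first coordinate is the conditional
  probability of \<open>S\<close>.\<close>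

definition slice_measure :: "('a::second_countable_topology \<times> real) measure \<Rightarrow> real set \<Rightarrow> 'a measure" where
  "slice_measure P S = distr (density P (\<lambda>z. indicator S (snd z))) borel fst"

lemma emeasure_slice_measure:
  assumes [measurable_cong]: "sets P = sets (borel \<Otimes>\<^sub>M borel)" and [measurable]: "S \<in> sets borel" "A \<in> sets borel"
  shows "emeasure (slice_measure P S) A = emeasure P (A \<times> S)"
proof -
  have AS: "A \<times> S \<in> sets P" using assms by auto
  have sp: "space P = UNIV" using sets_eq_imp_space_eq[OF assms(1)] by (simp add: space_pair_measure)
  have "fst -` A \<inter> space P \<in> sets P" by (rule measurable_sets[OF _ assms(3)]) measurable
  then have "emeasure (slice_measure P S) A = (\<integral>\<^sup>+z. indicator S (snd z) * indicator (fst -` A) z \<partial>P)"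
    unfolding slice_measure_def by (subst emeasure_distr) (auto simp: emeasure_density sp)
  also have "\<dots> = (\<integral>\<^sup>+z. indicator (A \<times> S) z \<partial>P)"
    by (intro nn_integral_cong) (auto simp: indicator_def)
  finally show ?thesis using AS by simp
qed

lemma emeasure_slice_snd:
  assumes [measurable_cong]: "sets M = sets (borel \<Otimes>\<^sub>M borel)" and [measurable]: "X \<in> sets borel" "Y \<in> sets borel"
  shows "emeasure (distr (density M (\<lambda>z. indicator X (fst z))) borel snd) Y = emeasure M (X \<times> Y)"
proof -
  have XY: "X \<times> Y \<in> sets M" using assms by auto
  have sp: "space M = UNIV" using sets_eq_imp_space_eq[OF assms(1)] by (simp add: space_pair_measure)
  have "snd -` Y \<inter> space M \<in> sets M" by (rule measurable_sets[OF _ assms(3)]) measurable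
  then have "emeasure (distr (density M (\<lambda>z. indicator X (fst z))) borel snd) Y = (\<integral>\<^sup>+z. indicator X (fst z) * indicator (snd -` Y) z \<partial>M)"
    by (subst emeasure_distr) (auto simp: emeasure_density sp)
  also have "\<dots> = (\<integral>\<^sup>+z. indicator (X \<times> Y) z \<partial>M)"
    by (intro nn_integral_cong) (auto simp: indicator_def)
  finally show ?thesis using XY by simp
qed

text \<open>Conditional probabilities can be compared outside one null set for countably many
  thresholds only. A half-line above an arbitrary t is therefore exhausted by half-lines above
  rationals.\<close>

lemma exists_decreasing_rationals:
  assumes "t < (b :: real)"
  obtains q where "decseq q" "\<And>n. q n \<in> \<rat>" "\<And>n. t < q n" "\<And>n. q n < b" "q \<longlonglongrightarrow> t"
proof -
  have ex: "\<exists>y. y \<in> \<rat> \<and> t < y \<and> y < b \<and> y < t + 1 / real (Suc n) \<and> y \<le> c" if "t < c" for c n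
  proof -
    have "t < min (min b (t + 1 / real (Suc n))) c" using assms that by simp
    then obtain y where "y \<in> \<rat>" "t < y" "y < min (min b (t + 1 / real (Suc n))) c"
      using Rats_dense_in_real by blast
    then show ?thesis by (intro exI[of _ y]) auto
  qed
  have "\<exists>q. \<forall>n. (q n \<in> \<rat> \<and> t < q n \<and> q n < b \<and> q n < t + 1 / real (Suc n)) \<and> q (Suc n) \<le> q n"
    using ex[OF assms] ex by (intro dependent_nat_choice) blast+
  then obtain q where q: "\<And>n. q n \<in> \<rat>" "\<And>n. t < q n" "\<And>n. q n < b" "\<And>n. q n < t + 1 / real (Suc n)" "\<And>n. q (Suc n) \<le> q n"
    by blast
  have "q \<longlonglongrightarrow> t"
  proof (rule real_tendsto_sandwich[where f="\<lambda>_. t"])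
    show "(\<lambda>n. t + 1 / real (Suc n)) \<longlonglongrightarrow> t"
      using LIMSEQ_inverse_real_of_nat_add[of t] by (simp add: field_simps)
    show "\<forall>\<^sub>F n in sequentially. q n \<le> t + 1 / real (Suc n)"
      using less_imp_le[OF q(4)] by (intro always_eventually) blast
  qed (use q in \<open>auto intro!: always_eventually less_imp_le\<close>)
  moreover have "decseq q" using q(5) by (simp add: decseq_Suc_iff)
  ultimately show ?thesis using q(1-3) by (intro that[of q])
qed

lemma prob_eqI_rectangles:
  assumes "finite_measure M" "sets M = sets (A \<Otimes>\<^sub>M B)" "sets N = sets (A \<Otimes>\<^sub>M B)"
    and eq: "\<And>X Y. X \<in> sets A \<Longrightarrow> Y \<in> sets B \<Longrightarrow> emeasure M (X \<times> Y) = emeasure N (X \<times> Y)"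
  shows "M = N"
proof (rule measure_eqI_generator_eq)
  interpret finite_measure M by fact
  show "emeasure M (space A \<times> space B) \<noteq> \<infinity>" by simp
  show "range (\<lambda>_. space A \<times> space B) \<subseteq> {X \<times> Y | X Y. X \<in> sets A \<and> Y \<in> sets B}" by auto
  show "sets M = sigma_sets (space A \<times> space B) {X \<times> Y | X Y. X \<in> sets A \<and> Y \<in> sets B}"
    "sets N = sigma_sets (space A \<times> space B) {X \<times> Y | X Y. X \<in> sets A \<and> Y \<in> sets B}"
    using assms(2,3) by (simp_all add: sets_pair_measure)
qed (auto simp: Int_stable_pair_measure_generator eq pair_measure_closed)

text \<open>\<open>\<kappa> S\<close> is the conditional probability of \<open>S\<close> given the
  first coordinate, obtained as a Radon-Nikodym derivative. \<open>\<psi> x\<close> is a generalised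
  inverse of the conditional survival function q -> \<open>\<kappa> {q<..} x\<close>, hence
  decreasing in the uniform variable: it exceeds t exactly for those v that are at most the survival
  probability at some rational q > t, and these v have the conditional probability of {t<..} as
  their measure.\<close>

lemma quantile_representation_unit:
  fixes P :: "('a::second_countable_topology \<times> real) measure"
  assumes prob: "prob_space P" and sets[measurable_cong]: "sets P = sets (borel \<Otimes>\<^sub>M borel)"
    and range: "emeasure P (UNIV \<times> - {0<..<1}) = 0"
  defines "\<nu> \<equiv> distr P borel fst" and "U \<equiv> uniform_measure lborel {0..1 :: real}"
  shows "\<exists>\<psi>. (\<lambda>(x, v). \<psi> x v) \<in> borel_measurable (borel \<Otimes>\<^sub>M borel) \<and>
    distr (\<nu> \<Otimes>\<^sub>M U) (borel \<Otimes>\<^sub>M borel) (\<lambda>(x, v). (x, \<psi> x v)) = P"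
proof -
  interpret P: prob_space P by (rule prob)
  have sp: "space P = UNIV" using sets_eq_imp_space_eq[OF sets] by (simp add: space_pair_measure)
  interpret \<nu>: prob_space \<nu> unfolding \<nu>_def by (rule P.prob_space_distr) simp
  interpret U: prob_space U unfolding U_def by (rule prob_space_uniform_measure) auto
  interpret \<nu>U: pair_prob_space \<nu> U ..
  have [measurable_cong, simp]: "sets \<nu> = sets borel" "sets U = sets borel"
    by (auto simp: \<nu>_def U_def)
  note es = emeasure_slice_measure[OF sets]
  have \<nu>_eq: "emeasure \<nu> A = emeasure P (A \<times> UNIV)" if "A \<in> sets borel" for A
    unfolding \<nu>_def using that by (subst emeasure_distr) (auto simp: sp intro!: arg_cong[where f="emeasure P"])
  have Prect: "A \<times> S \<in> sets P" if "A \<in> sets borel" "S \<in> sets borel" for A S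
    using that by (auto simp: sets)
  define \<kappa> where "\<kappa> S = RN_deriv \<nu> (slice_measure P S)" for S
  have \<kappa>_m [measurable]: "\<kappa> S \<in> borel_measurable borel" for S
    unfolding \<kappa>_def using borel_measurable_RN_deriv[of \<nu>] by simp
  have ss [simp]: "sets (slice_measure P S) = sets borel" for S by (simp add: slice_measure_def)
  have \<kappa>: "density \<nu> (\<kappa> S) = slice_measure P S" if S: "S \<in> sets borel" for S
    unfolding \<kappa>_def
  proof (rule \<nu>.density_RN_deriv)
    have "emeasure (slice_measure P S) A = 0" if A: "A \<in> sets borel" "emeasure \<nu> A = 0" for A
    proof -
      have "emeasure P (A \<times> S) \<le> emeasure P (A \<times> UNIV)"
        using A by (intro emeasure_mono) (auto intro!: Prect)
      then show ?thesis using A S by (simp add: es \<nu>_eq)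
    qed
    then show "absolutely_continuous \<nu> (slice_measure P S)"
      by (auto simp: absolutely_continuous_def null_sets_def)
  qed simp
  have \<kappa>_int: "(\<integral>\<^sup>+x. \<kappa> S x * indicator A x \<partial>\<nu>) = emeasure P (A \<times> S)" if "A \<in> sets borel" "S \<in> sets borel" for A S
    using that arg_cong[OF \<kappa>[OF that(2)], of "\<lambda>M. emeasure M A"] by (simp add: es emeasure_density)
  have \<kappa>_unique: "AE x in \<nu>. f x = \<kappa> S x" if S: "S \<in> sets borel" and [measurable]: "f \<in> borel_measurable borel"
      and f: "\<And>A. A \<in> sets borel \<Longrightarrow> (\<integral>\<^sup>+x. f x * indicator A x \<partial>\<nu>) = emeasure P (A \<times> S)" for f S
    unfolding \<kappa>_def
    by (rule \<nu>.RN_deriv_unique) (auto intro!: measure_eqI simp: emeasure_density f es S)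
  have \<kappa>_mono: "AE x in \<nu>. \<kappa> S x \<le> \<kappa> S' x" if S [measurable]: "S \<in> sets borel" "S' \<in> sets borel" "S \<subseteq> S'" for S S'
  proof -
    have "AE x in \<nu>. \<kappa> S x + \<kappa> (S' - S) x = \<kappa> S' x"
    proof (rule \<kappa>_unique)
      fix A :: "'a set" assume [measurable]: "A \<in> sets borel"
      have "A \<times> S' = A \<times> S \<union> A \<times> (S' - S)" using S by auto
      moreover have "emeasure P (A \<times> S \<union> A \<times> (S' - S)) = emeasure P (A \<times> S) + emeasure P (A \<times> (S' - S))"
        by (rule plus_emeasure[symmetric]) (auto intro!: Prect)
      ultimately show "(\<integral>\<^sup>+x. (\<kappa> S x + \<kappa> (S' - S) x) * indicator A x \<partial>\<nu>) = emeasure P (A \<times> S')"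
        by (simp add: distrib_right nn_integral_add \<kappa>_int)
    qed auto
    then show ?thesis by eventually_elim (metis le_iff_add)
  qed
  have \<kappa>_UNIV: "AE x in \<nu>. 1 = \<kappa> UNIV x"
    by (rule \<kappa>_unique) (auto simp: \<nu>_eq)
  have \<kappa>_le_1: "AE x in \<nu>. \<kappa> S x \<le> 1" if "S \<in> sets borel" for S
    using \<kappa>_mono[OF that, of UNIV] \<kappa>_UNIV by auto
  \<comment> \<open>Rational thresholds keep the supremum measurable, the inserted 0 makes the set
    nonempty when no threshold qualifies, and the range below 1 bounds it.\<close>
  define \<psi> where "\<psi> x v = Sup (insert 0 {q \<in> \<rat> \<inter> {0<..<1}. ennreal v \<le> \<kappa> {q<..} x})" for x v
  have \<psi>_gt: "t < \<psi> x v \<longleftrightarrow> t < 0 \<or> (\<exists>q\<in>\<rat> \<inter> {0<..<1}. t < q \<and> ennreal v \<le> \<kappa> {q<..} x)" for t x v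
  proof -
    have "bdd_above (insert 0 {q \<in> \<rat> \<inter> {0<..<1}. ennreal v \<le> \<kappa> {q<..} x})"
      by (rule bdd_aboveI[of _ 1]) auto
    from less_cSup_iff[OF _ this, of t] show ?thesis unfolding \<psi>_def by blast
  qed
  have count: "countable (\<rat> \<inter> {0<..<1 :: real})"
    by (rule countable_subset[OF _ countable_rat]) auto
  have \<psi>_m: "(\<lambda>(x, v). \<psi> x v) \<in> borel_measurable (borel \<Otimes>\<^sub>M borel)"
  proof (rule borel_measurable_iff_greater[THEN iffD2], rule allI)
    fix t
    have "{z \<in> space (borel \<Otimes>\<^sub>M borel). t < 0 \<or> (\<exists>q\<in>\<rat> \<inter> {0<..<1}. t < q \<and> ennreal (snd z) \<le> \<kappa> {q<..} (fst z))}
      \<in> sets (borel \<Otimes>\<^sub>M borel :: ('a \<times> real) measure)"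
      using count by measurable
    then show "{z \<in> space (borel \<Otimes>\<^sub>M borel). t < (case z of (x, v) \<Rightarrow> \<psi> x v)} \<in> sets (borel \<Otimes>\<^sub>M borel :: ('a \<times> real) measure)"
      unfolding split_beta \<psi>_gt .
  qed
  note [measurable] = \<psi>_m
  let ?R = "distr (\<nu> \<Otimes>\<^sub>M U) (borel \<Otimes>\<^sub>M borel) (\<lambda>(x, v). (x, \<psi> x v))"
  have R_rect: "emeasure ?R (A \<times> {t<..}) = emeasure P (A \<times> {t<..})" if A [measurable]: "A \<in> sets borel" for A t
  proof -
    have "emeasure ?R (A \<times> {t<..}) = emeasure (\<nu> \<Otimes>\<^sub>M U) {z \<in> space (\<nu> \<Otimes>\<^sub>M U). fst z \<in> A \<and> t < \<psi> (fst z) (snd z)}"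
      by (subst emeasure_distr) (auto intro!: arg_cong[where f="emeasure _"] simp: split_beta)
    also have "\<dots> = emeasure P (A \<times> {t<..})"
    proof -
      consider "t < 0" | "0 \<le> t" "t < 1" | "1 \<le> t" by linarith
      then show ?thesis
      proof cases
        case 1
        have "{z \<in> space (\<nu> \<Otimes>\<^sub>M U). fst z \<in> A \<and> t < \<psi> (fst z) (snd z)} = A \<times> space U"
          using 1 sets.sets_into_space[OF A] by (auto simp: \<psi>_gt space_pair_measure \<nu>_def)
        then have "emeasure (\<nu> \<Otimes>\<^sub>M U) {z \<in> space (\<nu> \<Otimes>\<^sub>M U). fst z \<in> A \<and> t < \<psi> (fst z) (snd z)} =
            emeasure \<nu> A * emeasure U (space U)"
          using A by (simp only:) (rule U.emeasure_pair_measure_Times[OF _ sets.top], simp)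
        also have "\<dots> = emeasure P (A \<times> UNIV)"
          unfolding U.emeasure_space_1 \<nu>_eq[OF A] by (rule mult_1_right)
        also have "\<dots> = emeasure P (A \<times> {t<..})"
        proof (rule emeasure_eq_AE)
          have "AE z in P. z \<notin> UNIV \<times> - {0<..<1}"
            using range by (intro AE_not_in) (auto simp: null_sets_def sets)
          then show "AE z in P. z \<in> A \<times> UNIV \<longleftrightarrow> z \<in> A \<times> {t<..}"
            by eventually_elim (use 1 in auto)
        qed (use A in \<open>auto intro!: Prect\<close>)
        finally show ?thesis .
      next
        case 3
        have "emeasure P (A \<times> {t<..}) \<le> emeasure P (UNIV \<times> - {0<..<1})"
          using 3 by (intro emeasure_mono) (auto intro!: Prect)
        then have "emeasure P (A \<times> {t<..}) = 0" using range by simp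
        moreover have none: "\<not> t < \<psi> x v" for x v using 3 by (auto simp: \<psi>_gt)
        ultimately show ?thesis by simp
      next
        case 2
        obtain q where q: "decseq q" "\<And>n. q n \<in> \<rat>" "\<And>n. t < q n" "\<And>n. q n < 1" "q \<longlonglongrightarrow> t"
          by (rule exists_decreasing_rationals[OF 2(2)], rule that)
        \<comment> \<open>Monotonicity in the threshold is a countable family of almost sure
          statements and so holds outside a single null set.\<close>
        have AE1: "AE x in \<nu>. \<forall>r\<in>\<rat>. \<forall>r'\<in>\<rat>. r \<le> r' \<longrightarrow> \<kappa> {r'<..} x \<le> \<kappa> {r<..} x"
          by (auto simp: AE_ball_countable countable_rat intro!: \<kappa>_mono)
        have AE2: "AE x in \<nu>. \<forall>r\<in>\<rat>. \<kappa> {r<..} x \<le> 1"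
          by (auto simp: AE_ball_countable countable_rat intro!: \<kappa>_le_1)
        have U_le: "emeasure U {v. ennreal v \<le> c} = c" if "c \<le> 1" for c
        proof (cases c)
          case (real r)
          then have r: "0 \<le> r" "r \<le> 1" using that by (auto simp: ennreal_le_1)
          have "{0..1} \<inter> {v. ennreal v \<le> c} = {0..r}"
            using r real by (auto simp: ennreal_le_iff)
          moreover have "{v. ennreal v \<le> c} \<in> sets borel" by measurable
          ultimately show ?thesis using r real by (simp add: U_def divide_ennreal_def)
        qed (use that in \<open>auto simp: top_unique\<close>)
        have "emeasure (\<nu> \<Otimes>\<^sub>M U) {z \<in> space (\<nu> \<Otimes>\<^sub>M U). fst z \<in> A \<and> t < \<psi> (fst z) (snd z)}
          = (\<integral>\<^sup>+x. emeasure U (Pair x -` {z \<in> space (\<nu> \<Otimes>\<^sub>M U). fst z \<in> A \<and> t < \<psi> (fst z) (snd z)}) \<partial>\<nu>)"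
          by (rule U.emeasure_pair_measure_alt) measurable
        also have "\<dots> = (\<integral>\<^sup>+x. (SUP n. \<kappa> {q n<..} x * indicator A x) \<partial>\<nu>)"
          using AE1 AE2
        proof (intro nn_integral_cong_AE, eventually_elim)
          fix x assume mono: "\<forall>r\<in>\<rat>. \<forall>r'\<in>\<rat>. r \<le> r' \<longrightarrow> \<kappa> {r'<..} x \<le> \<kappa> {r<..} x" and le1: "\<forall>r\<in>\<rat>. \<kappa> {r<..} x \<le> 1"
          show "emeasure U (Pair x -` {z \<in> space (\<nu> \<Otimes>\<^sub>M U). fst z \<in> A \<and> t < \<psi> (fst z) (snd z)}) = (SUP n. \<kappa> {q n<..} x * indicator A x)"
          proof (cases "x \<in> A")
            case True
            have "Pair x -` {z \<in> space (\<nu> \<Otimes>\<^sub>M U). fst z \<in> A \<and> t < \<psi> (fst z) (snd z)} = (\<Union>n. {v. ennreal v \<le> \<kappa> {q n<..} x})"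
            proof -
              have "(t < \<psi> x v) \<longleftrightarrow> (\<exists>n. ennreal v \<le> \<kappa> {q n<..} x)" for v
              proof
                assume "t < \<psi> x v"
                then obtain r where r: "r \<in> \<rat>" "t < r" "ennreal v \<le> \<kappa> {r<..} x"
                  using 2 by (auto simp: \<psi>_gt)
                from order_tendstoD(2)[OF q(5) r(2)] obtain n where "q n < r"
                  by (auto simp: eventually_sequentially)
                then have "\<kappa> {r<..} x \<le> \<kappa> {q n<..} x" using mono q(2) r(1) by auto
                with r(3) show "\<exists>n. ennreal v \<le> \<kappa> {q n<..} x" by (blast intro: order.trans)
              next
                assume "\<exists>n. ennreal v \<le> \<kappa> {q n<..} x"
                then obtain n where "ennreal v \<le> \<kappa> {q n<..} x" ..
                then show "t < \<psi> x v"
                  unfolding \<psi>_gt using q(2,3,4)[of n] 2 by (intro disjI2 bexI[of _ "q n"]) auto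
              qed
              then show ?thesis using True by (auto simp: space_pair_measure \<nu>_def U_def)
            qed
            also have "emeasure U \<dots> = (SUP n. emeasure U {v. ennreal v \<le> \<kappa> {q n<..} x})"
            proof (rule SUP_emeasure_incseq[symmetric])
              show "range (\<lambda>n. {v. ennreal v \<le> \<kappa> {q n<..} x}) \<subseteq> sets U" by auto
              show "incseq (\<lambda>n. {v. ennreal v \<le> \<kappa> {q n<..} x})"
                using mono q(2) decseqD[OF q(1)] by (auto simp: incseq_def intro: order.trans)
            qed
            finally show ?thesis using True le1 q(2) by (simp add: U_le)
          qed simp
        qed
        also have "\<dots> = (SUP n. \<integral>\<^sup>+x. \<kappa> {q n<..} x * indicator A x \<partial>\<nu>)"
        proof (rule nn_integral_monotone_convergence_SUP_AE)
          fix n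
          show "AE x in \<nu>. \<kappa> {q n<..} x * indicator A x \<le> \<kappa> {q (Suc n)<..} x * indicator A x"
            using AE1 by eventually_elim (use q(2) decseq_SucD[OF q(1)] in \<open>auto intro!: mult_right_mono\<close>)
        qed measurable
        also have "\<dots> = (SUP n. emeasure P (A \<times> {q n<..}))"
          by (simp add: \<kappa>_int)
        also have "\<dots> = emeasure P (\<Union>n. A \<times> {q n<..})"
        proof (rule SUP_emeasure_incseq)
          show "range (\<lambda>n. A \<times> {q n<..}) \<subseteq> sets P" using A by (auto intro!: Prect)
          show "incseq (\<lambda>n. A \<times> {q n<..})"
            using decseqD[OF q(1)] by (auto simp: incseq_def intro: le_less_trans)
        qed
        also have "(\<Union>n. A \<times> {q n<..}) = A \<times> {t<..}"
        proof -
          have "\<exists>n. q n < y" if "t < y" for y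
            using order_tendstoD(2)[OF q(5) that] by (auto simp: eventually_sequentially)
          then show ?thesis using q(3) by (auto intro: less_trans)
        qed
        finally show ?thesis .
      qed
    qed
    finally show ?thesis .
  qed
  have "?R = P"
  proof (rule prob_eqI_rectangles)
    have "prob_space ?R" by (rule \<nu>U.prob_space_distr) measurable
    then show fR: "finite_measure ?R" by (rule prob_space.finite_measure)
    fix X :: "'a set" and Y :: "real set" assume X: "X \<in> sets borel" and Y: "Y \<in> sets borel"
    have sR: "sets ?R = sets (borel \<Otimes>\<^sub>M borel)" by simp
    \<comment> \<open>For a fixed \<open>X\<close> both sides are finite measures in the second
      coordinate, and agreement on upper half-lines determines them.\<close>
    have "distr (density ?R (\<lambda>z. indicator X (fst z))) borel snd = distr (density P (\<lambda>z. indicator X (fst z))) borel snd"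
    proof (rule measure_eqI_lessThan)
      fix t :: real
      have t: "{t<..} \<in> sets borel" by simp
      show "emeasure (distr (density ?R (\<lambda>z. indicator X (fst z))) borel snd) {t<..} =
          emeasure (distr (density P (\<lambda>z. indicator X (fst z))) borel snd) {t<..}"
        unfolding emeasure_slice_snd[OF sR X t] emeasure_slice_snd[OF sets X t] by (rule R_rect[OF X])
      show "emeasure (distr (density ?R (\<lambda>z. indicator X (fst z))) borel snd) {t<..} < \<infinity>"
        unfolding emeasure_slice_snd[OF sR X t] R_rect[OF X] by (rule le_less_trans[OF P.emeasure_le_1]) simp
    qed (rule sets_distr)+
    from arg_cong[OF this, of "\<lambda>M. emeasure M Y"] show "emeasure ?R (X \<times> Y) = emeasure P (X \<times> Y)"
      unfolding emeasure_slice_snd[OF sR X Y] emeasure_slice_snd[OF sets X Y] .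
  qed (simp_all only: sets sets_distr)
  show ?thesis
    by (rule exI[where x=\<psi>], rule conjI, rule \<psi>_m, rule \<open>?R = P\<close>)
qed

text \<open>The second coordinate is moved into the unit interval by the strictly increasing map 1 /
  2 + arctan y / pi, and the quantile function found there is moved back by the tangent.\<close>

lemma quantile_representation:
  fixes P :: "('a::second_countable_topology \<times> real) measure"
  assumes prob: "prob_space P" and sets[measurable_cong]: "sets P = sets (borel \<Otimes>\<^sub>M borel)"
  shows "\<exists>\<psi>. (\<lambda>(x, v). \<psi> x v) \<in> borel_measurable (borel \<Otimes>\<^sub>M borel) \<and>
    distr (distr P borel fst \<Otimes>\<^sub>M uniform_measure lborel {0..1 :: real}) (borel \<Otimes>\<^sub>M borel) (\<lambda>(x, v). (x, \<psi> x v)) = P"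
proof -
  define g :: "real \<Rightarrow> real" where "g y = 1 / 2 + arctan y / pi" for y
  have g_m [measurable]: "g \<in> borel_measurable borel"
    unfolding g_def[abs_def] by measurable
  have [measurable]: "tan \<in> borel_measurable (borel :: real measure)"
    unfolding tan_def[abs_def] by measurable
  have g01: "0 < g y" "g y < 1" for y
    using arctan_lbound[of y] arctan_ubound[of y] by (auto simp: g_def divide_simps)
  have g_inv: "tan (pi * (g y - 1 / 2)) = y" for y
    by (simp add: g_def tan_arctan)
  interpret P: prob_space P by (rule prob)
  have sp: "space P = UNIV" using sets_eq_imp_space_eq[OF sets] by (simp add: space_pair_measure)
  define P' where "P' = distr P (borel \<Otimes>\<^sub>M borel) (\<lambda>(x, y). (x, g y))"
  have "prob_space P'" unfolding P'_def by (rule P.prob_space_distr) measurable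
  have sP' [measurable_cong]: "sets P' = sets (borel \<Otimes>\<^sub>M borel)" by (simp add: P'_def)
  have fst: "distr P' borel fst = distr P borel fst"
    unfolding P'_def by (subst distr_distr) (auto simp: comp_def split_beta)
  have "emeasure P' (UNIV \<times> - {0<..<1}) = 0"
  proof -
    have "(\<lambda>(x, y). (x, g y)) -` (UNIV \<times> - {0<..<1}) \<inter> space P = {}"
      using g01 by auto
    then show ?thesis
      unfolding P'_def by (subst emeasure_distr) auto
  qed
  from quantile_representation_unit[OF \<open>prob_space P'\<close> sP' this]
  obtain \<psi> where \<psi>_m [measurable]: "(\<lambda>(x, v). \<psi> x v) \<in> borel_measurable (borel \<Otimes>\<^sub>M borel)"
    and \<psi>: "distr (distr P borel fst \<Otimes>\<^sub>M uniform_measure lborel {0..1 :: real}) (borel \<Otimes>\<^sub>M borel) (\<lambda>(x, v). (x, \<psi> x v)) = P'"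
    unfolding fst by blast
  define h where "h y = tan (pi * (y - 1 / 2))" for y :: real
  have h_m [measurable]: "h \<in> borel_measurable borel" unfolding h_def[abs_def] by measurable
  have m: "(\<lambda>(x, v). (x, \<psi> x v)) \<in> distr P borel fst \<Otimes>\<^sub>M uniform_measure lborel {0..1 :: real} \<rightarrow>\<^sub>M borel \<Otimes>\<^sub>M borel"
    using \<psi>_m by measurable
  have "distr (distr P borel fst \<Otimes>\<^sub>M uniform_measure lborel {0..1 :: real}) (borel \<Otimes>\<^sub>M borel) (\<lambda>(x, v). (x, h (\<psi> x v)))
    = distr P' (borel \<Otimes>\<^sub>M borel) (\<lambda>(x, y). (x, h y))"
    unfolding \<psi>[symmetric] by (subst distr_distr[OF _ m]) (auto simp: comp_def split_beta')
  also have "\<dots> = distr P (borel \<Otimes>\<^sub>M borel) (\<lambda>z. z)"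
    unfolding P'_def by (subst distr_distr) (auto simp: comp_def split_beta h_def g_inv)
  also have "\<dots> = P" by (rule distr_id2) (rule sets[symmetric])
  finally have "distr (distr P borel fst \<Otimes>\<^sub>M uniform_measure lborel {0..1 :: real}) (borel \<Otimes>\<^sub>M borel) (\<lambda>(x, v). (x, h (\<psi> x v))) = P" .
  moreover have "(\<lambda>(x, v). h (\<psi> x v)) \<in> borel_measurable (borel \<Otimes>\<^sub>M borel)"
    using \<psi>_m by measurable
  ultimately show ?thesis by (intro exI[where x="\<lambda>x v. h (\<psi> x v)"] conjI)
qed

text \<open>An independent sample can be drawn by taking all covariates before any response: on a
  rectangle the integral over the uniform variables factorises at fixed covariates, and so does the
  remaining integral over the covariates.\<close>

lemma PiM_quantile:
  fixes P :: "('a::second_countable_topology \<times> real) measure"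
  assumes I: "finite I" and "prob_space \<nu>" "prob_space U" and [measurable_cong]: "sets \<nu> = sets borel" "sets U = sets borel"
    and \<psi>_m [measurable]: "(\<lambda>(x, v). \<psi> x v) \<in> borel_measurable (borel \<Otimes>\<^sub>M borel)"
    and P: "distr (\<nu> \<Otimes>\<^sub>M U) (borel \<Otimes>\<^sub>M borel) (\<lambda>(x, v :: real). (x, \<psi> x v)) = P"
  shows "distr (PiM I (\<lambda>_. \<nu>) \<Otimes>\<^sub>M PiM I (\<lambda>_. U)) (PiM I (\<lambda>_. borel \<Otimes>\<^sub>M borel)) (\<lambda>(x, v). \<lambda>i\<in>I. (x i, \<psi> (x i) (v i)))
    = PiM I (\<lambda>_. P)"
proof -
  interpret \<nu>: prob_space \<nu> by fact
  interpret U: prob_space U by fact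
  interpret \<nu>U: pair_prob_space \<nu> U ..
  have m: "(\<lambda>(x, v). (x, \<psi> x v)) \<in> \<nu> \<Otimes>\<^sub>M U \<rightarrow>\<^sub>M borel \<Otimes>\<^sub>M borel"
    using \<psi>_m by measurable
  interpret P: prob_space P unfolding P[symmetric] by (rule \<nu>U.prob_space_distr) (rule m)
  interpret PP: product_sigma_finite "\<lambda>_. P" ..
  interpret PN: product_sigma_finite "\<lambda>_. \<nu>" ..
  interpret PU: product_sigma_finite "\<lambda>_. U" ..
  interpret VN: sigma_finite_measure "PiM I (\<lambda>_. \<nu>)" by (rule PN.sigma_finite) (rule I)
  interpret VU: sigma_finite_measure "PiM I (\<lambda>_. U)" by (rule PU.sigma_finite) (rule I)
  have sP [measurable_cong]: "sets P = sets (borel \<Otimes>\<^sub>M borel)" unfolding P[symmetric] by simp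
  have comp: "(\<lambda>x. x i) \<in> PiM I (\<lambda>_. \<nu>) \<rightarrow>\<^sub>M borel" "(\<lambda>x. x i) \<in> PiM I (\<lambda>_. U) \<rightarrow>\<^sub>M borel" if "i \<in> I" for i
    using measurable_component_singleton[OF that, of "\<lambda>_. \<nu>"] measurable_component_singleton[OF that, of "\<lambda>_. U"]
    unfolding measurable_cong_sets[OF refl assms(4)] measurable_cong_sets[OF refl assms(5)] by blast+
  have cm: "(\<lambda>z. (fst z i, \<psi> (fst z i) (snd z i))) \<in> PiM I (\<lambda>_. \<nu>) \<Otimes>\<^sub>M PiM I (\<lambda>_. U) \<rightarrow>\<^sub>M borel \<Otimes>\<^sub>M borel" if "i \<in> I" for i
  proof -
    have a: "(\<lambda>z. fst z i) \<in> PiM I (\<lambda>_. \<nu>) \<Otimes>\<^sub>M PiM I (\<lambda>_. U) \<rightarrow>\<^sub>M borel"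
      by (rule measurable_compose[OF measurable_fst comp(1)[OF that]])
    have b: "(\<lambda>z. snd z i) \<in> PiM I (\<lambda>_. \<nu>) \<Otimes>\<^sub>M PiM I (\<lambda>_. U) \<rightarrow>\<^sub>M borel"
      by (rule measurable_compose[OF measurable_snd comp(2)[OF that]])
    show ?thesis
      using measurable_Pair[OF a measurable_compose[OF measurable_Pair[OF a b] \<psi>_m]] by simp
  qed
  have mm: "(\<lambda>(x, v). \<lambda>i\<in>I. (x i, \<psi> (x i) (v i))) \<in> PiM I (\<lambda>_. \<nu>) \<Otimes>\<^sub>M PiM I (\<lambda>_. U) \<rightarrow>\<^sub>M PiM I (\<lambda>_. borel \<Otimes>\<^sub>M borel)"
    unfolding split_beta by (rule measurable_restrict) (rule cm)
  show ?thesis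
  proof (rule PP.PiM_eqI[OF I])
    show "sets (distr (PiM I (\<lambda>_. \<nu>) \<Otimes>\<^sub>M PiM I (\<lambda>_. U)) (PiM I (\<lambda>_. borel \<Otimes>\<^sub>M borel)) (\<lambda>(x, v). \<lambda>i\<in>I. (x i, \<psi> (x i) (v i))))
      = sets (PiM I (\<lambda>_. P))"
      unfolding sets_distr by (rule sets_PiM_cong) (auto simp: sP)
    fix A assume A: "\<And>i. i \<in> I \<Longrightarrow> A i \<in> sets P"
    then have A' [measurable]: "i \<in> I \<Longrightarrow> A i \<in> sets (borel \<Otimes>\<^sub>M borel)" for i by (simp add: sP)
    have AE_m: "Pi\<^sub>E I A \<in> sets (PiM I (\<lambda>_. borel \<Otimes>\<^sub>M borel))"
      using A' by (intro sets_PiM_I_finite[OF I]) auto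
    define k where "k i x v = (indicator (A i) (x, \<psi> x v) :: ennreal)" for i x v
    have k_m: "(\<lambda>z. k i (fst z) (snd z)) \<in> borel_measurable (\<nu> \<Otimes>\<^sub>M U)" if "i \<in> I" for i
    proof -
      have "(\<lambda>z. indicator (A i) z :: ennreal) \<in> borel_measurable (borel \<Otimes>\<^sub>M borel)" using A'[OF that] by measurable
      from measurable_compose[OF m this] show ?thesis by (simp add: k_def split_beta)
    qed
    have "emeasure (distr (PiM I (\<lambda>_. \<nu>) \<Otimes>\<^sub>M PiM I (\<lambda>_. U)) (PiM I (\<lambda>_. borel \<Otimes>\<^sub>M borel)) (\<lambda>(x, v). \<lambda>i\<in>I. (x i, \<psi> (x i) (v i)))) (Pi\<^sub>E I A)
      = (\<integral>\<^sup>+z. indicator (Pi\<^sub>E I A) ((\<lambda>(x, v). \<lambda>i\<in>I. (x i, \<psi> (x i) (v i))) z) \<partial>(PiM I (\<lambda>_. \<nu>) \<Otimes>\<^sub>M PiM I (\<lambda>_. U)))"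
      using AE_m by (subst nn_integral_distr[OF mm, symmetric]) simp_all
    also have "\<dots> = (\<integral>\<^sup>+z. (\<Prod>i\<in>I. k i (fst z i) (snd z i)) \<partial>(PiM I (\<lambda>_. \<nu>) \<Otimes>\<^sub>M PiM I (\<lambda>_. U)))"
      using I by (intro nn_integral_cong) (auto simp: k_def indicator_def PiE_def Pi_def prod_eq_1_iff split_beta)
    also have "\<dots> = (\<integral>\<^sup>+x. (\<integral>\<^sup>+v. (\<Prod>i\<in>I. k i (x i) (v i)) \<partial>PiM I (\<lambda>_. U)) \<partial>PiM I (\<lambda>_. \<nu>))"
    proof (subst VU.nn_integral_fst[symmetric])
      have "(\<lambda>z. k i (fst z i) (snd z i)) \<in> borel_measurable (PiM I (\<lambda>_. \<nu>) \<Otimes>\<^sub>M PiM I (\<lambda>_. U))" if "i \<in> I" for i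
        using measurable_compose[OF cm[OF that] borel_measurable_indicator[OF A'[OF that]]] by (simp add: k_def)
      then show "(\<lambda>z. \<Prod>i\<in>I. k i (fst z i) (snd z i)) \<in> borel_measurable (PiM I (\<lambda>_. \<nu>) \<Otimes>\<^sub>M PiM I (\<lambda>_. U))"
        by (rule borel_measurable_prod_ennreal)
    qed simp
    also have "\<dots> = (\<integral>\<^sup>+x. (\<Prod>i\<in>I. (\<integral>\<^sup>+v. k i (x i) v \<partial>U)) \<partial>PiM I (\<lambda>_. \<nu>))"
    proof (intro nn_integral_cong PU.product_nn_integral_prod I)
      fix x i assume "x \<in> space (PiM I (\<lambda>_. \<nu>))" "i \<in> I"
      then have "(\<lambda>v. (x i, v)) \<in> U \<rightarrow>\<^sub>M \<nu> \<Otimes>\<^sub>M U"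
        by (intro measurable_Pair1') (auto simp: space_PiM)
      from measurable_compose[OF this k_m[OF \<open>i \<in> I\<close>]] show "k i (x i) \<in> borel_measurable U"
        by simp
    qed
    also have "\<dots> = (\<Prod>i\<in>I. (\<integral>\<^sup>+x. (\<integral>\<^sup>+v. k i x v \<partial>U) \<partial>\<nu>))"
      using U.borel_measurable_nn_integral[of "k i" \<nu> for i] k_m
      by (intro PN.product_nn_integral_prod I) (auto simp: split_beta)
    also have "\<dots> = (\<Prod>i\<in>I. emeasure P (A i))"
    proof (rule prod.cong[OF refl])
      fix i assume i: "i \<in> I"
      have "(\<integral>\<^sup>+x. (\<integral>\<^sup>+v. k i x v \<partial>U) \<partial>\<nu>) = (\<integral>\<^sup>+z. k i (fst z) (snd z) \<partial>(\<nu> \<Otimes>\<^sub>M U))"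
        by (subst U.nn_integral_fst[OF k_m[OF i], symmetric]) simp
      also have "\<dots> = (\<integral>\<^sup>+z. indicator (A i) z \<partial>P)"
        unfolding P[symmetric] using A'[OF i] by (subst nn_integral_distr[OF m]) (simp_all add: k_def split_beta)
      finally show "(\<integral>\<^sup>+x. (\<integral>\<^sup>+v. k i x v \<partial>U) \<partial>\<nu>) = emeasure P (A i)"
        using A[OF i] by simp
    qed
    finally show "emeasure (distr (PiM I (\<lambda>_. \<nu>) \<Otimes>\<^sub>M PiM I (\<lambda>_. U)) (PiM I (\<lambda>_. borel \<Otimes>\<^sub>M borel)) (\<lambda>(x, v). \<lambda>i\<in>I. (x i, \<psi> (x i) (v i)))) (Pi\<^sub>E I A)
      = (\<Prod>i\<in>I. emeasure P (A i))" .
  qed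
qed

section \<open>A Berry-Esseen bound\<close>

abbreviation phi :: "real \<Rightarrow> real" where "phi \<equiv> std_normal_density"

text \<open>As phi' = - z phi and phi'' = (z^2 - 1) phi, this is the second-order remainder of y ->
  phi (z - y) at y = 0. The subtracted polynomial, averaged over a centred law of y, depends on the
  variance alone.\<close>

definition taylor_rem :: "real \<Rightarrow> real \<Rightarrow> real" where
  "taylor_rem z y = phi (z - y) - phi z * (1 + z * y + (z\<^sup>2 - 1) / 2 * y\<^sup>2)"

lemma taylor_rem_measurable [measurable]:
  assumes [measurable]: "f \<in> borel_measurable M" "g \<in> borel_measurable M"
  shows "(\<lambda>w. taylor_rem (f w) (g w)) \<in> borel_measurable M"
  unfolding taylor_rem_def by measurable

lemma phi_deriv: "(phi has_real_derivative - z * phi z) (at z)"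
proof -
  have "((\<lambda>z. exp (- z\<^sup>2 / 2)) has_real_derivative - z * exp (- z\<^sup>2 / 2)) (at z)"
    by (auto intro!: derivative_eq_intros)
  from DERIV_cmult[OF this, of "1 / sqrt (2 * pi)"] show ?thesis
    by (simp add: std_normal_density_def[abs_def] mult.commute)
qed

text \<open>The left-hand side is the third derivative of \<open>phi\<close> at w; the bound is
  integrable in z and uniform over the points w that a remainder term may pick. From exp (u^2 / 6)
  >= u^2 / 6, cubed, comes exp (u^2 / 2) >= u^6 / 216, and 4320 = 20 * 216.\<close>

lemma phi_third_bound:
  assumes "\<bar>w - z\<bar> \<le> 1"
  shows "\<bar>(3 * w - w ^ 3) * phi w\<bar> \<le> 4320 / (1 + z\<^sup>2)"
proof -
  define u where "u = \<bar>w\<bar>"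
  have u: "0 \<le> u" by (simp add: u_def)
  have z: "\<bar>z\<bar> \<le> u + 1" using assms by (simp add: u_def)
  have z2: "1 + z\<^sup>2 \<le> 1 + (u + 1)\<^sup>2" using z by (simp add: abs_le_square_iff[symmetric])
  have e1: "1 \<le> exp (u\<^sup>2 / 2)" by simp
  have e2: "u ^ 6 / 216 \<le> exp (u\<^sup>2 / 2)"
  proof -
    have "u ^ 6 / 216 = (u\<^sup>2 / 6) ^ 3" by (simp add: power_divide flip: power_mult)
    also have "\<dots> \<le> exp (u\<^sup>2 / 6) ^ 3"
      using exp_ge_add_one_self[of "u\<^sup>2 / 6"] by (intro power_mono) (linarith, simp)
    also have "\<dots> = exp (u\<^sup>2 / 2)" by (simp flip: exp_of_nat_mult)
    finally show ?thesis .
  qed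
  have poly: "(1 + (u + 1)\<^sup>2) * (3 * u + u ^ 3) \<le> 4320 * exp (u\<^sup>2 / 2)"
  proof (cases "u \<le> 1")
    case True
    have "(1 + (u + 1)\<^sup>2) * (3 * u + u ^ 3) \<le> (1 + (1 + 1)\<^sup>2) * (3 * 1 + 1 ^ 3)"
      using u True by (intro mult_mono add_mono power_mono) auto
    also have "\<dots> \<le> 4320 * 1" by simp
    also have "\<dots> \<le> 4320 * exp (u\<^sup>2 / 2)" using e1 by simp
    finally show ?thesis .
  next
    case False
    then have u1: "1 \<le> u" by simp
    have "u ^ 1 \<le> u ^ 3" "u ^ 0 \<le> u ^ 2" "u ^ 1 \<le> u ^ 2" "u ^ 5 \<le> u ^ 6"
      using u1 by (intro power_increasing; simp)+
    then have "3 * u + u ^ 3 \<le> 4 * u ^ 3" "1 + (u + 1)\<^sup>2 \<le> 5 * u\<^sup>2" "u ^ 5 \<le> u ^ 6"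
      by (simp_all add: power2_sum)
    then have "(1 + (u + 1)\<^sup>2) * (3 * u + u ^ 3) \<le> (5 * u\<^sup>2) * (4 * u ^ 3)"
      using u by (intro mult_mono) auto
    also have "\<dots> = 20 * u ^ 5" by (simp add: eval_nat_numeral)
    also have "\<dots> \<le> 20 * u ^ 6" using \<open>u ^ 5 \<le> u ^ 6\<close> by simp
    also have "\<dots> \<le> 4320 * exp (u\<^sup>2 / 2)" using e2 by simp
    finally show ?thesis .
  qed
  have "\<bar>3 * w - w ^ 3\<bar> \<le> 3 * u + u ^ 3"
    unfolding u_def using abs_triangle_ineq4[of "3 * w" "w ^ 3"] by (simp add: power_abs)
  moreover have "phi w \<le> exp (- u\<^sup>2 / 2)"
  proof -
    have "1 \<le> sqrt (2 * pi)" using pi_gt3 by (intro real_le_rsqrt) auto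
    then have "1 / sqrt (2 * pi) \<le> 1" by simp
    then have "1 / sqrt (2 * pi) * exp (- u\<^sup>2 / 2) \<le> 1 * exp (- u\<^sup>2 / 2)" by (intro mult_right_mono) auto
    then show ?thesis unfolding std_normal_density_def u_def by simp
  qed
  ultimately have "\<bar>(3 * w - w ^ 3) * phi w\<bar> \<le> (3 * u + u ^ 3) * exp (- u\<^sup>2 / 2)"
    unfolding abs_mult using u by (intro mult_mono) auto
  also have "\<dots> \<le> 4320 / (1 + (u + 1)\<^sup>2)"
    using poly by (simp add: exp_minus field_simps add_pos_nonneg)
  also have "\<dots> \<le> 4320 / (1 + z\<^sup>2)"
    using z2 by (intro divide_left_mono) (auto intro!: add_pos_nonneg mult_pos_pos)
  finally show ?thesis .
qed

text \<open>Maclaurin's formula of order 3 in y. The intermediate point differs from z by at most 1,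
  and 720 = 4320 / 3!.\<close>

lemma taylor_rem_small:
  assumes "\<bar>y\<bar> \<le> 1"
  shows "\<bar>taylor_rem z y\<bar> \<le> 720 * \<bar>y\<bar> ^ 3 / (1 + z\<^sup>2)"
proof -
  define d where "d m t = (if m = 0 then phi (z - t) else if m = 1 then (z - t) * phi (z - t)
    else if m = 2 then ((z - t)\<^sup>2 - 1) * phi (z - t) else ((z - t) ^ 3 - 3 * (z - t)) * phi (z - t))" for m :: nat and t
  have ph: "((\<lambda>t. phi (z - t)) has_real_derivative (z - t) * phi (z - t)) (at t)" for t
  proof -
    have "((\<lambda>t. z - t) has_real_derivative - 1) (at t)" by (auto intro!: derivative_eq_intros)
    from DERIV_chain2[OF phi_deriv this] show ?thesis by (simp add: algebra_simps)
  qed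
  have "DERIV (d m) t :> d (Suc m) t" if "m < 3" for m t
  proof -
    have "m = 0 \<or> m = 1 \<or> m = 2" using that by auto
    then show ?thesis
    proof (elim disjE)
      assume "m = 0"
      then show ?thesis using ph[of t] by (simp add: d_def[abs_def])
    next
      assume m: "m = 1"
      have "((\<lambda>t. z - t) has_real_derivative - 1) (at t)" by (auto intro!: derivative_eq_intros)
      from DERIV_mult[OF this ph] show ?thesis
        using m by (simp add: d_def[abs_def] algebra_simps power2_eq_square)
    next
      assume m: "m = 2"
      have "((\<lambda>t. (z - t)\<^sup>2 - 1) has_real_derivative - 2 * (z - t)) (at t)"
        by (auto intro!: derivative_eq_intros)
      from DERIV_mult[OF this ph] show ?thesis
        using m by (simp add: d_def[abs_def] algebra_simps power2_eq_square power3_eq_cube)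
    qed
  qed
  then obtain t where t: "\<bar>t\<bar> \<le> \<bar>y\<bar>" "d 0 y = (\<Sum>m<3. d m 0 / fact m * y ^ m) + d 3 t / fact 3 * y ^ 3"
    using Maclaurin_bi_le[of d "d 0" 3 y] by auto
  have "taylor_rem z y = d 3 t / 6 * y ^ 3"
  proof -
    have "(\<Sum>m<3. d m 0 / fact m * y ^ m) = d 0 0 + d 1 0 * y + d 2 0 / 2 * y\<^sup>2"
      by (simp add: lessThan_nat_numeral lessThan_Suc power2_eq_square fact_2)
    moreover have "fact 3 = (6 :: real)" by (simp add: fact_numeral)
    ultimately show ?thesis
      using t(2) unfolding taylor_rem_def by (simp add: d_def field_simps)
  qed
  then have "\<bar>taylor_rem z y\<bar> = \<bar>(3 * (z - t) - (z - t) ^ 3) * phi (z - t)\<bar> / 6 * \<bar>y\<bar> ^ 3"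
  proof -
    have "d 3 t = - ((3 * (z - t) - (z - t) ^ 3) * phi (z - t))" by (simp add: d_def algebra_simps)
    then have "\<bar>d 3 t\<bar> = \<bar>(3 * (z - t) - (z - t) ^ 3) * phi (z - t)\<bar>" by (simp only: abs_minus_cancel)
    moreover have "\<bar>taylor_rem z y\<bar> = \<bar>d 3 t\<bar> / 6 * \<bar>y\<bar> ^ 3"
      unfolding \<open>taylor_rem z y = _\<close> by (simp add: abs_mult power_abs)
    ultimately show ?thesis by simp
  qed
  also have "\<dots> \<le> (4320 / (1 + z\<^sup>2)) / 6 * \<bar>y\<bar> ^ 3"
    using t(1) assms by (intro mult_right_mono divide_right_mono phi_third_bound) auto
  also have "4320 / c / 6 * Y = 720 * Y / c" for c Y :: real by simp
  finally show ?thesis .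
qed

lemma nn_integral_inverse_1_plus_square: "(\<integral>\<^sup>+z. ennreal (1 / (1 + z\<^sup>2)) \<partial>lborel) \<le> ennreal 4"
proof -
  have half: "(\<integral>\<^sup>+z. ennreal (1 / (1 + z\<^sup>2)) * indicator {0..} z \<partial>lborel) = ennreal (pi / 2 - arctan 0)"
    by (rule nn_integral_FTC_atLeast)
       (auto intro!: derivative_eq_intros tendsto_arctan_at_top simp: add_nonneg_eq_0_iff inverse_eq_divide)
  have neg: "(\<integral>\<^sup>+z. ennreal (1 / (1 + z\<^sup>2)) * indicator {..0} z \<partial>lborel) = (\<integral>\<^sup>+z. ennreal (1 / (1 + z\<^sup>2)) * indicator {0..} z \<partial>lborel)"
    by (subst nn_integral_real_affine[where c="-1" and t=0]) (auto intro!: nn_integral_cong simp: indicator_def)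
  have "(\<integral>\<^sup>+z. ennreal (1 / (1 + z\<^sup>2)) \<partial>lborel) \<le> (\<integral>\<^sup>+z. ennreal (1 / (1 + z\<^sup>2)) * indicator {..0} z + ennreal (1 / (1 + z\<^sup>2)) * indicator {0..} z \<partial>lborel)"
    by (intro nn_integral_mono) (auto simp: indicator_def)
  also have "\<dots> = ennreal (pi / 2) + ennreal (pi / 2)"
    by (subst nn_integral_add) (simp_all add: neg half)
  also have "\<dots> = ennreal pi" by (subst ennreal_plus[symmetric]) auto
  also have "\<dots> \<le> ennreal 4" using pi_less_4 by (intro ennreal_leI) simp
  finally show ?thesis .
qed

text \<open>For large y the terms of the remainder are integrated separately: the shifted density
  has mass 1 <= y^2, and the polynomial part is at most 2 y^2 phi + y^2 z^2 phi, with the integral 3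
  y^2.\<close>

lemma taylor_rem_large:
  assumes "1 \<le> \<bar>y\<bar>"
  shows "(\<integral>\<^sup>+z. ennreal \<bar>taylor_rem z y\<bar> \<partial>lborel) \<le> ennreal (4 * y\<^sup>2)"
proof -
  have 1: "(\<integral>\<^sup>+z. ennreal (phi (z - y)) \<partial>lborel) = 1"
  proof -
    have "(\<integral>\<^sup>+z. ennreal (phi (z - y)) \<partial>lborel) = (\<integral>\<^sup>+z. ennreal (phi z) \<partial>lborel)"
      by (subst nn_integral_real_affine[where c=1 and t=y]) auto
    also have "\<dots> = 1" by (subst nn_integral_eq_integral) auto
    finally show ?thesis .
  qed
  have i2: "integrable lborel (\<lambda>z. phi z * z\<^sup>2)" "(\<integral>z. phi z * z\<^sup>2 \<partial>lborel) = 1"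
    using std_normal_moment_even[of 1] by (auto simp: has_bochner_integral_iff)
  have i0: "integrable lborel phi" "(\<integral>z. phi z \<partial>lborel) = 1" by auto
  have 2: "(\<integral>\<^sup>+z. ennreal (phi z * (3 + z\<^sup>2) / 2 * y\<^sup>2 + phi z * (z\<^sup>2 + 1) / 2 * y\<^sup>2) \<partial>lborel) = ennreal (3 * y\<^sup>2)"
  proof -
    have eq: "phi z * (3 + z\<^sup>2) / 2 * y\<^sup>2 + phi z * (z\<^sup>2 + 1) / 2 * y\<^sup>2 = (2 * y\<^sup>2) * phi z + y\<^sup>2 * (phi z * z\<^sup>2)" for z
      by (simp add: field_simps)
    have "(\<integral>\<^sup>+z. ennreal ((2 * y\<^sup>2) * phi z + y\<^sup>2 * (phi z * z\<^sup>2)) \<partial>lborel) = ennreal (\<integral>z. (2 * y\<^sup>2) * phi z + y\<^sup>2 * (phi z * z\<^sup>2) \<partial>lborel)"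
      using i0 i2 by (intro nn_integral_eq_integral) auto
    also have "(\<integral>z. (2 * y\<^sup>2) * phi z + y\<^sup>2 * (phi z * z\<^sup>2) \<partial>lborel) = 3 * y\<^sup>2"
      using i0 i2 by simp
    finally show ?thesis unfolding eq .
  qed
  have y: "1 \<le> y\<^sup>2" "\<bar>y\<bar> \<le> y\<^sup>2"
    using assms mult_mono[of 1 "\<bar>y\<bar>" 1 "\<bar>y\<bar>"] mult_mono[of 1 "\<bar>y\<bar>" "\<bar>y\<bar>" "\<bar>y\<bar>"] by (auto simp: power2_eq_square)
  have pw: "\<bar>taylor_rem z y\<bar> \<le> phi (z - y) + (phi z * (3 + z\<^sup>2) / 2 * y\<^sup>2 + phi z * (z\<^sup>2 + 1) / 2 * y\<^sup>2)" for z
  proof -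
    have zz: "\<bar>z\<bar> \<le> (1 + z\<^sup>2) / 2"
      using zero_le_power2[of "\<bar>z\<bar> - 1"] by (simp add: power2_eq_square algebra_simps)
    have "\<bar>1 + z * y + (z\<^sup>2 - 1) / 2 * y\<^sup>2\<bar> \<le> 1 + \<bar>z\<bar> * \<bar>y\<bar> + \<bar>z\<^sup>2 - 1\<bar> / 2 * y\<^sup>2"
      using abs_triangle_ineq[of "1 + z * y" "(z\<^sup>2 - 1) / 2 * y\<^sup>2"] abs_triangle_ineq[of 1 "z * y"]
      by (simp add: abs_mult)
    also have "\<dots> \<le> y\<^sup>2 + (1 + z\<^sup>2) / 2 * y\<^sup>2 + (z\<^sup>2 + 1) / 2 * y\<^sup>2"
      using y zz by (intro add_mono mult_mono) (auto intro: order.trans[OF abs_triangle_ineq4])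
    finally have "phi z * \<bar>1 + z * y + (z\<^sup>2 - 1) / 2 * y\<^sup>2\<bar> \<le> phi z * (y\<^sup>2 + (1 + z\<^sup>2) / 2 * y\<^sup>2 + (z\<^sup>2 + 1) / 2 * y\<^sup>2)"
      by (rule mult_left_mono) auto
    moreover have "\<bar>taylor_rem z y\<bar> \<le> \<bar>phi (z - y)\<bar> + \<bar>phi z * (1 + z * y + (z\<^sup>2 - 1) / 2 * y\<^sup>2)\<bar>"
      unfolding taylor_rem_def by (rule abs_triangle_ineq4)
    moreover have "\<bar>phi z * (1 + z * y + (z\<^sup>2 - 1) / 2 * y\<^sup>2)\<bar> = phi z * \<bar>1 + z * y + (z\<^sup>2 - 1) / 2 * y\<^sup>2\<bar>"
      by (simp add: abs_mult)
    moreover have "phi z * (y\<^sup>2 + (1 + z\<^sup>2) / 2 * y\<^sup>2 + (z\<^sup>2 + 1) / 2 * y\<^sup>2) = phi z * (3 + z\<^sup>2) / 2 * y\<^sup>2 + phi z * (z\<^sup>2 + 1) / 2 * y\<^sup>2"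
      by (simp add: field_simps)
    moreover have "\<bar>phi (z - y)\<bar> = phi (z - y)" by simp
    ultimately show ?thesis by linarith
  qed
  have "(\<integral>\<^sup>+z. ennreal \<bar>taylor_rem z y\<bar> \<partial>lborel) \<le>
    (\<integral>\<^sup>+z. ennreal (phi (z - y)) + ennreal (phi z * (3 + z\<^sup>2) / 2 * y\<^sup>2 + phi z * (z\<^sup>2 + 1) / 2 * y\<^sup>2) \<partial>lborel)"
  proof (intro nn_integral_mono, goal_cases)
    case (1 z)
    have nn: "0 \<le> phi z * (3 + z\<^sup>2) / 2 * y\<^sup>2 + phi z * (z\<^sup>2 + 1) / 2 * y\<^sup>2"
      by (intro add_nonneg_nonneg mult_nonneg_nonneg divide_nonneg_nonneg) auto
    have "ennreal \<bar>taylor_rem z y\<bar> \<le> ennreal (phi (z - y) + (phi z * (3 + z\<^sup>2) / 2 * y\<^sup>2 + phi z * (z\<^sup>2 + 1) / 2 * y\<^sup>2))"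
      by (rule ennreal_leI[OF pw])
    then show ?case by (subst (asm) ennreal_plus) (simp, rule nn)
  qed
  also have "\<dots> = 1 + ennreal (3 * y\<^sup>2)"
    by (subst nn_integral_add, measurable) (simp only: 1 2)
  also have "\<dots> = ennreal (1 + 3 * y\<^sup>2)" by simp
  also have "\<dots> \<le> ennreal (4 * y\<^sup>2)" using y by (intro ennreal_leI) simp
  finally show ?thesis .
qed

text \<open>The orders |y|^3 for small y and y^2 for large y are both dominated by |y| to the power
  2 + d, because 0 < d <= 1. The constant is 720 times the bound 4 for the integral of 1 / (1 +
  z^2).\<close>

lemma taylor_rem_L1:
  assumes "0 < d" "d \<le> 1"
  shows "(\<integral>\<^sup>+z. ennreal \<bar>taylor_rem z y\<bar> \<partial>lborel) \<le> ennreal (2880 * \<bar>y\<bar> powr (2 + d))"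
proof (cases "\<bar>y\<bar> \<le> 1")
  case True
  have p: "\<bar>y\<bar> ^ 3 \<le> \<bar>y\<bar> powr (2 + d)"
  proof (cases "y = 0")
    case False
    then have "\<bar>y\<bar> ^ 3 = \<bar>y\<bar> powr 3" by (simp add: powr_numeral)
    also have "\<dots> \<le> \<bar>y\<bar> powr (2 + d)" using assms True False by (intro powr_mono') auto
    finally show ?thesis .
  qed simp
  have "(\<integral>\<^sup>+z. ennreal \<bar>taylor_rem z y\<bar> \<partial>lborel) \<le> (\<integral>\<^sup>+z. ennreal (720 * \<bar>y\<bar> ^ 3) * ennreal (1 / (1 + z\<^sup>2)) \<partial>lborel)"
    using taylor_rem_small[OF True] by (intro nn_integral_mono) (simp flip: ennreal_mult'' add: ennreal_leI)
  also have "\<dots> = ennreal (720 * \<bar>y\<bar> ^ 3) * (\<integral>\<^sup>+z. ennreal (1 / (1 + z\<^sup>2)) \<partial>lborel)"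
    by (rule nn_integral_cmult) measurable
  also have "\<dots> \<le> ennreal (720 * \<bar>y\<bar> ^ 3) * ennreal 4"
    by (intro mult_left_mono nn_integral_inverse_1_plus_square) simp
  also have "\<dots> = ennreal (2880 * \<bar>y\<bar> ^ 3)" by (subst ennreal_mult''[symmetric]) auto
  also have "\<dots> \<le> ennreal (2880 * \<bar>y\<bar> powr (2 + d))" using p by (intro ennreal_leI) simp
  finally show ?thesis .
next
  case False
  then have "y\<^sup>2 = \<bar>y\<bar> powr 2" by (simp add: powr_numeral)
  also have "\<dots> \<le> \<bar>y\<bar> powr (2 + d)" using False assms by (intro powr_mono) auto
  finally have "ennreal (4 * y\<^sup>2) \<le> ennreal (2880 * \<bar>y\<bar> powr (2 + d))"
    by (intro ennreal_leI) (use zero_le_power2[of y] in linarith)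
  from order.trans[OF taylor_rem_large this] show ?thesis using False by simp
qed

section \<open>Gaussian laws and moments\<close>

text \<open>The parameter is the variance, so that convolution adds parameters.\<close>

abbreviation gauss_density :: "real \<Rightarrow> real \<Rightarrow> real" where
  "gauss_density s \<equiv> normal_density 0 (sqrt s)"

definition gauss :: "real \<Rightarrow> real measure" where
  "gauss s = density lborel (\<lambda>z. ennreal (gauss_density s z))"

lemma gauss_density_scale:
  assumes "0 < s"
  shows "gauss_density s z = phi (z / sqrt s) / sqrt s"
  using assms by (simp add: normal_density_def power_divide real_sqrt_mult divide_simps)

lemma prob_space_gauss: "0 < s \<Longrightarrow> prob_space (gauss s)"
  unfolding gauss_def by (rule prob_space_normal_density) simp

lemma sets_gauss [simp, measurable_cong]: "sets (gauss s) = sets borel"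
  by (simp add: gauss_def)

lemma gauss_convolution:
  assumes "0 < s" "0 < t"
  shows "gauss s \<star> gauss t = gauss (s + t)"
proof -
  have fin: "finite_measure (density lborel (\<lambda>z. ennreal (gauss_density s z)))" if "0 < s" for s
    using prob_space_gauss[OF that] unfolding gauss_def by (rule prob_space.finite_measure)
  have "gauss s \<star> gauss t = density lborel (\<lambda>x. \<integral>\<^sup>+y. ennreal (gauss_density s (x - y)) * ennreal (gauss_density t y) \<partial>lborel)"
    unfolding gauss_def using assms by (intro convolution_density fin) auto
  also have "(\<lambda>x. \<integral>\<^sup>+y. ennreal (gauss_density s (x - y)) * ennreal (gauss_density t y) \<partial>lborel) = (\<lambda>x. ennreal (gauss_density (s + t) x))"
    using conv_normal_density_zero_mean[of "sqrt s" "sqrt t"] assms by (simp flip: ennreal_mult')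
  finally show ?thesis by (simp add: gauss_def)
qed

text \<open>With the distribution function of \<open>L\<close> under the integral, two such
  convolutions can be compared through the difference of their densities or through the difference
  of their distribution functions.\<close>

lemma cdf_convolution_density:
  assumes L: "prob_space L" "sets L = sets borel"
    and H: "prob_space (density lborel (\<lambda>z. ennreal (h z)))" and [measurable]: "h \<in> borel_measurable borel"
    and h: "\<And>z. 0 \<le> h z"
  shows "integrable lborel (\<lambda>z. cdf L (t - z) * h z)"
    and "cdf (L \<star> density lborel (\<lambda>z. ennreal (h z))) t = (\<integral>z. cdf L (t - z) * h z \<partial>lborel)"
proof -
  interpret L: prob_space L by fact
  interpret L: real_distribution L
    by standard (use L in \<open>auto dest: sets_eq_imp_space_eq\<close>)
  let ?H = "density lborel (\<lambda>z. ennreal (h z))"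
  interpret H: prob_space ?H by fact
  have int_h: "integrable lborel h"
    using H.emeasure_space_1 h by (intro integrableI_nonneg) (auto simp: emeasure_density)
  have cdf_m [measurable]: "cdf L \<in> borel_measurable borel"
    using L.cdf_nondecreasing by (intro borel_measurable_mono) (auto simp: mono_def)
  have b: "0 \<le> cdf L x" "cdf L x \<le> 1" for x
    by (auto simp: L.cdf_nonneg L.cdf_bounded_prob)
  show int: "integrable lborel (\<lambda>z. cdf L (t - z) * h z)"
    by (rule Bochner_Integration.integrable_bound[OF int_h]) (use b h in \<open>auto simp: abs_mult mult_left_le_one_le\<close>)
  have "emeasure (L \<star> ?H) {..t} = emeasure (?H \<star> L) {..t}"
    by (subst convolution_commutative) (auto simp: L L.finite_measure H.finite_measure)
  also have "\<dots> = (\<integral>\<^sup>+z. emeasure L {a. a + z \<in> {..t}} \<partial>?H)"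
    using sets_eq_imp_space_eq[OF L(2)] by (subst convolution_emeasure) (auto simp: L L.finite_measure H.finite_measure)
  also have "\<dots> = (\<integral>\<^sup>+z. ennreal (cdf L (t - z)) \<partial>?H)"
    by (intro nn_integral_cong) (auto simp: cdf_def L.emeasure_eq_measure[symmetric] le_diff_eq intro!: arg_cong[where f="emeasure L"])
  also have "\<dots> = (\<integral>\<^sup>+z. ennreal (cdf L (t - z) * h z) \<partial>lborel)"
    using h by (subst nn_integral_density) (simp_all add: ennreal_mult'[OF h] mult.commute[of "cdf L _"])
  also have "\<dots> = ennreal (\<integral>z. cdf L (t - z) * h z \<partial>lborel)"
    using int b h by (intro nn_integral_eq_integral) auto
  finally show "cdf (L \<star> ?H) t = (\<integral>z. cdf L (t - z) * h z \<partial>lborel)"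
    using b h by (simp add: cdf_def measure_def integral_nonneg_AE)
qed

lemma convolution_gauss_density:
  assumes m: "prob_space m" "sets m = sets borel" and s: "0 < s"
  shows "m \<star> gauss s = density lborel (\<lambda>z. ennreal (\<integral>y. gauss_density s (z - y) \<partial>m))"
proof -
  interpret m: prob_space m by fact
  interpret pair_sigma_finite m lborel ..
  note [measurable_cong] = m(2)
  have bound: "\<bar>gauss_density s z\<bar> \<le> 1 / sqrt (2 * pi * s)" for z
    using s by (auto simp: normal_density_def mult_left_le divide_simps)
  have int: "integrable m (\<lambda>y. gauss_density s (z - y))" for z
    by (rule m.integrable_const_bound[where B="1 / sqrt (2 * pi * s)"]) (use bound in auto)
  show ?thesis
  proof (rule measure_eqI)
    fix A assume "A \<in> sets (m \<star> gauss s)"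
    then have [measurable]: "A \<in> sets borel" by simp
    have "emeasure (m \<star> gauss s) A = (\<integral>\<^sup>+x. indicator A x \<partial>(m \<star> gauss s))" by simp
    also have "\<dots> = (\<integral>\<^sup>+y. \<integral>\<^sup>+w. indicator A (y + w) \<partial>gauss s \<partial>m)"
      using prob_space_gauss[OF s] by (intro nn_integral_convolution) (auto simp: m m.finite_measure prob_space.finite_measure)
    also have "\<dots> = (\<integral>\<^sup>+y. \<integral>\<^sup>+z. ennreal (gauss_density s (z - y)) * indicator A z \<partial>lborel \<partial>m)"
    proof (rule nn_integral_cong)
      fix y
      have "(\<integral>\<^sup>+w. indicator A (y + w) \<partial>gauss s) = (\<integral>\<^sup>+w. ennreal (gauss_density s w) * indicator A (y + w) \<partial>lborel)"
        unfolding gauss_def by (rule nn_integral_density) measurable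
      also have "\<dots> = (\<integral>\<^sup>+z. ennreal (gauss_density s (z - y)) * indicator A z \<partial>lborel)"
        by (subst (2) nn_integral_real_affine[where c=1 and t=y]) auto
      finally show "(\<integral>\<^sup>+w. indicator A (y + w) \<partial>gauss s) = (\<integral>\<^sup>+z. ennreal (gauss_density s (z - y)) * indicator A z \<partial>lborel)" .
    qed
    also have "\<dots> = (\<integral>\<^sup>+z. \<integral>\<^sup>+y. ennreal (gauss_density s (z - y)) * indicator A z \<partial>m \<partial>lborel)"
      by (rule Fubini'[symmetric]) measurable
    also have "\<dots> = (\<integral>\<^sup>+z. ennreal (\<integral>y. gauss_density s (z - y) \<partial>m) * indicator A z \<partial>lborel)"
      by (intro nn_integral_cong) (simp add: nn_integral_multc nn_integral_eq_integral int)
    also have "\<dots> = emeasure (density lborel (\<lambda>z. ennreal (\<integral>y. gauss_density s (z - y) \<partial>m))) A"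
      by (rule emeasure_density[symmetric]) measurable
    finally show "emeasure (m \<star> gauss s) A = emeasure (density lborel (\<lambda>z. ennreal (\<integral>y. gauss_density s (z - y) \<partial>m))) A" .
  qed simp
qed

text \<open>Integrability is demanded apart because a Bochner integral that does not exist has the
  value 0. For the first moment it follows from that of the square.\<close>

definition centered_moments :: "real \<Rightarrow> real measure \<Rightarrow> real \<Rightarrow> real \<Rightarrow> bool" where
  "centered_moments d m v \<beta> \<longleftrightarrow> prob_space m \<and> sets m = sets borel \<and>
     integrable m (\<lambda>y. y\<^sup>2) \<and> (\<integral>y. y \<partial>m) = 0 \<and> (\<integral>y. y\<^sup>2 \<partial>m) = v \<and>
     integrable m (\<lambda>y. \<bar>y\<bar> powr (2 + d)) \<and> (\<integral>y. \<bar>y\<bar> powr (2 + d) \<partial>m) \<le> \<beta>"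

lemma integrable_of_square:
  assumes "prob_space m" "sets m = sets borel" "integrable m (\<lambda>y :: real. y\<^sup>2)"
  shows "integrable m (\<lambda>y. y)"
proof -
  interpret prob_space m by fact
  note [measurable_cong] = assms(2)
  have "\<bar>y\<bar> \<le> 1 + y\<^sup>2" for y :: real
  proof -
    have "0 \<le> (\<bar>y\<bar> - 1 / 2)\<^sup>2" by simp
    then show ?thesis by (simp add: power2_eq_square algebra_simps)
  qed
  then have "AE y in m. norm y \<le> norm (1 + y\<^sup>2)" by (intro AE_I2) simp
  moreover have "integrable m (\<lambda>y. 1 + y\<^sup>2)" using assms(3) by simp
  ultimately show ?thesis by (rule Bochner_Integration.integrable_bound[where f="\<lambda>y. 1 + y\<^sup>2", rotated 2]) measurable
qed

text \<open>Lyapunov's inequality up to a factor 2, from the pointwise bound of y^2 by a plus |y|^(2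
  + d) a^(- d / 2): either y^2 <= a, or the power |y|^d is at least a^(d / 2). The choice a = v / 2
  leaves half of the variance on the other side.\<close>

lemma lyapunov:
  assumes "centered_moments d m v \<beta>" "0 < d" "0 < v"
  shows "(v / 2) powr (1 + d / 2) \<le> \<beta>"
proof -
  note c = assms(1)[unfolded centered_moments_def]
  interpret prob_space m using c by blast
  define a where "a = v / 2"
  have a: "0 < a" using assms by (simp add: a_def)
  have pw: "y\<^sup>2 \<le> a + \<bar>y\<bar> powr (2 + d) * a powr (- (d / 2))" for y :: real
  proof (cases "y\<^sup>2 \<le> a")
    case True
    then show ?thesis by (simp add: add_increasing2)
  next
    case False
    then have y: "y \<noteq> 0" "a < y\<^sup>2" using a by auto
    have "a powr (d / 2) \<le> (y\<^sup>2) powr (d / 2)" using y a assms by (intro powr_mono2) auto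
    also have "(y\<^sup>2) powr (d / 2) = \<bar>y\<bar> powr d"
    proof -
      have "y\<^sup>2 = \<bar>y\<bar> powr 2" using y by (simp add: powr_numeral)
      then show ?thesis by (simp only: powr_powr) simp
    qed
    finally have "y\<^sup>2 * a powr (d / 2) \<le> y\<^sup>2 * \<bar>y\<bar> powr d" by (intro mult_left_mono) auto
    also have "\<dots> = \<bar>y\<bar> powr (2 + d)" using y by (simp add: powr_add powr_numeral)
    finally have "y\<^sup>2 \<le> \<bar>y\<bar> powr (2 + d) * a powr (- (d / 2))"
      using a by (simp add: powr_minus divide_simps)
    then show ?thesis using a by simp
  qed
  have "v = (\<integral>y. y\<^sup>2 \<partial>m)" using c by simp
  also have "\<dots> \<le> (\<integral>y. a + \<bar>y\<bar> powr (2 + d) * a powr (- (d / 2)) \<partial>m)"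
    using c pw by (intro integral_mono) auto
  also have "\<dots> = a + (\<integral>y. \<bar>y\<bar> powr (2 + d) \<partial>m) * a powr (- (d / 2))"
    using c by (subst Bochner_Integration.integral_add) (auto simp: prob_space)
  also have "\<dots> \<le> a + \<beta> * a powr (- (d / 2))"
    using c by (intro add_left_mono mult_right_mono) auto
  finally have "a \<le> \<beta> * a powr (- (d / 2))" by (simp add: a_def)
  then have "a * a powr (d / 2) \<le> \<beta>"
    using a by (simp add: powr_minus divide_simps)
  then show ?thesis using a by (simp add: powr_add a_def[symmetric])
qed

text \<open>In the variable u = |y| / sqrt v the power 2 + d is at most 1 + u^4, and the fourth
  moment 3 v^2 makes the constant 1 + 3.\<close>

lemma centered_moments_gauss:
  assumes "0 < v" "0 < d" "d \<le> 1"
  shows "centered_moments d (gauss v) v (4 * v powr (1 + d / 2))"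
proof -
  interpret prob_space "gauss v" by (rule prob_space_gauss) fact
  have s: "0 < sqrt v" using assms by simp
  have bi: "has_bochner_integral (gauss v) f I \<longleftrightarrow> has_bochner_integral lborel (\<lambda>x. gauss_density v x * f x) I"
    if "f \<in> borel_measurable borel" for f :: "real \<Rightarrow> real" and I
    unfolding gauss_def has_bochner_integral_iff using that by (simp add: integrable_real_density integral_real_density)
  have m1: "has_bochner_integral (gauss v) (\<lambda>y. y) 0"
    using normal_moment_odd[OF s, of 0 0] by (subst bi) (auto simp: assms)
  have m2: "has_bochner_integral (gauss v) (\<lambda>y. y\<^sup>2) v"
    using normal_moment_even[OF s, of 0 1] assms by (subst bi) (auto simp: power_divide)
  have m4: "has_bochner_integral (gauss v) (\<lambda>y. y ^ 4) (3 * v\<^sup>2)"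
    using normal_moment_even[OF s, of 0 2] assms by (subst bi) (auto simp: power_divide fact_numeral divide_simps)
  have pw: "\<bar>y\<bar> powr (2 + d) \<le> v powr (1 + d / 2) * (1 + y ^ 4 / v\<^sup>2)" for y
  proof -
    define u where "u = \<bar>y\<bar> / sqrt v"
    have u: "0 \<le> u" using assms by (simp add: u_def)
    have "u powr (2 + d) \<le> 1 + u ^ 4"
    proof (cases "u \<le> 1")
      case True
      then have "u powr (2 + d) \<le> 1 powr (2 + d)" using u assms by (intro powr_mono2) auto
      then show ?thesis using u by (simp add: add_increasing2)
    next
      case False
      then have "u powr (2 + d) \<le> u powr 4" using assms by (intro powr_mono) auto
      then show ?thesis using False by (simp add: powr_numeral)
    qed
    moreover have "u ^ 4 = y ^ 4 / v\<^sup>2"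
    proof -
      have "sqrt v ^ 4 = v\<^sup>2" using assms by (metis less_imp_le mult_2 numeral_Bit0 power2_eq_square power_add real_sqrt_pow2)
      then show ?thesis by (simp add: u_def power_divide)
    qed
    moreover have "\<bar>y\<bar> powr (2 + d) = v powr (1 + d / 2) * u powr (2 + d)"
    proof -
      have "sqrt v powr (2 + d) = v powr (1 + d / 2)"
        using assms by (simp add: powr_half_sqrt[symmetric] powr_powr algebra_simps add_divide_distrib)
      moreover have "\<bar>y\<bar> = sqrt v * u" using assms by (simp add: u_def)
      ultimately show ?thesis using u assms by (simp add: powr_mult)
    qed
    ultimately show ?thesis by (simp add: mult_left_mono)
  qed
  have int: "has_bochner_integral (gauss v) (\<lambda>y. v powr (1 + d / 2) * (1 + y ^ 4 / v\<^sup>2)) (v powr (1 + d / 2) * (1 + 3 * v\<^sup>2 / v\<^sup>2))"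
  proof -
    have "has_bochner_integral (gauss v) (\<lambda>y. 1 :: real) 1"
      using prob_space by (auto simp: has_bochner_integral_iff)
    then show ?thesis
      by (intro has_bochner_integral_mult_right has_bochner_integral_add has_bochner_integral_divide_zero[OF m4])
  qed
  have i: "integrable (gauss v) (\<lambda>y. \<bar>y\<bar> powr (2 + d))"
    by (rule Bochner_Integration.integrable_bound[OF integrable.intros[OF int]]) (use pw in \<open>auto intro: order.trans[OF _ abs_ge_self]\<close>)
  have "(\<integral>y. \<bar>y\<bar> powr (2 + d) \<partial>gauss v) \<le> (\<integral>y. v powr (1 + d / 2) * (1 + y ^ 4 / v\<^sup>2) \<partial>gauss v)"
    using pw by (intro integral_mono i integrable.intros[OF int])
  also have "\<dots> = 4 * v powr (1 + d / 2)"
    using has_bochner_integral_integral_eq[OF int] assms by simp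
  finally show ?thesis
    using m1 m2 i prob_space_axioms by (auto simp: centered_moments_def has_bochner_integral_iff)
qed

section \<open>Exchanging one summand for a Gaussian\<close>

text \<open>Averaging the Taylor polynomial over m removes its linear term and turns y^2 into v, so
  the difference is the average of the remainder. By Fubini its L1 norm in z is bounded at each y;
  rescaling by sqrt s produces the power of s.\<close>

lemma smoothed_density_L1:
  assumes c: "centered_moments d m v \<beta>" and d: "0 < d" "d \<le> 1" and s: "0 < s"
  shows "(\<integral>\<^sup>+z. ennreal \<bar>(\<integral>y. gauss_density s (z - y) \<partial>m) - gauss_density s z * (1 + (z\<^sup>2 / s - 1) / (2 * s) * v)\<bar> \<partial>lborel)
    \<le> ennreal (2880 * \<beta> / s powr (1 + d / 2))"
proof -
  note c' = c[unfolded centered_moments_def]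
  have sm [measurable_cong]: "sets m = sets borel" using c' by blast
  interpret m: prob_space m using c' by blast
  interpret pair_sigma_finite m lborel ..
  define r where "r z y = taylor_rem (z / sqrt s) (y / sqrt s) / sqrt s" for z y
  have r_m [measurable]: "(\<lambda>(y, z). r z y) \<in> borel_measurable (borel \<Otimes>\<^sub>M borel)"
    unfolding r_def by measurable
  have ss: "sqrt s * sqrt s = s" "0 < sqrt s" using s by auto
  have dens: "gauss_density s (z - y) = r z y + gauss_density s z * (1 + z / s * y + (z\<^sup>2 / s - 1) / (2 * s) * y\<^sup>2)" for z y
  proof -
    have 1: "z / sqrt s * (y / sqrt s) = z / s * y" 
    proof -
      have "z / sqrt s * (y / sqrt s) = z * y / (sqrt s * sqrt s)" by (rule times_divide_times_eq)
      then show ?thesis unfolding ss(1) by simp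
    qed
    have 2: "((z / sqrt s)\<^sup>2 - 1) / 2 * (y / sqrt s)\<^sup>2 = (z\<^sup>2 / s - 1) / (2 * s) * y\<^sup>2"
      using s by (simp add: power_divide)
    have 3: "A / q = (A - p * a) / q + p / q * a" for A p q a :: real
      by (simp add: diff_divide_distrib)
    show ?thesis
      unfolding gauss_density_scale[OF s] r_def taylor_rem_def 1 2 diff_divide_distrib[of z y] by (rule 3)
  qed
  have i1: "integrable m (\<lambda>y. y)" using c' by (intro integrable_of_square) auto
  have bound: "\<bar>gauss_density s z\<bar> \<le> 1 / sqrt (2 * pi * s)" for z
    using s by (auto simp: normal_density_def mult_left_le divide_simps)
  have ig: "integrable m (\<lambda>y. gauss_density s (z - y))" for z
    by (rule m.integrable_const_bound[where B="1 / sqrt (2 * pi * s)"]) (use bound in auto)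
  have ip: "has_bochner_integral m (\<lambda>y. gauss_density s z * (1 + z / s * y + (z\<^sup>2 / s - 1) / (2 * s) * y\<^sup>2))
     (gauss_density s z * (1 + z / s * 0 + (z\<^sup>2 / s - 1) / (2 * s) * v))" for z
  proof -
    have "has_bochner_integral m (\<lambda>y. 1 :: real) 1" "has_bochner_integral m (\<lambda>y. y) 0" "has_bochner_integral m (\<lambda>y. y\<^sup>2) v"
      using c' i1 m.prob_space by (auto simp: has_bochner_integral_iff)
    then show ?thesis by (intro has_bochner_integral_mult_right has_bochner_integral_add)
  qed
  have ir: "integrable m (r z)" for z
  proof -
    have "r z = (\<lambda>y. gauss_density s (z - y) - gauss_density s z * (1 + z / s * y + (z\<^sup>2 / s - 1) / (2 * s) * y\<^sup>2))"
      by (simp add: dens)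
    then show ?thesis using Bochner_Integration.integrable_diff[OF ig integrable.intros[OF ip]] by simp
  qed
  have eq: "(\<integral>y. gauss_density s (z - y) \<partial>m) - gauss_density s z * (1 + (z\<^sup>2 / s - 1) / (2 * s) * v) = (\<integral>y. r z y \<partial>m)" for z
    unfolding dens Bochner_Integration.integral_add[OF ir integrable.intros[OF ip]] has_bochner_integral_integral_eq[OF ip]
    by simp
  have "(\<integral>\<^sup>+z. ennreal \<bar>\<integral>y. r z y \<partial>m\<bar> \<partial>lborel) \<le> (\<integral>\<^sup>+z. \<integral>\<^sup>+y. ennreal \<bar>r z y\<bar> \<partial>m \<partial>lborel)"
  proof (rule nn_integral_mono)
    fix z
    show "ennreal \<bar>\<integral>y. r z y \<partial>m\<bar> \<le> (\<integral>\<^sup>+y. ennreal \<bar>r z y\<bar> \<partial>m)"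
      using integral_norm_bound_ennreal[OF ir[of z]] by simp
  qed
  also have "\<dots> = (\<integral>\<^sup>+y. \<integral>\<^sup>+z. ennreal \<bar>r z y\<bar> \<partial>lborel \<partial>m)"
    by (rule Fubini') measurable
  also have "\<dots> \<le> (\<integral>\<^sup>+y. ennreal (2880 / s powr (1 + d / 2) * \<bar>y\<bar> powr (2 + d)) \<partial>m)"
  proof (rule nn_integral_mono)
    fix y
    have "(\<integral>\<^sup>+z. ennreal \<bar>r z y\<bar> \<partial>lborel) = (\<integral>\<^sup>+z. ennreal \<bar>taylor_rem z (y / sqrt s)\<bar> \<partial>lborel)"
    proof -
      have "(\<integral>\<^sup>+z. ennreal \<bar>r z y\<bar> \<partial>lborel) = ennreal (sqrt s) * (\<integral>\<^sup>+z. ennreal \<bar>r (sqrt s * z) y\<bar> \<partial>lborel)"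
        using s by (subst nn_integral_real_affine[where c="sqrt s" and t=0]) (auto simp: r_def)
      also have "\<dots> = (\<integral>\<^sup>+z. ennreal (sqrt s) * ennreal \<bar>r (sqrt s * z) y\<bar> \<partial>lborel)"
        by (rule nn_integral_cmult[symmetric]) (simp add: r_def)
      also have "\<dots> = (\<integral>\<^sup>+z. ennreal \<bar>taylor_rem z (y / sqrt s)\<bar> \<partial>lborel)"
        using s by (intro nn_integral_cong, subst ennreal_mult'[symmetric]) (auto simp: r_def abs_mult)
      finally show ?thesis .
    qed
    also have "\<dots> \<le> ennreal (2880 * \<bar>y / sqrt s\<bar> powr (2 + d))"
      by (rule taylor_rem_L1[OF d])
    also have "2880 * \<bar>y / sqrt s\<bar> powr (2 + d) = 2880 / s powr (1 + d / 2) * \<bar>y\<bar> powr (2 + d)"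
    proof -
      have "sqrt s powr (2 + d) = s powr (1 + d / 2)"
        using s by (simp add: powr_half_sqrt[symmetric] powr_powr algebra_simps add_divide_distrib)
      then show ?thesis using s by (simp add: abs_divide powr_divide)
    qed
    finally show "(\<integral>\<^sup>+z. ennreal \<bar>r z y\<bar> \<partial>lborel) \<le> ennreal (2880 / s powr (1 + d / 2) * \<bar>y\<bar> powr (2 + d))" .
  qed
  also have "\<dots> = ennreal (\<integral>y. 2880 / s powr (1 + d / 2) * \<bar>y\<bar> powr (2 + d) \<partial>m)"
    using c' s by (intro nn_integral_eq_integral) auto
  also have "\<dots> = ennreal (2880 / s powr (1 + d / 2) * (\<integral>y. \<bar>y\<bar> powr (2 + d) \<partial>m))" by simp
  also have "\<dots> \<le> ennreal (2880 / s powr (1 + d / 2) * \<beta>)"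
    using c' s by (intro ennreal_leI mult_left_mono) auto
  finally show ?thesis unfolding eq by (simp add: mult.commute)
qed

lemma centered_moments_nonneg:
  assumes "centered_moments d m v \<beta>"
  shows "0 \<le> v" "0 \<le> \<beta>"
proof -
  have "0 \<le> (\<integral>y. y\<^sup>2 \<partial>m)" "0 \<le> (\<integral>y. \<bar>y\<bar> powr (2 + d) \<partial>m)"
    by (rule Bochner_Integration.integral_nonneg, simp)+
  then show "0 \<le> v" "0 \<le> \<beta>" using assms unfolding centered_moments_def by linarith+
qed

text \<open>m and the Gaussian law of the same variance share their Taylor polynomial, so the
  remainders of both bound the difference. By \<open>lyapunov\<close>, v^(1 + d / 2) <= 3 beta, and
  37440 = 2880 + 2880 * 4 * 3.\<close>

lemma smoothed_density_diff:
  assumes c: "centered_moments d m v \<beta>" and d: "0 < d" "d \<le> 1" and s: "0 < s"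
  defines "h \<equiv> \<lambda>z. (\<integral>y. gauss_density s (z - y) \<partial>m)"
  shows "(\<integral>\<^sup>+z. ennreal \<bar>h z - gauss_density (s + v) z\<bar> \<partial>lborel) \<le> ennreal (37440 * \<beta> / s powr (1 + d / 2))"
proof -
  note c' = c[unfolded centered_moments_def]
  have [measurable_cong]: "sets m = sets borel" using c' by blast
  interpret m: prob_space m using c' by blast
  have \<beta>: "0 \<le> \<beta>"
    by (rule centered_moments_nonneg[OF c])
  have v: "0 \<le> v" using c' Bochner_Integration.integral_nonneg[of m "\<lambda>y. y\<^sup>2"] by auto
  have h_m [measurable]: "h \<in> borel_measurable borel" unfolding h_def by measurable
  define t where "t z = gauss_density s z * (1 + (z\<^sup>2 / s - 1) / (2 * s) * v)" for z
  have t_m [measurable]: "t \<in> borel_measurable borel" unfolding t_def[abs_def] by measurable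
  have A: "(\<integral>\<^sup>+z. ennreal \<bar>h z - t z\<bar> \<partial>lborel) \<le> ennreal (2880 * \<beta> / s powr (1 + d / 2))"
    unfolding h_def t_def by (rule smoothed_density_L1[OF c d s])
  show ?thesis
  proof (cases "v = 0")
    case True
    have le: "2880 * \<beta> / s powr (1 + d / 2) \<le> 37440 * \<beta> / s powr (1 + d / 2)"
      using \<beta> by (intro divide_right_mono) auto
    have "t z = gauss_density (s + v) z" for z by (simp add: t_def True)
    then show ?thesis using order.trans[OF A ennreal_leI[OF le]] by simp
  next
    case False
    with v have v: "0 < v" by simp
    have hG: "(\<integral>y. gauss_density s (z - y) \<partial>gauss v) = gauss_density (s + v) z" for z
    proof -
      have "ennreal (\<integral>y. gauss_density s (z - y) \<partial>gauss v) = ennreal (gauss_density (s + v) z)"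
      proof -
        have "\<bar>gauss_density s z\<bar> \<le> 1 / sqrt (2 * pi * s)" for z
          using s by (auto simp: normal_density_def mult_left_le divide_simps)
        then have "integrable (gauss v) (\<lambda>y. gauss_density s (z - y))"
          using prob_space_gauss[OF v]
          by (intro finite_measure.integrable_const_bound[where B="1 / sqrt (2 * pi * s)"]) (auto intro: prob_space.finite_measure)
        then have "ennreal (\<integral>y. gauss_density s (z - y) \<partial>gauss v) = (\<integral>\<^sup>+y. ennreal (gauss_density s (z - y)) \<partial>gauss v)"
          by (intro nn_integral_eq_integral[symmetric]) auto
        also have "\<dots> = (\<integral>\<^sup>+y. ennreal (gauss_density v y) * ennreal (gauss_density s (z - y)) \<partial>lborel)"
          unfolding gauss_def by (rule nn_integral_density) auto
        also have "\<dots> = (\<integral>\<^sup>+y. ennreal (gauss_density s (z - y) * gauss_density v y) \<partial>lborel)"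
          by (intro nn_integral_cong) (simp add: ennreal_mult' mult.commute)
        also have "\<dots> = ennreal (gauss_density (s + v) z)"
          using fun_cong[OF conv_normal_density_zero_mean[of "sqrt s" "sqrt v"], of z] s v by simp
        finally show ?thesis .
      qed
      then show ?thesis by (subst (asm) ennreal_inj) (auto intro!: Bochner_Integration.integral_nonneg)
    qed
    have "(v / 2) powr (1 + d / 2) \<le> \<beta>" by (rule lyapunov[OF c d(1) v])
    moreover have "v powr (1 + d / 2) \<le> 3 * (v / 2) powr (1 + d / 2)"
    proof -
      have "(2::real) powr (1 + d / 2) \<le> 2 powr (3 / 2)" using d by (intro powr_mono) auto
      also have "(2::real) powr (3 / 2) \<le> 3"
      proof -
        have "(2::real) powr (3 / 2) = (2 powr 3) powr (1 / 2)" by (simp only: powr_powr) simp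
        also have "(2::real) powr 3 = 8" by (simp add: powr_numeral)
        also have "(8::real) powr (1 / 2) = sqrt 8" by (simp only: powr_half_sqrt)
        also have "\<dots> \<le> 3" by (intro real_le_lsqrt) auto
        finally show ?thesis .
      qed
      finally have "(2::real) powr (1 + d / 2) * (v / 2) powr (1 + d / 2) \<le> 3 * (v / 2) powr (1 + d / 2)"
        by (rule mult_right_mono) simp
      moreover have "(2::real) powr (1 + d / 2) * (v / 2) powr (1 + d / 2) = v powr (1 + d / 2)"
        using v by (subst powr_mult[symmetric]) auto
      ultimately show ?thesis by simp
    qed
    ultimately have v\<beta>: "v powr (1 + d / 2) \<le> 3 * \<beta>" by linarith
    have B: "(\<integral>\<^sup>+z. ennreal \<bar>gauss_density (s + v) z - t z\<bar> \<partial>lborel) \<le> ennreal (2880 * (4 * v powr (1 + d / 2)) / s powr (1 + d / 2))"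
      using smoothed_density_L1[OF centered_moments_gauss[OF v d] d s] unfolding hG t_def .
    have "(\<integral>\<^sup>+z. ennreal \<bar>h z - gauss_density (s + v) z\<bar> \<partial>lborel)
      \<le> (\<integral>\<^sup>+z. ennreal \<bar>h z - t z\<bar> + ennreal \<bar>gauss_density (s + v) z - t z\<bar> \<partial>lborel)"
    proof (rule nn_integral_mono)
      fix z
      have "ennreal \<bar>h z - gauss_density (s + v) z\<bar> \<le> ennreal (\<bar>h z - t z\<bar> + \<bar>gauss_density (s + v) z - t z\<bar>)"
        by (rule ennreal_leI) linarith
      then show "ennreal \<bar>h z - gauss_density (s + v) z\<bar> \<le> ennreal \<bar>h z - t z\<bar> + ennreal \<bar>gauss_density (s + v) z - t z\<bar>"
        by (subst (asm) ennreal_plus) simp_all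
    qed
    also have "\<dots> = (\<integral>\<^sup>+z. ennreal \<bar>h z - t z\<bar> \<partial>lborel) + (\<integral>\<^sup>+z. ennreal \<bar>gauss_density (s + v) z - t z\<bar> \<partial>lborel)"
      by (rule nn_integral_add) measurable
    also have "\<dots> \<le> ennreal (2880 * \<beta> / s powr (1 + d / 2)) + ennreal (2880 * (4 * v powr (1 + d / 2)) / s powr (1 + d / 2))"
      by (rule add_mono[OF A B])
    also have "\<dots> = ennreal ((2880 * \<beta> + 2880 * (4 * v powr (1 + d / 2))) / s powr (1 + d / 2))"
      using \<beta> by (subst ennreal_plus[symmetric]) (auto simp: add_divide_distrib)
    also have "\<dots> \<le> ennreal (37440 * \<beta> / s powr (1 + d / 2))"
      using v\<beta> by (intro ennreal_leI divide_right_mono) auto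
    finally show ?thesis .
  qed
qed

text \<open>The effect of exchanging one summand for a Gaussian one of the same variance in a smoothed sum.\<close>

definition gauss_step :: "real measure \<Rightarrow> real measure \<Rightarrow> real \<Rightarrow> real \<Rightarrow> real \<Rightarrow> real" where
  "gauss_step L m v s t = cdf (L \<star> (m \<star> gauss s)) t - cdf (L \<star> gauss (s + v)) t"

text \<open>The step is the integral of the shifted distribution function of \<open>L\<close>
  against a difference of densities that is small in L1. Bounding the distribution function by 1
  gives the first estimate. By linearity in \<open>L\<close>, replacing \<open>L\<close> by a law at
  distance D costs only D times the same bound, and this gain drives the induction below.\<close>

lemma gauss_step_bounds:
  assumes c: "centered_moments d m v \<beta>" and d: "0 < d" "d \<le> 1" and s: "0 < s"
    and L: "prob_space L" "sets L = sets borel"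
  shows "\<bar>gauss_step L m v s t\<bar> \<le> 37440 * \<beta> / s powr (1 + d / 2)"
    and "prob_space L' \<Longrightarrow> sets L' = sets borel \<Longrightarrow> (\<And>t. \<bar>cdf L t - cdf L' t\<bar> \<le> D) \<Longrightarrow>
      \<bar>gauss_step L m v s t - gauss_step L' m v s t\<bar> \<le> D * (37440 * \<beta> / s powr (1 + d / 2))"
proof -
  note c' = c[unfolded centered_moments_def]
  have [measurable_cong]: "sets m = sets borel" using c' by blast
  interpret m: prob_space m using c' by blast
  have m: "prob_space m" "sets m = sets borel" using c' by blast+
  have v: "0 \<le> v" using c' Bochner_Integration.integral_nonneg[of m "\<lambda>y. y\<^sup>2"] by auto
  define h where "h z = (\<integral>y. gauss_density s (z - y) \<partial>m)" for z
  have h_m [measurable]: "h \<in> borel_measurable borel" unfolding h_def[abs_def] by measurable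
  have h0: "0 \<le> h z" for z by (simp add: h_def Bochner_Integration.integral_nonneg)
  have mg: "m \<star> gauss s = density lborel (\<lambda>z. ennreal (h z))"
    unfolding h_def by (rule convolution_gauss_density[OF m s])
  have "prob_space (m \<star> gauss s)"
  proof -
    interpret g: prob_space "gauss s" by (rule prob_space_gauss[OF s])
    interpret mg: pair_prob_space m "gauss s" ..
    show ?thesis unfolding convolution_def by (rule mg.prob_space_distr) measurable
  qed
  then have ph: "prob_space (density lborel (\<lambda>z. ennreal (h z)))" unfolding mg .
  have pg: "prob_space (density lborel (\<lambda>z. ennreal (gauss_density (s + v) z)))"
    using prob_space_gauss[of "s + v"] s v by (simp add: gauss_def)
  define \<Delta> where "\<Delta> z = h z - gauss_density (s + v) z" for z
  have \<Delta>_m [measurable]: "\<Delta> \<in> borel_measurable borel" unfolding \<Delta>_def[abs_def] by measurable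
  have \<Delta>L1: "(\<integral>\<^sup>+z. ennreal \<bar>\<Delta> z\<bar> \<partial>lborel) \<le> ennreal (37440 * \<beta> / s powr (1 + d / 2))"
    unfolding \<Delta>_def h_def by (rule smoothed_density_diff[OF c d s])
  have int_\<Delta>: "integrable lborel \<Delta>"
    using le_less_trans[OF \<Delta>L1] by (intro integrableI_bounded) auto
  have \<beta>: "0 \<le> \<beta>"
    by (rule centered_moments_nonneg[OF c])
  have L1: "(\<integral>z. \<bar>\<Delta> z\<bar> \<partial>lborel) \<le> 37440 * \<beta> / s powr (1 + d / 2)"
  proof -
    have "ennreal (\<integral>z. \<bar>\<Delta> z\<bar> \<partial>lborel) \<le> ennreal (37440 * \<beta> / s powr (1 + d / 2))"
      using \<Delta>L1 int_\<Delta> by (subst (asm) nn_integral_eq_integral) auto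
    then show ?thesis using \<beta> by (subst (asm) ennreal_le_iff) auto
  qed
  have step: "integrable lborel (\<lambda>z. cdf L (t - z) * \<Delta> z)" "gauss_step L m v s t = (\<integral>z. cdf L (t - z) * \<Delta> z \<partial>lborel)"
    if L: "prob_space L" "sets L = sets borel" for L t
  proof -
    note 1 = cdf_convolution_density[OF L ph h_m h0, of t]
    note 2 = cdf_convolution_density[OF L pg _ normal_density_nonneg, of t]
    show "integrable lborel (\<lambda>z. cdf L (t - z) * \<Delta> z)"
      using Bochner_Integration.integrable_diff[OF 1(1) 2(1)] by (simp add: \<Delta>_def right_diff_distrib)
    show "gauss_step L m v s t = (\<integral>z. cdf L (t - z) * \<Delta> z \<partial>lborel)"
      unfolding gauss_step_def mg unfolding gauss_def 1(2)
      using Bochner_Integration.integral_diff[OF 1(1) 2(1)] 2(2) by (simp add: \<Delta>_def right_diff_distrib)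
  qed
  have "\<bar>gauss_step L m v s t\<bar> \<le> (\<integral>z. \<bar>\<Delta> z\<bar> \<partial>lborel)"
  proof -
    interpret L: real_distribution L
      by (rule real_distribution.intro[OF L(1)], standard) (use L in \<open>auto dest: sets_eq_imp_space_eq\<close>)
    have "\<bar>gauss_step L m v s t\<bar> \<le> (\<integral>z. \<bar>cdf L (t - z) * \<Delta> z\<bar> \<partial>lborel)"
      unfolding step(2)[OF L] using integral_norm_bound[of lborel "\<lambda>z. cdf L (t - z) * \<Delta> z"] by simp
    also have "\<dots> \<le> (\<integral>z. \<bar>\<Delta> z\<bar> \<partial>lborel)"
    proof (rule integral_mono)
      show "integrable lborel (\<lambda>z. \<bar>cdf L (t - z) * \<Delta> z\<bar>)" by (rule integrable_abs[OF step(1)[OF L]])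
      show "integrable lborel (\<lambda>z. \<bar>\<Delta> z\<bar>)" by (rule integrable_abs[OF int_\<Delta>])
    qed (simp add: abs_mult L.cdf_nonneg L.cdf_bounded_prob mult_left_le_one_le)
    finally show ?thesis .
  qed
  then show "\<bar>gauss_step L m v s t\<bar> \<le> 37440 * \<beta> / s powr (1 + d / 2)" using L1 by linarith
  assume L': "prob_space L'" "sets L' = sets borel" and D: "\<And>t. \<bar>cdf L t - cdf L' t\<bar> \<le> D"
  have "0 \<le> D" using order.trans[OF abs_ge_zero D] .
  have "\<bar>gauss_step L m v s t - gauss_step L' m v s t\<bar> = \<bar>\<integral>z. (cdf L (t - z) - cdf L' (t - z)) * \<Delta> z \<partial>lborel\<bar>"
    unfolding step(2)[OF L] step(2)[OF L'] using step(1)[OF L, of t] step(1)[OF L', of t]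
    by (simp add: left_diff_distrib)
  also have "\<dots> \<le> (\<integral>z. \<bar>(cdf L (t - z) - cdf L' (t - z)) * \<Delta> z\<bar> \<partial>lborel)"
    using integral_norm_bound[of lborel "\<lambda>z. (cdf L (t - z) - cdf L' (t - z)) * \<Delta> z"] by simp
  also have "\<dots> \<le> (\<integral>z. D * \<bar>\<Delta> z\<bar> \<partial>lborel)"
  proof (rule integral_mono)
    have "integrable lborel (\<lambda>z. (cdf L (t - z) - cdf L' (t - z)) * \<Delta> z)"
      using Bochner_Integration.integrable_diff[OF step(1)[OF L, of t] step(1)[OF L', of t]] by (simp add: left_diff_distrib)
    then show "integrable lborel (\<lambda>z. \<bar>(cdf L (t - z) - cdf L' (t - z)) * \<Delta> z\<bar>)" by (rule integrable_abs)
    show "integrable lborel (\<lambda>z. D * \<bar>\<Delta> z\<bar>)" using int_\<Delta> by simp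
    show "\<bar>(cdf L (t - z) - cdf L' (t - z)) * \<Delta> z\<bar> \<le> D * \<bar>\<Delta> z\<bar>" for z
      unfolding abs_mult by (intro mult_right_mono D) simp
  qed
  also have "\<dots> = D * (\<integral>z. \<bar>\<Delta> z\<bar> \<partial>lborel)" by simp
  also have "\<dots> \<le> D * (37440 * \<beta> / s powr (1 + d / 2))" using L1 \<open>0 \<le> D\<close> by (rule mult_left_mono)
  finally show "\<bar>gauss_step L m v s t - gauss_step L' m v s t\<bar> \<le> D * (37440 * \<beta> / s powr (1 + d / 2))" .
qed

lemma real_distribution_of_prob:
  assumes "prob_space L" "sets L = sets borel"
  shows "real_distribution L"
  by (rule real_distribution.intro[OF assms(1)], standard) (use assms in \<open>auto dest: sets_eq_imp_space_eq\<close>)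

lemma prob_space_convolution:
  fixes L m :: "real measure"
  assumes "prob_space L" "sets L = sets borel" "prob_space m" "sets m = sets borel"
  shows "prob_space (L \<star> m)"
proof -
  note [measurable_cong] = assms(2,4)
  interpret L: prob_space L by fact
  interpret m: prob_space m by fact
  interpret Lm: pair_prob_space L m ..
  show ?thesis unfolding convolution_def by (rule Lm.prob_space_distr) measurable
qed

lemma return_zero_convolution:
  fixes m :: "real measure"
  assumes "prob_space m" "sets m = sets borel"
  shows "return borel 0 \<star> m = m"
proof (rule measure_eqI)
  have r: "prob_space (return borel (0::real))" by (rule prob_space_return) simp
  fix A assume "A \<in> sets (return borel 0 \<star> m)"
  then have A [measurable]: "A \<in> sets borel" by simp
  have "emeasure (return borel 0 \<star> m) A = (\<integral>\<^sup>+x. emeasure m {a. a + x \<in> A} \<partial>return borel 0)"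
    using A assms r sets_eq_imp_space_eq[OF assms(2)]
    by (intro convolution_emeasure) (auto simp: prob_space.finite_measure)
  also have "\<dots> = emeasure m {a. a + 0 \<in> A}"
  proof (rule nn_integral_return)
    interpret prob_space m by (rule assms(1))
    have "(\<lambda>x. emeasure m {a. a + x \<in> A}) = (\<lambda>x. emeasure m (Pair x -` {z \<in> space (borel \<Otimes>\<^sub>M m). snd z + fst z \<in> A}))"
      using sets_eq_imp_space_eq[OF assms(2)] by (auto simp: space_pair_measure)
    moreover have "{z \<in> space (borel \<Otimes>\<^sub>M m). snd z + fst z \<in> A} \<in> sets (borel \<Otimes>\<^sub>M m)"
    proof -
      note [measurable_cong] = assms(2)
      show ?thesis by measurable
    qed
    ultimately show "(\<lambda>x. emeasure m {a. a + x \<in> A}) \<in> borel_measurable borel"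
      by (simp only:) (rule measurable_emeasure_Pair)
  qed simp
  finally show "emeasure (return borel 0 \<star> m) A = emeasure m A" by simp
qed (simp add: assms)

section \<open>Smoothing, telescoping and induction\<close>

lemma cdf_gauss_lipschitz:
  assumes "0 < v" "x \<le> y"
  shows "cdf (gauss v) y - cdf (gauss v) x \<le> (y - x) / (2 * sqrt v)"
proof (cases "x = y")
  case False
  with assms have xy: "x < y" by simp
  interpret real_distribution "gauss v"
    by (rule real_distribution_of_prob) (auto simp: prob_space_gauss assms)
  have dens: "gauss_density v z \<le> 1 / (2 * sqrt v)" for z
  proof -
    have "2 * sqrt v \<le> sqrt (2 * pi) * sqrt v"
      using pi_gt3 assms by (intro mult_right_mono real_le_rsqrt) auto
    then have "1 / sqrt (2 * pi * v) \<le> 1 / (2 * sqrt v)"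
      using assms by (simp add: real_sqrt_mult frac_le)
    moreover have "gauss_density v z \<le> 1 / sqrt (2 * pi * v)"
      using assms by (auto simp: normal_density_def mult_left_le divide_simps)
    ultimately show ?thesis by linarith
  qed
  have "ennreal (measure (gauss v) {x<..y}) = (\<integral>\<^sup>+z. ennreal (gauss_density v z) * indicator {x<..y} z \<partial>lborel)"
    unfolding emeasure_eq_measure[symmetric] by (simp add: gauss_def emeasure_density)
  also have "\<dots> \<le> (\<integral>\<^sup>+z. ennreal (1 / (2 * sqrt v)) * indicator {x<..y} z \<partial>lborel)"
    using dens by (intro nn_integral_mono mult_right_mono ennreal_leI) auto
  also have "\<dots> = ennreal (1 / (2 * sqrt v)) * ennreal (y - x)"
    using xy by (simp add: nn_integral_cmult_indicator)
  also have "\<dots> = ennreal ((y - x) / (2 * sqrt v))"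
    using xy assms by (subst ennreal_mult'[symmetric]) auto
  finally have "measure (gauss v) {x<..y} \<le> (y - x) / (2 * sqrt v)"
    using xy assms by (subst (asm) ennreal_le_iff) auto
  then show ?thesis using cdf_diff_eq[OF xy] by simp
qed simp

text \<open>Let D be the supremum of |f|. For |w| <= u monotonicity of the distribution function of
  \<open>L\<close> gives f (t0 + u - w) >= f t0 - c, where c bounds the growth of the Gaussian one
  over the length 2 u. For |w| > u the loss is at most 2 D. Averaging over the smoothing Gaussian
  and arguing likewise to the left yields D <= De + c + D / 2, and the last term is
  absorbed.\<close>

lemma gauss_smoothing:
  assumes L: "prob_space L" "sets L = sets borel" and v: "0 < v" and e: "0 < e"
    and De: "\<And>t. \<bar>cdf (L \<star> gauss e) t - cdf (gauss (v + e)) t\<bar> \<le> De"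
  shows "\<bar>cdf L t - cdf (gauss v) t\<bar> \<le> 2 * De + 4 * (sqrt e / sqrt v)"
proof -
  interpret L: real_distribution L by (rule real_distribution_of_prob[OF L])
  interpret G: real_distribution "gauss v"
    by (rule real_distribution_of_prob) (auto simp: prob_space_gauss v)
  define f where "f t = cdf L t - cdf (gauss v) t" for t
  define D where "D = (SUP t. \<bar>f t\<bar>)"
  \<comment> \<open>With u = 2 sqrt e the mean of 2 D w^2 / u^2 under the Gaussian of variance e is
    exactly D / 2.\<close>
  define u c where "u = 2 * sqrt e" and "c = 2 * (sqrt e / sqrt v)"
  have u: "0 < u" using e by (simp add: u_def)
  have c: "0 \<le> c" using e v by (simp add: c_def)
  have f1: "\<bar>f t\<bar> \<le> 1" for t
    using L.cdf_nonneg[of t] L.cdf_bounded_prob[of t] G.cdf_nonneg[of t] G.cdf_bounded_prob[of t]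
    unfolding f_def by linarith
  have fD: "\<bar>f t\<bar> \<le> D" for t
    unfolding D_def by (rule cSUP_upper2[of _ _ t]) (auto intro!: bdd_aboveI[of _ 1] f1)
  have int: "integrable lborel (\<lambda>w. f (t - w) * gauss_density e w)"
    "cdf (L \<star> gauss e) t - cdf (gauss (v + e)) t = (\<integral>w. f (t - w) * gauss_density e w \<partial>lborel)" for t
  proof -
    have pe: "prob_space (density lborel (\<lambda>z. ennreal (gauss_density e z)))"
      using prob_space_gauss[OF e] by (simp add: gauss_def)
    note 1 = cdf_convolution_density[OF L pe _ normal_density_nonneg, of t]
    note 2 = cdf_convolution_density[OF prob_space_gauss[OF v] sets_gauss pe _ normal_density_nonneg, of t]
    show "integrable lborel (\<lambda>w. f (t - w) * gauss_density e w)"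
      using Bochner_Integration.integrable_diff[OF 1(1) 2(1)] by (simp add: f_def left_diff_distrib)
    have ge: "gauss (v + e) = (gauss v \<star> gauss e)" using gauss_convolution[OF v e] by simp
    show "cdf (L \<star> gauss e) t - cdf (gauss (v + e)) t = (\<integral>w. f (t - w) * gauss_density e w \<partial>lborel)"
      unfolding ge unfolding gauss_def[of e]
      using 1(2) 2(2) Bochner_Integration.integral_diff[OF 1(1) 2(1)] by (simp add: f_def left_diff_distrib)
  qed
  \<comment> \<open>The loss for |w| > u is dominated by a quadratic function of w, so the second
    moment takes the place of a Gaussian tail estimate.\<close>
  have quad: "has_bochner_integral lborel (\<lambda>w. (a - 2 * D * w\<^sup>2 / u\<^sup>2) * gauss_density e w) (a - D / 2)" for a
  proof -
    have m0: "has_bochner_integral lborel (gauss_density e) 1"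
      using e by (auto simp: has_bochner_integral_iff)
    have m2: "has_bochner_integral lborel (\<lambda>w. gauss_density e w * w\<^sup>2) e"
      using normal_moment_even[of "sqrt e" 0 1] e by (simp add: power_divide)
    have "has_bochner_integral lborel (\<lambda>w. a * gauss_density e w - 2 * D / u\<^sup>2 * (gauss_density e w * w\<^sup>2)) (a * 1 - 2 * D / u\<^sup>2 * e)"
      by (intro has_bochner_integral_diff has_bochner_integral_mult_right m0 m2)
    moreover have "a * 1 - 2 * D / u\<^sup>2 * e = a - D / 2"
      using e by (simp add: u_def power_mult_distrib)
    moreover have "(\<lambda>w. a * gauss_density e w - 2 * D / u\<^sup>2 * (gauss_density e w * w\<^sup>2)) = (\<lambda>w. (a - 2 * D * w\<^sup>2 / u\<^sup>2) * gauss_density e w)"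
      by (auto simp: algebra_simps)
    ultimately show ?thesis by (simp only:)
  qed
  have far: "2 * D \<le> 2 * D * w\<^sup>2 / u\<^sup>2" if "u < \<bar>w\<bar>" for w
  proof -
    have "u\<^sup>2 \<le> w\<^sup>2" using that u by (simp add: abs_le_square_iff[symmetric])
    then have "1 \<le> w\<^sup>2 / u\<^sup>2" using u by simp
    moreover have "0 \<le> 2 * D" using fD[of 0] by simp
    ultimately have "2 * D * 1 \<le> 2 * D * (w\<^sup>2 / u\<^sup>2)" by (rule mult_left_mono)
    then show ?thesis by simp
  qed
  have D0: "0 \<le> D" using fD[of 0] by simp
  have lip: "cdf (gauss v) y - cdf (gauss v) x \<le> c" if "x \<le> y" "y - x \<le> 2 * u" for x y
  proof -
    have "cdf (gauss v) y - cdf (gauss v) x \<le> (y - x) / (2 * sqrt v)"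
      by (rule cdf_gauss_lipschitz[OF v that(1)])
    also have "\<dots> \<le> 2 * u / (2 * sqrt v)" using that v by (intro divide_right_mono) auto
    also have "\<dots> = c" by (simp add: u_def c_def)
    finally show ?thesis .
  qed
  have up: "f t0 - c - D / 2 \<le> De" for t0
  proof -
    have "f t0 - c - 2 * D * w\<^sup>2 / u\<^sup>2 \<le> f (t0 + u - w)" for w
    proof (cases "\<bar>w\<bar> \<le> u")
      case True
      have "f t0 - c \<le> f (t0 + u - w)"
      proof -
        have w: "w \<le> u" "- w \<le> u" using True by linarith+
        have "cdf L t0 \<le> cdf L (t0 + u - w)" using w by (intro L.cdf_nondecreasing) linarith
        moreover have "cdf (gauss v) (t0 + u - w) - cdf (gauss v) t0 \<le> c" using w by (intro lip) linarith+
        ultimately show ?thesis unfolding f_def by linarith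
      qed
      moreover have "0 \<le> 2 * D * w\<^sup>2 / u\<^sup>2" using D0 by simp
      ultimately show ?thesis by linarith
    next
      case False
      then show ?thesis using far[of w] fD[of t0] fD[of "t0 + u - w"] c by linarith
    qed
    then have "(\<integral>w. (f t0 - c - 2 * D * w\<^sup>2 / u\<^sup>2) * gauss_density e w \<partial>lborel) \<le> (\<integral>w. f (t0 + u - w) * gauss_density e w \<partial>lborel)"
      by (intro integral_mono integrable.intros[OF quad] int(1) mult_right_mono) auto
    then show ?thesis
      unfolding has_bochner_integral_integral_eq[OF quad] int(2)[symmetric] using De[of "t0 + u"] by linarith
  qed
  have down: "- f t0 - c - D / 2 \<le> De" for t0
  proof -
    have "f (t0 - u - w) \<le> - (- f t0 - c - 2 * D * w\<^sup>2 / u\<^sup>2)" for w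
    proof (cases "\<bar>w\<bar> \<le> u")
      case True
      have "f (t0 - u - w) \<le> f t0 + c"
      proof -
        have w: "w \<le> u" "- w \<le> u" using True by linarith+
        have "cdf L (t0 - u - w) \<le> cdf L t0" using w by (intro L.cdf_nondecreasing) linarith
        moreover have "cdf (gauss v) t0 - cdf (gauss v) (t0 - u - w) \<le> c" using w by (intro lip) linarith+
        ultimately show ?thesis unfolding f_def by linarith
      qed
      moreover have "0 \<le> 2 * D * w\<^sup>2 / u\<^sup>2" using D0 by simp
      ultimately show ?thesis by linarith
    next
      case False
      then show ?thesis using far[of w] fD[of t0] fD[of "t0 - u - w"] c by linarith
    qed
    then have "(\<integral>w. (- f t0 - c - 2 * D * w\<^sup>2 / u\<^sup>2) * gauss_density e w \<partial>lborel) \<le> (\<integral>w. - (f (t0 - u - w) * gauss_density e w) \<partial>lborel)"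
    proof (intro integral_mono integrable.intros[OF quad] Bochner_Integration.integrable_minus int(1))
      fix w assume *: "\<And>w. f (t0 - u - w) \<le> - (- f t0 - c - 2 * D * w\<^sup>2 / u\<^sup>2)"
      then have "- f t0 - c - 2 * D * w\<^sup>2 / u\<^sup>2 \<le> - f (t0 - u - w)" using *[of w] by linarith
      then have "(- f t0 - c - 2 * D * w\<^sup>2 / u\<^sup>2) * gauss_density e w \<le> - f (t0 - u - w) * gauss_density e w"
        by (rule mult_right_mono) simp
      then show "(- f t0 - c - 2 * D * w\<^sup>2 / u\<^sup>2) * gauss_density e w \<le> - (f (t0 - u - w) * gauss_density e w)" by simp
    qed
    then show ?thesis
      unfolding has_bochner_integral_integral_eq[OF quad] Bochner_Integration.integral_minus int(2)[symmetric]
      using De[of "t0 - u"] by linarith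
  qed
  have "\<bar>f t\<bar> \<le> De + c + D / 2" for t
    using up[of t] down[of t] by linarith
  then have "D \<le> De + c + D / 2" unfolding D_def by (intro cSUP_least) auto
  then have "D \<le> 2 * De + 2 * c" by linarith
  then show ?thesis using fD[of t] unfolding f_def c_def by simp
qed

primrec sum_law :: "(nat \<Rightarrow> real measure) \<Rightarrow> nat \<Rightarrow> real measure" where
  "sum_law m 0 = return borel 0"
| "sum_law m (Suc k) = (sum_law m k \<star> m k)"

lemma sets_sum_law [simp]: "sets (sum_law m k) = sets borel"
  by (cases k) simp_all

lemma prob_space_sum_law:
  assumes "\<And>j. j < k \<Longrightarrow> prob_space (m j) \<and> sets (m j) = sets borel"
  shows "prob_space (sum_law m k)"
  using assms by (induction k) (auto intro!: prob_space_convolution prob_space_return)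

text \<open>The mean value theorem compares v s^(- (1 + d / 2)) with the increment of x^(- d / 2)
  over [s, s + v]. Since v <= s, the intermediate point is below 2 s, which costs 2^(1 + d / 2) <=
  3; hence 6 / d = 3 * (2 / d).\<close>

lemma power_telescope:
  fixes v s d :: real
  assumes "0 \<le> v" "v \<le> s" "0 < s" "0 < d" "d \<le> 1"
  shows "v * s powr (- (1 + d / 2)) \<le> 6 / d * (s powr (- (d / 2)) - (s + v) powr (- (d / 2)))"
proof (cases "v = 0")
  case False
  with assms have v: "0 < v" by simp
  have "\<exists>z. s < z \<and> z < s + v \<and> (s + v) powr (- (d / 2)) - s powr (- (d / 2)) = (s + v - s) * (- (d / 2) * z powr (- (d / 2) - 1))"
    using v assms by (intro MVT2) (auto intro!: derivative_eq_intros)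
  then obtain z where z: "s < z" "z < s + v"
    "(s + v) powr (- (d / 2)) - s powr (- (d / 2)) = (s + v - s) * (- (d / 2) * z powr (- (d / 2) - 1))" by blast
  have "(2 * s) powr (- (d / 2) - 1) \<le> z powr (- (d / 2) - 1)"
    using z assms by (intro powr_mono2') auto
  moreover have "(2 * s) powr (- (d / 2) - 1) \<ge> s powr (- (1 + d / 2)) / 3"
  proof -
    have "(2::real) powr (d / 2 + 1) \<le> 2 powr (3 / 2)" using assms by (intro powr_mono) auto
    also have "(2::real) powr (3 / 2) = (2 powr 3) powr (1 / 2)" by (simp only: powr_powr) simp
    also have "(2::real) powr 3 = 8" by (simp add: powr_numeral)
    also have "(8::real) powr (1 / 2) = sqrt 8" by (simp only: powr_half_sqrt)
    also have "\<dots> \<le> 3" by (intro real_le_lsqrt) auto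
    finally have "1 / 3 \<le> 1 / (2::real) powr (d / 2 + 1)" by (intro divide_left_mono) auto
    also have "\<dots> = 2 powr (- (d / 2) - 1)" by (simp add: powr_minus_divide[symmetric])
    finally have "1 / 3 * s powr (- (1 + d / 2)) \<le> 2 powr (- (d / 2) - 1) * s powr (- (1 + d / 2))"
      by (rule mult_right_mono) simp
    moreover have "(2 * s) powr (- (d / 2) - 1) = 2 powr (- (d / 2) - 1) * s powr (- (1 + d / 2))"
    proof -
      have "- (1 + d / 2) = - (d / 2) - 1" by simp
      then show ?thesis using assms by (simp only: powr_mult)
    qed
    ultimately show ?thesis by simp
  qed
  ultimately have zz: "s powr (- (1 + d / 2)) / 3 \<le> z powr (- (d / 2) - 1)" by linarith
  have "v * s powr (- (1 + d / 2)) = 6 / d * (v * (d / 2) * (s powr (- (1 + d / 2)) / 3))" using assms by simp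
  also have "\<dots> \<le> 6 / d * (v * (d / 2) * z powr (- (d / 2) - 1))"
    using zz v assms by (intro mult_left_mono) auto
  also have "v * (d / 2) * z powr (- (d / 2) - 1) = s powr (- (d / 2)) - (s + v) powr (- (d / 2))"
    using z(3) by simp
  finally show ?thesis .
qed simp

text \<open>A Gaussian law in front merges with the smoothing Gaussian. The step is then one that
  starts from the point mass at 0 with the smoothing variance s + w, which stays large when s is
  small.\<close>

lemma gauss_step_gauss:
  assumes c: "centered_moments d m v \<beta>" and d: "0 < d" "d \<le> 1" and s: "0 < s" and w: "0 < w"
  shows "\<bar>gauss_step (gauss w) m v s t\<bar> \<le> 37440 * \<beta> / (s + w) powr (1 + d / 2)"
proof -
  have m: "prob_space m" "sets m = sets borel" using c by (simp_all add: centered_moments_def)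
  have v: "0 \<le> v" by (rule centered_moments_nonneg[OF c])
  note pf = prob_space.finite_measure
  have ps: "prob_space (gauss s)" and pw: "prob_space (gauss w)" and psw: "prob_space (gauss (s + w))"
    using s w by (simp_all add: prob_space_gauss)
  have pms: "prob_space (m \<star> gauss s)" by (rule prob_space_convolution[OF m ps sets_gauss])
  have "gauss w \<star> (m \<star> gauss s) = ((m \<star> gauss s) \<star> gauss w)"
    by (rule convolution_commutative[OF pf[OF pw] pf[OF pms]]) simp_all
  also have "\<dots> = (m \<star> (gauss s \<star> gauss w))"
    by (rule convolution_associative[OF pf[OF ps] pf[OF pw] pf[OF m(1)], symmetric]) (simp_all add: m)
  also have "\<dots> = (return borel 0 \<star> (m \<star> gauss (s + w)))"
    unfolding gauss_convolution[OF s w]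
    by (rule return_zero_convolution[symmetric]) (simp_all add: prob_space_convolution[OF m psw])
  finally have 1: "(gauss w \<star> (m \<star> gauss s)) = (return borel 0 \<star> (m \<star> gauss (s + w)))" .
  have "(gauss w \<star> gauss (s + v)) = gauss (w + (s + v))" using s v w by (intro gauss_convolution) auto
  also have "\<dots> = (return borel 0 \<star> gauss (s + w + v))"
    using s v w by (subst return_zero_convolution) (auto intro!: prob_space_gauss simp: ac_simps)
  finally have 2: "(gauss w \<star> gauss (s + v)) = (return borel 0 \<star> gauss (s + w + v))" .
  have "gauss_step (gauss w) m v s t = gauss_step (return borel 0) m v (s + w) t"
    unfolding gauss_step_def 1 2 ..
  then show ?thesis
    using gauss_step_bounds(1)[OF c d, of "s + w" "return borel 0" t] s w by (simp add: prob_space_return)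
qed

text \<open>Lindeberg's exchange. In the j-th term the first j summands are genuine, and those after
  the exchanged one are Gaussian already; their variances join the smoothing variance.\<close>

lemma telescoped_smoothing:
  assumes m: "\<And>j. j < N \<Longrightarrow> centered_moments d (m j) (\<sigma> j) (\<beta> j)" and e: "0 < e"
  defines "V \<equiv> \<lambda>k. \<Sum>j<k. \<sigma> j"
  shows "cdf (sum_law m N \<star> gauss e) t - cdf (gauss (V N + e)) t =
    (\<Sum>j<N. gauss_step (sum_law m j) (m j) (\<sigma> j) (e + (V N - V (Suc j))) t)"
proof -
  define T where "T j = cdf (sum_law m j \<star> gauss (e + (V N - V j))) t" for j
  have pm: "prob_space (m j)" "sets (m j) = sets borel" "0 \<le> \<sigma> j" if "j < N" for j
    using m[OF that] centered_moments_nonneg[OF m[OF that]] by (auto simp: centered_moments_def)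
  have VN: "V j \<le> V N" if "j \<le> N" for j
    unfolding V_def using that pm(3) by (intro sum_mono2) auto
  have pL: "prob_space (sum_law m j)" if "j \<le> N" for j
    using that pm by (intro prob_space_sum_law) auto
  note pf = prob_space.finite_measure
  have "T (Suc j) - T j = gauss_step (sum_law m j) (m j) (\<sigma> j) (e + (V N - V (Suc j))) t" if j: "j < N" for j
  proof -
    have s: "0 < e + (V N - V (Suc j))" using VN[of "Suc j"] j e by simp
    have "(sum_law m (Suc j) \<star> gauss (e + (V N - V (Suc j)))) = (sum_law m j \<star> (m j \<star> gauss (e + (V N - V (Suc j)))))"
      unfolding sum_law.simps
      by (rule convolution_associative[OF pf pf pf, OF pm(1)[OF j] prob_space_gauss[OF s] pL, symmetric])
         (use j in \<open>simp_all add: pm\<close>)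
    moreover have "e + (V N - V (Suc j)) + \<sigma> j = e + (V N - V j)" by (simp add: V_def)
    ultimately show ?thesis by (simp only: T_def gauss_step_def)
  qed
  then have "(\<Sum>j<N. gauss_step (sum_law m j) (m j) (\<sigma> j) (e + (V N - V (Suc j))) t) = (\<Sum>j<N. T (Suc j) - T j)"
    by simp
  also have "\<dots> = T N - T 0" by (rule sum_lessThan_telescope)
  also have "T N = cdf (sum_law m N \<star> gauss e) t" by (simp add: T_def)
  also have "T 0 = cdf (gauss (V N + e)) t"
    using VN[of 0] e by (simp add: T_def V_def return_zero_convolution prob_space_gauss add_nonneg_pos add.commute add_pos_nonneg)
  finally show ?thesis by simp
qed

text \<open>The assumption that every moment of order 2 + d is at most rho times the variance fits
  weighted sums, where rho is governed by the largest weight. While the partial variance is below v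
  / 4, much smoothing is left and the crude step bound suffices. Later, the law of the partial sum
  is replaced by a Gaussian at the price of the induction hypothesis; the error is C R times a
  telescoping sum, which a large smoothing variance makes small, while the step from the Gaussian is
  small in itself.\<close>

theorem berry_esseen:
  assumes d: "0 < d" "d \<le> 1"
  shows "\<exists>C>0. \<forall>m \<sigma> \<rho> N. (\<forall>j<N. centered_moments d (m j) (\<sigma> j) (\<rho> * \<sigma> j)) \<longrightarrow> 0 < (\<Sum>j<N. \<sigma> j) \<longrightarrow>
    (\<forall>t. \<bar>cdf (sum_law m N) t - cdf (gauss (\<Sum>j<N. \<sigma> j)) t\<bar> \<le> C * (\<rho> * (\<Sum>j<N. \<sigma> j) powr (- (d / 2))))"
proof -
  define Q :: real where "Q = 37440"
  define Cs where "Cs = 6 / d"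
  \<comment> \<open>K >= 4 makes the smoothing variance dominate each single variance, and K >= 8 Q
    Cs brings the factor of the induction hypothesis down to 1 / 8.\<close>
  define K where "K = max 4 (8 * Q * Cs)"
  \<comment> \<open>C >= 8 forces R <= 1 / 8 in the nontrivial case; the other bound makes half of C
    pay for all terms that do not involve the induction hypothesis.\<close>
  define C where "C = max 8 (2 * (6 * Q + 4 * K))"
  have K: "4 \<le> K" "8 * Q * Cs \<le> K" by (auto simp: K_def)
  have C: "8 \<le> C" "2 * (6 * Q + 4 * K) \<le> C" by (auto simp: C_def)
  have Q: "0 < Q" by (simp add: Q_def)
  have Cs: "0 < Cs" using d by (simp add: Cs_def)
  have CK: "K \<le> C"
  proof -
    have "K \<le> 2 * (6 * Q + 4 * K)" using K(1) Q by simp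
    then show ?thesis using C(2) by (rule order.trans)
  qed
  have main: "\<bar>cdf (sum_law m N) t - cdf (gauss (\<Sum>j<N. \<sigma> j)) t\<bar> \<le> C * (\<rho> * (\<Sum>j<N. \<sigma> j) powr (- (d / 2)))"
    if m: "\<And>j. j < N \<Longrightarrow> centered_moments d (m j) (\<sigma> j) (\<rho> * \<sigma> j)" and pos: "0 < (\<Sum>j<N. \<sigma> j)" for m \<sigma> \<rho> N t
    using that
  proof (induction N arbitrary: t rule: less_induct)
    case (less N)
    define V where "V k = (\<Sum>j<k. \<sigma> j)" for k
    define v where "v = V N"
    have v: "0 < v" using less.prems(2) by (simp add: v_def V_def)
    have \<sigma>: "0 \<le> \<sigma> j" if "j < N" for j using centered_moments_nonneg[OF less.prems(1)[OF that]] by simp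
    obtain j0 where j0: "j0 < N" "0 < \<sigma> j0"
    proof -
      have "\<exists>j<N. 0 < \<sigma> j"
      proof (rule ccontr)
        assume "\<not> (\<exists>j<N. 0 < \<sigma> j)"
        then have "(\<Sum>j<N. \<sigma> j) \<le> 0" by (intro sum_nonpos) auto
        then show False using less.prems(2) by simp
      qed
      then show ?thesis using that by blast
    qed
    \<comment> \<open>Some summand has positive variance, and \<open>lyapunov\<close> bounds its
      moment away from 0.\<close>
    have \<rho>: "0 < \<rho>"
    proof -
      have "0 < (\<sigma> j0 / 2) powr (1 + d / 2)" using j0 by simp
      also have "\<dots> \<le> \<rho> * \<sigma> j0" by (rule lyapunov[OF less.prems(1)[OF j0(1)] d(1) j0(2)])
      finally show ?thesis using j0 by (simp add: zero_less_mult_iff)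
    qed
    define R where "R = \<rho> * v powr (- (d / 2))"
    have R: "0 < R" using \<rho> v by (simp add: R_def)
    interpret LN: real_distribution "sum_law m N"
      by (rule real_distribution_of_prob[OF prob_space_sum_law]) (use less.prems(1) in \<open>auto simp: centered_moments_def\<close>)
    interpret GN: real_distribution "gauss v"
      by (rule real_distribution_of_prob[OF prob_space_gauss[OF v]]) simp
    show ?case
    \<comment> \<open>If C R >= 1, the claim is weaker than the bound 1 for a difference of
      probabilities.\<close>
    proof (cases "1 \<le> C * R")
      case True
      have "\<bar>cdf (sum_law m N) t - cdf (gauss v) t\<bar> \<le> 1"
        using LN.cdf_nonneg[of t] LN.cdf_bounded_prob[of t] GN.cdf_nonneg[of t] GN.cdf_bounded_prob[of t] by linarith
      then show ?thesis using True unfolding R_def v_def V_def by linarith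
    next
      case False
      then have CR: "C * R < 1" by simp
      have R8: "R \<le> 1 / 8"
      proof -
        have "8 * R \<le> C * R" using C(1) R by (intro mult_right_mono) auto
        then show ?thesis using CR by simp
      qed
      have KR: "K * R \<le> 1"
      proof -
        have "K * R \<le> C * R" using CK R by (intro mult_right_mono) auto
        then show ?thesis using CR by simp
      qed
      \<comment> \<open>The smoothing variance satisfies e^(d / 2) = K rho. Hence sqrt (e / v) = (K
        R)^(1 / d) <= K R, so removing the smoothing costs no more than the order R.\<close>
      define e where "e = (K * \<rho>) powr (2 / d)"
      have e: "0 < e" using K \<rho> by (simp add: e_def)
      have ed: "e powr (d / 2) = K * \<rho>" using d K \<rho> by (simp add: e_def powr_powr)
      have \<rho>R: "\<rho> = R * v powr (d / 2)" using v by (simp add: R_def powr_minus)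
      have vv: "(v powr (d / 2)) powr (2 / d) = v" using d v by (simp add: powr_powr)
      have two: "4 \<le> (2::real) powr (2 / d)"
      proof -
        have "(2::real) powr 2 \<le> 2 powr (2 / d)" using d by (intro powr_mono) (auto simp: divide_simps)
        then show ?thesis by (simp add: powr_numeral)
      qed
      have \<sigma>_le: "\<sigma> j \<le> 2 * (2 * \<rho>) powr (2 / d)" if j: "j < N" for j
      proof (cases "\<sigma> j = 0")
        case False
        then have p: "0 < \<sigma> j" using \<sigma>[OF j] by simp
        have "(\<sigma> j / 2) powr (1 + d / 2) \<le> \<rho> * \<sigma> j" by (rule lyapunov[OF less.prems(1)[OF j] d(1) p])
        then have "(\<sigma> j / 2) * (\<sigma> j / 2) powr (d / 2) \<le> (\<sigma> j / 2) * (2 * \<rho>)" using p by (simp add: powr_add)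
        then have "(\<sigma> j / 2) powr (d / 2) \<le> 2 * \<rho>" using p by (simp only: mult_le_cancel_left_pos half_gt_zero_iff)
        then have "((\<sigma> j / 2) powr (d / 2)) powr (2 / d) \<le> (2 * \<rho>) powr (2 / d)" using d by (intro powr_mono2) auto
        then show ?thesis using d p by (simp add: powr_powr)
      qed (use \<rho> in simp)
      \<comment> \<open>This is the condition of \<open>power_telescope\<close>, as each remaining
        smoothing variance is at least e. It follows from \<open>lyapunov\<close> with 4 <= 2^(2 /
        d) and K >= 4.\<close>
      have \<sigma>e: "\<sigma> j \<le> e" if j: "j < N" for j
      proof -
        have "2 * (2 * \<rho>) powr (2 / d) \<le> 2 powr (2 / d) * (2 * \<rho>) powr (2 / d)"
          using two by (intro mult_right_mono) auto
        also have "\<dots> = (4 * \<rho>) powr (2 / d)" using \<rho> by (subst powr_mult[symmetric]) auto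
        also have "\<dots> \<le> e" unfolding e_def using K \<rho> d by (intro powr_mono2) auto
        finally show ?thesis using \<sigma>_le[OF j] by linarith
      qed
      \<comment> \<open>No summand dominates: by R <= 1 / 8 each variance is at most a quarter of
        the total, so the variances before and after an exchange together stay above v / 2.\<close>
      have \<sigma>v: "\<sigma> j \<le> v / 4" if j: "j < N" for j
      proof -
        have "(2 * \<rho>) powr (2 / d) = (2 * R) powr (2 / d) * v"
          unfolding \<rho>R using R v vv by (subst mult.assoc[symmetric], subst powr_mult) auto
        also have "\<dots> \<le> (2 * R) powr 2 * v"
          using R R8 d v by (intro mult_right_mono powr_mono') (auto simp: divide_simps)
        also have "\<dots> \<le> (1 / 4) powr 2 * v"
          using R R8 v by (intro mult_right_mono powr_mono2) auto
        also have "\<dots> = v / 16" by (simp add: powr_numeral power2_eq_square)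
        finally show ?thesis using \<sigma>_le[OF j] v by linarith
      qed
      have Vmono: "V j \<le> V k" if "j \<le> k" "k \<le> N" for j k
        unfolding V_def using that \<sigma> by (intro sum_mono2) auto
      define s where "s j = e + (v - V (Suc j))" for j
      have s: "e \<le> s j" if "j < N" for j using Vmono[of "Suc j" N] that by (simp add: s_def v_def)
      have sV: "s j + V j = e + v - \<sigma> j" for j by (simp add: s_def V_def)
      define p where "p = 1 + d / 2"
      have neg: "a / x powr p = a * x powr (- p)" for a x by (simp add: powr_minus divide_inverse)
      have step_bd: "\<bar>gauss_step (sum_law m j) (m j) (\<sigma> j) (s j) t\<bar> \<le>
          Q * \<rho> * (v / 2) powr (- p) * \<sigma> j + 2 * C * R * (Q * \<rho>) * (\<sigma> j * s j powr (- p))" if j: "j < N" for j t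
      proof -
        note c = less.prems(1)[OF j]
        have sj: "0 < s j" using s[OF j] e by linarith
        have pL: "prob_space (sum_law m j)"
          by (rule prob_space_sum_law) (use less.prems(1) j in \<open>auto simp: centered_moments_def\<close>)
        have half: "Q * (\<rho> * \<sigma> j) / x powr p \<le> Q * \<rho> * (v / 2) powr (- p) * \<sigma> j" if "v / 2 \<le> x" for x
        proof -
          have "x powr (- p) \<le> (v / 2) powr (- p)" using that v d by (intro powr_mono2') (auto simp: p_def)
          then have "Q * (\<rho> * \<sigma> j) * x powr (- p) \<le> Q * (\<rho> * \<sigma> j) * (v / 2) powr (- p)"
            using Q \<rho> \<sigma>[OF j] by (intro mult_left_mono) auto
          then show ?thesis unfolding neg by (simp add: ac_simps)
        qed
        show ?thesis
        \<comment> \<open>For small \<open>V j\<close> the remaining variance \<open>s j\<close>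
          exceeds v / 2. Otherwise \<open>V j\<close> is positive and comparable to v, so the
          induction hypothesis for the first j summands is of order R.\<close>
        proof (cases "V j < v / 4")
          case True
          have "v / 2 \<le> s j" using sV[of j] True \<sigma>v[OF j] e by linarith
          then have "\<bar>gauss_step (sum_law m j) (m j) (\<sigma> j) (s j) t\<bar> \<le> Q * \<rho> * (v / 2) powr (- p) * \<sigma> j"
            using gauss_step_bounds(1)[OF c d sj pL sets_sum_law, of t] half[of "s j"] unfolding Q_def p_def by linarith
          moreover have "0 \<le> 2 * C * R * (Q * \<rho>) * (\<sigma> j * s j powr (- p))"
            using C R Q \<rho> \<sigma>[OF j] by simp
          ultimately show ?thesis by linarith
        next
          case False
          then have Vj: "0 < V j" "v / 4 \<le> V j" using v by auto
          have D: "\<bar>cdf (sum_law m j) t - cdf (gauss (V j)) t\<bar> \<le> 2 * C * R" for t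
          proof -
            have "\<bar>cdf (sum_law m j) t - cdf (gauss (V j)) t\<bar> \<le> C * (\<rho> * V j powr (- (d / 2)))"
              unfolding V_def by (rule less.IH[OF j]) (use less.prems(1) j Vj in \<open>auto simp: V_def\<close>)
            moreover have "V j powr (- (d / 2)) \<le> 2 * v powr (- (d / 2))"
            proof -
            have "V j powr (- (d / 2)) \<le> (v / 4) powr (- (d / 2))"
              using Vj v d by (intro powr_mono2') auto
            also have "(v / 4) powr (- (d / 2)) = v powr (- (d / 2)) * 4 powr (d / 2)"
              using v by (simp add: powr_divide powr_minus divide_simps)
            also have "v powr (- (d / 2)) * 4 powr (d / 2) \<le> v powr (- (d / 2)) * 2"
            proof (rule mult_left_mono)
              show "(4::real) powr (d / 2) \<le> 2"
            proof -
              have "(4::real) powr (d / 2) \<le> 4 powr (1 / 2)" using d by (intro powr_mono) auto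
              then show ?thesis by (simp add: powr_half_sqrt)
            qed
            qed simp
            finally show ?thesis by (simp only: mult.commute)
            qed
            then have "C * (\<rho> * V j powr (- (d / 2))) \<le> C * (\<rho> * (2 * v powr (- (d / 2))))"
              using C \<rho> by (intro mult_left_mono) auto
            moreover have "C * (\<rho> * (2 * v powr (- (d / 2)))) = 2 * C * R" by (simp add: R_def)
            ultimately show ?thesis by linarith
          qed
          have "\<bar>gauss_step (gauss (V j)) (m j) (\<sigma> j) (s j) t\<bar> \<le> Q * \<rho> * (v / 2) powr (- p) * \<sigma> j"
          proof -
            have "v / 2 \<le> s j + V j" using sV[of j] \<sigma>v[OF j] e v by linarith
            then show ?thesis
              using gauss_step_gauss[OF c d sj Vj(1), of t] half[of "s j + V j"] unfolding Q_def p_def by linarith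
          qed
          moreover have "\<bar>gauss_step (sum_law m j) (m j) (\<sigma> j) (s j) t - gauss_step (gauss (V j)) (m j) (\<sigma> j) (s j) t\<bar>
              \<le> 2 * C * R * (Q * (\<rho> * \<sigma> j) / s j powr p)"
            unfolding Q_def p_def
            by (rule gauss_step_bounds(2)[OF c d sj pL sets_sum_law prob_space_gauss[OF Vj(1)] sets_gauss D])
          ultimately show ?thesis unfolding neg by (simp add: ac_simps)
        qed
      qed
      \<comment> \<open>The sum telescopes to e^(- d / 2) = 1 / (K rho), whose rho cancels the one
        in the step bound.\<close>
      have sum_s: "(\<Sum>j<N. \<sigma> j * s j powr (- p)) \<le> Cs / (K * \<rho>)"
      proof -
        define W where "W j = (e + (v - V j)) powr (- (d / 2))" for j
        have "(\<Sum>j<N. \<sigma> j * s j powr (- p)) \<le> (\<Sum>j<N. Cs * (W (Suc j) - W j))"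
        proof (rule sum_mono)
          fix j assume "j \<in> {..<N}"
          then have j: "j < N" by simp
          have tele: "\<sigma> j * s j powr (- p) \<le> Cs * (s j powr (- (d / 2)) - (s j + \<sigma> j) powr (- (d / 2)))"
            unfolding Cs_def p_def
            by (rule power_telescope) (use \<sigma>[OF j] \<sigma>e[OF j] s[OF j] e d in linarith)+
          have "W j = (s j + \<sigma> j) powr (- (d / 2))" "W (Suc j) = s j powr (- (d / 2))"
            by (simp_all add: W_def s_def V_def)
          then show "\<sigma> j * s j powr (- p) \<le> Cs * (W (Suc j) - W j)"
            using tele by (simp only:)
        qed
        also have "\<dots> = Cs * (W N - W 0)"
          unfolding sum_distrib_left[symmetric] sum_lessThan_telescope ..
        also have "\<dots> \<le> Cs * W N" using Cs by (simp add: W_def)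
        also have "Cs * W N = Cs / (K * \<rho>)"
        proof -
          have "W N = e powr (- (d / 2))" by (simp add: W_def v_def)
          also have "\<dots> = inverse (K * \<rho>)" by (simp only: powr_minus ed)
          finally show ?thesis by (simp only: divide_inverse)
        qed
        finally show ?thesis .
      qed
      have smooth: "\<bar>cdf (sum_law m N \<star> gauss e) t - cdf (gauss (v + e)) t\<bar> \<le> 3 * Q * R + 2 * C * R * (Q * Cs / K)" for t
      proof -
        have "\<bar>cdf (sum_law m N \<star> gauss e) t - cdf (gauss (v + e)) t\<bar> = \<bar>\<Sum>j<N. gauss_step (sum_law m j) (m j) (\<sigma> j) (s j) t\<bar>"
          unfolding v_def V_def s_def by (rule arg_cong[OF telescoped_smoothing[OF less.prems(1) e]])
        also have "\<dots> \<le> (\<Sum>j<N. Q * \<rho> * (v / 2) powr (- p) * \<sigma> j + 2 * C * R * (Q * \<rho>) * (\<sigma> j * s j powr (- p)))"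
          by (rule order.trans[OF sum_abs sum_mono]) (use step_bd in auto)
        also have "\<dots> = Q * \<rho> * (v / 2) powr (- p) * v + 2 * C * R * (Q * \<rho>) * (\<Sum>j<N. \<sigma> j * s j powr (- p))"
          by (simp add: sum.distrib sum_distrib_left v_def V_def)
        also have "\<dots> \<le> 3 * Q * R + 2 * C * R * (Q * Cs / K)"
        proof -
          have "(v / 2) powr (- p) * v \<le> 3 * v powr (- (d / 2))"
          proof -
            have "(v / 2) powr (- p) = v powr (- p) * 2 powr p" using v by (simp add: powr_divide powr_minus divide_simps)
            moreover have "v powr (- p) * v = v powr (- (d / 2))"
            proof -
              have "v powr (- p) * v powr 1 = v powr (- p + 1)" by (rule powr_add[symmetric])
              then show ?thesis using v by (simp add: p_def)
            qed
            moreover have "(2::real) powr p \<le> 3"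
            proof -
              have "(2::real) powr p \<le> 2 powr (3 / 2)" unfolding p_def using d by (intro powr_mono) auto
              also have "(2::real) powr (3 / 2) = (2 powr 3) powr (1 / 2)" by (simp only: powr_powr) simp
              also have "(2::real) powr 3 = 8" by (simp add: powr_numeral)
              also have "(8::real) powr (1 / 2) = sqrt 8" by (simp only: powr_half_sqrt)
              also have "\<dots> \<le> 3" by (intro real_le_lsqrt) auto
              finally show ?thesis .
            qed
            ultimately have "(v / 2) powr (- p) * v = 2 powr p * v powr (- (d / 2))" "(2::real) powr p \<le> 3"
              by (simp_all add: ac_simps)
            then show ?thesis by (simp add: mult_right_mono)
          qed
          then have "Q * \<rho> * ((v / 2) powr (- p) * v) \<le> Q * \<rho> * (3 * v powr (- (d / 2)))"
            using Q \<rho> by (intro mult_left_mono) auto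
          then have "Q * \<rho> * (v / 2) powr (- p) * v \<le> 3 * Q * R" by (simp add: R_def ac_simps)
          moreover have "2 * C * R * (Q * \<rho>) * (\<Sum>j<N. \<sigma> j * s j powr (- p)) \<le> 2 * C * R * (Q * \<rho>) * (Cs / (K * \<rho>))"
            using C R Q \<rho> by (intro mult_left_mono[OF sum_s]) auto
          moreover have "2 * C * R * (Q * \<rho>) * (Cs / (K * \<rho>)) = 2 * C * R * (Q * Cs / K)"
            using \<rho> by simp
          ultimately show ?thesis by linarith
        qed
        finally show ?thesis .
      qed
      have ev: "sqrt e / sqrt v \<le> K * R"
      proof -
        have "sqrt e / sqrt v = sqrt (e / v)" by (simp add: real_sqrt_divide)
        also have "e / v = (K * R) powr (2 / d)"
        proof -
          have "e = (K * R * v powr (d / 2)) powr (2 / d)" unfolding e_def by (subst \<rho>R) (simp add: ac_simps)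
          also have "\<dots> = (K * R) powr (2 / d) * v" using K R v vv by (subst powr_mult) auto
          finally show ?thesis using v by simp
        qed
        also have "sqrt ((K * R) powr (2 / d)) = (K * R) powr (1 / d)"
          using K R by (simp add: powr_half_sqrt[symmetric] powr_powr)
        also have "\<dots> \<le> (K * R) powr 1"
          using K R KR d by (intro powr_mono') (auto simp: divide_simps)
        finally show ?thesis using K R by simp
      qed
      have "\<bar>cdf (sum_law m N) t - cdf (gauss v) t\<bar> \<le> 2 * (3 * Q * R + 2 * C * R * (Q * Cs / K)) + 4 * (sqrt e / sqrt v)"
        by (rule gauss_smoothing[OF _ sets_sum_law v e smooth]) (rule LN.prob_space_axioms)
      \<comment> \<open>Removing the smoothing doubles the term with C to C R / 2, and the other
        half of C R covers the rest.\<close>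
      also have "\<dots> \<le> 2 * (3 * Q * R + 2 * C * R * (1 / 8)) + 4 * (K * R)"
      proof -
        have "Q * Cs / K \<le> 1 / 8" using K Q Cs by (simp add: divide_simps)
        then have "2 * C * R * (Q * Cs / K) \<le> 2 * C * R * (1 / 8)" using C R by (intro mult_left_mono) auto
        moreover have "2 * (a + x) + 4 * y \<le> 2 * (a + x') + 4 * y'" if "x \<le> x'" "y \<le> y'" for a x x' y y' :: real
          using that by (simp add: add_mono)
        ultimately show ?thesis using ev by blast
      qed
      also have "\<dots> = (6 * Q + 4 * K) * R + C * R / 2" by (simp add: algebra_simps)
      also have "\<dots> \<le> C * R"
      proof -
        have "2 * (6 * Q + 4 * K) * R \<le> C * R" using C(2) R by (intro mult_right_mono) auto
        then show ?thesis by (simp add: algebra_simps)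
      qed
      finally show ?thesis unfolding v_def V_def R_def .
    qed
  qed
  show ?thesis
    using C main by (intro exI[of _ C]) auto
qed

section \<open>Counts and sums of independent variables\<close>

text \<open>Chebyshev's inequality, with the variance p - p^2 of an indicator bounded by p. It
  serves for covariates in a cell, covariates in a cube and escaping trees.\<close>

lemma (in prob_space) indep_count_second_moment:
  assumes indep: "indep_vars (\<lambda>_. S) X I" and fin: "finite I" and E: "E \<in> sets S"
    and p: "\<And>i. i \<in> I \<Longrightarrow> prob (X i -` E \<inter> space M) = p" and a: "0 < a"
  shows "prob {\<omega> \<in> space M. a \<le> \<bar>(\<Sum>i\<in>I. indicator E (X i \<omega>)) - real (card I) * p\<bar>} \<le> real (card I) * p / a\<^sup>2"
proof -
  define Z where "Z i \<omega> = indicator E (X i \<omega>) - p" for i \<omega>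
  have rv: "random_variable S (X i)" if "i \<in> I" for i using indep that by (auto simp: indep_vars_def)
  have EZ: "X i -` E \<inter> space M \<in> events" if "i \<in> I" for i by (rule measurable_sets[OF rv[OF that] E])
  have ind_m: "(\<lambda>x. indicator E x - p :: real) \<in> borel_measurable S" using E by measurable
  have indZ: "indep_vars (\<lambda>_. borel) Z I"
    unfolding Z_def[abs_def] by (rule indep_vars_compose2[OF indep]) (rule ind_m)
  have Zm: "Z i \<in> borel_measurable M" if "i \<in> I" for i using indZ that by (auto simp: indep_vars_def)
  have Ei: "integrable M (indicator (X i -` E \<inter> space M) :: _ \<Rightarrow> real)" if "i \<in> I" for i
    using EZ[OF that] by (simp add: less_top[symmetric])
  have Zeq: "Z i \<omega> = indicator (X i -` E \<inter> space M) \<omega> - p" if "\<omega> \<in> space M" for i \<omega>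
    using that by (simp add: Z_def indicator_def)
  have p01: "0 \<le> p" "p \<le> 1" if "i \<in> I" for i using p[OF that] measure_nonneg prob_le_1 by metis+
  have Zb: "\<bar>Z i \<omega>\<bar> \<le> 1" if "i \<in> I" for i \<omega>
    using p01[OF that] by (auto simp: Z_def indicator_def)
  have Zi: "integrable M (Z i)" if "i \<in> I" for i
    by (rule integrable_const_bound[where B=1]) (use Zb[OF that] Zm[OF that] in auto)
  have ZZi: "integrable M (\<lambda>\<omega>. Z i \<omega> * Z j \<omega>)" if "i \<in> I" "j \<in> I" for i j
  proof (rule integrable_const_bound[where B=1])
    have "\<bar>Z i \<omega>\<bar> * \<bar>Z j \<omega>\<bar> \<le> 1 * 1" for \<omega>
      using Zb that by (intro mult_mono) auto
    then show "AE \<omega> in M. norm (Z i \<omega> * Z j \<omega>) \<le> 1" by (auto simp: abs_mult)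
  qed (use Zm that in measurable)
  have EZ0: "expectation (Z i) = 0" if "i \<in> I" for i
  proof -
    have "expectation (Z i) = expectation (\<lambda>\<omega>. indicator (X i -` E \<inter> space M) \<omega> - p)"
      by (rule Bochner_Integration.integral_cong) (auto simp: Zeq)
    also have "\<dots> = 0" using EZ[OF that] p[OF that] Ei[OF that] by (subst Bochner_Integration.integral_diff) (auto simp: prob_space)
    finally show ?thesis .
  qed
  have cross: "expectation (\<lambda>\<omega>. Z i \<omega> * Z j \<omega>) = 0" if "i \<in> I" "j \<in> I" "i \<noteq> j" for i j
  proof -
    have "indep_vars (\<lambda>_. borel) Z {i, j}" by (rule indep_vars_subset[OF indZ]) (use that in auto)
    then have "expectation (\<lambda>\<omega>. \<Prod>k\<in>{i, j}. Z k \<omega>) = (\<Prod>k\<in>{i, j}. expectation (Z k))"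
      by (intro indep_vars_lebesgue_integral) (use that Zi in auto)
    then show ?thesis using that EZ0 by simp
  qed
  have diag: "expectation (\<lambda>\<omega>. Z i \<omega> * Z i \<omega>) \<le> p" if i: "i \<in> I" for i
  proof -
    have "expectation (\<lambda>\<omega>. Z i \<omega> * Z i \<omega>) = expectation (\<lambda>\<omega>. (1 - 2 * p) * indicator (X i -` E \<inter> space M) \<omega> + p\<^sup>2)"
      by (rule Bochner_Integration.integral_cong) (auto simp: Zeq indicator_def power2_eq_square algebra_simps)
    also have "\<dots> = (1 - 2 * p) * p + p\<^sup>2"
      using EZ[OF i] p[OF i] Ei[OF i] by (subst Bochner_Integration.integral_add) (auto simp: prob_space)
    also have "\<dots> \<le> p" using zero_le_power2[of p] by (simp add: power2_eq_square algebra_simps)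
    finally show ?thesis .
  qed
  define T where "T \<omega> = (\<Sum>i\<in>I. Z i \<omega>)" for \<omega>
  have TT: "(\<lambda>\<omega>. (T \<omega>)\<^sup>2) = (\<lambda>\<omega>. \<Sum>i\<in>I. \<Sum>j\<in>I. Z i \<omega> * Z j \<omega>)"
    by (auto simp: T_def power2_eq_square sum_product)
  have Tint: "integrable M (\<lambda>\<omega>. (T \<omega>)\<^sup>2)" unfolding TT using ZZi by auto
  have Tm: "T \<in> borel_measurable M" unfolding T_def[abs_def] using Zm by measurable
  have "expectation (\<lambda>\<omega>. (T \<omega>)\<^sup>2) = (\<Sum>i\<in>I. \<Sum>j\<in>I. expectation (\<lambda>\<omega>. Z i \<omega> * Z j \<omega>))"
    unfolding TT using ZZi by (simp add: Bochner_Integration.integral_sum)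
  also have "\<dots> = (\<Sum>i\<in>I. expectation (\<lambda>\<omega>. Z i \<omega> * Z i \<omega>))"
  proof (rule sum.cong[OF refl])
    fix i assume i: "i \<in> I"
    have "(\<Sum>j\<in>I. expectation (\<lambda>\<omega>. Z i \<omega> * Z j \<omega>)) = (\<Sum>j\<in>I. if j = i then expectation (\<lambda>\<omega>. Z i \<omega> * Z i \<omega>) else 0)"
      using cross i by (intro sum.cong) auto
    then show "(\<Sum>j\<in>I. expectation (\<lambda>\<omega>. Z i \<omega> * Z j \<omega>)) = expectation (\<lambda>\<omega>. Z i \<omega> * Z i \<omega>)"
      using i fin by simp
  qed
  also have "\<dots> \<le> (\<Sum>i\<in>I. p)" by (rule sum_mono) (rule diag)
  finally have ET: "expectation (\<lambda>\<omega>. (T \<omega>)\<^sup>2) \<le> real (card I) * p" by simp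
  have Teq: "(\<Sum>i\<in>I. indicator E (X i \<omega>)) - real (card I) * p = T \<omega>" for \<omega>
    by (simp add: T_def Z_def sum_subtractf)
  have ev: "{\<omega> \<in> space M. a \<le> \<bar>T \<omega>\<bar>} \<in> events" using Tm by measurable
  have "prob {\<omega> \<in> space M. a \<le> \<bar>T \<omega>\<bar>} = expectation (indicator {\<omega> \<in> space M. a \<le> \<bar>T \<omega>\<bar>})"
    using ev by simp
  also have "\<dots> \<le> expectation (\<lambda>\<omega>. (T \<omega>)\<^sup>2 / a\<^sup>2)"
  proof (rule integral_mono)
    show "integrable M (indicator {\<omega> \<in> space M. a \<le> \<bar>T \<omega>\<bar>} :: _ \<Rightarrow> real)"
      using ev by (simp add: less_top[symmetric])
    show "indicator {\<omega> \<in> space M. a \<le> \<bar>T \<omega>\<bar>} \<omega> \<le> (T \<omega>)\<^sup>2 / a\<^sup>2" for \<omega>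
    proof (cases "a \<le> \<bar>T \<omega>\<bar>")
      case True
      then have "a\<^sup>2 \<le> (T \<omega>)\<^sup>2" using a by (simp add: abs_le_square_iff[symmetric])
      then show ?thesis using a by (simp add: indicator_def)
    qed (simp add: indicator_def)
  qed (use Tint in simp)
  also have "\<dots> \<le> real (card I) * p / a\<^sup>2" using ET by (simp add: divide_right_mono)
  finally show ?thesis by (simp only: Teq)
qed

text \<open>Splitting off the last coordinate of the product measure is one convolution. The shift
  by \<open>Suc\<close> arises because samples are numbered from 1 and \<open>sum_law\<close> counts
  from 0.\<close>

lemma distr_sum_eq_sum_law:
  assumes U: "prob_space U" and g: "\<And>i. g i \<in> borel_measurable U"
  shows "distr (PiM {1..n} (\<lambda>_. U)) borel (\<lambda>v. \<Sum>i=1..n. g i (v i)) = sum_law (\<lambda>j. distr U borel (g (Suc j))) n"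
proof (induction n)
  case 0
  show ?case
  proof (rule measure_eqI)
    interpret P: prob_space "PiM {1..0::nat} (\<lambda>_. U)" by (rule prob_space_PiM) (rule U)
    fix A assume "A \<in> sets (distr (PiM {1..0::nat} (\<lambda>_. U)) borel (\<lambda>v. \<Sum>i=1..0. g i (v i)))"
    then have A: "A \<in> sets borel" by simp
    show "emeasure (distr (PiM {1..0::nat} (\<lambda>_. U)) borel (\<lambda>v. \<Sum>i=1..0. g i (v i))) A =
      emeasure (sum_law (\<lambda>j. distr U borel (g (Suc j))) 0) A"
      using A P.emeasure_space_1 by (subst emeasure_distr) (auto simp: indicator_def)
  qed simp
next
  case (Suc n)
  interpret U: prob_space U by (rule U)
  interpret P: product_sigma_finite "\<lambda>_. U" ..
  let ?L = "sum_law (\<lambda>j. distr U borel (g (Suc j)))"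
  have pU: "prob_space (distr U borel (g i))" for i by (rule U.prob_space_distr[OF g])
  have pL: "prob_space (?L k)" for k by (rule prob_space_sum_law) (simp add: pU)
  have gm: "(\<lambda>v. \<Sum>i\<in>J. g i (v i)) \<in> borel_measurable (PiM K (\<lambda>_. U))" if "J \<subseteq> K" for J K :: "nat set"
  proof (rule borel_measurable_sum)
    fix i assume "i \<in> J"
    then have "(\<lambda>v. v i) \<in> PiM K (\<lambda>_. U) \<rightarrow>\<^sub>M U" using that by (intro measurable_component_singleton) auto
    then show "(\<lambda>v. g i (v i)) \<in> borel_measurable (PiM K (\<lambda>_. U))" by (rule measurable_compose[OF _ g])
  qed
  have ins: "{1..Suc n} = insert (Suc n) {1..n}" by auto
  show ?case
  proof (rule measure_eqI)
    fix A assume "A \<in> sets (distr (PiM {1..Suc n} (\<lambda>_. U)) borel (\<lambda>v. \<Sum>i=1..Suc n. g i (v i)))"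
    then have A: "A \<in> sets borel" by simp
    have "emeasure (distr (PiM {1..Suc n} (\<lambda>_. U)) borel (\<lambda>v. \<Sum>i=1..Suc n. g i (v i))) A
      = (\<integral>\<^sup>+v. indicator A (\<Sum>i=1..Suc n. g i (v i)) \<partial>PiM {1..Suc n} (\<lambda>_. U))"
      using A gm[of "{1..Suc n}" "{1..Suc n}"] by (subst nn_integral_distr[symmetric]) auto
    also have "\<dots> = (\<integral>\<^sup>+x. \<integral>\<^sup>+y. indicator A (\<Sum>i=1..Suc n. g i ((x(Suc n := y)) i)) \<partial>U \<partial>PiM {1..n} (\<lambda>_. U))"
      unfolding ins
    proof (rule P.product_nn_integral_insert)
      show "(\<lambda>v. indicator A (\<Sum>i\<in>insert (Suc n) {1..n}. g i (v i)) :: ennreal) \<in> borel_measurable (PiM (insert (Suc n) {1..n}) (\<lambda>_. U))"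
        using measurable_compose[OF gm[of "insert (Suc n) {1..n}" "insert (Suc n) {1..n}"] borel_measurable_indicator[OF A]] by simp
    qed auto
    also have "\<dots> = (\<integral>\<^sup>+x. \<integral>\<^sup>+y. indicator A ((\<Sum>i=1..n. g i (x i)) + g (Suc n) y) \<partial>U \<partial>PiM {1..n} (\<lambda>_. U))"
    proof (intro nn_integral_cong)
      fix x y
      have "(\<Sum>i=1..Suc n. g i ((x(Suc n := y)) i)) = (\<Sum>i=1..n. g i ((x(Suc n := y)) i)) + g (Suc n) y" by simp
      also have "(\<Sum>i=1..n. g i ((x(Suc n := y)) i)) = (\<Sum>i=1..n. g i (x i))" by (intro sum.cong) auto
      finally show "indicator A (\<Sum>i=1..Suc n. g i ((x(Suc n := y)) i)) = (indicator A ((\<Sum>i=1..n. g i (x i)) + g (Suc n) y) :: ennreal)"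
        by simp
    qed
    also have "\<dots> = (\<integral>\<^sup>+x. \<integral>\<^sup>+y. indicator A ((\<Sum>i=1..n. g i (x i)) + y) \<partial>distr U borel (g (Suc n)) \<partial>PiM {1..n} (\<lambda>_. U))"
      using A by (intro nn_integral_cong, subst nn_integral_distr) (auto simp: g)
    also have "\<dots> = (\<integral>\<^sup>+x. \<integral>\<^sup>+y. indicator A (x + y) \<partial>distr U borel (g (Suc n)) \<partial>distr (PiM {1..n} (\<lambda>_. U)) borel (\<lambda>v. \<Sum>i=1..n. g i (v i)))"
    proof (rule nn_integral_distr[symmetric])
      interpret D: prob_space "distr U borel (g (Suc n))" by (rule pU)
      show "(\<lambda>x. \<integral>\<^sup>+y. indicator A (x + y) \<partial>distr U borel (g (Suc n))) \<in> borel_measurable (distr (PiM {1..n} (\<lambda>_. U)) borel (\<lambda>v. \<Sum>i=1..n. g i (v i)))"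
      proof -
        have "(\<lambda>x. \<integral>\<^sup>+y. indicator A (x + y) \<partial>distr U borel (g (Suc n))) \<in> borel_measurable borel"
          by (intro D.borel_measurable_nn_integral) (use A in measurable)
        then show ?thesis by simp
      qed
    qed (rule gm, simp)
    also have "\<dots> = (\<integral>\<^sup>+x. \<integral>\<^sup>+y. indicator A (x + y) \<partial>distr U borel (g (Suc n)) \<partial>?L n)"
      unfolding Suc ..
    also have "\<dots> = emeasure (?L n \<star> distr U borel (g (Suc n))) A"
      by (rule convolution_emeasure'[symmetric])
         (use A in \<open>simp_all add: prob_space.finite_measure[OF pL] prob_space.finite_measure[OF pU]\<close>)
    finally show "emeasure (distr (PiM {1..Suc n} (\<lambda>_. U)) borel (\<lambda>v. \<Sum>i=1..Suc n. g i (v i))) A = emeasure (?L (Suc n)) A"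
      by simp
  qed simp
qed

section \<open>Regression model\<close>

text \<open>For derivative order 0 the Hoelder estimate with the positive exponent beta gives
  continuity; for higher order differentiability does. By compactness the regression functions are
  then bounded on the cube.\<close>

lemma holder_class_continuous:
  fixes g :: "real ^ 'd \<Rightarrow> real"
  assumes "holder_class \<beta> g" "0 < \<beta>"
  shows "continuous_on (cbox 0 1) g"
proof -
  define k where "k = nat \<lceil>\<beta> - 1\<rceil>"
  from assms(1) obtain D where D0: "\<And>x. x \<in> cbox 0 1 \<Longrightarrow> D (\<lambda>_. 0) x = g x"
    and D1: "\<And>\<nu> x. sum \<nu> UNIV < k \<Longrightarrow> x \<in> cbox 0 1 \<Longrightarrow>
          (D \<nu> has_derivative (\<lambda>h. \<Sum>j\<in>UNIV. D (\<nu>(j := Suc (\<nu> j))) x * h $ j)) (at x within cbox 0 1)"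
    and D2: "\<exists>C>0. \<forall>\<nu>. sum \<nu> UNIV = k \<longrightarrow> (\<forall>x\<in>cbox 0 1. \<forall>x'\<in>cbox 0 1.
          \<bar>D \<nu> x - D \<nu> x'\<bar> \<le> C * norm (x - x') powr (\<beta> - real k))"
    unfolding holder_class_def k_def[symmetric] Let_def by blast
  have "continuous_on (cbox 0 1) (D (\<lambda>_. 0))"
  proof (cases "k = 0")
    case False
    then show ?thesis
      by (intro has_derivative_continuous_on[OF D1]) auto
  next
    case True
    with D2 obtain C where C: "0 < C" "\<And>x x'. x \<in> cbox 0 1 \<Longrightarrow> x' \<in> cbox 0 1 \<Longrightarrow>
        \<bar>D (\<lambda>_. 0) x - D (\<lambda>_. 0) x'\<bar> \<le> C * norm (x - x') powr \<beta>"
      by (auto dest!: spec[where x="\<lambda>_. 0"])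
    show ?thesis unfolding continuous_on_def
    proof
      fix x :: "real ^ 'd" assume x: "x \<in> cbox 0 1"
      have t0: "((\<lambda>x'. norm (x' - x)) \<longlongrightarrow> 0) (at x within cbox 0 1)"
        by (intro tendsto_norm_zero LIM_zero tendsto_ident_at)
      have "((\<lambda>x'. norm (x' - x) powr \<beta>) \<longlongrightarrow> 0) (at x within cbox 0 1)"
        by (rule tendsto_zero_powrI[OF t0 tendsto_const _ assms(2)]) simp
      from tendsto_mult_right_zero[OF this, of C] have "((\<lambda>x'. D (\<lambda>_. 0) x' - D (\<lambda>_. 0) x) \<longlongrightarrow> 0) (at x within cbox 0 1)"
        by (rule Lim_null_comparison[rotated]) (use C x in \<open>auto simp: eventually_at_filter\<close>)
      then show "(D (\<lambda>_. 0) \<longlongrightarrow> D (\<lambda>_. 0) x) (at x within cbox 0 1)" by (rule LIM_zero_cancel)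
    qed
  qed
  then show ?thesis using D0 by (simp cong: continuous_on_cong)
qed

lemma nn_AE_le_of_set_integrals:
  assumes "finite_measure M" and [measurable]: "G \<in> borel_measurable M" and C: "C < \<infinity>"
    and le: "\<And>A. A \<in> sets M \<Longrightarrow> (\<integral>\<^sup>+x. indicator A x * G x \<partial>M) \<le> C * emeasure M A"
  shows "AE x in M. G x \<le> (C :: ennreal)"
proof -
  interpret finite_measure M by fact
  define N where "N = {x \<in> space M. C < G x}"
  have N [measurable]: "N \<in> sets M" unfolding N_def by measurable
  have "emeasure M N < \<infinity>" using emeasure_finite[of N] by (simp add: less_top[symmetric])
  then have fin: "C * emeasure M N < \<infinity>" using C by (simp add: ennreal_mult_less_top)
  have "(\<integral>\<^sup>+x. indicator N x * G x - indicator N x * C \<partial>M) = (\<integral>\<^sup>+x. indicator N x * G x \<partial>M) - (\<integral>\<^sup>+x. indicator N x * C \<partial>M)"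
  proof (rule nn_integral_diff)
    have "(\<integral>\<^sup>+x. indicator N x * C \<partial>M) = C * emeasure M N"
      by (simp add: mult.commute[of _ C] nn_integral_cmult_indicator)
    then show "(\<integral>\<^sup>+x. indicator N x * C \<partial>M) \<noteq> \<infinity>" using fin by (simp add: less_top)
  qed (auto simp: N_def indicator_def)
  also have "\<dots> \<le> C * emeasure M N - C * emeasure M N"
    using le[OF N] by (intro ennreal_minus_mono) (auto simp: mult.commute[of _ C] nn_integral_cmult_indicator)
  also have "\<dots> = 0" using fin by (simp add: less_top)
  finally have "AE x in M. indicator N x * G x - indicator N x * C = 0"
    by (subst nn_integral_0_iff_AE[symmetric]) auto
  then show ?thesis
    using AE_space
  proof eventually_elim
    case (elim x)
    show ?case
    proof (rule ccontr)
      assume "\<not> G x \<le> C"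
      then have G: "C < G x" by simp
      then have "G x - C = 0" using elim by (simp add: N_def)
      then show False using G by (auto simp: diff_eq_0_iff_ennreal dest: leD)
    qed
  qed
qed

section \<open>Conditional laws given the covariate\<close>

text \<open>\<open>\<psi> x\<close>, applied to a uniform variable, realises a version of the
  conditional law of the response at the covariate x, so that conditional moments become integrals
  over \<open>U\<close>.\<close>

locale quantile_model =
  fixes P :: "((real ^ 'd) \<times> real) measure" and \<psi> :: "real ^ 'd \<Rightarrow> real \<Rightarrow> real"
    and \<nu> :: "(real ^ 'd) measure" and U :: "real measure"
  assumes prob_P: "prob_space P" and sets_P: "sets P = sets (borel \<Otimes>\<^sub>M borel)"
    and \<nu>_def: "\<nu> = distr P borel fst" and U_def: "U = uniform_measure lborel {0..1}"
    and \<psi>_measurable: "(\<lambda>(x, v). \<psi> x v) \<in> borel_measurable (borel \<Otimes>\<^sub>M borel)"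
    and \<psi>: "distr (\<nu> \<Otimes>\<^sub>M U) (borel \<Otimes>\<^sub>M borel) (\<lambda>(x, v). (x, \<psi> x v)) = P"
begin

sublocale P: prob_space P by (rule prob_P)

lemma fst_measurable_P: "fst \<in> P \<rightarrow>\<^sub>M borel" and snd_measurable_P: "snd \<in> P \<rightarrow>\<^sub>M borel"
  using measurable_fst measurable_snd unfolding measurable_cong_sets[OF sets_P refl] by blast+

sublocale \<nu>: prob_space \<nu> unfolding \<nu>_def by (rule P.prob_space_distr) (rule fst_measurable_P)
sublocale U: prob_space U unfolding U_def by (rule prob_space_uniform_measure) auto
sublocale \<nu>U: pair_prob_space \<nu> U ..

lemma sets_\<nu> [simp, measurable_cong]: "sets \<nu> = sets borel" and sets_U [simp, measurable_cong]: "sets U = sets borel"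
  by (auto simp: \<nu>_def U_def)

lemma space_P: "space P = UNIV" and space_\<nu>: "space \<nu> = UNIV" and space_U: "space U = UNIV"
  using sets_eq_imp_space_eq[OF sets_P] by (auto simp: \<nu>_def U_def space_pair_measure)

lemma pair_\<psi>_measurable: "(\<lambda>(x, v). (x, \<psi> x v)) \<in> \<nu> \<Otimes>\<^sub>M U \<rightarrow>\<^sub>M borel \<Otimes>\<^sub>M borel"
  using \<psi>_measurable by measurable

lemma \<psi>_measurable2: "(\<lambda>v. \<psi> x v) \<in> borel_measurable borel"
  using measurable_compose[OF measurable_Pair1' \<psi>_measurable, of x] by simp

lemma nn_integral_P:
  assumes [measurable]: "h \<in> borel_measurable (borel \<Otimes>\<^sub>M borel)"
  shows "(\<integral>\<^sup>+z. h z \<partial>P) = (\<integral>\<^sup>+x. \<integral>\<^sup>+v. h (x, \<psi> x v) \<partial>U \<partial>\<nu>)"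
    and "(\<lambda>x. \<integral>\<^sup>+v. h (x, \<psi> x v) \<partial>U) \<in> borel_measurable borel"
proof -
  have m: "(\<lambda>z. h ((\<lambda>(x, v). (x, \<psi> x v)) z)) \<in> borel_measurable (\<nu> \<Otimes>\<^sub>M U)"
    by (rule measurable_compose[OF pair_\<psi>_measurable assms])
  have "(\<integral>\<^sup>+z. h z \<partial>P) = (\<integral>\<^sup>+z. h ((\<lambda>(x, v). (x, \<psi> x v)) z) \<partial>(\<nu> \<Otimes>\<^sub>M U))"
    unfolding \<psi>[symmetric] by (rule nn_integral_distr[OF pair_\<psi>_measurable]) simp
  also have "\<dots> = (\<integral>\<^sup>+x. \<integral>\<^sup>+v. h (x, \<psi> x v) \<partial>U \<partial>\<nu>)"
    using U.nn_integral_fst[OF m] by simp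
  finally show "(\<integral>\<^sup>+z. h z \<partial>P) = (\<integral>\<^sup>+x. \<integral>\<^sup>+v. h (x, \<psi> x v) \<partial>U \<partial>\<nu>)" .
  show "(\<lambda>x. \<integral>\<^sup>+v. h (x, \<psi> x v) \<partial>U) \<in> borel_measurable borel"
    using U.borel_measurable_nn_integral_fst[OF m] by simp
qed

lemma AE_P_fst:
  assumes "AE x in \<nu>. Q x"
  shows "AE z in P. Q (fst z)"
  using AE_distrD[OF fst_measurable_P] assms unfolding \<nu>_def by blast

lemma subalgebra_covariate: "subalgebra P (covariate_algebra P)"
proof -
  have "sigma_sets (space P) {fst -` A \<inter> space P |A. A \<in> sets borel} \<subseteq> sets P"
    by (rule sets.sigma_sets_subset) (auto intro: measurable_sets[OF fst_measurable_P])
  then show ?thesis unfolding subalgebra_def by (simp add: sets_vimage_algebra)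
qed

sublocale cov: finite_measure_subalgebra P "covariate_algebra P"
  by standard (rule subalgebra_covariate)

lemma measurable_covariate: "h \<in> borel_measurable borel \<Longrightarrow> (\<lambda>z. h (fst z)) \<in> borel_measurable (covariate_algebra P)"
  by (rule measurable_compose[OF measurable_vimage_algebra1]) auto

text \<open>Over each set of covariates the abstract conditional moment and the explicit integral
  over \<open>U\<close> have the same integral, so an almost sure bound carries over from one to the
  other.\<close>

lemma cond_moment_AE:
  assumes "cond_abs_moment_bounded P p"
  shows "\<exists>C\<ge>0. AE x in \<nu>. (\<integral>\<^sup>+v. ennreal (\<bar>\<psi> x v\<bar> powr p) \<partial>U) \<le> ennreal C"
proof -
  from assms obtain C0 where C0: "AE z in P. nn_cond_exp P (covariate_algebra P) (\<lambda>z. ennreal (\<bar>snd z\<bar> powr p)) z \<le> ennreal C0"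
    by (auto simp: cond_abs_moment_bounded_def)
  have m: "(\<lambda>z :: (real ^ 'd) \<times> real. ennreal (\<bar>snd z\<bar> powr p)) \<in> borel_measurable (borel \<Otimes>\<^sub>M borel)" by measurable
  then have mP: "(\<lambda>z. ennreal (\<bar>snd z\<bar> powr p)) \<in> borel_measurable P" unfolding measurable_cong_sets[OF sets_P refl] .
  have "AE x in \<nu>. (\<integral>\<^sup>+v. ennreal (\<bar>\<psi> x v\<bar> powr p) \<partial>U) \<le> ennreal C0"
  proof (rule nn_AE_le_of_set_integrals)
    show "finite_measure \<nu>" by (rule \<nu>.finite_measure)
    show Gm: "(\<lambda>x. \<integral>\<^sup>+v. ennreal (\<bar>\<psi> x v\<bar> powr p) \<partial>U) \<in> borel_measurable \<nu>" using nn_integral_P(2)[OF m] by simp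
    fix A assume "A \<in> sets \<nu>"
    then have A [measurable]: "A \<in> sets borel" by simp
    have "(\<integral>\<^sup>+x. indicator A x * (\<integral>\<^sup>+v. ennreal (\<bar>\<psi> x v\<bar> powr p) \<partial>U) \<partial>\<nu>) =
       (\<integral>\<^sup>+x. \<integral>\<^sup>+v. indicator A x * ennreal (\<bar>\<psi> x v\<bar> powr p) \<partial>U \<partial>\<nu>)"
      by (intro nn_integral_cong nn_integral_cmult[symmetric]) (use \<psi>_measurable2 in measurable)
    also have "\<dots> = (\<integral>\<^sup>+z. indicator A (fst z) * ennreal (\<bar>snd z\<bar> powr p) \<partial>P)"
      by (subst nn_integral_P(1)) auto
    also have "\<dots> = (\<integral>\<^sup>+z. indicator A (fst z) * nn_cond_exp P (covariate_algebra P) (\<lambda>z. ennreal (\<bar>snd z\<bar> powr p)) z \<partial>P)"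
      by (rule cov.nn_cond_exp_intg[symmetric, OF measurable_covariate mP]) measurable
    also have "\<dots> \<le> (\<integral>\<^sup>+z. indicator A (fst z) * ennreal C0 \<partial>P)"
      using C0 by (intro nn_integral_mono_AE, eventually_elim) (auto intro!: mult_left_mono)
    also have "\<dots> = (\<integral>\<^sup>+x. indicator A x * ennreal C0 \<partial>\<nu>)"
      unfolding \<nu>_def by (subst nn_integral_distr[OF fst_measurable_P]) auto
    also have "\<dots> = ennreal C0 * emeasure \<nu> A"
      by (simp add: mult.commute[of _ "ennreal C0"] nn_integral_cmult_indicator)
    finally show "(\<integral>\<^sup>+x. indicator A x * (\<integral>\<^sup>+v. ennreal (\<bar>\<psi> x v\<bar> powr p) \<partial>U) \<partial>\<nu>) \<le> ennreal C0 * emeasure \<nu> A" .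
  qed simp
  then show ?thesis
    by (intro exI[of _ "max 0 C0"] conjI) (auto elim!: eventually_mono intro: order.trans[OF _ ennreal_leI])
qed

text \<open>The integral over \<open>U\<close> and k have equal integrals over every Borel set of
  covariates, and this determines an integrable function almost everywhere.\<close>

lemma cond_exp_AE:
  assumes h [measurable]: "h \<in> borel_measurable (borel \<Otimes>\<^sub>M borel)" and int: "integrable P h"
    and ce: "AE z in P. real_cond_exp P (covariate_algebra P) h z = k (fst z)"
    and k [measurable]: "k \<in> borel_measurable borel"
  shows "AE x in \<nu>. integrable U (\<lambda>v. h (x, \<psi> x v)) \<and> (\<integral>v. h (x, \<psi> x v) \<partial>U) = k x"
proof -
  have int2: "integrable (\<nu> \<Otimes>\<^sub>M U) (\<lambda>z. h ((\<lambda>(x, v). (x, \<psi> x v)) z))"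
    using int unfolding \<psi>[symmetric] integrable_distr_eq[OF pair_\<psi>_measurable h] .
  have AEi: "AE x in \<nu>. integrable U (\<lambda>v. h (x, \<psi> x v))"
    using \<nu>U.AE_integrable_fst'[OF int2] by simp
  have mi: "integrable \<nu> (\<lambda>x. \<integral>v. h (x, \<psi> x v) \<partial>U)" using \<nu>U.integrable_fst'[OF int2] by simp
  have ki: "integrable \<nu> k"
  proof -
    have "integrable P (\<lambda>z. k (fst z))"
      by (rule integrable_cong_AE_imp[OF cov.real_cond_exp_int(1)[OF int]])
         (use ce fst_measurable_P in \<open>auto elim!: eventually_mono\<close>)
    then show ?thesis unfolding \<nu>_def by (subst integrable_distr_eq[OF fst_measurable_P]) auto
  qed
  have "AE x in \<nu>. (\<integral>v. h (x, \<psi> x v) \<partial>U) = k x"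
  proof (rule density_unique_real[OF mi ki])
    fix A assume "A \<in> sets \<nu>"
    then have A [measurable]: "A \<in> sets borel" by simp
    have iA: "integrable P (\<lambda>z. indicator A (fst z) * h z)"
      using integrable_mult_indicator[OF measurable_sets[OF fst_measurable_P A] int] by (simp add: space_P indicator_def if_distrib)
    have iA2: "integrable (\<nu> \<Otimes>\<^sub>M U) (\<lambda>z. indicator A (fst ((\<lambda>(x, v). (x, \<psi> x v)) z)) * h ((\<lambda>(x, v). (x, \<psi> x v)) z))"
      using iA unfolding \<psi>[symmetric] by (subst (asm) integrable_distr_eq[OF pair_\<psi>_measurable]) auto
    have "(\<integral>x\<in>A. (\<integral>v. h (x, \<psi> x v) \<partial>U) \<partial>\<nu>) = (\<integral>x. \<integral>v. indicator A x * h (x, \<psi> x v) \<partial>U \<partial>\<nu>)"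
      by (simp add: set_lebesgue_integral_def)
    also have "\<dots> = (\<integral>z. indicator A (fst ((\<lambda>(x, v). (x, \<psi> x v)) z)) * h ((\<lambda>(x, v). (x, \<psi> x v)) z) \<partial>(\<nu> \<Otimes>\<^sub>M U))"
      using \<nu>U.integral_fst'[OF iA2] by simp
    also have "\<dots> = (\<integral>z. indicator A (fst z) * h z \<partial>P)"
      unfolding \<psi>[symmetric] by (rule integral_distr[symmetric, OF pair_\<psi>_measurable]) measurable
    also have "\<dots> = (\<integral>z. indicator A (fst z) * real_cond_exp P (covariate_algebra P) h z \<partial>P)"
      by (rule cov.real_cond_exp_intg(2)[symmetric, OF iA measurable_covariate])
         (use int in \<open>auto simp: integrable_iff_bounded\<close>)
    also have "\<dots> = (\<integral>z. indicator A (fst z) * k (fst z) \<partial>P)"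
    proof (rule integral_cong_AE)
      show "(\<lambda>z. indicator A (fst z) * k (fst z)) \<in> borel_measurable P"
        using fst_measurable_P by measurable
      show "(\<lambda>z. indicator A (fst z) * real_cond_exp P (covariate_algebra P) h z) \<in> borel_measurable P"
        using fst_measurable_P by measurable
    qed (use ce in \<open>auto elim!: eventually_mono\<close>)
    also have "\<dots> = (\<integral>x. indicator A x * k x \<partial>\<nu>)"
      unfolding \<nu>_def by (rule integral_distr[symmetric, OF fst_measurable_P]) measurable
    finally show "(\<integral>x\<in>A. (\<integral>v. h (x, \<psi> x v) \<partial>U) \<partial>\<nu>) = (\<integral>x\<in>A. k x \<partial>\<nu>)"
      by (simp add: set_lebesgue_integral_def)
  qed
  with AEi show ?thesis by eventually_elim simp
qed

end

lemma powr_sum_bound: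
  fixes a b q :: real
  assumes "0 \<le> q" "q \<le> 3"
  shows "\<bar>a - b\<bar> powr q \<le> 8 * (\<bar>a\<bar> powr q + \<bar>b\<bar> powr q)"
proof -
  define m where "m = max \<bar>a\<bar> \<bar>b\<bar>"
  have m: "0 \<le> m" by (simp add: m_def)
  have "\<bar>a - b\<bar> powr q \<le> (2 * m) powr q" using assms by (intro powr_mono2) (auto simp: m_def)
  also have "\<dots> = 2 powr q * m powr q" using m by (simp add: powr_mult)
  also have "\<dots> \<le> 8 * m powr q"
  proof (rule mult_right_mono)
    have "(2::real) powr q \<le> 2 powr 3" using assms by (intro powr_mono) auto
    then show "(2::real) powr q \<le> 8" by (simp add: powr_numeral)
  qed simp
  also have "m powr q \<le> \<bar>a\<bar> powr q + \<bar>b\<bar> powr q" by (cases "\<bar>a\<bar> \<le> \<bar>b\<bar>") (auto simp: m_def max_def)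
  finally show ?thesis by simp
qed

text \<open>The moment of order 2 + delta controls the smaller order 2 + d, as a power is at most 1
  plus any larger power; centring costs the constant of \<open>powr_sum_bound\<close>.\<close>

lemma (in quantile_model) residual_moments:
  fixes \<mu>' \<sigma>' :: "real ^ 'd \<Rightarrow> real"
  assumes m1: "AE x in \<nu>. integrable U (\<lambda>v. \<psi> x v) \<and> (\<integral>v. \<psi> x v \<partial>U) = \<mu>' x"
    and m2: "AE x in \<nu>. integrable U (\<lambda>v. (\<psi> x v - \<mu>' x)\<^sup>2) \<and> (\<integral>v. (\<psi> x v - \<mu>' x)\<^sup>2 \<partial>U) = \<sigma>' x"
    and m3: "AE x in \<nu>. (\<integral>\<^sup>+v. ennreal (\<bar>\<psi> x v\<bar> powr (2 + \<delta>)) \<partial>U) \<le> ennreal C" and C: "0 \<le> C"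
    and \<mu>': "\<And>x. \<bar>\<mu>' x\<bar> \<le> K" and d: "0 < d" "d \<le> 1" "d \<le> \<delta>"
  shows "AE x in \<nu>. centered_moments d (distr U borel (\<lambda>v. \<psi> x v - \<mu>' x)) (\<sigma>' x) (8 * (1 + C + K powr (2 + d)))"
  using m1 m2 m3
proof eventually_elim
  case (elim x)
  have [measurable]: "\<psi> x \<in> borel_measurable borel" using \<psi>_measurable2[of x] by simp
  define D where "D = distr U borel (\<lambda>v. \<psi> x v - \<mu>' x)"
  have D_m: "(\<lambda>v. \<psi> x v - \<mu>' x) \<in> U \<rightarrow>\<^sub>M borel" by measurable
  have K: "0 \<le> K" using \<mu>'[of x] by linarith
  have pw: "\<bar>y - \<mu>' x\<bar> powr (2 + d) \<le> 8 * (1 + K powr (2 + d)) + 8 * \<bar>y\<bar> powr (2 + \<delta>)" for y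
  proof -
    have "\<bar>y\<bar> powr (2 + d) \<le> 1 + \<bar>y\<bar> powr (2 + \<delta>)"
    proof (cases "\<bar>y\<bar> \<le> 1")
      case True
      have "\<bar>y\<bar> powr (2 + d) \<le> 1 powr (2 + d)" using True d by (intro powr_mono2) auto
      moreover have "0 \<le> \<bar>y\<bar> powr (2 + \<delta>)" by simp
      ultimately show ?thesis by (metis add.commute add_increasing powr_one_eq_one)
    next
      case False
      then have "\<bar>y\<bar> powr (2 + d) \<le> \<bar>y\<bar> powr (2 + \<delta>)" using d by (intro powr_mono) auto
      then show ?thesis by simp
    qed
    moreover have "\<bar>\<mu>' x\<bar> powr (2 + d) \<le> K powr (2 + d)" using \<mu>'[of x] d by (intro powr_mono2) auto
    moreover have "\<bar>y - \<mu>' x\<bar> powr (2 + d) \<le> 8 * (\<bar>y\<bar> powr (2 + d) + \<bar>\<mu>' x\<bar> powr (2 + d))"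
      by (rule powr_sum_bound) (use d in auto)
    ultimately show ?thesis by simp
  qed
  have le: "(\<integral>\<^sup>+v. ennreal (\<bar>\<psi> x v - \<mu>' x\<bar> powr (2 + d)) \<partial>U) \<le> ennreal (8 * (1 + C + K powr (2 + d)))"
  proof -
    have "(\<integral>\<^sup>+v. ennreal (\<bar>\<psi> x v - \<mu>' x\<bar> powr (2 + d)) \<partial>U) \<le>
      (\<integral>\<^sup>+v. ennreal (8 * (1 + K powr (2 + d))) + ennreal 8 * ennreal (\<bar>\<psi> x v\<bar> powr (2 + \<delta>)) \<partial>U)"
    proof (rule nn_integral_mono)
      fix v
      have "ennreal (\<bar>\<psi> x v - \<mu>' x\<bar> powr (2 + d)) \<le> ennreal (8 * (1 + K powr (2 + d)) + 8 * \<bar>\<psi> x v\<bar> powr (2 + \<delta>))"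
        by (rule ennreal_leI[OF pw])
      also have "\<dots> = ennreal (8 * (1 + K powr (2 + d))) + ennreal 8 * ennreal (\<bar>\<psi> x v\<bar> powr (2 + \<delta>))"
        by (subst ennreal_plus) (simp_all add: ennreal_mult')
      finally show "ennreal (\<bar>\<psi> x v - \<mu>' x\<bar> powr (2 + d)) \<le> ennreal (8 * (1 + K powr (2 + d))) + ennreal 8 * ennreal (\<bar>\<psi> x v\<bar> powr (2 + \<delta>))" .
    qed
    also have "\<dots> = ennreal (8 * (1 + K powr (2 + d))) + ennreal 8 * (\<integral>\<^sup>+v. ennreal (\<bar>\<psi> x v\<bar> powr (2 + \<delta>)) \<partial>U)"
      using U.emeasure_space_1 by (simp add: nn_integral_add nn_integral_cmult)
    also have "\<dots> \<le> ennreal (8 * (1 + K powr (2 + d))) + ennreal 8 * ennreal C"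
      using elim(3) by (intro add_left_mono mult_left_mono) auto
    also have "\<dots> = ennreal (8 * (1 + K powr (2 + d)) + 8 * C)"
      using C by (subst ennreal_plus) (simp_all add: ennreal_mult')
    also have "\<dots> = ennreal (8 * (1 + C + K powr (2 + d)))" by (simp add: algebra_simps)
    finally show ?thesis .
  qed
  have i3: "integrable U (\<lambda>v. \<bar>\<psi> x v - \<mu>' x\<bar> powr (2 + d))"
    using le_less_trans[OF le, of \<infinity>] by (intro integrableI_bounded) auto
  have e3: "(\<integral>v. \<bar>\<psi> x v - \<mu>' x\<bar> powr (2 + d) \<partial>U) \<le> 8 * (1 + C + K powr (2 + d))"
  proof -
    have "ennreal (\<integral>v. \<bar>\<psi> x v - \<mu>' x\<bar> powr (2 + d) \<partial>U) \<le> ennreal (8 * (1 + C + K powr (2 + d)))"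
      using le i3 by (subst (asm) nn_integral_eq_integral) auto
    then show ?thesis using C by (subst (asm) ennreal_le_iff) auto
  qed
  have "(\<integral>v. \<psi> x v - \<mu>' x \<partial>U) = 0"
    using elim(1) U.prob_space by (subst Bochner_Integration.integral_diff) auto
  then show ?case
    unfolding centered_moments_def
    using elim(2) i3 e3 U.prob_space_distr[OF D_m]
    by (simp add: integrable_distr_eq[OF D_m] integral_distr[OF D_m])
qed

section \<open>Constants of the regression law\<close>

text \<open>The bounds on \<open>\<mu>'\<close> and \<open>\<sigma>'\<close> are demanded at every
  point, those on the residual moments almost everywhere only. The density enters through the
  comparison of its law with Lebesgue measure on the cube.\<close>

definition regression_data where
  "regression_data P d \<psi> \<mu>' \<sigma>' C0 c0 cf Cf K \<longleftrightarrow>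
     quantile_model P \<psi> (distr P borel fst) (uniform_measure lborel {0..1}) \<and>
     \<mu>' \<in> borel_measurable borel \<and> \<sigma>' \<in> borel_measurable borel \<and>
     0 < c0 \<and> 0 < C0 \<and> 0 < cf \<and> 0 < Cf \<and> (\<forall>x. c0 \<le> \<sigma>' x \<and> \<sigma>' x \<le> K \<and> \<bar>\<mu>' x\<bar> \<le> K) \<and>
     (AE x in distr P borel fst. centered_moments d (distr (uniform_measure lborel {0..1}) borel (\<lambda>v. \<psi> x v - \<mu>' x)) (\<sigma>' x) C0) \<and>
     (\<forall>A\<in>sets borel. A \<subseteq> cbox 0 1 \<longrightarrow>
        ennreal cf * emeasure lborel A \<le> emeasure (distr P borel fst) A \<and>
        emeasure (distr P borel fst) A \<le> ennreal Cf * emeasure lborel A) \<and>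
     integrable P (\<lambda>z. (snd z)\<^sup>2)"

lemma continuous_on_cube_bounded:
  fixes g :: "real ^ 'd \<Rightarrow> real"
  assumes "continuous_on (cbox 0 1) g"
  shows "\<exists>K>0. \<forall>x\<in>cbox 0 1. \<bar>g x\<bar> \<le> K"
proof -
  have "bounded (g ` cbox 0 1)" by (intro compact_imp_bounded compact_continuous_image assms compact_cbox)
  then obtain K where "0 < K" "\<forall>y\<in>g ` cbox 0 1. norm y \<le> K" by (auto simp: bounded_pos)
  then show ?thesis by auto
qed

lemma regression_data_exists:
  fixes f \<mu> \<sigma>2 :: "real ^ 'd \<Rightarrow> real"
  assumes rl: "regression_law P f \<mu> \<sigma>2 \<beta>f \<beta>\<mu> \<beta>\<sigma>" and \<delta>: "0 < \<delta>" and mom: "cond_abs_moment_bounded P (2 + \<delta>)"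
  shows "\<exists>\<psi> \<mu>' \<sigma>' C0 c0 cf Cf K. regression_data P (min 1 \<delta>) \<psi> \<mu>' \<sigma>' C0 c0 cf Cf K"
proof -
  have prob: "prob_space P" and sP: "sets P = sets borel"
    and dist: "distributed P lborel fst (\<lambda>x. ennreal (f x) * indicator (cbox 0 1) x)"
    and f_lb: "\<exists>c>0. \<forall>x\<in>cbox 0 1. c \<le> f x" and f_h: "\<beta>f > 0" "holder_class \<beta>f f"
    and mom2: "cond_abs_moment_bounded P 2"
    and mean: "AE z in P. real_cond_exp P (covariate_algebra P) snd z = \<mu> (fst z)"
    and \<mu>_h: "\<beta>\<mu> > 0" "holder_class \<beta>\<mu> \<mu>"
    and var: "AE z in P. real_cond_exp P (covariate_algebra P) (\<lambda>z. (snd z - \<mu> (fst z))\<^sup>2) z = \<sigma>2 (fst z)"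
    and \<sigma>_lb: "\<exists>c>0. \<forall>x\<in>cbox 0 1. c \<le> \<sigma>2 x" and \<sigma>_h: "\<beta>\<sigma> > 0" "holder_class \<beta>\<sigma> \<sigma>2"
    using rl unfolding regression_law_def by blast+
  have sP': "sets P = sets (borel \<Otimes>\<^sub>M borel)" using sP by (simp only: borel_prod)
  obtain cf where cf: "0 < cf" "\<And>x. x \<in> cbox 0 1 \<Longrightarrow> cf \<le> f x" using f_lb by blast
  obtain c0 where c0: "0 < c0" "\<And>x. x \<in> cbox 0 1 \<Longrightarrow> c0 \<le> \<sigma>2 x" using \<sigma>_lb by blast
  note f_c = holder_class_continuous[OF f_h(2,1)] and \<mu>_c = holder_class_continuous[OF \<mu>_h(2,1)]
    and \<sigma>_c = holder_class_continuous[OF \<sigma>_h(2,1)]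
  obtain Cf where Cf: "0 < Cf" "\<And>x. x \<in> cbox 0 1 \<Longrightarrow> \<bar>f x\<bar> \<le> Cf" using continuous_on_cube_bounded[OF f_c] by blast
  obtain K1 where K1: "0 < K1" "\<And>x. x \<in> cbox 0 1 \<Longrightarrow> \<bar>\<mu> x\<bar> \<le> K1" using continuous_on_cube_bounded[OF \<mu>_c] by blast
  obtain K2 where K2: "0 < K2" "\<And>x. x \<in> cbox 0 1 \<Longrightarrow> \<bar>\<sigma>2 x\<bar> \<le> K2" using continuous_on_cube_bounded[OF \<sigma>_c] by blast
  define K where "K = max K1 (max K2 c0)"
  \<comment> \<open>Outside the cube, a null set for the covariates, the regression functions are
    arbitrary. Constant values there make them measurable and bounded on the whole space.\<close>
  define \<mu>' where "\<mu>' x = (if x \<in> cbox 0 1 then \<mu> x else 0)" for x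
  define \<sigma>' where "\<sigma>' x = (if x \<in> cbox 0 1 then \<sigma>2 x else c0)" for x
  have \<mu>'_m [measurable]: "\<mu>' \<in> borel_measurable borel"
    unfolding \<mu>'_def[abs_def] by (intro borel_measurable_continuous_on_if \<mu>_c continuous_on_const) auto
  have \<sigma>'_m [measurable]: "\<sigma>' \<in> borel_measurable borel"
    unfolding \<sigma>'_def[abs_def] by (intro borel_measurable_continuous_on_if \<sigma>_c continuous_on_const) auto
  have bounds: "c0 \<le> \<sigma>' x" "\<sigma>' x \<le> K" "\<bar>\<mu>' x\<bar> \<le> K" for x
  proof -
    show "c0 \<le> \<sigma>' x" using c0 by (simp add: \<sigma>'_def)
    show "\<sigma>' x \<le> K" using K2(2)[of x] by (auto simp: \<sigma>'_def K_def)
    show "\<bar>\<mu>' x\<bar> \<le> K" using K1(1) K1(2)[of x] by (auto simp: \<mu>'_def K_def)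
  qed
  from quantile_representation[OF prob sP'] obtain \<psi> where
    \<psi>: "(\<lambda>(x, v). \<psi> x v) \<in> borel_measurable (borel \<Otimes>\<^sub>M borel)"
      "distr (distr P borel fst \<Otimes>\<^sub>M uniform_measure lborel {0..1 :: real}) (borel \<Otimes>\<^sub>M borel) (\<lambda>(x, v). (x, \<psi> x v)) = P"
    by blast
  define \<nu> where "\<nu> = distr P borel fst"
  define U where "U = uniform_measure lborel {0..1 :: real}"
  have qm: "quantile_model P \<psi> \<nu> U"
    by (rule quantile_model.intro[OF prob sP' \<nu>_def U_def \<psi>(1)]) (use \<psi>(2) in \<open>simp add: \<nu>_def U_def\<close>)
  interpret quantile_model P \<psi> \<nu> U by (rule qm)
  have \<nu>_dens: "\<nu> = density lborel (\<lambda>x. ennreal (f x) * indicator (cbox 0 1) x)"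
  proof -
    have "distr P lborel fst = density lborel (\<lambda>x. ennreal (f x) * indicator (cbox 0 1) x)"
      by (rule distributed_distr_eq_density[OF dist])
    moreover have "distr P lborel fst = \<nu>" unfolding \<nu>_def by (rule distr_cong) auto
    ultimately show ?thesis by simp
  qed
  have dens_m: "(\<lambda>x. ennreal (f x) * indicator (cbox 0 1) x) \<in> borel_measurable lborel"
    by (rule distributed_borel_measurable[OF dist])
  have em: "emeasure \<nu> A = (\<integral>\<^sup>+x. ennreal (f x) * indicator (cbox 0 1) x * indicator A x \<partial>lborel)" if "A \<in> sets borel" for A
    unfolding \<nu>_dens using that dens_m by (subst emeasure_density) auto
  have cube: "AE x in \<nu>. x \<in> cbox 0 1"
    unfolding \<nu>_dens by (subst AE_density[OF dens_m]) (auto simp: indicator_def)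
  have cubeP: "AE z in P. fst z \<in> cbox 0 1" by (rule AE_P_fst[OF cube])
  have meas: "ennreal cf * emeasure lborel A \<le> emeasure \<nu> A \<and> emeasure \<nu> A \<le> ennreal Cf * emeasure lborel A"
    if A: "A \<in> sets borel" "A \<subseteq> cbox 0 1" for A
  proof
    have "ennreal cf * emeasure lborel A = (\<integral>\<^sup>+x. ennreal cf * indicator A x \<partial>lborel)" using A by (simp add: nn_integral_cmult_indicator)
    also have "\<dots> \<le> emeasure \<nu> A"
      unfolding em[OF A(1)] using A(2) cf by (intro nn_integral_mono) (auto simp: indicator_def intro!: ennreal_leI)
    finally show "ennreal cf * emeasure lborel A \<le> emeasure \<nu> A" .
    have "emeasure \<nu> A \<le> (\<integral>\<^sup>+x. ennreal Cf * indicator A x \<partial>lborel)"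
      unfolding em[OF A(1)] using A(2) Cf by (intro nn_integral_mono) (auto simp: indicator_def intro!: ennreal_leI dest: abs_le_D1)
    then show "emeasure \<nu> A \<le> ennreal Cf * emeasure lborel A" using A by (simp add: nn_integral_cmult_indicator)
  qed
  obtain C2 where C2: "0 \<le> C2" "AE x in \<nu>. (\<integral>\<^sup>+v. ennreal (\<bar>\<psi> x v\<bar> powr 2) \<partial>U) \<le> ennreal C2"
    using cond_moment_AE[OF mom2] by blast
  obtain C3 where C3: "0 \<le> C3" "AE x in \<nu>. (\<integral>\<^sup>+v. ennreal (\<bar>\<psi> x v\<bar> powr (2 + \<delta>)) \<partial>U) \<le> ennreal C3"
    using cond_moment_AE[OF mom] by blast
  have sndP: "snd \<in> borel_measurable P" by (rule snd_measurable_P)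
  have sq_eq: "\<bar>y\<bar> powr 2 = y\<^sup>2" for y :: real by (cases "y = 0") (auto simp: powr_numeral)
  have int_sq: "integrable P (\<lambda>z. (snd z)\<^sup>2)"
  proof (rule integrableI_bounded)
    have "(\<integral>\<^sup>+z. ennreal (norm ((snd z)\<^sup>2)) \<partial>P) = (\<integral>\<^sup>+x. \<integral>\<^sup>+v. ennreal (\<bar>\<psi> x v\<bar> powr 2) \<partial>U \<partial>\<nu>)"
      by (subst nn_integral_P(1)) (auto simp: sq_eq)
    also have "\<dots> \<le> (\<integral>\<^sup>+x. ennreal C2 \<partial>\<nu>)" by (rule nn_integral_mono_AE[OF C2(2)])
    also have "\<dots> < \<infinity>" using \<nu>.emeasure_space_1 by simp
    finally show "(\<integral>\<^sup>+z. ennreal (norm ((snd z)\<^sup>2)) \<partial>P) < \<infinity>" .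
  qed (use sndP in measurable)
  have int_1: "integrable P snd"
  proof (rule Bochner_Integration.integrable_bound[where f="\<lambda>z. 1 + (snd z)\<^sup>2"])
    have "\<bar>y\<bar> \<le> 1 + y\<^sup>2" for y :: real
      using zero_le_power2[of "\<bar>y\<bar> - 1"] by (simp add: power2_eq_square algebra_simps)
    then show "AE z in P. norm (snd z) \<le> norm (1 + (snd z)\<^sup>2)" by simp
  qed (use int_sq sndP in auto)
  have m1: "AE x in \<nu>. integrable U (\<lambda>v. \<psi> x v) \<and> (\<integral>v. \<psi> x v \<partial>U) = \<mu>' x"
  proof -
    have "AE z in P. real_cond_exp P (covariate_algebra P) snd z = \<mu>' (fst z)"
      using mean cubeP by eventually_elim (simp add: \<mu>'_def)
    from cond_exp_AE[OF _ int_1 this \<mu>'_m] show ?thesis by simp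
  qed
  have hm: "(\<lambda>z. (snd z - \<mu>' (fst z))\<^sup>2) \<in> borel_measurable (borel \<Otimes>\<^sub>M borel)" by measurable
  have hmP: "(\<lambda>z. (snd z - \<mu>' (fst z))\<^sup>2) \<in> borel_measurable P" using hm unfolding measurable_cong_sets[OF sP' refl] .
  have hi: "integrable P (\<lambda>z. (snd z - \<mu>' (fst z))\<^sup>2)"
  proof (rule Bochner_Integration.integrable_bound[where f="\<lambda>z. 2 * (snd z)\<^sup>2 + 2 * K\<^sup>2"])
    have "(y - m)\<^sup>2 \<le> 2 * y\<^sup>2 + 2 * K\<^sup>2" if "\<bar>m\<bar> \<le> K" for y m :: real
    proof -
      have "m\<^sup>2 \<le> K\<^sup>2" using that by (metis abs_ge_zero power2_abs power_mono)
      moreover have "0 \<le> (y + m)\<^sup>2" by simp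
      ultimately show ?thesis by (simp add: power2_eq_square algebra_simps)
    qed
    then show "AE z in P. norm ((snd z - \<mu>' (fst z))\<^sup>2) \<le> norm (2 * (snd z)\<^sup>2 + 2 * K\<^sup>2)" using bounds(3) by simp
  qed (use int_sq hmP in auto)
  have m2: "AE x in \<nu>. integrable U (\<lambda>v. (\<psi> x v - \<mu>' x)\<^sup>2) \<and> (\<integral>v. (\<psi> x v - \<mu>' x)\<^sup>2 \<partial>U) = \<sigma>' x"
  proof -
    \<comment> \<open>\<open>\<mu>\<close> may be arbitrary off the cube, so measurability is not
      evident. Were the square not measurable, its conditional expectation would have the default
      value 0, against the lower bound \<open>c0\<close> for the conditional variance.\<close>
    have meas_g: "(\<lambda>z. (snd z - \<mu> (fst z))\<^sup>2) \<in> borel_measurable P"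
    proof (rule ccontr)
      assume n: "(\<lambda>z. (snd z - \<mu> (fst z))\<^sup>2) \<notin> borel_measurable P"
      have "(\<lambda>z. ennreal ((snd z - \<mu> (fst z))\<^sup>2)) \<notin> borel_measurable P"
      proof
        assume "(\<lambda>z. ennreal ((snd z - \<mu> (fst z))\<^sup>2)) \<in> borel_measurable P"
        then have "(\<lambda>z. enn2real (ennreal ((snd z - \<mu> (fst z))\<^sup>2))) \<in> borel_measurable P" by measurable
        with n show False by simp
      qed
      moreover have "(\<lambda>z. ennreal (- (snd z - \<mu> (fst z))\<^sup>2)) = (\<lambda>_. 0)" by (auto simp: ennreal_neg)
      moreover have "AE z in P. nn_cond_exp P (covariate_algebra P) (\<lambda>_. 0) z = 0"
        using cov.nn_cond_exp_F_meas[of "\<lambda>_. 0"] by simp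
      ultimately have "AE z in P. real_cond_exp P (covariate_algebra P) (\<lambda>z. (snd z - \<mu> (fst z))\<^sup>2) z = 0"
        by (auto simp: real_cond_exp_def nn_cond_exp_def[of _ _ "\<lambda>z. ennreal ((snd z - \<mu> (fst z))\<^sup>2)"] elim!: eventually_mono)
      with var cubeP have "AE z in P. False"
      proof eventually_elim
        case (elim z)
        then show ?case using c0(1) c0(2)[of "fst z"] by simp
      qed
      then show False using P.AE_False by simp
    qed
    have "AE z in P. real_cond_exp P (covariate_algebra P) (\<lambda>z. (snd z - \<mu>' (fst z))\<^sup>2) z =
        real_cond_exp P (covariate_algebra P) (\<lambda>z. (snd z - \<mu> (fst z))\<^sup>2) z"
      by (rule cov.real_cond_exp_cong[OF _ hmP meas_g]) (use cubeP in \<open>auto elim!: eventually_mono simp: \<mu>'_def\<close>)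
    then have "AE z in P. real_cond_exp P (covariate_algebra P) (\<lambda>z. (snd z - \<mu>' (fst z))\<^sup>2) z = \<sigma>' (fst z)"
      using var cubeP by eventually_elim (simp add: \<sigma>'_def)
    from cond_exp_AE[OF hm hi this \<sigma>'_m] show ?thesis by simp
  qed
  have "AE x in \<nu>. centered_moments (min 1 \<delta>) (distr U borel (\<lambda>v. \<psi> x v - \<mu>' x)) (\<sigma>' x) (8 * (1 + C3 + K powr (2 + min 1 \<delta>)))"
    by (rule residual_moments[OF m1 m2 C3(2) C3(1) bounds(3)]) (use \<delta> in auto)
  moreover have "0 < 8 * (1 + C3 + K powr (2 + min 1 \<delta>))" using C3(1) by (simp add: add_pos_nonneg)
  ultimately have "regression_data P (min 1 \<delta>) \<psi> \<mu>' \<sigma>' (8 * (1 + C3 + K powr (2 + min 1 \<delta>))) c0 cf Cf K"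
    unfolding regression_data_def \<nu>_def[symmetric] U_def[symmetric]
    using qm \<mu>'_m \<sigma>'_m c0(1) cf(1) Cf(1) bounds meas int_sq by blast
  then show ?thesis by blast
qed

section \<open>Cells\<close>

text \<open>The indicator of the cell of \<open>x\<close>, in a form that is measurable in the point and the tree together.\<close>

primrec same_cell :: "real ^ 'd \<Rightarrow> real ^ 'd \<Rightarrow> 'd mondrian_tree \<Rightarrow> real" where
  "same_cell x y Leaf = indicator (cbox 0 1) y"
| "same_cell x y (Node L v R) =
     (if x $ fst v \<le> snd v then (if y $ fst v \<le> snd v then same_cell x y L else 0)
      else (if y $ fst v > snd v then same_cell x y R else 0))"

lemma tree_cell_Int: "tree_cell D T x = D \<inter> tree_cell UNIV T x"
proof (induction T arbitrary: D)
  case (Node L v R)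
  obtain k s where v: "v = (k, s)" by force
  show ?case
    using Node(1)[of "{y \<in> D. y $ k \<le> s}"] Node(1)[of "{y. y $ k \<le> s}"]
      Node(2)[of "{y \<in> D. y $ k > s}"] Node(2)[of "{y. y $ k > s}"]
    by (auto simp: v)
qed simp

lemma indicator_tree_cell: "indicator (tree_cell (cbox 0 1) T x) y = same_cell x y T"
proof (induction T)
  case (Node L v R)
  obtain k s where v: "v = (k, s)" by force
  show ?case
    using Node tree_cell_Int[of "{y \<in> cbox 0 1. y $ k \<le> s}" L x] tree_cell_Int[of "cbox 0 1" L x]
      tree_cell_Int[of "{y \<in> cbox 0 1. y $ k > s}" R x] tree_cell_Int[of "cbox 0 1" R x]
    by (auto simp: v indicator_def split: if_splits)
qed simp

lemma same_cell_01: "same_cell x y T = 0 \<or> same_cell x y T = 1"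
  by (metis indicator_tree_cell indicator_simps)

lemma same_cell_bounds: "0 \<le> same_cell x y T" "same_cell x y T \<le> 1"
  using same_cell_01[of x y T] by auto

lemma same_cell_measurable [measurable (raw)]:
  assumes [measurable]: "f \<in> N \<rightarrow>\<^sub>M borel" "t \<in> N \<rightarrow>\<^sub>M tree_space"
  shows "(\<lambda>z. same_cell x (f z) (t z)) \<in> borel_measurable N"
proof -
  have eq: "same_cell x y T = rec_tree (indicator (cbox 0 1) y) (\<lambda>L v R a b. if x $ fst v \<le> snd v then (if y $ fst v \<le> snd v then a else 0)
      else (if y $ fst v > snd v then b else 0)) T" for y T
    by (induction T) auto
  show ?thesis unfolding eq by measurable
qed

lemma same_cell_subset:
  assumes "same_cell x y T \<noteq> 0"
  shows "y \<in> cbox 0 1" "cell_lo x j T \<le> y $ j" "y $ j \<le> cell_hi x j T"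
proof -
  have "y \<in> cbox 0 1 \<and> cell_lo x j T \<le> y $ j \<and> y $ j \<le> cell_hi x j T"
    using assms
    by (induction T) (auto simp: indicator_def mem_box_cart split: if_splits)
  then show "y \<in> cbox 0 1" "cell_lo x j T \<le> y $ j" "y $ j \<le> cell_hi x j T" by auto
qed

text \<open>A split belongs to the left cell only, so which faces a cell contains depends on the
  tree. The cell lies between the open box with its corners, by this lemma, and the closed one, by
  \<open>same_cell_subset\<close>.\<close>

lemma box_subset_tree_cell:
  assumes "y \<in> cbox 0 1" "\<And>j. cell_lo x j T < y $ j" "\<And>j. y $ j < cell_hi x j T"
  shows "same_cell x y T = 1"
  using assms(2,3)
proof (induction T)
  case (Node L v R)
  show ?case
  proof (cases "x $ fst v \<le> snd v")
    case True
    have "same_cell x y L = 1"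
    proof (rule Node.IH(1))
      show "cell_lo x j L < y $ j" "y $ j < cell_hi x j L" for j
        using Node.prems(1)[of j] Node.prems(2)[of j] True by (auto split: if_splits)
    qed
    then show ?thesis using Node.prems(2)[of "fst v"] True by auto
  next
    case False
    have "same_cell x y R = 1"
    proof (rule Node.IH(2))
      show "cell_lo x j R < y $ j" "y $ j < cell_hi x j R" for j
        using Node.prems(1)[of j] Node.prems(2)[of j] False by (auto split: if_splits)
    qed
    then show ?thesis using Node.prems(1)[of "fst v"] False by auto
  qed
qed (use assms(1) in simp)

lemma tree_cell_measurable: "{y. same_cell x y T = 1} \<in> sets borel"
proof (cases "T \<in> space tree_space")
  case True
  have "(\<lambda>y. same_cell x y T) \<in> borel_measurable borel"
    by (rule same_cell_measurable) (use True in auto)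
  then show ?thesis by simp
next
  case False
  then show ?thesis by (simp add: space_tree_sigma space_pair_measure)
qed

lemma emeasure_lborel_box_cart:
  fixes l u :: "real ^ 'd"
  assumes "\<And>j. l $ j \<le> u $ j"
  shows "emeasure lborel (box l u) = ennreal (\<Prod>j\<in>UNIV. u $ j - l $ j)"
    and "emeasure lborel (cbox l u) = ennreal (\<Prod>j\<in>UNIV. u $ j - l $ j)"
proof -
  have ne: "cbox l u \<noteq> {}" using assms by (auto simp: interval_ne_empty_cart)
  have le: "\<And>b. b \<in> Basis \<Longrightarrow> l \<bullet> b \<le> u \<bullet> b" using ne by (simp add: box_ne_empty)
  show c: "emeasure lborel (cbox l u) = ennreal (\<Prod>j\<in>UNIV. u $ j - l $ j)"
    unfolding content_cbox_cart[OF ne, symmetric] by (rule emeasure_eq_ennreal_measure) (simp add: emeasure_lborel_cbox_eq)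
  show "emeasure lborel (box l u) = ennreal (\<Prod>j\<in>UNIV. u $ j - l $ j)"
    using c le by (simp add: emeasure_lborel_box_eq emeasure_lborel_cbox_eq)
qed

lemma emeasure_tree_cell_ge:
  fixes x :: "real ^ 'd"
  assumes x: "x \<in> box 0 1"
  shows "ennreal (\<Prod>j\<in>UNIV. cell_hi x j T - cell_lo x j T) \<le> emeasure lborel {y. same_cell x y T = 1}"
proof -
  define l u :: "real ^ 'd" where "l = (\<chi> j. cell_lo x j T)" and "u = (\<chi> j. cell_hi x j T)"
  have "ennreal (\<Prod>j\<in>UNIV. cell_hi x j T - cell_lo x j T) = emeasure lborel (box l u)"
    using cell_lo_bounds[OF x, of _ T] by (subst emeasure_lborel_box_cart) (auto simp: l_def u_def intro: less_imp_le[OF less_le_trans])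
  also have "\<dots> \<le> emeasure lborel {y. same_cell x y T = 1}"
  proof (rule emeasure_mono)
    show "box l u \<subseteq> {y. same_cell x y T = 1}"
    proof
      fix y assume y: "y \<in> box l u"
      have "y \<in> cbox 0 1"
        using y cell_lo_bounds(1)[OF x, of _ T] cell_lo_bounds(4)[OF x, of _ T]
        by (auto simp: mem_box_cart l_def u_def intro: less_imp_le[OF le_less_trans] less_imp_le[OF less_le_trans])
      then show "y \<in> {y. same_cell x y T = 1}" using y by (auto simp: mem_box_cart l_def u_def intro!: box_subset_tree_cell)
    qed
  qed (use tree_cell_measurable in simp)
  finally show ?thesis .
qed

lemma indep_vars_PiM_coordinates:
  assumes "prob_space \<nu>" "I \<noteq> {}"
  shows "prob_space.indep_vars (PiM I (\<lambda>_. \<nu>)) (\<lambda>_. \<nu>) (\<lambda>i xs. xs i) I"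
proof -
  interpret \<nu>: prob_space \<nu> by fact
  interpret P: product_prob_space "\<lambda>_. \<nu>" I ..
  have "distr (PiM I (\<lambda>_. \<nu>)) (PiM I (\<lambda>_. \<nu>)) (\<lambda>xs. \<lambda>i\<in>I. xs i) = distr (PiM I (\<lambda>_. \<nu>)) (PiM I (\<lambda>_. \<nu>)) (\<lambda>xs. xs)"
    by (rule distr_cong) (auto simp: space_PiM)
  also have "\<dots> = PiM I (\<lambda>i. distr (PiM I (\<lambda>_. \<nu>)) \<nu> (\<lambda>xs. xs i))"
    by (auto intro!: PiM_cong simp: P.PiM_component)
  finally show ?thesis
    by (subst P.P.indep_vars_iff_distr_eq_PiM'[OF assms(2)]) auto
qed

text \<open>By Chebyshev's inequality with the deviation n p / 2, the count is at least n p / 2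
  outside an event of probability 4 / (n p). On this event the integrand is at most 1, and 6 = 2 +
  4.\<close>

lemma expectation_inverse_count:
  assumes "prob_space \<nu>" "sets \<nu> = sets borel" and n: "1 \<le> n" and p: "0 < p" "p = measure \<nu> {y. same_cell x y T = 1}"
  shows "(\<integral>\<^sup>+xs. ennreal (1 / max 1 (\<Sum>i=1..n. same_cell x (xs i) T)) \<partial>PiM {1..n} (\<lambda>_. \<nu>)) \<le> ennreal (6 / (real n * p))"
proof -
  interpret \<nu>: prob_space \<nu> by fact
  interpret product_prob_space "\<lambda>_. \<nu>" "{1..n}" ..
  define E where "E = {y. same_cell x y T = 1}"
  have E: "E \<in> sets \<nu>" using tree_cell_measurable assms(2) by (simp add: E_def)
  have ind: "indicator E y = same_cell x y T" for y using same_cell_01[of x y T] by (auto simp: E_def)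
  define a where "a = real n * p / 2"
  have a: "0 < a" using n p(1) by (simp add: a_def)
  let ?P = "PiM {1..n} (\<lambda>_. \<nu>)"
  let ?Bad = "{xs \<in> space ?P. a \<le> \<bar>(\<Sum>i\<in>{1..n}. indicator E (xs i)) - real (card {1..n}) * p\<bar>}"
  have Bm: "?Bad \<in> sets ?P" using E by measurable
  have "P.prob ?Bad \<le> real (card {1..n}) * p / a\<^sup>2"
  proof (rule P.indep_count_second_moment[where S=\<nu> and X="\<lambda>i xs. xs i"])
    show "P.indep_vars (\<lambda>_. \<nu>) (\<lambda>i xs. xs i) {1..n}"
      by (rule indep_vars_PiM_coordinates) (use n assms(1) in auto)
    show "P.prob ((\<lambda>xs. xs i) -` E \<inter> space ?P) = p" if "i \<in> {1..n}" for i
    proof -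
      have "P.prob ((\<lambda>xs. xs i) -` E \<inter> space ?P) = measure (distr ?P \<nu> (\<lambda>xs. xs i)) E"
        using that E by (subst measure_distr) auto
      also have "distr ?P \<nu> (\<lambda>xs. xs i) = \<nu>" using that by (rule PiM_component)
      finally show ?thesis by (simp add: p E_def)
    qed
  qed (use E a in auto)
  also have "\<dots> = 4 / (real n * p)" using n p(1) by (simp add: a_def power2_eq_square field_simps)
  finally have bad: "P.prob ?Bad \<le> 4 / (real n * p)" .
  have "(\<integral>\<^sup>+xs. ennreal (1 / max 1 (\<Sum>i=1..n. same_cell x (xs i) T)) \<partial>?P) \<le>
      (\<integral>\<^sup>+xs. ennreal (2 / (real n * p)) + indicator ?Bad xs \<partial>?P)"
  proof (rule nn_integral_mono)
    fix xs assume xs: "xs \<in> space ?P"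
    show "ennreal (1 / max 1 (\<Sum>i=1..n. same_cell x (xs i) T)) \<le> ennreal (2 / (real n * p)) + indicator ?Bad xs"
    proof (cases "xs \<in> ?Bad")
      case True
      have "ennreal (1 / max 1 (\<Sum>i=1..n. same_cell x (xs i) T)) \<le> ennreal 1" by (intro ennreal_leI) (simp add: divide_simps)
      also have "\<dots> \<le> ennreal (2 / (real n * p)) + 1" by simp
      finally show ?thesis using True by simp
    next
      case False
      then have "\<bar>(\<Sum>i=1..n. same_cell x (xs i) T) - real n * p\<bar> < real n * p / 2" using xs by (simp add: ind a_def not_le)
      then have "real n * p / 2 \<le> max 1 (\<Sum>i=1..n. same_cell x (xs i) T)" by linarith
      then have "1 / max 1 (\<Sum>i=1..n. same_cell x (xs i) T) \<le> 1 / (real n * p / 2)"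
        using a by (intro divide_left_mono mult_pos_pos) (auto simp: a_def)
      then show ?thesis using False by (auto intro!: ennreal_leI)
    qed
  qed
  also have "\<dots> = ennreal (2 / (real n * p)) + emeasure ?P ?Bad"
    using Bm P.emeasure_space_1 by (simp add: nn_integral_add)
  also have "\<dots> \<le> ennreal (2 / (real n * p)) + ennreal (4 / (real n * p))"
    using bad by (intro add_left_mono) (simp only: P.emeasure_eq_measure ennreal_leI)
  also have "\<dots> = ennreal (6 / (real n * p))" using n p(1) by (subst ennreal_plus[symmetric]) (auto simp: field_simps)
  finally show ?thesis .
qed

section \<open>Disintegration\<close>

text \<open>The lower comparison with Lebesgue measure keeps cells from being empty, the upper one
  limits the number of covariates near \<open>x\<close>.\<close>

locale regression_model = quantile_model P \<psi> \<nu> U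
  for P :: "((real ^ 'd) \<times> real) measure" and \<psi> \<nu> U +
  fixes d :: real and \<mu> \<sigma> :: "real ^ 'd \<Rightarrow> real" and C0 c0 cf Cf K :: real
  assumes \<mu>_measurable [measurable]: "\<mu> \<in> borel_measurable borel"
    and \<sigma>_measurable [measurable]: "\<sigma> \<in> borel_measurable borel"
    and pos: "0 < c0" "0 < C0" "0 < cf" "0 < Cf"
    and \<sigma>_bounds: "\<And>x. c0 \<le> \<sigma> x" "\<And>x. \<sigma> x \<le> K" and \<mu>_bound: "\<And>x. \<bar>\<mu> x\<bar> \<le> K"
    and residual: "\<And>x. centered_moments d (distr U borel (\<lambda>v. \<psi> x v - \<mu> x)) (\<sigma> x) C0"
    and \<nu>_lower: "\<And>A. A \<in> sets borel \<Longrightarrow> A \<subseteq> cbox 0 1 \<Longrightarrow> ennreal cf * emeasure lborel A \<le> emeasure \<nu> A"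
    and \<nu>_upper: "\<And>A. A \<in> sets borel \<Longrightarrow> A \<subseteq> cbox 0 1 \<Longrightarrow> emeasure \<nu> A \<le> ennreal Cf * emeasure lborel A"
    and square_integrable: "integrable P (\<lambda>z. (snd z)\<^sup>2)"

text \<open>The conditional laws may be changed on a null set of covariates, so the moment conditions can be
  assumed at every covariate.\<close>

lemma regression_model_exists:
  assumes "regression_data P d \<psi> \<mu> \<sigma> C0 c0 cf Cf K"
  shows "\<exists>\<psi>' \<mu>' \<sigma>'. regression_model P \<psi>' (distr P borel fst) (uniform_measure lborel {0..1}) d \<mu>' \<sigma>' C0 c0 cf Cf K"
proof -
  define \<nu> where "\<nu> = distr P borel fst"
  define U where "U = uniform_measure lborel {0..1 :: real}"
  from assms have qm: "quantile_model P \<psi> \<nu> U"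
    and m [measurable]: "\<mu> \<in> borel_measurable borel" "\<sigma> \<in> borel_measurable borel"
    and pos: "0 < c0" "0 < C0" "0 < cf" "0 < Cf" and b: "\<And>x. c0 \<le> \<sigma> x \<and> \<sigma> x \<le> K \<and> \<bar>\<mu> x\<bar> \<le> K"
    and ae: "AE x in \<nu>. centered_moments d (distr U borel (\<lambda>v. \<psi> x v - \<mu> x)) (\<sigma> x) C0"
    and meas: "\<And>A. A \<in> sets borel \<Longrightarrow> A \<subseteq> cbox 0 1 \<Longrightarrow>
        ennreal cf * emeasure lborel A \<le> emeasure \<nu> A \<and> emeasure \<nu> A \<le> ennreal Cf * emeasure lborel A"
    and sq: "integrable P (\<lambda>z. (snd z)\<^sup>2)"
    unfolding regression_data_def \<nu>_def[symmetric] U_def[symmetric] by blast+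
  interpret quantile_model P \<psi> \<nu> U by fact
  from ae obtain N where N: "{x \<in> space \<nu>. \<not> centered_moments d (distr U borel (\<lambda>v. \<psi> x v - \<mu> x)) (\<sigma> x) C0} \<subseteq> N"
    "emeasure \<nu> N = 0" "N \<in> sets \<nu>" by (rule AE_E)
  then have [measurable]: "N \<in> sets borel" by simp
  have good: "centered_moments d (distr U borel (\<lambda>v. \<psi> x v - \<mu> x)) (\<sigma> x) C0" if "x \<notin> N" for x
    using N(1) that space_\<nu> by auto
  have "N \<noteq> UNIV" using N(2) \<nu>.emeasure_space_1 space_\<nu> by auto
  then obtain x0 where x0: "x0 \<notin> N" by auto
  \<comment> \<open>The exceptional covariates are all sent to one good point. As they form a null
    set, no law changes.\<close>
  define p where "p x = (if x \<in> N then x0 else x)" for x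
  have p [measurable]: "p \<in> borel \<rightarrow>\<^sub>M borel" unfolding p_def[abs_def] by measurable
  have pN: "p x \<notin> N" for x using x0 by (simp add: p_def)
  have AEp: "AE x in \<nu>. p x = x"
    by (rule AE_I'[of N]) (use N in \<open>auto simp: p_def null_sets_def\<close>)
  have \<psi>m [measurable]: "(\<lambda>z. \<psi> (fst z) (snd z)) \<in> borel_measurable (borel \<Otimes>\<^sub>M borel)"
    using \<psi>_measurable by (simp add: split_beta)
  have "(\<lambda>z. \<psi> (fst (p (fst z), snd z)) (snd (p (fst z), snd z))) \<in> borel_measurable (borel \<Otimes>\<^sub>M borel)"
    by (rule measurable_compose[OF _ \<psi>m]) measurable
  then have \<psi>pm: "(\<lambda>(x, v). \<psi> (p x) v) \<in> borel_measurable (borel \<Otimes>\<^sub>M borel)" by (simp add: split_beta)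
  have "distr (\<nu> \<Otimes>\<^sub>M U) (borel \<Otimes>\<^sub>M borel) (\<lambda>(x, v). (x, \<psi> (p x) v)) = distr (\<nu> \<Otimes>\<^sub>M U) (borel \<Otimes>\<^sub>M borel) (\<lambda>(x, v). (x, \<psi> x v))"
  proof (rule distr_cong_AE)
    have s: "{z \<in> space (\<nu> \<Otimes>\<^sub>M U). p (fst z) = fst z} \<in> sets (\<nu> \<Otimes>\<^sub>M U)" by measurable
    have "AE z in \<nu> \<Otimes>\<^sub>M U. p (fst z) = fst z"
      by (rule \<nu>U.AE_pair_measure[OF s]) (use AEp in \<open>auto elim!: eventually_mono\<close>)
    then show "AE z in \<nu> \<Otimes>\<^sub>M U. (case z of (x, v) \<Rightarrow> (x, \<psi> (p x) v)) = (case z of (x, v) \<Rightarrow> (x, \<psi> x v))"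
      by (auto elim!: eventually_mono simp: split_beta)
    show "(\<lambda>(x, v). (x, \<psi> (p x) v)) \<in> \<nu> \<Otimes>\<^sub>M U \<rightarrow>\<^sub>M borel \<Otimes>\<^sub>M borel" using \<psi>pm by measurable
  qed (use pair_\<psi>_measurable in simp_all)
  then have \<psi>p: "distr (\<nu> \<Otimes>\<^sub>M U) (borel \<Otimes>\<^sub>M borel) (\<lambda>(x, v). (x, \<psi> (p x) v)) = P" using \<psi> by simp
  have "regression_model P (\<lambda>x. \<psi> (p x)) \<nu> U d (\<lambda>x. \<mu> (p x)) (\<lambda>x. \<sigma> (p x)) C0 c0 cf Cf K"
    using b meas pos sq good[OF pN]
    by (intro regression_model.intro quantile_model.intro regression_model_axioms.intro prob_P sets_P \<nu>_def U_def \<psi>pm \<psi>p) auto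
  then show ?thesis unfolding \<nu>_def U_def by blast
qed

lemma subalgebra_vimage:
  assumes "f \<in> M \<rightarrow>\<^sub>M N"
  shows "subalgebra M (vimage_algebra (space M) f N)"
  unfolding subalgebra_def sets_vimage_algebra
  by (auto intro!: sets.sigma_sets_subset simp del: measurable_compose intro: measurable_sets[OF assms])

text \<open>Under the product measure \<open>a\<close> and \<open>v\<close> are independent, and
  \<open>\<pi>\<close> recovers \<open>a\<close>; conditioning on \<open>\<pi>\<close> therefore
  means freezing \<open>a\<close> and integrating over \<open>v\<close>. Equality of the laws
  carries this over to M.\<close>

lemma cond_exp_disintegration:
  assumes "prob_space M" "prob_space A" "prob_space V"
    and Z [measurable]: "Z \<in> M \<rightarrow>\<^sub>M N" and \<pi> [measurable]: "\<pi> \<in> N \<rightarrow>\<^sub>M A" and \<Theta> [measurable]: "\<Theta> \<in> A \<Otimes>\<^sub>M V \<rightarrow>\<^sub>M N"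
    and law: "distr M N Z = distr (A \<Otimes>\<^sub>M V) N \<Theta>" and \<pi>\<Theta>: "\<And>a v. a \<in> space A \<Longrightarrow> v \<in> space V \<Longrightarrow> \<pi> (\<Theta> (a, v)) = a"
    and h [measurable]: "h \<in> borel_measurable N" and int: "integrable M (\<lambda>\<omega>. h (Z \<omega>))"
    and k [measurable]: "k \<in> borel_measurable A" and hk: "\<And>a. a \<in> space A \<Longrightarrow> (\<integral>v. h (\<Theta> (a, v)) \<partial>V) = (k a :: real)"
  shows "AE \<omega> in M. real_cond_exp M (vimage_algebra (space M) (\<lambda>\<omega>. \<pi> (Z \<omega>)) A) (\<lambda>\<omega>. h (Z \<omega>)) \<omega> = k (\<pi> (Z \<omega>))"
proof -
  interpret M: prob_space M by fact
  interpret A: prob_space A by fact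
  interpret V: prob_space V by fact
  interpret AV: pair_prob_space A V ..
  let ?G = "vimage_algebra (space M) (\<lambda>\<omega>. \<pi> (Z \<omega>)) A"
  have \<pi>Z [measurable]: "(\<lambda>\<omega>. \<pi> (Z \<omega>)) \<in> M \<rightarrow>\<^sub>M A" by measurable
  have sub: "subalgebra M ?G" by (rule subalgebra_vimage[OF \<pi>Z])
  interpret G: finite_measure_subalgebra M ?G by standard (rule sub)
  have G_m: "(\<lambda>\<omega>. \<pi> (Z \<omega>)) \<in> ?G \<rightarrow>\<^sub>M A"
    by (rule measurable_vimage_algebra1) (use measurable_space[OF \<pi>Z] in auto)
  have trans: "(\<integral>\<omega>. F (Z \<omega>) \<partial>M) = (\<integral>z. F (\<Theta> z) \<partial>(A \<Otimes>\<^sub>M V))" if [measurable]: "F \<in> borel_measurable N" for F :: "_ \<Rightarrow> real"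
    using arg_cong[OF law, of "\<lambda>m. integral\<^sup>L m F"] by (simp add: integral_distr)
  have trans_i: "integrable M (\<lambda>\<omega>. F (Z \<omega>)) \<longleftrightarrow> integrable (A \<Otimes>\<^sub>M V) (\<lambda>z. F (\<Theta> z))" if [measurable]: "F \<in> borel_measurable N" for F :: "_ \<Rightarrow> real"
    using arg_cong[OF law, of "\<lambda>m. integrable m F"] by (simp add: integrable_distr_eq)
  have fstA: "distr (A \<Otimes>\<^sub>M V) A fst = A" by (rule V.distr_pair_fst)
  have hi: "integrable (A \<Otimes>\<^sub>M V) (\<lambda>z. h (\<Theta> z))" using int trans_i[OF h] by simp
  have "integrable A (\<lambda>a. \<integral>v. h (\<Theta> (a, v)) \<partial>V)" using AV.integrable_fst'[OF hi] by simp
  then have kA: "integrable A k" by (subst (asm) Bochner_Integration.integrable_cong[OF refl hk]) auto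
  have "integrable (A \<Otimes>\<^sub>M V) (\<lambda>z. k (fst z))"
    using kA fstA by (metis integrable_distr_eq k measurable_fst)
  then have "integrable (A \<Otimes>\<^sub>M V) (\<lambda>z. k (\<pi> (\<Theta> z)))"
    by (subst Bochner_Integration.integrable_cong[OF refl, of _ _ "\<lambda>z. k (fst z)"]) (auto simp: space_pair_measure \<pi>\<Theta>)
  then have ki: "integrable M (\<lambda>\<omega>. k (\<pi> (Z \<omega>)))" using trans_i[of "\<lambda>z. k (\<pi> z)"] by simp
  show ?thesis
  proof (rule G.real_cond_exp_charact[OF _ int ki])
    show "(\<lambda>\<omega>. k (\<pi> (Z \<omega>))) \<in> borel_measurable ?G" by (rule measurable_compose[OF G_m k])
    fix S assume "S \<in> sets ?G"
    then obtain B where B [measurable]: "B \<in> sets A" and S: "S = (\<lambda>\<omega>. \<pi> (Z \<omega>)) -` B \<inter> space M"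
      using sets_vimage_algebra2[of "\<lambda>\<omega>. \<pi> (Z \<omega>)" "space M" A] measurable_space[OF \<pi>Z] by auto
    have "(\<integral>\<omega>\<in>S. h (Z \<omega>) \<partial>M) = (\<integral>\<omega>. indicator B (\<pi> (Z \<omega>)) * h (Z \<omega>) \<partial>M)"
      unfolding set_lebesgue_integral_def by (rule Bochner_Integration.integral_cong) (auto simp: S indicator_def)
    also have "\<dots> = (\<integral>z. indicator B (\<pi> (\<Theta> z)) * h (\<Theta> z) \<partial>(A \<Otimes>\<^sub>M V))" by (rule trans) measurable
    also have "\<dots> = (\<integral>z. indicator B (fst z) * h (\<Theta> z) \<partial>(A \<Otimes>\<^sub>M V))"
      by (rule Bochner_Integration.integral_cong) (auto simp: space_pair_measure \<pi>\<Theta>)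
    also have "\<dots> = (\<integral>a. \<integral>v. indicator B a * h (\<Theta> (a, v)) \<partial>V \<partial>A)"
    proof (subst AV.integral_fst'[symmetric])
      show "integrable (A \<Otimes>\<^sub>M V) (\<lambda>z. indicator B (fst z) * h (\<Theta> z))"
        by (rule Bochner_Integration.integrable_bound[OF hi]) (auto simp: indicator_def)
    qed simp
    also have "\<dots> = (\<integral>a. indicator B a * k a \<partial>A)"
      by (rule Bochner_Integration.integral_cong) (simp_all add: hk)
    also have "\<dots> = (\<integral>z. indicator B (fst z) * k (fst z) \<partial>(A \<Otimes>\<^sub>M V))"
      by (subst (1) fstA[symmetric], subst integral_distr) auto
    also have "\<dots> = (\<integral>z. indicator B (\<pi> (\<Theta> z)) * k (\<pi> (\<Theta> z)) \<partial>(A \<Otimes>\<^sub>M V))"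
      by (rule Bochner_Integration.integral_cong) (auto simp: space_pair_measure \<pi>\<Theta>)
    also have "\<dots> = (\<integral>\<omega>. indicator B (\<pi> (Z \<omega>)) * k (\<pi> (Z \<omega>)) \<partial>M)" by (rule trans[symmetric]) measurable
    also have "\<dots> = (\<integral>\<omega>\<in>S. k (\<pi> (Z \<omega>)) \<partial>M)"
      unfolding set_lebesgue_integral_def by (rule Bochner_Integration.integral_cong) (auto simp: S indicator_def)
    finally show "(\<integral>\<omega>\<in>S. h (Z \<omega>) \<partial>M) = (\<integral>\<omega>\<in>S. k (\<pi> (Z \<omega>)) \<partial>M)" .
  qed
qed

lemma distribution_function_disintegration:
  assumes "prob_space M" "prob_space A" "prob_space V"
    and Z [measurable]: "Z \<in> M \<rightarrow>\<^sub>M N" and \<pi> [measurable]: "\<pi> \<in> N \<rightarrow>\<^sub>M A" and \<Theta> [measurable]: "\<Theta> \<in> A \<Otimes>\<^sub>M V \<rightarrow>\<^sub>M N"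
    and law: "distr M N Z = distr (A \<Otimes>\<^sub>M V) N \<Theta>" and \<pi>\<Theta>: "\<And>a v. a \<in> space A \<Longrightarrow> v \<in> space V \<Longrightarrow> \<pi> (\<Theta> (a, v)) = a"
    and h [measurable]: "h \<in> borel_measurable N"
    and e [measurable]: "e \<in> borel_measurable A" and ei: "integrable M (\<lambda>\<omega>. e (\<pi> (Z \<omega>)))"
    and bound: "\<And>a. a \<in> space A \<Longrightarrow> \<bar>measure V {v \<in> space V. h (\<Theta> (a, v)) \<le> t} - c\<bar> \<le> (e a :: real)"
  shows "\<bar>measure M {\<omega> \<in> space M. h (Z \<omega>) \<le> (t :: real)} - c\<bar> \<le> (\<integral>\<omega>. e (\<pi> (Z \<omega>)) \<partial>M)"
proof -
  interpret M: prob_space M by fact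
  interpret A: prob_space A by fact
  interpret V: prob_space V by fact
  interpret AV: pair_prob_space A V ..
  define F where "F z = (indicator {..t} (h z) :: real)" for z
  have F [measurable]: "F \<in> borel_measurable N" unfolding F_def by measurable
  have trans: "(\<integral>\<omega>. F (Z \<omega>) \<partial>M) = (\<integral>z. F (\<Theta> z) \<partial>(A \<Otimes>\<^sub>M V))" if [measurable]: "F \<in> borel_measurable N" for F :: "_ \<Rightarrow> real"
    using arg_cong[OF law, of "\<lambda>m. integral\<^sup>L m F"] by (simp add: integral_distr)
  have trans_i: "integrable M (\<lambda>\<omega>. F (Z \<omega>)) \<longleftrightarrow> integrable (A \<Otimes>\<^sub>M V) (\<lambda>z. F (\<Theta> z))" if [measurable]: "F \<in> borel_measurable N" for F :: "_ \<Rightarrow> real"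
    using arg_cong[OF law, of "\<lambda>m. integrable m F"] by (simp add: integrable_distr_eq)
  have fstA: "distr (A \<Otimes>\<^sub>M V) A fst = A" by (rule V.distr_pair_fst)
  have Fi: "integrable (A \<Otimes>\<^sub>M V) (\<lambda>z. F (\<Theta> z))"
    by (rule AV.integrable_const_bound[where B=1]) (auto simp: F_def)
  have "integrable (A \<Otimes>\<^sub>M V) (\<lambda>z. e (\<pi> (\<Theta> z)))" using ei trans_i[of "\<lambda>z. e (\<pi> z)"] by simp
  then have "integrable (A \<Otimes>\<^sub>M V) (\<lambda>z. e (fst z))"
    by (subst Bochner_Integration.integrable_cong[OF refl, of _ _ "\<lambda>z. e (\<pi> (\<Theta> z))"]) (auto simp: space_pair_measure \<pi>\<Theta>)
  then have eA: "integrable A e" by (subst (1) fstA[symmetric], subst integrable_distr_eq) auto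
  have "(\<integral>\<omega>. e (\<pi> (Z \<omega>)) \<partial>M) = (\<integral>z. e (\<pi> (\<Theta> z)) \<partial>(A \<Otimes>\<^sub>M V))" by (rule trans) measurable
  also have "\<dots> = (\<integral>z. e (fst z) \<partial>(A \<Otimes>\<^sub>M V))"
    by (rule Bochner_Integration.integral_cong) (auto simp: space_pair_measure \<pi>\<Theta>)
  also have "\<dots> = (\<integral>a. e a \<partial>A)" by (subst (2) fstA[symmetric], subst integral_distr) auto
  finally have eq_e: "(\<integral>\<omega>. e (\<pi> (Z \<omega>)) \<partial>M) = (\<integral>a. e a \<partial>A)" .
  have "measure M {\<omega> \<in> space M. h (Z \<omega>) \<le> t} = (\<integral>\<omega>. indicator {\<omega> \<in> space M. h (Z \<omega>) \<le> t} \<omega> \<partial>M)"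
    by simp
  also have "\<dots> = (\<integral>\<omega>. F (Z \<omega>) \<partial>M)"
    by (rule Bochner_Integration.integral_cong) (auto simp: F_def indicator_def)
  also have "\<dots> = (\<integral>z. F (\<Theta> z) \<partial>(A \<Otimes>\<^sub>M V))" by (rule trans) measurable
  also have "\<dots> = (\<integral>a. \<integral>v. F (\<Theta> (a, v)) \<partial>V \<partial>A)" by (rule AV.integral_fst'[symmetric, OF Fi])
  finally have eq: "measure M {\<omega> \<in> space M. h (Z \<omega>) \<le> t} = (\<integral>a. \<integral>v. F (\<Theta> (a, v)) \<partial>V \<partial>A)" .
  have gi: "integrable A (\<lambda>a. \<integral>v. F (\<Theta> (a, v)) \<partial>V)" using AV.integrable_fst'[OF Fi] by simp
  have inner: "(\<integral>v. F (\<Theta> (a, v)) \<partial>V) = measure V {v \<in> space V. h (\<Theta> (a, v)) \<le> t}" if "a \<in> space A" for a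
  proof -
    have [measurable]: "(\<lambda>v. h (\<Theta> (a, v))) \<in> borel_measurable V" using that by measurable
    have "(\<integral>v. F (\<Theta> (a, v)) \<partial>V) = (\<integral>v. indicator {v \<in> space V. h (\<Theta> (a, v)) \<le> t} v \<partial>V)"
      by (rule Bochner_Integration.integral_cong) (auto simp: F_def indicator_def)
    then show ?thesis by simp
  qed
  have "(\<integral>a. \<integral>v. F (\<Theta> (a, v)) \<partial>V \<partial>A) - c = (\<integral>a. (\<integral>v. F (\<Theta> (a, v)) \<partial>V) - c \<partial>A)"
    using gi A.prob_space by simp
  also have "\<bar>\<dots>\<bar> \<le> (\<integral>a. \<bar>(\<integral>v. F (\<Theta> (a, v)) \<partial>V) - c\<bar> \<partial>A)" by (rule integral_abs_bound)
  also have "\<dots> \<le> (\<integral>a. e a \<partial>A)"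
    by (rule integral_mono) (use gi eA bound inner in auto)
  finally show ?thesis by (simp only: eq eq_e)
qed

lemma PiM_sum_second_moment:
  assumes U: "prob_space U" and fin: "finite I"
    and g [measurable]: "\<And>i. i \<in> I \<Longrightarrow> g i \<in> borel_measurable U" and g2: "\<And>i. i \<in> I \<Longrightarrow> integrable U (\<lambda>u. (g i u)\<^sup>2)"
    and g0: "\<And>i. i \<in> I \<Longrightarrow> (\<integral>u. g i u \<partial>U) = 0" and gs: "\<And>i. i \<in> I \<Longrightarrow> (\<integral>u. (g i u)\<^sup>2 \<partial>U) = s i"
  shows "(\<integral>v. (\<Sum>i\<in>I. g i (v i))\<^sup>2 \<partial>PiM I (\<lambda>_. U)) = (\<Sum>i\<in>I. s i :: real)"
proof (cases "I = {}")
  case True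
  then show ?thesis by simp
next
  case False
  interpret U: prob_space U by fact
  interpret product_prob_space "\<lambda>_. U" I ..
  let ?V = "PiM I (\<lambda>_. U)"
  have comp: "distr ?V U (\<lambda>v. v i) = U" if "i \<in> I" for i using that by (rule PiM_component)
  have e1: "(\<integral>v. f (v i) \<partial>?V) = (\<integral>u. f u \<partial>U)" if "i \<in> I" "f \<in> borel_measurable U" for i and f :: "_ \<Rightarrow> real"
    by (subst (2) comp[OF that(1), symmetric], subst integral_distr) (use that in auto)
  have e2: "integrable ?V (\<lambda>v. f (v i)) \<longleftrightarrow> integrable U f" if "i \<in> I" "f \<in> borel_measurable U" for i and f :: "_ \<Rightarrow> real"
    by (subst (2) comp[OF that(1), symmetric], subst integrable_distr_eq) (use that in auto)
  have sq: "integrable ?V (\<lambda>v. (g i (v i))\<^sup>2)" if "i \<in> I" for i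
    using e2[OF that, of "\<lambda>u. (g i u)\<^sup>2"] g[OF that] g2[OF that] by simp
  have Zm: "(\<lambda>v. g i (v i)) \<in> borel_measurable ?V" if "i \<in> I" for i using that by measurable
  have Zi: "integrable ?V (\<lambda>v. g i (v i))" if "i \<in> I" for i
  proof (rule Bochner_Integration.integrable_bound[where f="\<lambda>v. 1 + (g i (v i))\<^sup>2"])
    have "\<bar>y\<bar> \<le> 1 + y\<^sup>2" for y :: real
      using zero_le_power2[of "\<bar>y\<bar> - 1"] by (simp add: power2_eq_square algebra_simps)
    then show "AE v in ?V. norm (g i (v i)) \<le> norm (1 + (g i (v i))\<^sup>2)" by simp
  qed (use sq Zm that in auto)
  have ZZi: "integrable ?V (\<lambda>v. g i (v i) * g j (v j))" if "i \<in> I" "j \<in> I" for i j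
  proof (rule Bochner_Integration.integrable_bound[where f="\<lambda>v. (g i (v i))\<^sup>2 + (g j (v j))\<^sup>2"])
    have "\<bar>a * b\<bar> \<le> a\<^sup>2 + b\<^sup>2" for a b :: real
      using zero_le_power2[of "\<bar>a\<bar> - \<bar>b\<bar>"] zero_le_power2[of a] zero_le_power2[of b]
      unfolding power2_diff abs_mult power2_abs by linarith
    then show "AE v in ?V. norm (g i (v i) * g j (v j)) \<le> norm ((g i (v i))\<^sup>2 + (g j (v j))\<^sup>2)" by simp
  qed (use sq Zm that in auto)
  have cross: "(\<integral>v. g i (v i) * g j (v j) \<partial>?V) = 0" if "i \<in> I" "j \<in> I" "i \<noteq> j" for i j
  proof -
    have "P.indep_vars (\<lambda>_. borel) (\<lambda>i v. g i (v i)) I"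
      by (rule P.indep_vars_compose2[OF indep_vars_PiM_coordinates[OF U False]]) (use g in auto)
    then have "P.indep_vars (\<lambda>_. borel) (\<lambda>i v. g i (v i)) {i, j}" by (rule P.indep_vars_subset) (use that in auto)
    then have "(\<integral>v. (\<Prod>k\<in>{i, j}. g k (v k)) \<partial>?V) = (\<Prod>k\<in>{i, j}. \<integral>v. g k (v k) \<partial>?V)"
      by (intro P.indep_vars_lebesgue_integral) (use that Zi in auto)
    then show ?thesis using that g0 e1[OF that(1) g[OF that(1)]] by simp
  qed
  have "(\<integral>v. (\<Sum>i\<in>I. g i (v i))\<^sup>2 \<partial>?V) = (\<integral>v. (\<Sum>i\<in>I. \<Sum>j\<in>I. g i (v i) * g j (v j)) \<partial>?V)"
    by (simp add: power2_eq_square sum_product)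
  also have "\<dots> = (\<Sum>i\<in>I. \<Sum>j\<in>I. \<integral>v. g i (v i) * g j (v j) \<partial>?V)"
    by (subst Bochner_Integration.integral_sum, use ZZi in simp, rule sum.cong[OF refl],
        subst Bochner_Integration.integral_sum) (use ZZi in auto)
  also have "\<dots> = (\<Sum>i\<in>I. \<Sum>j\<in>I. if i = j then s i else 0)"
  proof (intro sum.cong refl)
    fix i j assume ij: "i \<in> I" "j \<in> I"
    show "(\<integral>v. g i (v i) * g j (v j) \<partial>?V) = (if i = j then s i else 0)"
      using cross[OF ij] e1[OF ij(1), of "\<lambda>u. (g i u)\<^sup>2"] g[OF ij(1)] gs[OF ij(1)] by (auto simp: power2_eq_square)
  qed
  also have "\<dots> = (\<Sum>i\<in>I. s i)" using fin by (simp add: sum.delta)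
  finally show ?thesis .
qed

section \<open>Forest weights\<close>

definition cell_count :: "real ^ 'd \<Rightarrow> nat \<Rightarrow> (nat \<Rightarrow> real ^ 'd) \<Rightarrow> 'd mondrian_tree \<Rightarrow> real" where
  "cell_count x n xs T = (\<Sum>i=1..n. same_cell x (xs i) T)"

text \<open>A common form for the weights of the estimator, their upper bound and the fraction of
  escaping trees, so that linearity and monotonicity are proved once.\<close>

definition tree_average :: "nat \<Rightarrow> nat \<Rightarrow> (nat \<Rightarrow> real) \<Rightarrow> ('d mondrian_tree \<Rightarrow> real) \<Rightarrow> (nat \<times> nat \<Rightarrow> 'd mondrian_tree) \<Rightarrow> real" where
  "tree_average B J w g \<tau> = (\<Sum>r=0..J. w r * (1 / real B * (\<Sum>b=1..B. g (\<tau> (b, r)))))"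

definition forest_weight :: "real ^ 'd \<Rightarrow> nat \<Rightarrow> nat \<Rightarrow> nat \<Rightarrow> (nat \<Rightarrow> real) \<Rightarrow> (nat \<Rightarrow> real ^ 'd) \<Rightarrow> (nat \<times> nat \<Rightarrow> 'd mondrian_tree) \<Rightarrow> nat \<Rightarrow> real" where
  "forest_weight x n B J w xs \<tau> i = tree_average B J w (\<lambda>T. same_cell x (xs i) T / cell_count x n xs T) \<tau>"

text \<open>The debiasing weights can be negative, hence the absolute values. The quantity is
  defined from the design alone and does not depend on the index of the observation.\<close>

definition weight_bound :: "real ^ 'd \<Rightarrow> nat \<Rightarrow> nat \<Rightarrow> nat \<Rightarrow> (nat \<Rightarrow> real) \<Rightarrow> (nat \<Rightarrow> real ^ 'd) \<Rightarrow> (nat \<times> nat \<Rightarrow> 'd mondrian_tree) \<Rightarrow> real" where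
  "weight_bound x n B J w xs \<tau> = tree_average B J (\<lambda>r. \<bar>w r\<bar>) (\<lambda>T. 1 / max 1 (cell_count x n xs T)) \<tau>"

text \<open>Distances are measured from \<open>x\<close> to each face, so that escape is a finite
  union of the events in \<open>mondrian_side_tail\<close>.\<close>

definition escaping_trees :: "real ^ 'd \<Rightarrow> real \<Rightarrow> 'd mondrian_tree set" where
  "escaping_trees x h = {T \<in> space tree_space. \<exists>j. x $ j - cell_lo x j T > h \<or> cell_hi x j T - x $ j > h}"

definition cube :: "real ^ 'd \<Rightarrow> real \<Rightarrow> (real ^ 'd) set" where
  "cube x h = {y \<in> cbox 0 1. \<forall>j. \<bar>y $ j - x $ j\<bar> \<le> h}"

lemma tree_average_mono:
  assumes "\<And>r. r \<le> J \<Longrightarrow> 0 \<le> w r" "\<And>b r. b \<in> {1..B} \<Longrightarrow> r \<le> J \<Longrightarrow> g (\<tau> (b, r)) \<le> g' (\<tau> (b, r))"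
  shows "tree_average B J w g \<tau> \<le> tree_average B J w g' \<tau>"
  unfolding tree_average_def using assms by (intro sum_mono mult_left_mono) auto

lemma tree_average_abs:
  "\<bar>tree_average B J w g \<tau>\<bar> \<le> tree_average B J (\<lambda>r. \<bar>w r\<bar>) (\<lambda>T. \<bar>g T\<bar>) \<tau>"
proof -
  have "\<bar>tree_average B J w g \<tau>\<bar> \<le> (\<Sum>r=0..J. \<bar>w r * (1 / real B * (\<Sum>b=1..B. g (\<tau> (b, r))))\<bar>)"
    unfolding tree_average_def by (rule sum_abs)
  also have "\<dots> \<le> tree_average B J (\<lambda>r. \<bar>w r\<bar>) (\<lambda>T. \<bar>g T\<bar>) \<tau>"
    unfolding tree_average_def abs_mult
    by (intro sum_mono mult_left_mono) (auto intro: divide_right_mono sum_abs)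
  finally show ?thesis .
qed

lemma tree_average_const: "1 \<le> B \<Longrightarrow> tree_average B J w (\<lambda>_. c) \<tau> = (\<Sum>r=0..J. w r) * c"
  by (simp add: tree_average_def sum_distrib_right)

lemma tree_average_diff: "tree_average B J w (\<lambda>T. g T - g' T) \<tau> = tree_average B J w g \<tau> - tree_average B J w g' \<tau>"
  and tree_average_add: "tree_average B J w (\<lambda>T. g T + g' T) \<tau> = tree_average B J w g \<tau> + tree_average B J w g' \<tau>"
  by (simp_all add: tree_average_def sum_subtractf sum.distrib algebra_simps)

lemma tree_average_sum: "(\<Sum>i\<in>I. tree_average B J w (g i) \<tau> * c i) = tree_average B J w (\<lambda>T. \<Sum>i\<in>I. g i T * c i) \<tau>"
proof -
  have "(\<Sum>i\<in>I. tree_average B J w (g i) \<tau> * c i) = (\<Sum>i\<in>I. \<Sum>r=0..J. w r * (1 / real B * (\<Sum>b=1..B. g i (\<tau> (b, r)) * c i)))"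
    unfolding tree_average_def by (simp add: sum_distrib_right sum_distrib_left mult_ac)
  also have "\<dots> = (\<Sum>r=0..J. \<Sum>i\<in>I. w r * (1 / real B * (\<Sum>b=1..B. g i (\<tau> (b, r)) * c i)))"
    by (rule sum.swap)
  also have "\<dots> = tree_average B J w (\<lambda>T. \<Sum>i\<in>I. g i T * c i) \<tau>"
    unfolding tree_average_def
    by (intro sum.cong refl, unfold sum_distrib_left[symmetric], subst sum.swap, rule refl)
  finally show ?thesis .
qed

lemma cell_count_nonneg: "0 \<le> cell_count x n xs T"
  unfolding cell_count_def by (intro sum_nonneg same_cell_bounds)

lemma same_cell_le_count: "i \<in> {1..n} \<Longrightarrow> same_cell x (xs i) T \<le> cell_count x n xs T"
  unfolding cell_count_def by (rule member_le_sum) (auto simp: same_cell_bounds)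

lemma cell_share_bounds:
  assumes "i \<in> {1..n}"
  shows "0 \<le> same_cell x (xs i) T / cell_count x n xs T"
    "same_cell x (xs i) T / cell_count x n xs T \<le> 1 / max 1 (cell_count x n xs T)"
proof -
  show "0 \<le> same_cell x (xs i) T / cell_count x n xs T" by (intro divide_nonneg_nonneg same_cell_bounds cell_count_nonneg)
  show "same_cell x (xs i) T / cell_count x n xs T \<le> 1 / max 1 (cell_count x n xs T)"
    using same_cell_01[of x "xs i" T] same_cell_le_count[OF assms, of x xs T] by (auto simp: max_def)
qed

lemma forest_weight_abs_le:
  assumes "i \<in> {1..n}"
  shows "\<bar>forest_weight x n B J w xs \<tau> i\<bar> \<le> weight_bound x n B J w xs \<tau>"
proof -
  have "\<bar>forest_weight x n B J w xs \<tau> i\<bar> \<le> tree_average B J (\<lambda>r. \<bar>w r\<bar>) (\<lambda>T. \<bar>same_cell x (xs i) T / cell_count x n xs T\<bar>) \<tau>"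
    unfolding forest_weight_def by (rule tree_average_abs)
  also have "\<dots> \<le> weight_bound x n B J w xs \<tau>"
    unfolding weight_bound_def
    by (rule tree_average_mono) (simp, use cell_share_bounds[OF assms, of x xs] in \<open>simp only: abs_of_nonneg\<close>)
  finally show ?thesis .
qed

lemma weight_bound_bounds:
  assumes "1 \<le> B"
  shows "0 \<le> weight_bound x n B J w xs \<tau>" "weight_bound x n B J w xs \<tau> \<le> (\<Sum>r=0..J. \<bar>w r\<bar>)"
proof -
  have "tree_average B J (\<lambda>r. \<bar>w r\<bar>) (\<lambda>_. 0) \<tau> \<le> weight_bound x n B J w xs \<tau>"
    unfolding weight_bound_def by (rule tree_average_mono) auto
  then show "0 \<le> weight_bound x n B J w xs \<tau>" using assms by (simp add: tree_average_const)
  have "weight_bound x n B J w xs \<tau> \<le> tree_average B J (\<lambda>r. \<bar>w r\<bar>) (\<lambda>_. 1) \<tau>"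
    unfolding weight_bound_def by (rule tree_average_mono) (auto simp: divide_simps)
  then show "weight_bound x n B J w xs \<tau> \<le> (\<Sum>r=0..J. \<bar>w r\<bar>)" using assms by (simp add: tree_average_const)
qed

lemma debiased_forest_eq:
  "debiased_forest n B J w X Y (\<lambda>b r. \<tau> (b, r)) x = (\<Sum>i=1..n. forest_weight x n B J w X \<tau> i * Y i)"
  unfolding forest_weight_def tree_average_sum
  by (simp add: debiased_forest_def tree_average_def tree_estimator_def indicator_tree_cell cell_count_def
      sum_divide_distrib mult_ac)

text \<open>The weights of a tree with a nonempty cell sum to 1 and all sit in the cube unless the
  tree escapes. An empty cell contributes weight 0, and there the term 1 / max 1 N is 1, which
  covers the loss.\<close>

lemma local_weight_mass:
  assumes w: "(\<Sum>r=0..J. w r) = 1" and B: "1 \<le> B" and \<tau>: "\<And>b r. b \<in> {1..B} \<Longrightarrow> r \<le> J \<Longrightarrow> \<tau> (b, r) \<in> space tree_space"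
  shows "\<bar>1 - (\<Sum>i=1..n. forest_weight x n B J w xs \<tau> i * indicator (cube x h) (xs i))\<bar>
    \<le> weight_bound x n B J w xs \<tau> + tree_average B J (\<lambda>r. \<bar>w r\<bar>) (indicator (escaping_trees x h)) \<tau>"
proof -
  define q where "q T = (\<Sum>i=1..n. same_cell x (xs i) T / cell_count x n xs T * indicator (cube x h) (xs i))" for T
  have q: "\<bar>1 - q T\<bar> \<le> 1 / max 1 (cell_count x n xs T) + indicator (escaping_trees x h) T" if T: "T \<in> space tree_space" for T
  proof (cases "cell_count x n xs T = 0")
    case True
    then show ?thesis by (simp add: q_def)
  next
    case False
    then have c: "0 < cell_count x n xs T" using cell_count_nonneg[of x n xs T] by linarith
    have one: "(\<Sum>i=1..n. same_cell x (xs i) T / cell_count x n xs T) = 1"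
      using c by (simp add: sum_divide_distrib[symmetric] cell_count_def)
    show ?thesis
    proof (cases "T \<in> escaping_trees x h")
      case True
      have "0 \<le> q T" unfolding q_def by (intro sum_nonneg mult_nonneg_nonneg) (auto simp: same_cell_bounds c less_imp_le)
      moreover have "q T \<le> 1"
        unfolding q_def one[symmetric]
        by (intro sum_mono) (use c in \<open>auto simp: indicator_def same_cell_bounds less_imp_le\<close>)
      moreover have "0 \<le> 1 / max 1 (cell_count x n xs T)" by simp
      ultimately show ?thesis unfolding indicator_simps(1)[OF True] by linarith
    next
      case esc: False
      have "xs i \<in> cube x h" if "same_cell x (xs i) T \<noteq> 0" for i
      proof -
        have "\<bar>xs i $ j - x $ j\<bar> \<le> h" for j
          using same_cell_subset(2,3)[OF that, of j] esc T unfolding escaping_trees_def by (auto simp: not_less dest!: spec[of _ j])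
        then show ?thesis using same_cell_subset(1)[OF that] by (simp add: cube_def)
      qed
      then have "q T = 1" unfolding q_def one[symmetric] by (intro sum.cong refl) (auto simp: indicator_def)
      then show ?thesis by simp
    qed
  qed
  have "1 - (\<Sum>i=1..n. forest_weight x n B J w xs \<tau> i * indicator (cube x h) (xs i)) = tree_average B J w (\<lambda>T. 1 - q T) \<tau>"
    unfolding forest_weight_def tree_average_sum tree_average_diff q_def tree_average_const[OF B] by (simp add: w)
  also have "\<bar>\<dots>\<bar> \<le> tree_average B J (\<lambda>r. \<bar>w r\<bar>) (\<lambda>T. \<bar>1 - q T\<bar>) \<tau>" by (rule tree_average_abs)
  also have "\<dots> \<le> tree_average B J (\<lambda>r. \<bar>w r\<bar>) (\<lambda>T. 1 / max 1 (cell_count x n xs T) + indicator (escaping_trees x h) T) \<tau>"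
    by (rule tree_average_mono) (use q \<tau> in auto)
  also have "\<dots> = weight_bound x n B J w xs \<tau> + tree_average B J (\<lambda>r. \<bar>w r\<bar>) (indicator (escaping_trees x h)) \<tau>"
    by (simp add: tree_average_add weight_bound_def)
  finally show ?thesis .
qed

text \<open>The mass in the cube is at least 1 - 1 / 4 - 1 / 4; its square is bounded by
  Cauchy-Schwarz against the indicator of the cube.\<close>

lemma sum_weights_square_ge:
  assumes w: "(\<Sum>r=0..J. w r) = 1" and B: "1 \<le> B" and \<tau>: "\<And>b r. b \<in> {1..B} \<Longrightarrow> r \<le> J \<Longrightarrow> \<tau> (b, r) \<in> space tree_space"
    and "weight_bound x n B J w xs \<tau> \<le> 1 / 4"
    and "tree_average B J (\<lambda>r. \<bar>w r\<bar>) (indicator (escaping_trees x h)) \<tau> \<le> 1 / 4"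
    and m: "(\<Sum>i=1..n. indicator (cube x h) (xs i)) \<le> m" "0 < m"
  shows "1 / (4 * m) \<le> (\<Sum>i=1..n. (forest_weight x n B J w xs \<tau> i)\<^sup>2)"
proof -
  let ?s = "\<Sum>i=1..n. forest_weight x n B J w xs \<tau> i * indicator (cube x h) (xs i)"
  have "1 / 2 \<le> ?s" using local_weight_mass[where x=x and n=n and xs=xs and h=h and \<tau>=\<tau>, OF w B \<tau>] assms(4,5) by linarith
  then have "(1 / 2)\<^sup>2 \<le> ?s\<^sup>2" by (rule power_mono) simp
  also have "\<dots> \<le> (\<Sum>i=1..n. (forest_weight x n B J w xs \<tau> i)\<^sup>2) * (\<Sum>i=1..n. (indicator (cube x h) (xs i))\<^sup>2)"
    by (rule Cauchy_Schwarz_ineq_sum)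
  also have "(\<Sum>i=1..n. (indicator (cube x h) (xs i))\<^sup>2) = (\<Sum>i=1..n. indicator (cube x h) (xs i) :: real)"
    by (intro sum.cong refl) (simp add: indicator_def)
  also have "(\<Sum>i=1..n. (forest_weight x n B J w xs \<tau> i)\<^sup>2) * \<dots> \<le> (\<Sum>i=1..n. (forest_weight x n B J w xs \<tau> i)\<^sup>2) * m"
    by (intro mult_left_mono m sum_nonneg) auto
  finally show ?thesis using m(2) by (simp add: field_simps power2_eq_square)
qed

context regression_model
begin

lemma residual_facts:
  shows "integrable U (\<lambda>v. (\<psi> x v - \<mu> x)\<^sup>2)" "(\<integral>v. \<psi> x v - \<mu> x \<partial>U) = 0" "(\<integral>v. (\<psi> x v - \<mu> x)\<^sup>2 \<partial>U) = \<sigma> x"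
    "integrable U (\<lambda>v. \<bar>\<psi> x v - \<mu> x\<bar> powr (2 + d))" "(\<integral>v. \<bar>\<psi> x v - \<mu> x\<bar> powr (2 + d) \<partial>U) \<le> C0"
    "integrable U (\<psi> x)" "(\<integral>v. \<psi> x v \<partial>U) = \<mu> x"
proof -
  have [measurable]: "(\<lambda>v. \<psi> x v - \<mu> x) \<in> borel_measurable U" using \<psi>_measurable2[of x] by measurable
  note r = residual[of x, unfolded centered_moments_def]
  show "integrable U (\<lambda>v. (\<psi> x v - \<mu> x)\<^sup>2)" "(\<integral>v. (\<psi> x v - \<mu> x)\<^sup>2 \<partial>U) = \<sigma> x"
    "integrable U (\<lambda>v. \<bar>\<psi> x v - \<mu> x\<bar> powr (2 + d))" "(\<integral>v. \<bar>\<psi> x v - \<mu> x\<bar> powr (2 + d) \<partial>U) \<le> C0"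
    and z: "(\<integral>v. \<psi> x v - \<mu> x \<partial>U) = 0"
    using r by (simp_all add: integrable_distr_eq integral_distr)
  have "integrable (distr U borel (\<lambda>v. \<psi> x v - \<mu> x)) (\<lambda>y. y)"
    by (rule integrable_of_square) (use r in auto)
  then have "integrable U (\<lambda>v. \<psi> x v - \<mu> x)" by (simp add: integrable_distr_eq)
  from Bochner_Integration.integrable_add[OF this, of "\<lambda>_. \<mu> x"] show i: "integrable U (\<psi> x)" by simp
  show "(\<integral>v. \<psi> x v \<partial>U) = \<mu> x" using z i U.prob_space by simp
qed

text \<open>|c|^(2 + d) = c^2 |c|^d, and \<open>c0\<close> <= \<open>\<sigma> x\<close> turns the
  moment bound into a multiple of the variance. The multiple depends only on the common bound b, as
  \<open>berry_esseen\<close> requires.\<close>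

lemma scaled_residual:
  assumes c: "\<bar>c\<bar> \<le> b" "0 < d"
  shows "centered_moments d (distr U borel (\<lambda>v. c * (\<psi> x v - \<mu> x))) (c\<^sup>2 * \<sigma> x) (C0 / c0 * b powr d * (c\<^sup>2 * \<sigma> x))"
proof -
  have [measurable]: "(\<lambda>v. \<psi> x v - \<mu> x) \<in> borel_measurable U" using \<psi>_measurable2[of x] by measurable
  have cp: "\<bar>c * y\<bar> powr (2 + d) = \<bar>c\<bar> powr (2 + d) * \<bar>y\<bar> powr (2 + d)" for y by (simp add: abs_mult powr_mult)
  have c2: "\<bar>c\<bar> powr (2 + d) = c\<^sup>2 * \<bar>c\<bar> powr d"
    by (cases "c = 0") (auto simp: powr_add powr_numeral)
  have "\<bar>c\<bar> powr (2 + d) * (\<integral>v. \<bar>\<psi> x v - \<mu> x\<bar> powr (2 + d) \<partial>U) \<le> (c\<^sup>2 * b powr d) * C0"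
    unfolding c2 using c residual_facts(5)[of x]
    by (intro mult_mono mult_nonneg_nonneg powr_mono2) auto
  also have "\<dots> \<le> (c\<^sup>2 * b powr d) * (C0 * (\<sigma> x / c0))"
    using pos \<sigma>_bounds(1)[of x] by (intro mult_left_mono) (auto simp: field_simps)
  also have "\<dots> = C0 / c0 * b powr d * (c\<^sup>2 * \<sigma> x)" by simp
  finally have "\<bar>c\<bar> powr (2 + d) * (\<integral>v. \<bar>\<psi> x v - \<mu> x\<bar> powr (2 + d) \<partial>U) \<le> C0 / c0 * b powr d * (c\<^sup>2 * \<sigma> x)" .
  then show ?thesis
    unfolding centered_moments_def
    using residual_facts[of x] by (simp add: U.prob_space_distr integrable_distr_eq integral_distr power_mult_distrib cp)
qed

text \<open>The summands are divided by sqrt V, so the total variance is 1 and only the common ratio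
  of moment to variance remains in the bound of \<open>berry_esseen\<close>.\<close>

lemma weighted_residual_normal_approx:
  assumes d: "0 < d" "d \<le> 1"
  shows "\<exists>C>0. \<forall>(n :: nat) s xs b V t. (\<forall>i\<in>{1..n}. \<bar>s i\<bar> \<le> b) \<longrightarrow> V = (\<Sum>i=1..n. (s i)\<^sup>2 * \<sigma> (xs i)) \<longrightarrow> 0 < V \<longrightarrow>
    \<bar>measure (PiM {1..n} (\<lambda>_. U)) {v \<in> space (PiM {1..n} (\<lambda>_. U)).
       (\<Sum>i=1..n. s i * (\<psi> (xs i) (v i) - \<mu> (xs i))) / sqrt V \<le> t} - cdf std_normal_distribution t\<bar>
    \<le> C * (b / sqrt V) powr d"
proof -
  obtain C where C: "0 < C" and BE: "\<And>m s \<rho> N t. (\<forall>j<N. centered_moments d (m j) (s j) (\<rho> * s j)) \<Longrightarrow> 0 < (\<Sum>j<N. s j) \<Longrightarrow>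
    \<bar>cdf (sum_law m N) t - cdf (gauss (\<Sum>j<N. s j)) t\<bar> \<le> C * (\<rho> * (\<Sum>j<N. s j) powr (- (d / 2)))"
    using berry_esseen[OF d] by blast
  show ?thesis
  proof (intro exI[of _ "C * (C0 / c0)"] conjI allI impI)
    show "0 < C * (C0 / c0)" using C pos by simp
    fix n :: nat and s :: "nat \<Rightarrow> real" and xs b V t
    assume b: "\<forall>i\<in>{1..n}. \<bar>s i\<bar> \<le> b" and V: "V = (\<Sum>i=1..n. (s i)\<^sup>2 * \<sigma> (xs i))" "0 < V"
    define g where "g i v = s i / sqrt V * (\<psi> (xs i) v - \<mu> (xs i))" for i v
    have g_m: "g i \<in> borel_measurable U" for i
      unfolding g_def[abs_def] using \<psi>_measurable2[of "xs i"] by measurable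
    let ?m = "\<lambda>j. distr U borel (g (Suc j))"
    let ?s = "\<lambda>j. (s (Suc j) / sqrt V)\<^sup>2 * \<sigma> (xs (Suc j))"
    have "(\<Sum>j<n. ?s j) = (\<Sum>i=1..n. (s i / sqrt V)\<^sup>2 * \<sigma> (xs i))" by (simp add: sum.atLeast1_atMost_eq)
    also have "\<dots> = 1" using V by (simp add: power_divide sum_divide_distrib[symmetric])
    finally have one: "(\<Sum>j<n. ?s j) = 1" .
    have cm: "\<forall>j<n. centered_moments d (?m j) (?s j) (C0 / c0 * (b / sqrt V) powr d * ?s j)"
    proof (intro allI impI)
      fix j assume "j < n"
      then have "\<bar>s (Suc j) / sqrt V\<bar> \<le> b / sqrt V" using b V(2) by (simp add: divide_right_mono)
      from scaled_residual[OF this d(1), of "xs (Suc j)"]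
      show "centered_moments d (?m j) (?s j) (C0 / c0 * (b / sqrt V) powr d * ?s j)" by (simp add: g_def[abs_def])
    qed
    have g1: "gauss 1 = std_normal_distribution" by (simp add: gauss_def comp_def)
    have sum_g: "(\<Sum>i=1..n. g i (v i)) = (\<Sum>i=1..n. s i * (\<psi> (xs i) (v i) - \<mu> (xs i))) / sqrt V" for v
      by (simp add: g_def sum_divide_distrib)
    have sm: "(\<lambda>v. \<Sum>i=1..n. g i (v i)) \<in> borel_measurable (PiM {1..n} (\<lambda>_. U))"
      using g_m by measurable
    have law: "sum_law ?m n = distr (PiM {1..n} (\<lambda>_. U)) borel (\<lambda>v. \<Sum>i=1..n. g i (v i))"
      by (rule distr_sum_eq_sum_law[OF U.prob_space_axioms g_m, symmetric])
    have eq: "cdf (sum_law ?m n) t = measure (PiM {1..n} (\<lambda>_. U)) {v \<in> space (PiM {1..n} (\<lambda>_. U)). (\<Sum>i=1..n. g i (v i)) \<le> t}"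
      unfolding law cdf_def
      by (subst measure_distr[OF sm]) (auto intro!: arg_cong[where f="measure _"])
    show "\<bar>measure (PiM {1..n} (\<lambda>_. U)) {v \<in> space (PiM {1..n} (\<lambda>_. U)).
       (\<Sum>i=1..n. s i * (\<psi> (xs i) (v i) - \<mu> (xs i))) / sqrt V \<le> t} - cdf std_normal_distribution t\<bar>
      \<le> C * (C0 / c0) * (b / sqrt V) powr d"
      using BE[OF cm, of t] zero_less_one unfolding eq one g1 sum_g by (simp add: mult.assoc)
  qed
qed

end

section \<open>Law of the estimator\<close>

text \<open>Otherwise the simplifier turns the index set \<open>{1..n}\<close> of product spaces into \<open>{Suc 0..n}\<close>, which the rules
  stated for these spaces no longer match.\<close>

declare One_nat_def [simp del]

lemma tree_average_measurable:
  assumes "\<And>b r. b \<in> {1..B} \<Longrightarrow> r \<le> J \<Longrightarrow> (\<lambda>z. g z (t z (b, r))) \<in> borel_measurable N"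
  shows "(\<lambda>z. tree_average B J w (g z) (t z)) \<in> borel_measurable N"
  unfolding tree_average_def
  by (intro borel_measurable_sum borel_measurable_times borel_measurable_const assms) auto

lemma tree_average_cong:
  assumes "\<And>b r. b \<in> {1..B} \<Longrightarrow> r \<le> J \<Longrightarrow> g (t (b, r)) = g' (t' (b, r))"
  shows "tree_average B J w g t = tree_average B J w g' t'"
  unfolding tree_average_def by (intro sum.cong arg_cong2[where f="(*)"] refl) (use assms in auto)

lemma cell_count_cong: "(\<And>i. i \<in> {1..n} \<Longrightarrow> xs i = xs' i) \<Longrightarrow> cell_count x n xs T = cell_count x n xs' T"
  unfolding cell_count_def by (intro sum.cong) auto

text \<open>Tuples in product spaces are restricted to their index sets, the sequences in the
  estimator are not; the weights depend on the common part.\<close>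

lemma forest_weight_cong:
  assumes "\<And>i. i \<in> {1..n} \<Longrightarrow> xs i = xs' i" "\<And>b r. b \<in> {1..B} \<Longrightarrow> r \<le> J \<Longrightarrow> \<tau> (b, r) = \<tau>' (b, r)" "i \<in> {1..n}"
  shows "forest_weight x n B J w xs \<tau> i = forest_weight x n B J w xs' \<tau>' i"
proof -
  have "cell_count x n xs = cell_count x n xs'" by (rule ext) (rule cell_count_cong[OF assms(1)])
  then show ?thesis
    unfolding forest_weight_def
    by (intro tree_average_cong) (simp add: assms(2) assms(1)[OF assms(3)])
qed

lemma escaping_trees_sets [measurable]: "escaping_trees x h \<in> sets tree_space"
  unfolding escaping_trees_def by measurable

lemma cube_sets [measurable]: "cube x h \<in> sets borel"
proof -
  have "cube x h = cbox 0 1 \<inter> (\<Inter>j. {y. \<bar>y $ j - x $ j\<bar> \<le> h})" by (auto simp: cube_def)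
  moreover have "{y. \<bar>y $ j - x $ j\<bar> \<le> h} \<in> sets borel" for j by measurable
  ultimately show ?thesis by (auto intro!: sets.Int sets.finite_INT)
qed

section \<open>The sample as a function of design and uniforms\<close>

locale forest_experiment = regression_model P \<psi> \<nu> U d \<mu> \<sigma> C0 c0 cf Cf K
  for P :: "((real ^ 'd) \<times> real) measure" and \<psi> \<nu> U d \<mu> \<sigma> C0 c0 cf Cf K +
  fixes M :: "'w measure" and n B J :: nat and a w :: "nat \<Rightarrow> real" and lam :: real
    and X :: "nat \<Rightarrow> 'w \<Rightarrow> real ^ 'd" and Y :: "nat \<Rightarrow> 'w \<Rightarrow> real"
    and T :: "nat \<Rightarrow> nat \<Rightarrow> 'w \<Rightarrow> 'd mondrian_tree" and x :: "real ^ 'd"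
  assumes sample: "forest_sample M P n B J a lam X Y T"
    and n: "1 \<le> n" and B: "1 \<le> B" and lam: "0 < lam" and a: "\<And>r. r \<le> J \<Longrightarrow> 0 < a r"
    and w: "(\<Sum>r=0..J. w r) = 1" and x: "x \<in> box 0 1"
begin

sublocale M: prob_space M using sample by (simp add: forest_sample_def)

abbreviation "NX \<equiv> PiM {1..n} (\<lambda>_. borel \<Otimes>\<^sub>M borel) :: (nat \<Rightarrow> (real ^ 'd) \<times> real) measure"
abbreviation "TT \<equiv> tree_tuple_space B J :: (nat \<times> nat \<Rightarrow> 'd mondrian_tree) measure"
abbreviation "V \<equiv> PiM {1..n} (\<lambda>_. U)"

text \<open>The setting of the disintegration: \<open>A\<close> is the law of a design, that is of
  covariates and trees; \<open>\<Theta>\<close> builds a sample from a design and uniform variables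
  by conditional quantiles, and \<open>\<pi>\<close> forgets the responses.\<close>

definition "D \<omega> = (\<lambda>i\<in>{1..n}. (X i \<omega>, Y i \<omega>))"
definition "Q = distr M TT (tree_tuple B J T)"
definition "A = PiM {1..n} (\<lambda>_. \<nu>) \<Otimes>\<^sub>M Q"
definition "Z \<omega> = (D \<omega>, tree_tuple B J T \<omega>)"
definition "\<Theta> z = (\<lambda>i\<in>{1..n}. (fst (fst z) i, \<psi> (fst (fst z) i) (snd z i)), snd (fst z))"
definition "\<pi> y = (\<lambda>i\<in>{1..n}. fst (fst y i), snd y)"

lemma XY_measurable: "i \<in> {1..n} \<Longrightarrow> (\<lambda>\<omega>. (X i \<omega>, Y i \<omega>)) \<in> M \<rightarrow>\<^sub>M borel \<Otimes>\<^sub>M borel"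
  and T_measurable: "b \<in> {1..B} \<Longrightarrow> r \<le> J \<Longrightarrow> T b r \<in> M \<rightarrow>\<^sub>M tree_space"
proof -
  have "M.indep_vars (\<lambda>_. borel) (\<lambda>i \<omega>. (X i \<omega>, Y i \<omega>)) {1..n}"
    using sample unfolding forest_sample_def by blast
  then show "(\<lambda>\<omega>. (X i \<omega>, Y i \<omega>)) \<in> M \<rightarrow>\<^sub>M borel \<Otimes>\<^sub>M borel" if "i \<in> {1..n}"
    using that unfolding M.indep_vars_def borel_prod by blast
  have "M.indep_vars (\<lambda>_. tree_space) (\<lambda>(b, r). T b r) ({1..B} \<times> {0..J})"
    using sample unfolding forest_sample_def by blast
  then have *: "\<forall>i\<in>{1..B} \<times> {0..J}. (case i of (b, r) \<Rightarrow> T b r) \<in> M \<rightarrow>\<^sub>M tree_space"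
    unfolding M.indep_vars_def by blast
  show "T b r \<in> M \<rightarrow>\<^sub>M tree_space" if "b \<in> {1..B}" "r \<le> J"
    using bspec[OF *, of "(b, r)"] that by simp
qed

lemma X_measurable: "i \<in> {1..n} \<Longrightarrow> X i \<in> M \<rightarrow>\<^sub>M borel" and Y_measurable: "i \<in> {1..n} \<Longrightarrow> Y i \<in> borel_measurable M"
  using measurable_compose[OF XY_measurable measurable_fst] measurable_compose[OF XY_measurable measurable_snd] by simp_all

lemma D_measurable [measurable]: "D \<in> M \<rightarrow>\<^sub>M NX"
  unfolding D_def[abs_def] by (rule measurable_restrict) (rule XY_measurable)

lemma tree_tuple_measurable [measurable]: "tree_tuple B J T \<in> M \<rightarrow>\<^sub>M TT"
  unfolding tree_tuple_def[abs_def]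
  by (rule measurable_restrict) (use T_measurable in \<open>auto simp: split_beta\<close>)

sublocale Q: prob_space Q unfolding Q_def by (rule M.prob_space_distr) measurable
sublocale V: prob_space V by (rule prob_space_PiM) (rule U.prob_space_axioms)
sublocale NU: prob_space "PiM {1..n} (\<lambda>_. \<nu>)" by (rule prob_space_PiM) (rule \<nu>.prob_space_axioms)
sublocale NUQ: pair_prob_space "PiM {1..n} (\<lambda>_. \<nu>)" Q ..

lemma sets_Q [simp, measurable_cong]: "sets Q = sets TT" by (simp add: Q_def)

lemma sets_NU [simp, measurable_cong]: "sets (PiM {1..n} (\<lambda>_. \<nu>)) = sets (PiM {1..n} (\<lambda>_. borel))"
  by (rule sets_PiM_cong) auto

lemma sets_V [simp, measurable_cong]: "sets V = sets (PiM {1..n} (\<lambda>_. borel))"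
  by (rule sets_PiM_cong) auto

lemma sets_A [simp, measurable_cong]: "sets A = sets (PiM {1..n} (\<lambda>_. borel) \<Otimes>\<^sub>M TT)"
  unfolding A_def by (rule sets_pair_measure_cong) simp_all

lemma prob_space_A: "prob_space A" unfolding A_def by unfold_locales
sublocale A: prob_space A by (rule prob_space_A)
sublocale AV: pair_prob_space A V ..

lemma Z_measurable [measurable]: "Z \<in> M \<rightarrow>\<^sub>M NX \<Otimes>\<^sub>M TT" unfolding Z_def[abs_def] by measurable

lemma \<pi>_measurable [measurable]: "\<pi> \<in> NX \<Otimes>\<^sub>M TT \<rightarrow>\<^sub>M A"
proof -
  have "(\<lambda>z. (\<lambda>i\<in>{1..n}. fst (fst z i), snd z)) \<in> NX \<Otimes>\<^sub>M TT \<rightarrow>\<^sub>M PiM {1..n} (\<lambda>_. borel) \<Otimes>\<^sub>M TT" by measurable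
  then show ?thesis unfolding \<pi>_def[abs_def] measurable_cong_sets[OF refl sets_A] .
qed

lemma quantile_tuple_measurable:
  "(\<lambda>(xs, v). \<lambda>i\<in>{1..n}. (xs i, \<psi> (xs i) (v i))) \<in> PiM {1..n} (\<lambda>_. borel) \<Otimes>\<^sub>M PiM {1..n} (\<lambda>_. borel) \<rightarrow>\<^sub>M NX"
proof -
  have [measurable]: "(\<lambda>z. \<psi> (fst z) (snd z)) \<in> borel_measurable (borel \<Otimes>\<^sub>M borel)"
    using \<psi>_measurable by (simp add: split_beta)
  have "(\<lambda>z. \<psi> (fst (fst z i, snd z i)) (snd (fst z i, snd z i))) \<in> borel_measurable (PiM {1..n} (\<lambda>_. borel) \<Otimes>\<^sub>M PiM {1..n} (\<lambda>_. borel))"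
    if "i \<in> {1..n}" for i
    by (rule measurable_compose[OF _ \<open>(\<lambda>z. \<psi> (fst z) (snd z)) \<in> _\<close>]) (use that in measurable)
  then show ?thesis unfolding split_beta by (intro measurable_restrict measurable_Pair) auto
qed

lemma \<Theta>_measurable [measurable]: "\<Theta> \<in> A \<Otimes>\<^sub>M V \<rightarrow>\<^sub>M NX \<Otimes>\<^sub>M TT"
proof -
  have 1: "(\<lambda>z. (fst (fst z), snd z)) \<in> A \<Otimes>\<^sub>M V \<rightarrow>\<^sub>M PiM {1..n} (\<lambda>_. borel) \<Otimes>\<^sub>M PiM {1..n} (\<lambda>_. borel)" by measurable
  have 2: "(\<lambda>z. snd (fst z)) \<in> A \<Otimes>\<^sub>M V \<rightarrow>\<^sub>M TT" by measurable
  show ?thesis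
    unfolding \<Theta>_def[abs_def] using measurable_Pair[OF measurable_compose[OF 1 quantile_tuple_measurable] 2] by (simp add: split_beta)
qed

lemma \<pi>_\<Theta>: "z \<in> space A \<Longrightarrow> \<pi> (\<Theta> (z, v)) = z"
proof -
  assume "z \<in> space A"
  then have "fst z \<in> extensional {1..n}" by (auto simp: A_def space_pair_measure space_PiM PiE_def)
  then have "(\<lambda>i\<in>{1..n}. fst z i) = fst z" by (rule extensional_restrict)
  moreover have "\<pi> (\<Theta> (z, v)) = (\<lambda>i\<in>{1..n}. fst z i, snd z)" by (simp add: \<pi>_def \<Theta>_def cong: restrict_cong)
  ultimately show ?thesis by simp
qed

lemma distr_D: "distr M NX D = PiM {1..n} (\<lambda>_. P)"
proof -
  have "M.indep_vars (\<lambda>_. borel \<Otimes>\<^sub>M borel) (\<lambda>i \<omega>. (X i \<omega>, Y i \<omega>)) {1..n}"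
    using sample unfolding forest_sample_def borel_prod by blast
  then have "distr M NX D = PiM {1..n} (\<lambda>i. distr M (borel \<Otimes>\<^sub>M borel) (\<lambda>\<omega>. (X i \<omega>, Y i \<omega>)))"
    unfolding D_def[abs_def] by (subst (asm) M.indep_vars_iff_distr_eq_PiM') (use n XY_measurable in auto)
  also have "\<dots> = PiM {1..n} (\<lambda>_. P)"
    by (rule PiM_cong) (use sample in \<open>auto simp: forest_sample_def borel_prod\<close>)
  finally show ?thesis .
qed

text \<open>Two measures on a product agree if they do so on rectangles. There the independence of
  data and trees separates the factors, and \<open>PiM_quantile\<close> rewrites the one of the
  data.\<close>

lemma law: "distr M (NX \<Otimes>\<^sub>M TT) Z = distr (A \<Otimes>\<^sub>M V) (NX \<Otimes>\<^sub>M TT) \<Theta>"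
proof (rule prob_eqI_rectangles)
  show "finite_measure (distr M (NX \<Otimes>\<^sub>M TT) Z)"
    by (rule prob_space.finite_measure, rule M.prob_space_distr) measurable
  fix E F assume E [measurable]: "E \<in> sets NX" and F [measurable]: "F \<in> sets TT"
  have EF [measurable]: "E \<times> F \<in> sets (NX \<Otimes>\<^sub>M TT)" by (rule pair_measureI[OF E F])
  have qm [measurable]: "(\<lambda>(xs, v). \<lambda>i\<in>{1..n}. (xs i, \<psi> (xs i) (v i))) \<in> PiM {1..n} (\<lambda>_. \<nu>) \<Otimes>\<^sub>M V \<rightarrow>\<^sub>M NX"
    using quantile_tuple_measurable by measurable
  have m2: "(\<lambda>z. indicator E ((\<lambda>(xs, v). \<lambda>i\<in>{1..n}. (xs i, \<psi> (xs i) (v i))) z) :: ennreal) \<in> borel_measurable (PiM {1..n} (\<lambda>_. \<nu>) \<Otimes>\<^sub>M V)"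
    by (rule measurable_compose[OF qm borel_measurable_indicator[OF E]])
  have "M.indep_set (sets (vimage_algebra (space M) D NX)) (sets (vimage_algebra (space M) (tree_tuple B J T) TT))"
    using sample unfolding forest_sample_def D_def[abs_def] borel_prod by blast
  from M.indep_setD[OF this in_vimage_algebra[OF E] in_vimage_algebra[OF F]]
  have "measure M ((D -` E \<inter> space M) \<inter> (tree_tuple B J T -` F \<inter> space M)) = measure M (D -` E \<inter> space M) * measure M (tree_tuple B J T -` F \<inter> space M)"
    .
  moreover have "(D -` E \<inter> space M) \<inter> (tree_tuple B J T -` F \<inter> space M) = Z -` (E \<times> F) \<inter> space M"
    by (auto simp: Z_def)
  ultimately have "emeasure (distr M (NX \<Otimes>\<^sub>M TT) Z) (E \<times> F) = emeasure (distr M NX D) E * emeasure Q F"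
    by (simp add: emeasure_distr[OF Z_measurable EF] emeasure_distr[OF D_measurable E] emeasure_distr[OF tree_tuple_measurable F] Q_def M.emeasure_eq_measure ennreal_mult')
  also have "emeasure (distr M NX D) E = emeasure (distr (PiM {1..n} (\<lambda>_. \<nu>) \<Otimes>\<^sub>M V) NX (\<lambda>(xs, v). \<lambda>i\<in>{1..n}. (xs i, \<psi> (xs i) (v i)))) E"
    unfolding distr_D by (subst PiM_quantile) (use \<nu>.prob_space_axioms U.prob_space_axioms \<psi>_measurable \<psi> in auto)
  also have "\<dots> = (\<integral>\<^sup>+z. indicator E ((\<lambda>(xs, v). \<lambda>i\<in>{1..n}. (xs i, \<psi> (xs i) (v i))) z) \<partial>(PiM {1..n} (\<lambda>_. \<nu>) \<Otimes>\<^sub>M V))"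
    using nn_integral_distr[OF qm, of "indicator E"] E by simp
  also have "\<dots> = (\<integral>\<^sup>+xs. \<integral>\<^sup>+v. indicator E (\<lambda>i\<in>{1..n}. (xs i, \<psi> (xs i) (v i))) \<partial>V \<partial>PiM {1..n} (\<lambda>_. \<nu>))"
    by (subst V.nn_integral_fst[OF m2, symmetric]) simp
  also have "\<dots> * emeasure Q F = (\<integral>\<^sup>+xs. (\<integral>\<^sup>+v. indicator E (\<lambda>i\<in>{1..n}. (xs i, \<psi> (xs i) (v i))) \<partial>V) * emeasure Q F \<partial>PiM {1..n} (\<lambda>_. \<nu>))"
  proof (rule nn_integral_multc[symmetric])
    from V.borel_measurable_nn_integral_fst[OF m2]
    show "(\<lambda>xs. \<integral>\<^sup>+v. indicator E (\<lambda>i\<in>{1..n}. (xs i, \<psi> (xs i) (v i))) \<partial>V) \<in> borel_measurable (PiM {1..n} (\<lambda>_. \<nu>))" by simp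
  qed
  also have "\<dots> = (\<integral>\<^sup>+xs. (\<integral>\<^sup>+\<tau>. (\<integral>\<^sup>+v. indicator E (\<lambda>i\<in>{1..n}. (xs i, \<psi> (xs i) (v i))) * indicator F \<tau> \<partial>V) \<partial>Q) \<partial>PiM {1..n} (\<lambda>_. \<nu>))"
  proof (rule nn_integral_cong)
    fix xs assume xs: "xs \<in> space (PiM {1..n} (\<lambda>_. \<nu>))"
    have m1: "(\<lambda>v. \<lambda>i\<in>{1..n}. (xs i, \<psi> (xs i) (v i))) \<in> V \<rightarrow>\<^sub>M NX"
      by (intro measurable_restrict measurable_Pair) (use \<psi>_measurable2 in measurable)
    have m: "(\<lambda>v. indicator E (\<lambda>i\<in>{1..n}. (xs i, \<psi> (xs i) (v i))) :: ennreal) \<in> borel_measurable V"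
      by (rule measurable_compose[OF m1 borel_measurable_indicator[OF E]])
    show "(\<integral>\<^sup>+v. indicator E (\<lambda>i\<in>{1..n}. (xs i, \<psi> (xs i) (v i))) \<partial>V) * emeasure Q F =
      (\<integral>\<^sup>+\<tau>. (\<integral>\<^sup>+v. indicator E (\<lambda>i\<in>{1..n}. (xs i, \<psi> (xs i) (v i))) * indicator F \<tau> \<partial>V) \<partial>Q)"
      using F by (simp add: nn_integral_multc[OF m] nn_integral_cmult_indicator)
  qed
  also have "\<dots> = (\<integral>\<^sup>+z. \<integral>\<^sup>+v. indicator (E \<times> F) (\<Theta> (z, v)) \<partial>V \<partial>A)"
  proof -
    have "(\<lambda>z. indicator (E \<times> F) (\<Theta> z) :: ennreal) \<in> borel_measurable (A \<Otimes>\<^sub>M V)"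
      by (rule measurable_compose[OF \<Theta>_measurable borel_measurable_indicator[OF EF]])
    from V.borel_measurable_nn_integral_fst[OF this]
    have "(\<lambda>z. \<integral>\<^sup>+v. indicator (E \<times> F) (\<Theta> (z, v)) \<partial>V) \<in> borel_measurable (PiM {1..n} (\<lambda>_. \<nu>) \<Otimes>\<^sub>M Q)" by (simp add: A_def)
    from Q.nn_integral_fst[OF this] show ?thesis by (simp add: A_def \<Theta>_def indicator_times)
  qed
  also have "\<dots> = (\<integral>\<^sup>+z. indicator (E \<times> F) (\<Theta> z) \<partial>(A \<Otimes>\<^sub>M V))"
    by (rule V.nn_integral_fst) measurable
  also have "\<dots> = emeasure (distr (A \<Otimes>\<^sub>M V) (NX \<Otimes>\<^sub>M TT) \<Theta>) (E \<times> F)"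
    using nn_integral_distr[OF \<Theta>_measurable, of "indicator (E \<times> F)"] EF by simp
  finally show "emeasure (distr M (NX \<Otimes>\<^sub>M TT) Z) (E \<times> F) = emeasure (distr (A \<Otimes>\<^sub>M V) (NX \<Otimes>\<^sub>M TT) \<Theta>) (E \<times> F)" .
qed simp_all

text \<open>The letter z stands for a design and y for a sample. Given the design, the weights are
  constants, so mean and variance of the estimator are these sums.\<close>

definition "S z i = forest_weight x n B J w (fst z) (snd z) i"
definition "max_weight z = weight_bound x n B J w (fst z) (snd z)"
definition "cond_mean z = (\<Sum>i=1..n. S z i * \<mu> (fst z i))"
definition "cond_variance z = (\<Sum>i=1..n. (S z i)\<^sup>2 * \<sigma> (fst z i))"
definition "estimate y = (\<Sum>i=1..n. S (\<pi> y) i * snd (fst y i))"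
definition "residual_sum y = (\<Sum>i=1..n. S (\<pi> y) i * (snd (fst y i) - \<mu> (fst (\<pi> y) i)))"

lemma same_cell_A_measurable:
  "i \<in> {1..n} \<Longrightarrow> b \<in> {1..B} \<Longrightarrow> r \<le> J \<Longrightarrow> (\<lambda>z. same_cell x (fst z i) (snd z (b, r))) \<in> borel_measurable A"
  by measurable

lemma cell_count_A_measurable:
  "b \<in> {1..B} \<Longrightarrow> r \<le> J \<Longrightarrow> (\<lambda>z. cell_count x n (fst z) (snd z (b, r))) \<in> borel_measurable A"
  unfolding cell_count_def by (intro borel_measurable_sum same_cell_A_measurable) auto

lemma S_measurable [measurable]: "i \<in> {1..n} \<Longrightarrow> (\<lambda>z. S z i) \<in> borel_measurable A"
  unfolding S_def forest_weight_def
  by (intro tree_average_measurable borel_measurable_divide same_cell_A_measurable cell_count_A_measurable) auto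

lemma max_weight_measurable [measurable]: "max_weight \<in> borel_measurable A"
  unfolding max_weight_def[abs_def] weight_bound_def
  by (intro tree_average_measurable borel_measurable_divide borel_measurable_max borel_measurable_const cell_count_A_measurable) auto

lemma cond_mean_measurable [measurable]: "cond_mean \<in> borel_measurable A" and cond_variance_measurable [measurable]: "cond_variance \<in> borel_measurable A"
  unfolding cond_mean_def[abs_def] cond_variance_def[abs_def] by measurable

lemma estimate_measurable [measurable]: "estimate \<in> borel_measurable (NX \<Otimes>\<^sub>M TT)"
  and residual_sum_measurable [measurable]: "residual_sum \<in> borel_measurable (NX \<Otimes>\<^sub>M TT)"
proof -
  have 1: "(\<lambda>y. S (\<pi> y) i) \<in> borel_measurable (NX \<Otimes>\<^sub>M TT)" if "i \<in> {1..n}" for i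
    by (rule measurable_compose[OF \<pi>_measurable S_measurable[OF that]])
  have "(\<lambda>z. fst z i) \<in> A \<rightarrow>\<^sub>M borel" if "i \<in> {1..n}" for i using that by measurable
  from measurable_compose[OF \<pi>_measurable this]
  have 2: "(\<lambda>y. fst (\<pi> y) i) \<in> NX \<Otimes>\<^sub>M TT \<rightarrow>\<^sub>M borel" if "i \<in> {1..n}" for i using that .
  have 3: "(\<lambda>y. snd (fst y i)) \<in> borel_measurable (NX \<Otimes>\<^sub>M TT)" if "i \<in> {1..n}" for i using that by measurable
  show "estimate \<in> borel_measurable (NX \<Otimes>\<^sub>M TT)" "residual_sum \<in> borel_measurable (NX \<Otimes>\<^sub>M TT)"
    unfolding estimate_def[abs_def] residual_sum_def[abs_def]
    by (intro borel_measurable_sum borel_measurable_times borel_measurable_diff 1 3 measurable_compose[OF 2 \<mu>_measurable]; assumption)+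
qed

lemma S_bound: "i \<in> {1..n} \<Longrightarrow> \<bar>S z i\<bar> \<le> max_weight z" unfolding S_def max_weight_def by (rule forest_weight_abs_le)

lemma max_weight_bounds: "0 \<le> max_weight z" "max_weight z \<le> (\<Sum>r=0..J. \<bar>w r\<bar>)" unfolding max_weight_def by (rule weight_bound_bounds[OF B])+

lemma estimate_Z: "estimate (Z \<omega>) = debiased_forest n B J w (\<lambda>i. X i \<omega>) (\<lambda>i. Y i \<omega>) (\<lambda>b r. T b r \<omega>) x"
proof -
  have "debiased_forest n B J w (\<lambda>i. X i \<omega>) (\<lambda>i. Y i \<omega>) (\<lambda>b r. (\<lambda>(b, r). T b r \<omega>) (b, r)) x =
      (\<Sum>i=1..n. forest_weight x n B J w (\<lambda>i. X i \<omega>) (\<lambda>(b, r). T b r \<omega>) i * Y i \<omega>)"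
    by (rule debiased_forest_eq)
  also have "\<dots> = estimate (Z \<omega>)"
    unfolding estimate_def S_def
    by (intro sum.cong refl arg_cong2[where f="(*)"] forest_weight_cong) (auto simp: Z_def D_def \<pi>_def tree_tuple_def)
  finally show ?thesis by simp
qed

lemma design_algebra_eq: "design_algebra M n B J X T = vimage_algebra (space M) (\<lambda>\<omega>. \<pi> (Z \<omega>)) A"
proof -
  have "(\<lambda>\<omega>. \<pi> (Z \<omega>)) = (\<lambda>\<omega>. (\<lambda>i\<in>{1..n}. X i \<omega>, tree_tuple B J T \<omega>))"
    by (auto simp: \<pi>_def Z_def D_def fun_eq_iff)
  then show ?thesis unfolding design_algebra_def by (simp add: vimage_algebra_cong[OF refl refl sets_A])
qed

end

section \<open>Conditional mean, variance and the statistic\<close>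

context forest_experiment
begin

abbreviation "\<Omega> \<equiv> (\<Sum>r=0..J. \<bar>w r\<bar>)"

lemma Y_square_integrable: "i \<in> {1..n} \<Longrightarrow> integrable M (\<lambda>\<omega>. (Y i \<omega>)\<^sup>2)"
proof -
  assume i: "i \<in> {1..n}"
  have "distr M (borel \<Otimes>\<^sub>M borel) (\<lambda>\<omega>. (X i \<omega>, Y i \<omega>)) = P"
    using sample i unfolding forest_sample_def borel_prod by blast
  then have "integrable (distr M (borel \<Otimes>\<^sub>M borel) (\<lambda>\<omega>. (X i \<omega>, Y i \<omega>))) (\<lambda>z. (snd z)\<^sup>2)"
    using square_integrable by simp
  then show ?thesis by (subst (asm) integrable_distr_eq[OF XY_measurable[OF i]]) auto
qed

lemma Z_simps: "i \<in> {1..n} \<Longrightarrow> fst (Z \<omega>) i = (X i \<omega>, Y i \<omega>)" "i \<in> {1..n} \<Longrightarrow> fst (\<pi> (Z \<omega>)) i = X i \<omega>"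
    "b \<in> {1..B} \<Longrightarrow> r \<le> J \<Longrightarrow> snd (\<pi> (Z \<omega>)) (b, r) = T b r \<omega>"
  by (simp_all add: Z_def D_def \<pi>_def tree_tuple_def)

lemma estimate_\<Theta>: "z \<in> space A \<Longrightarrow> estimate (\<Theta> (z, v)) = (\<Sum>i=1..n. S z i * \<psi> (fst z i) (v i))"
  unfolding estimate_def by (simp add: \<pi>_\<Theta>) (simp add: \<Theta>_def)

lemma residual_sum_\<Theta>: "z \<in> space A \<Longrightarrow> residual_sum (\<Theta> (z, v)) = (\<Sum>i=1..n. S z i * (\<psi> (fst z i) (v i) - \<mu> (fst z i)))"
  unfolding residual_sum_def by (simp add: \<pi>_\<Theta>) (simp add: \<Theta>_def)

lemma S_bound': "i \<in> {1..n} \<Longrightarrow> \<bar>S z i\<bar> \<le> \<Omega>" using S_bound max_weight_bounds order.trans by blast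

lemma integrable_estimate: "integrable M (\<lambda>\<omega>. estimate (Z \<omega>))"
proof -
  have "integrable M (\<lambda>\<omega>. S (\<pi> (Z \<omega>)) i * Y i \<omega>)" if i: "i \<in> {1..n}" for i
  proof (rule Bochner_Integration.integrable_bound[where f="\<lambda>\<omega>. \<Omega> * (1 + (Y i \<omega>)\<^sup>2)"])
    have y: "\<bar>y\<bar> \<le> 1 + y\<^sup>2" for y :: real
      using zero_le_power2[of "\<bar>y\<bar> - 1"] by (simp add: power2_eq_square algebra_simps)
    have "\<bar>S (\<pi> (Z \<omega>)) i\<bar> * \<bar>Y i \<omega>\<bar> \<le> \<Omega> * (1 + (Y i \<omega>)\<^sup>2)" for \<omega>
      using S_bound'[OF i] y by (intro mult_mono) (auto intro: sum_nonneg)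
    then show "AE \<omega> in M. norm (S (\<pi> (Z \<omega>)) i * Y i \<omega>) \<le> norm (\<Omega> * (1 + (Y i \<omega>)\<^sup>2))"
      by (auto simp: abs_mult intro: order.trans[OF _ abs_ge_self])
    show "(\<lambda>\<omega>. S (\<pi> (Z \<omega>)) i * Y i \<omega>) \<in> borel_measurable M"
      by (intro borel_measurable_times Y_measurable[OF i] measurable_compose[OF _ S_measurable[OF i]]) measurable
  qed (use Y_square_integrable[OF i] in simp)
  then have "integrable M (\<lambda>\<omega>. \<Sum>i=1..n. S (\<pi> (Z \<omega>)) i * Y i \<omega>)" by (rule Bochner_Integration.integrable_sum)
  then show ?thesis unfolding estimate_def by (simp add: Z_simps)
qed

lemma integrable_residual_sum: "integrable M (\<lambda>\<omega>. (residual_sum (Z \<omega>))\<^sup>2)"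
proof (rule Bochner_Integration.integrable_bound[where f="\<lambda>\<omega>. (\<Sum>i=1..n. \<Omega>\<^sup>2 * (2 * (Y i \<omega>)\<^sup>2 + 2 * K\<^sup>2)) * real (card {1..n})"])
  have "(residual_sum (Z \<omega>))\<^sup>2 \<le> (\<Sum>i=1..n. \<Omega>\<^sup>2 * (2 * (Y i \<omega>)\<^sup>2 + 2 * K\<^sup>2)) * real (card {1..n})" for \<omega>
  proof -
    have "(residual_sum (Z \<omega>))\<^sup>2 \<le> (\<Sum>i=1..n. (S (\<pi> (Z \<omega>)) i * (Y i \<omega> - \<mu> (X i \<omega>)))\<^sup>2) * real (card {1..n})"
      unfolding residual_sum_def by (simp add: Z_simps del: card_atLeastAtMost) (rule sum_squared_le_sum_of_squares)
    also have "\<dots> \<le> (\<Sum>i=1..n. \<Omega>\<^sup>2 * (2 * (Y i \<omega>)\<^sup>2 + 2 * K\<^sup>2)) * real (card {1..n})"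
    proof (intro mult_right_mono sum_mono)
      fix i assume i: "i \<in> {1..n}"
      have "(S (\<pi> (Z \<omega>)) i)\<^sup>2 \<le> \<Omega>\<^sup>2" using power_mono[OF S_bound'[OF i] abs_ge_zero, of _ 2] by simp
      moreover have "(Y i \<omega> - m)\<^sup>2 \<le> 2 * (Y i \<omega>)\<^sup>2 + 2 * K\<^sup>2" if "\<bar>m\<bar> \<le> K" for m :: real
      proof -
        have "m\<^sup>2 \<le> K\<^sup>2" using that by (metis abs_ge_zero power2_abs power_mono)
        moreover have "0 \<le> (Y i \<omega> + m)\<^sup>2" by simp
        ultimately show ?thesis by (simp add: power2_eq_square algebra_simps)
      qed
      ultimately show "(S (\<pi> (Z \<omega>)) i * (Y i \<omega> - \<mu> (X i \<omega>)))\<^sup>2 \<le> \<Omega>\<^sup>2 * (2 * (Y i \<omega>)\<^sup>2 + 2 * K\<^sup>2)"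
        unfolding power_mult_distrib using \<mu>_bound by (intro mult_mono) auto
    qed simp
    finally show ?thesis .
  qed
  then show "AE \<omega> in M. norm ((residual_sum (Z \<omega>))\<^sup>2) \<le> norm ((\<Sum>i=1..n. \<Omega>\<^sup>2 * (2 * (Y i \<omega>)\<^sup>2 + 2 * K\<^sup>2)) * real (card {1..n}))"
    by (auto intro: order.trans[OF _ abs_ge_self])
  show "(\<lambda>\<omega>. (residual_sum (Z \<omega>))\<^sup>2) \<in> borel_measurable M" by measurable
qed (use Y_square_integrable in auto)

lemma V_component:
  assumes i: "i \<in> {1..n}" and f: "f \<in> borel_measurable borel"
  shows "(\<integral>v. f (v i) \<partial>V) = (\<integral>u. f u \<partial>U :: real)" "integrable V (\<lambda>v. f (v i)) \<longleftrightarrow> integrable U f"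
proof -
  have m: "(\<lambda>v. v i) \<in> V \<rightarrow>\<^sub>M U" using i by measurable
  have "distr V U (\<lambda>v. v i) = U" by (rule distr_PiM_component) (use i U.prob_space_axioms in auto)
  then show "(\<integral>v. f (v i) \<partial>V) = (\<integral>u. f u \<partial>U)" "integrable V (\<lambda>v. f (v i)) \<longleftrightarrow> integrable U f"
    using integral_distr[OF m, of f] integrable_distr_eq[OF m, of f] f by simp_all
qed

abbreviation "G \<equiv> design_algebra M n B J X T"
abbreviation "est \<equiv> (\<lambda>\<omega>. debiased_forest n B J w (\<lambda>i. X i \<omega>) (\<lambda>i. Y i \<omega>) (\<lambda>b r. T b r \<omega>) x)"

lemma cond_exp_est: "AE \<omega> in M. real_cond_exp M G est \<omega> = cond_mean (\<pi> (Z \<omega>))"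
  unfolding design_algebra_eq estimate_Z[symmetric]
proof (rule cond_exp_disintegration[OF M.prob_space_axioms prob_space_A V.prob_space_axioms Z_measurable \<pi>_measurable \<Theta>_measurable law \<pi>_\<Theta>
      estimate_measurable integrable_estimate cond_mean_measurable])
  fix z assume z: "z \<in> space A"
  have "integrable V (\<lambda>v. S z i * \<psi> (fst z i) (v i))" if "i \<in> {1..n}" for i
    using V_component(2)[OF that \<psi>_measurable2] residual_facts(6) by auto
  then have "(\<integral>v. (\<Sum>i=1..n. S z i * \<psi> (fst z i) (v i)) \<partial>V) = (\<Sum>i=1..n. \<integral>v. S z i * \<psi> (fst z i) (v i) \<partial>V)"
    by (rule Bochner_Integration.integral_sum)
  also have "\<dots> = cond_mean z"
    unfolding cond_mean_def by (intro sum.cong refl) (simp add: V_component(1)[OF _ \<psi>_measurable2] residual_facts(7))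
  finally show "(\<integral>v. estimate (\<Theta> (z, v)) \<partial>V) = cond_mean z" by (simp only: estimate_\<Theta>[OF z])
qed

lemma cond_exp_residual_sum: "AE \<omega> in M. real_cond_exp M G (\<lambda>\<omega>. (residual_sum (Z \<omega>))\<^sup>2) \<omega> = cond_variance (\<pi> (Z \<omega>))"
  unfolding design_algebra_eq
proof (rule cond_exp_disintegration[OF M.prob_space_axioms prob_space_A V.prob_space_axioms Z_measurable \<pi>_measurable \<Theta>_measurable law \<pi>_\<Theta>
      _ integrable_residual_sum cond_variance_measurable])
  show "(\<lambda>y. (residual_sum y)\<^sup>2) \<in> borel_measurable (NX \<Otimes>\<^sub>M TT)" by measurable
  fix z assume z: "z \<in> space A"
  have [measurable]: "\<psi> y \<in> borel_measurable borel" for y using \<psi>_measurable2[of y] by simp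
  have "(\<integral>v. (\<Sum>i=1..n. S z i * (\<psi> (fst z i) (v i) - \<mu> (fst z i)))\<^sup>2 \<partial>V) = (\<Sum>i=1..n. (S z i)\<^sup>2 * \<sigma> (fst z i))"
    by (rule PiM_sum_second_moment[where g="\<lambda>i u. S z i * (\<psi> (fst z i) u - \<mu> (fst z i))"])
      (use residual_facts U.prob_space_axioms in \<open>auto simp: power_mult_distrib\<close>)
  then show "(\<integral>v. (residual_sum (\<Theta> (z, v)))\<^sup>2 \<partial>V) = cond_variance z" by (simp only: residual_sum_\<Theta>[OF z] cond_variance_def)
qed

lemma est_measurable: "est \<in> borel_measurable M" unfolding estimate_Z[symmetric] by measurable

lemma est_minus_cond_exp: "AE \<omega> in M. est \<omega> - real_cond_exp M G est \<omega> = residual_sum (Z \<omega>)"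
  using cond_exp_est
proof eventually_elim
  case (elim \<omega>)
  then show ?case unfolding elim unfolding estimate_Z[symmetric]
    by (simp add: estimate_def cond_mean_def residual_sum_def sum_subtractf right_diff_distrib)
qed

lemma cond_var_est: "AE \<omega> in M. cond_var M G est \<omega> = cond_variance (\<pi> (Z \<omega>))"
proof -
  interpret G: finite_measure_subalgebra M G
    unfolding design_algebra_eq by standard (rule subalgebra_vimage, measurable)
  have "AE \<omega> in M. cond_var M G est \<omega> = real_cond_exp M G (\<lambda>\<omega>. (residual_sum (Z \<omega>))\<^sup>2) \<omega>"
    unfolding cond_var_def
  proof (rule G.real_cond_exp_cong)
    show "(\<lambda>\<omega>. (est \<omega> - real_cond_exp M G est \<omega>)\<^sup>2) \<in> borel_measurable M" using est_measurable by measurable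
    show "(\<lambda>\<omega>. (residual_sum (Z \<omega>))\<^sup>2) \<in> borel_measurable M" by measurable
  qed (use est_minus_cond_exp in \<open>auto elim!: eventually_mono\<close>)
  with cond_exp_residual_sum show ?thesis by eventually_elim simp
qed

text \<open>The scale c cancels, and almost surely the statistic is the weighted sum of residuals
  over its conditional standard deviation; when the variance is 0, both quotients are 0. The claim
  is then an average over designs.\<close>

lemma statistic_distribution:
  assumes c: "0 < c"
    and e: "e \<in> borel_measurable A" "integrable M (\<lambda>\<omega>. e (\<pi> (Z \<omega>)))"
    and bound: "\<And>z. z \<in> space A \<Longrightarrow> \<bar>measure V {v \<in> space V.
       (\<Sum>i=1..n. S z i * (\<psi> (fst z i) (v i) - \<mu> (fst z i))) / sqrt (cond_variance z) \<le> t} - p\<bar> \<le> e z"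
  shows "\<bar>measure M {\<omega> \<in> space M. sqrt c * ((est \<omega> - real_cond_exp M G est \<omega>) / sqrt (c * cond_var M G est \<omega>)) \<le> t} - p\<bar>
    \<le> (\<integral>\<omega>. e (\<pi> (Z \<omega>)) \<partial>M)"
proof -
  have h: "(\<lambda>y. residual_sum y / sqrt (cond_variance (\<pi> y))) \<in> borel_measurable (NX \<Otimes>\<^sub>M TT)" by measurable
  have "\<bar>measure M {\<omega> \<in> space M. residual_sum (Z \<omega>) / sqrt (cond_variance (\<pi> (Z \<omega>))) \<le> t} - p\<bar> \<le> (\<integral>\<omega>. e (\<pi> (Z \<omega>)) \<partial>M)"
    by (rule distribution_function_disintegration[OF M.prob_space_axioms prob_space_A V.prob_space_axioms Z_measurable
        \<pi>_measurable \<Theta>_measurable law \<pi>_\<Theta> h e]) (use bound in \<open>simp_all add: residual_sum_\<Theta> \<pi>_\<Theta>\<close>)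
  moreover have "measure M {\<omega> \<in> space M. sqrt c * ((est \<omega> - real_cond_exp M G est \<omega>) / sqrt (c * cond_var M G est \<omega>)) \<le> t} =
      measure M {\<omega> \<in> space M. residual_sum (Z \<omega>) / sqrt (cond_variance (\<pi> (Z \<omega>))) \<le> t}"
  proof (rule M.finite_measure_eq_AE)
    show "AE \<omega> in M. (\<omega> \<in> {\<omega> \<in> space M. sqrt c * ((est \<omega> - real_cond_exp M G est \<omega>) / sqrt (c * cond_var M G est \<omega>)) \<le> t}) \<longleftrightarrow>
        (\<omega> \<in> {\<omega> \<in> space M. residual_sum (Z \<omega>) / sqrt (cond_variance (\<pi> (Z \<omega>))) \<le> t})"
      using est_minus_cond_exp cond_var_est
    proof eventually_elim
      case (elim \<omega>)
      have "sqrt c * (residual_sum (Z \<omega>) / sqrt (c * cond_variance (\<pi> (Z \<omega>)))) = residual_sum (Z \<omega>) / sqrt (cond_variance (\<pi> (Z \<omega>)))"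
        using c by (simp add: real_sqrt_mult)
      then show ?case unfolding mem_Collect_eq elim by simp
    qed
    have [measurable]: "cond_var M G est \<in> borel_measurable M" unfolding cond_var_def by measurable
    show "{\<omega> \<in> space M. sqrt c * ((est \<omega> - real_cond_exp M G est \<omega>) / sqrt (c * cond_var M G est \<omega>)) \<le> t} \<in> sets M"
      using est_measurable by measurable
    show "{\<omega> \<in> space M. residual_sum (Z \<omega>) / sqrt (cond_variance (\<pi> (Z \<omega>))) \<le> t} \<in> sets M" by measurable
  qed
  ultimately show ?thesis by simp
qed

end

section \<open>Probabilities of unfavourable designs\<close>

context forest_experiment
begin

text \<open>\<open>\<pi>\<close> undoes \<open>\<Theta>\<close> up to the first projection, whose
  law under the product is \<open>A\<close>.\<close>

lemma distr_\<pi>Z: "distr M A (\<lambda>\<omega>. \<pi> (Z \<omega>)) = A"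
proof -
  have "distr M A (\<lambda>\<omega>. \<pi> (Z \<omega>)) = distr (distr M (NX \<Otimes>\<^sub>M TT) Z) A \<pi>"
    by (subst distr_distr) (auto simp: comp_def)
  also have "\<dots> = distr (A \<Otimes>\<^sub>M V) A (\<lambda>z. \<pi> (\<Theta> z))"
    unfolding law by (subst distr_distr) (auto simp: comp_def)
  also have "\<dots> = distr (A \<Otimes>\<^sub>M V) A fst"
    by (rule distr_cong) (auto simp: space_pair_measure \<pi>_\<Theta>)
  also have "\<dots> = A" by (rule V.distr_pair_fst)
  finally show ?thesis .
qed

lemma measure_tree:
  assumes "b \<in> {1..B}" "r \<le> J"
  shows "distr M tree_space (T b r) = mondrian (a r * lam)"
  using sample assms unfolding forest_sample_def by auto

lemma cell_probability:
  "cf * (\<Prod>j\<in>UNIV. cell_hi x j t - cell_lo x j t) \<le> measure \<nu> {y. same_cell x y t = 1}"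
  "0 < cf * (\<Prod>j\<in>UNIV. cell_hi x j t - cell_lo x j t)"
proof -
  have d: "0 < cell_hi x j t - cell_lo x j t" for j using cell_lo_bounds[OF x, of j t] by simp
  then have p: "0 < (\<Prod>j\<in>UNIV. cell_hi x j t - cell_lo x j t)" by (intro prod_pos) auto
  then show "0 < cf * (\<Prod>j\<in>UNIV. cell_hi x j t - cell_lo x j t)" using pos by simp
  have "{y. same_cell x y t = 1} \<subseteq> cbox 0 1" using same_cell_subset(1)[of x _ t] by auto
  then have "ennreal cf * emeasure lborel {y. same_cell x y t = 1} \<le> emeasure \<nu> {y. same_cell x y t = 1}"
    by (rule \<nu>_lower[OF tree_cell_measurable])
  then have "ennreal cf * ennreal (\<Prod>j\<in>UNIV. cell_hi x j t - cell_lo x j t) \<le> ennreal (measure \<nu> {y. same_cell x y t = 1})"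
    using emeasure_tree_cell_ge[OF x, of t] unfolding \<nu>.emeasure_eq_measure
    by (meson mult_left_mono order.trans zero_le)
  then show "cf * (\<Prod>j\<in>UNIV. cell_hi x j t - cell_lo x j t) \<le> measure \<nu> {y. same_cell x y t = 1}"
    using pos p by (simp add: ennreal_mult'[symmetric])
qed

text \<open>The covariates are integrated out at fixed trees, which leaves the inverse probability
  of a cell. The lower comparison with Lebesgue measure bounds it by the inverse volume, whose
  expectation is known for the single tree in question.\<close>

lemma expectation_inverse_cell_count:
  assumes br: "b \<in> {1..B}" "r \<le> J"
  shows "(\<integral>\<omega>. 1 / max 1 (cell_count x n (fst (\<pi> (Z \<omega>))) (T b r \<omega>)) \<partial>M)
    \<le> 6 / (real n * cf) * (\<Prod>j\<in>UNIV. 1 / (x $ j) + 1 / (1 - x $ j) + a r * lam)" (is "_ \<le> ?R")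
proof -
  let ?f = "\<lambda>z. 1 / max 1 (cell_count x n (fst z) (snd z (b, r)))"
  have fm [measurable]: "?f \<in> borel_measurable A"
    by (intro borel_measurable_divide borel_measurable_max borel_measurable_const cell_count_A_measurable br)
  have Tm [measurable]: "T b r \<in> M \<rightarrow>\<^sub>M tree_space" by (rule T_measurable[OF br])
  have comp: "(\<lambda>\<tau>. \<tau> (b, r)) \<in> TT \<rightarrow>\<^sub>M tree_space" by (rule measurable_component_singleton) (use br in auto)
  let ?g = "\<lambda>t. ennreal (6 / (real n * cf)) * ennreal (\<Prod>j\<in>UNIV. 1 / (cell_hi x j t - cell_lo x j t))"
  have g_m: "?g \<in> borel_measurable tree_space" by measurable
  have "(\<integral>\<^sup>+\<omega>. ennreal (?f (\<pi> (Z \<omega>))) \<partial>M) = (\<integral>\<^sup>+z. ennreal (?f z) \<partial>distr M A (\<lambda>\<omega>. \<pi> (Z \<omega>)))"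
    by (subst nn_integral_distr) auto
  also have "\<dots> = (\<integral>\<^sup>+\<tau>. \<integral>\<^sup>+xs. ennreal (?f (xs, \<tau>)) \<partial>PiM {1..n} (\<lambda>_. \<nu>) \<partial>Q)"
    unfolding distr_\<pi>Z using fm unfolding A_def by (intro NUQ.nn_integral_snd[symmetric]) measurable
  also have "\<dots> \<le> (\<integral>\<^sup>+\<tau>. ?g (\<tau> (b, r)) \<partial>Q)"
  proof (rule nn_integral_mono)
    fix \<tau> :: "nat \<times> nat \<Rightarrow> 'd mondrian_tree"
    let ?t = "\<tau> (b, r)"
    let ?p = "measure \<nu> {y. same_cell x y ?t = 1}"
    note cp = cell_probability[of ?t]
    have pp: "0 < ?p" using cp by linarith
    have "(\<integral>\<^sup>+xs. ennreal (?f (xs, \<tau>)) \<partial>PiM {1..n} (\<lambda>_. \<nu>)) \<le> ennreal (6 / (real n * ?p))"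
      using expectation_inverse_count[OF \<nu>.prob_space_axioms sets_\<nu> n pp refl] unfolding cell_count_def by simp
    also have "\<dots> \<le> ennreal (6 / (real n * cf) * (\<Prod>j\<in>UNIV. 1 / (cell_hi x j ?t - cell_lo x j ?t)))"
    proof (rule ennreal_leI)
      have "6 / (real n * ?p) \<le> 6 / (real n * (cf * (\<Prod>j\<in>UNIV. cell_hi x j ?t - cell_lo x j ?t)))"
      proof (rule frac_le)
        show "0 < real n * (cf * (\<Prod>j\<in>UNIV. cell_hi x j ?t - cell_lo x j ?t))"
          by (rule mult_pos_pos) (use n cp(2) in simp_all)
        show "real n * (cf * (\<Prod>j\<in>UNIV. cell_hi x j ?t - cell_lo x j ?t)) \<le> real n * ?p"
          by (rule mult_left_mono[OF cp(1)]) simp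
      qed simp_all
      also have "\<dots> = 6 / (real n * cf) * (\<Prod>j\<in>UNIV. 1 / (cell_hi x j ?t - cell_lo x j ?t))"
        by (simp add: prod_dividef mult.assoc)
      finally show "6 / (real n * ?p) \<le> 6 / (real n * cf) * (\<Prod>j\<in>UNIV. 1 / (cell_hi x j ?t - cell_lo x j ?t))" .
    qed
    also have "\<dots> = ?g ?t" using pos by (intro ennreal_mult') simp
    finally show "(\<integral>\<^sup>+xs. ennreal (?f (xs, \<tau>)) \<partial>PiM {1..n} (\<lambda>_. \<nu>)) \<le> ?g ?t" .
  qed
  also have "\<dots> = (\<integral>\<^sup>+\<omega>. ?g (tree_tuple B J T \<omega> (b, r)) \<partial>M)"
    unfolding Q_def by (rule nn_integral_distr[OF tree_tuple_measurable]) (simp only: measurable_distr_eq1, rule measurable_compose[OF comp g_m])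
  also have "\<dots> = (\<integral>\<^sup>+t. ?g t \<partial>distr M tree_space (T b r))"
    using nn_integral_distr[OF Tm, of ?g] g_m br by (simp add: tree_tuple_def)
  also have "\<dots> = ennreal (6 / (real n * cf)) * (\<integral>\<^sup>+t. ennreal (\<Prod>j\<in>UNIV. 1 / (cell_hi x j t - cell_lo x j t)) \<partial>mondrian (a r * lam))"
    unfolding measure_tree[OF br] by (rule nn_integral_cmult) measurable
  also have "\<dots> \<le> ennreal (6 / (real n * cf)) * ennreal (\<Prod>j\<in>UNIV. 1 / (x $ j) + 1 / (1 - x $ j) + a r * lam)"
    using a[OF br(2)] lam by (intro mult_left_mono mondrian_inverse_volume[OF x]) auto
  also have "\<dots> = ennreal ?R" using pos by (intro ennreal_mult'[symmetric]) simp
  finally have le: "(\<integral>\<^sup>+\<omega>. ennreal (?f (\<pi> (Z \<omega>))) \<partial>M) \<le> ennreal ?R" .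
  have xj: "0 < x $ j" "x $ j < 1" for j using x by (auto simp: mem_box_cart)
  have R0: "0 \<le> ?R"
    using pos lam a[OF br(2)] by (intro mult_nonneg_nonneg prod_nonneg add_nonneg_nonneg) (auto simp: xj less_imp_le)
  have "(\<integral>\<omega>. ?f (\<pi> (Z \<omega>)) \<partial>M) \<le> ?R" by (rule integral_real_bounded[OF R0 le])
  then show ?thesis using br by (simp add: Z_simps)
qed

lemma expectation_max_weight:
  "(\<integral>\<omega>. max_weight (\<pi> (Z \<omega>)) \<partial>M) \<le> (\<Sum>r=0..J. \<bar>w r\<bar> * (6 / (real n * cf) * (\<Prod>j\<in>UNIV. 1 / (x $ j) + 1 / (1 - x $ j) + a r * lam)))"
proof -
  let ?f = "\<lambda>b r \<omega>. 1 / max 1 (cell_count x n (fst (\<pi> (Z \<omega>))) (T b r \<omega>))"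
  let ?R = "\<lambda>r. 6 / (real n * cf) * (\<Prod>j\<in>UNIV. 1 / (x $ j) + 1 / (1 - x $ j) + a r * lam)"
  have fi: "integrable M (?f b r)" if br: "b \<in> {1..B}" "r \<le> J" for b r
  proof (rule M.integrable_const_bound[where B=1])
    have "(\<lambda>z. 1 / max 1 (cell_count x n (fst z) (snd z (b, r)))) \<in> borel_measurable A"
      by (intro borel_measurable_divide borel_measurable_max borel_measurable_const cell_count_A_measurable br)
    from measurable_compose[OF measurable_compose[OF Z_measurable \<pi>_measurable] this]
    show "?f b r \<in> borel_measurable M" using br by (simp add: Z_simps)
  qed (auto simp: divide_simps)
  have "(\<integral>\<omega>. max_weight (\<pi> (Z \<omega>)) \<partial>M) = (\<integral>\<omega>. (\<Sum>r=0..J. \<bar>w r\<bar> * (1 / real B * (\<Sum>b=1..B. ?f b r \<omega>))) \<partial>M)"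
    unfolding max_weight_def weight_bound_def tree_average_def by (simp add: Z_simps)
  also have "\<dots> = (\<Sum>r=0..J. \<bar>w r\<bar> * (1 / real B * (\<Sum>b=1..B. \<integral>\<omega>. ?f b r \<omega> \<partial>M)))"
  proof (subst Bochner_Integration.integral_sum)
    have fs: "integrable M (\<lambda>\<omega>. \<Sum>b=1..B. ?f b r \<omega>)" if "r \<in> {0..J}" for r
      using that by (intro Bochner_Integration.integrable_sum fi) auto
    then show "integrable M (\<lambda>\<omega>. \<bar>w r\<bar> * (1 / real B * (\<Sum>b=1..B. ?f b r \<omega>)))" if "r \<in> {0..J}" for r
      using that by (intro integrable_mult_right) auto
    show "(\<Sum>r=0..J. \<integral>\<omega>. \<bar>w r\<bar> * (1 / real B * (\<Sum>b=1..B. ?f b r \<omega>)) \<partial>M) = (\<Sum>r=0..J. \<bar>w r\<bar> * (1 / real B * (\<Sum>b=1..B. \<integral>\<omega>. ?f b r \<omega> \<partial>M)))"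
      unfolding integral_mult_right_zero
      by (intro sum.cong arg_cong2[where f="(*)"] refl Bochner_Integration.integral_sum fi) auto
  qed
  also have "\<dots> \<le> (\<Sum>r=0..J. \<bar>w r\<bar> * (1 / real B * (\<Sum>b=1..B. ?R r)))"
    by (intro sum_mono mult_left_mono expectation_inverse_cell_count) auto
  also have "\<dots> = (\<Sum>r=0..J. \<bar>w r\<bar> * ?R r)" using B by simp
  finally show ?thesis .
qed

text \<open>A union bound over two faces in each coordinate, each exceeding the distance h with
  probability at most 2 / (a r lam h).\<close>

lemma escape_probability:
  assumes h: "0 < h" and r: "r \<le> J"
  shows "measure (mondrian (a r * lam)) (escaping_trees x h) \<le> 4 * real CARD('d) / (a r * lam * h)"
proof -
  let ?m = "mondrian (a r * lam)"
  have al: "0 < a r * lam" using a[OF r] lam by simp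
  interpret finite_measure ?m by (rule finite_measure_mondrian)
  have K: "0 < a r * lam * h" using al h by simp
  have hK: "a r * lam * h / (a r * lam) = h" by (rule nonzero_mult_div_cancel_left) (rule less_imp_neq[OF al, symmetric])
  have 1: "measure ?m {t \<in> space tree_space. x $ j - cell_lo x j t > h} \<le> 2 / (a r * lam * h)"
    "measure ?m {t \<in> space tree_space. cell_hi x j t - x $ j > h} \<le> 2 / (a r * lam * h)" for j
    using mondrian_side_tail[OF x al K, of j] K unfolding hK emeasure_eq_measure by (simp_all add: ennreal_le_iff)
  have m: "{t \<in> space tree_space. x $ j - cell_lo x j t > h} \<in> sets ?m" "{t \<in> space tree_space. cell_hi x j t - x $ j > h} \<in> sets ?m" for j
    unfolding sets_mondrian by measurable
  have "escaping_trees x h = (\<Union>j. {t \<in> space tree_space. x $ j - cell_lo x j t > h} \<union> {t \<in> space tree_space. cell_hi x j t - x $ j > h})"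
    by (auto simp: escaping_trees_def)
  also have "measure ?m \<dots> \<le> (\<Sum>j\<in>UNIV. measure ?m ({t \<in> space tree_space. x $ j - cell_lo x j t > h} \<union> {t \<in> space tree_space. cell_hi x j t - x $ j > h}))"
    by (rule finite_measure_subadditive_finite) (use m in \<open>auto simp: image_subset_iff intro!: sets.Un simp del: sets_mondrian\<close>)
  also have "\<dots> \<le> (\<Sum>j\<in>(UNIV :: 'd set). 2 / (a r * lam * h) + 2 / (a r * lam * h))"
    by (intro sum_mono order.trans[OF measure_Un_le[OF m] add_mono[OF 1]])
  also have "\<dots> = 4 * real CARD('d) / (a r * lam * h)" by (simp add: mult_ac)
  finally show ?thesis .
qed

text \<open>The expected fraction of escaping trees is at most 1 / (8 \<Omega>), so a fraction above
  1 / (4 \<Omega>) deviates by B / (8 \<Omega>) trees from the mean. Chebyshev's inequality bounds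
  this by 8 \<Omega> / B in each of the J + 1 forests. If all fractions are at most 1 / (4
  \<Omega>), the average weighted with |w r| is at most 1 / 4.\<close>

lemma escape_fraction_probability:
  assumes h: "0 < h" and small: "\<And>r. r \<le> J \<Longrightarrow> 4 * real CARD('d) / (a r * lam * h) \<le> 1 / (8 * \<Omega>)"
  shows "measure M {\<omega> \<in> space M. 1 / 4 < tree_average B J (\<lambda>r. \<bar>w r\<bar>) (indicator (escaping_trees x h)) (snd (\<pi> (Z \<omega>)))}
    \<le> real (Suc J) * (8 * \<Omega> / real B)"
proof -
  let ?E = "escaping_trees x h"
  have "1 \<le> \<bar>\<Sum>r=0..J. w r\<bar>" using w by simp
  also have "\<dots> \<le> \<Omega>" by (rule sum_abs)
  finally have \<Omega>1: "1 \<le> \<Omega>" .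
  define p where "p r = measure (mondrian (a r * lam)) ?E" for r
  have p: "p r \<le> 1 / (8 * \<Omega>)" if "r \<le> J" for r
    unfolding p_def using escape_probability[OF h that] small[OF that] by linarith
  define al where "al = real B / (8 * \<Omega>)"
  have al: "0 < al" using B \<Omega>1 by (simp add: al_def)
  let ?F = "\<lambda>r. {\<omega> \<in> space M. al \<le> \<bar>(\<Sum>b\<in>{1..B}. indicator ?E (T b r \<omega>)) - real (card {1..B}) * p r\<bar>}"
  have indep: "M.indep_vars (\<lambda>_. tree_space) (\<lambda>(b, r). T b r) ((\<lambda>b. (b, r)) ` {1..B})" if r: "r \<le> J" for r
  proof -
    have "M.indep_vars (\<lambda>_. tree_space) (\<lambda>(b, r). T b r) ({1..B} \<times> {0..J})"
      using sample unfolding forest_sample_def by blast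
    then have "M.indep_vars (\<lambda>_. tree_space) (\<lambda>(b, r). T b r) ((\<lambda>b. (b, r)) ` {1..B})"
      by (rule M.indep_vars_subset) (use r in auto)
    then show ?thesis .
  qed
  have F_le: "measure M (?F r) \<le> 8 * \<Omega> / real B" if r: "r \<le> J" for r
  proof -
    let ?I = "(\<lambda>b. (b, r)) ` {1..B}"
    have inj: "inj_on (\<lambda>b. (b, r)) {1..B}" by (simp add: inj_on_def)
    have "measure M {\<omega> \<in> space M. al \<le> \<bar>(\<Sum>i\<in>?I. indicator ?E ((case i of (b, r) \<Rightarrow> T b r) \<omega>)) - real (card ?I) * p r\<bar>} \<le> real (card ?I) * p r / al\<^sup>2"
    proof (rule M.indep_count_second_moment[OF indep[OF r]])
      fix i assume "i \<in> ?I"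
      then obtain b where b: "b \<in> {1..B}" and i: "i = (b, r)" by auto
      have "measure M (T b r -` ?E \<inter> space M) = p r"
        unfolding p_def measure_tree[OF b r, symmetric] by (rule measure_distr[symmetric, OF T_measurable[OF b r]]) simp
      then show "measure M ((case i of (b, r) \<Rightarrow> T b r) -` ?E \<inter> space M) = p r" by (simp add: i)
    qed (use al in auto)
    then have "measure M (?F r) \<le> real (card {1..B}) * p r / al\<^sup>2"
      unfolding sum.reindex[OF inj] card_image[OF inj] comp_def prod.case .
    also have "\<dots> \<le> real B * (1 / (8 * \<Omega>)) / al\<^sup>2"
      by (intro divide_right_mono order.trans[OF mult_left_mono[OF p[OF r]]]) auto
    also have "\<dots> = 8 * \<Omega> / real B" using B \<Omega>1 by (simp add: al_def power2_eq_square field_simps)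
    finally show ?thesis .
  qed
  have Fm: "?F r \<in> sets M" if "r \<le> J" for r
  proof -
    have "(\<lambda>\<omega>. indicator ?E (T b r \<omega>) :: real) \<in> borel_measurable M" if "b \<in> {1..B}" for b
      by (rule measurable_compose[OF T_measurable[OF that \<open>r \<le> J\<close>]]) simp
    then show ?thesis by measurable
  qed
  have "{\<omega> \<in> space M. 1 / 4 < tree_average B J (\<lambda>r. \<bar>w r\<bar>) (indicator ?E) (snd (\<pi> (Z \<omega>)))} \<subseteq> (\<Union>r\<in>{0..J}. ?F r)"
  proof (rule subsetI, rule ccontr)
    fix \<omega> assume "\<omega> \<in> {\<omega> \<in> space M. 1 / 4 < tree_average B J (\<lambda>r. \<bar>w r\<bar>) (indicator ?E) (snd (\<pi> (Z \<omega>)))}"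
    then have \<omega>: "\<omega> \<in> space M" and big: "1 / 4 < (\<Sum>r=0..J. \<bar>w r\<bar> * (1 / real B * (\<Sum>b=1..B. indicator ?E (T b r \<omega>))))"
      by (auto simp: tree_average_def Z_simps)
    assume "\<omega> \<notin> (\<Union>r\<in>{0..J}. ?F r)"
    then have F: "\<bar>(\<Sum>b\<in>{1..B}. indicator ?E (T b r \<omega>)) - real B * p r\<bar> < al" if "r \<le> J" for r
      using \<omega> that by (auto simp: not_le)
    have "(\<Sum>b=1..B. indicator ?E (T b r \<omega>)) \<le> al + real B * p r" if "r \<le> J" for r using F[OF that] by linarith
    moreover have "al + real B * p r \<le> real B * (1 / (4 * \<Omega>))" if "r \<le> J" for r
    proof -
      have "real B * p r \<le> real B * (1 / (8 * \<Omega>))" by (rule mult_left_mono[OF p[OF that]]) simp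
      moreover have "al + real B * (1 / (8 * \<Omega>)) = real B * (1 / (4 * \<Omega>))" using \<Omega>1 by (simp add: al_def field_simps)
      ultimately show ?thesis by linarith
    qed
    ultimately have le: "(\<Sum>b=1..B. indicator ?E (T b r \<omega>)) \<le> real B * (1 / (4 * \<Omega>))" if "r \<le> J" for r
      using that order.trans by blast
    have "(\<Sum>r=0..J. \<bar>w r\<bar> * (1 / real B * (\<Sum>b=1..B. indicator ?E (T b r \<omega>)))) \<le> (\<Sum>r=0..J. \<bar>w r\<bar> * (1 / real B * (real B * (1 / (4 * \<Omega>)))))"
      by (intro sum_mono mult_left_mono le) auto
    also have "\<dots> = \<Omega> * (1 / (4 * \<Omega>))"
    proof -
      have "1 / real B * (real B * y) = y" for y using B by simp
      then show ?thesis by (simp only: sum_distrib_right)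
    qed
    also have "\<dots> = 1 / 4" using \<Omega>1 by simp
    finally show False using big by simp
  qed
  then have "measure M {\<omega> \<in> space M. 1 / 4 < tree_average B J (\<lambda>r. \<bar>w r\<bar>) (indicator ?E) (snd (\<pi> (Z \<omega>)))} \<le> measure M (\<Union>r\<in>{0..J}. ?F r)"
    by (rule M.finite_measure_mono) (use Fm in auto)
  also have "\<dots> \<le> (\<Sum>r\<in>{0..J}. measure M (?F r))"
    by (rule M.finite_measure_subadditive_finite) (use Fm in auto)
  also have "\<dots> \<le> (\<Sum>r\<in>{0..J}. 8 * \<Omega> / real B)" by (intro sum_mono F_le) auto
  finally show ?thesis by simp
qed

text \<open>n q bounds the expected count, so exceeding 2 n q is a deviation of at least n q, and
  Chebyshev's inequality gives n q / (n q)^2.\<close>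

lemma cube_count_probability:
  assumes h: "0 < h"
  defines "q \<equiv> Cf * (2 * h) ^ CARD('d)"
  shows "measure M {\<omega> \<in> space M. 2 * real n * q < (\<Sum>i=1..n. indicator (cube x h) (fst (\<pi> (Z \<omega>)) i))} \<le> 1 / (real n * q)"
proof -
  let ?E = "cube x h"
  define p where "p = measure \<nu> ?E"
  have q: "0 < q" using pos h by (simp add: q_def)
  have nq: "0 < real n * q" using n q by simp
  have "p \<le> q"
  proof -
    have "emeasure \<nu> ?E \<le> ennreal Cf * emeasure lborel ?E" by (rule \<nu>_upper) (simp, auto simp: cube_def)
    also have "emeasure lborel ?E \<le> emeasure lborel (cbox (\<chi> j. x $ j - h) (\<chi> j. x $ j + h))"
      by (rule emeasure_mono) (auto simp: cube_def mem_box_cart abs_le_iff algebra_simps)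
    also have "\<dots> = ennreal (\<Prod>j\<in>(UNIV :: 'd set). 2 * h)"
      using h by (subst emeasure_lborel_box_cart(2)) auto
    finally have "emeasure \<nu> ?E \<le> ennreal Cf * ennreal ((2 * h) ^ CARD('d))" by (simp add: mult_left_mono)
    also have "\<dots> = ennreal q" using pos by (simp add: q_def ennreal_mult')
    finally show ?thesis using q by (simp add: p_def \<nu>.emeasure_eq_measure)
  qed
  have p0: "0 \<le> p" by (simp add: p_def)
  have indep: "M.indep_vars (\<lambda>_. borel) X {1..n}"
  proof -
    have "M.indep_vars (\<lambda>_. borel \<Otimes>\<^sub>M borel) (\<lambda>i \<omega>. (X i \<omega>, Y i \<omega>)) {1..n}"
      using sample unfolding forest_sample_def borel_prod by blast
    from M.indep_vars_compose2[OF this, of "\<lambda>_. fst" "\<lambda>_. borel"] show ?thesis by simp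
  qed
  have X_prob: "measure M (X i -` ?E \<inter> space M) = p" if i: "i \<in> {1..n}" for i
  proof -
    have "distr M (borel \<Otimes>\<^sub>M borel) (\<lambda>\<omega>. (X i \<omega>, Y i \<omega>)) = P"
      using sample i unfolding forest_sample_def borel_prod by blast
    then have "\<nu> = distr (distr M (borel \<Otimes>\<^sub>M borel) (\<lambda>\<omega>. (X i \<omega>, Y i \<omega>))) borel fst" by (simp add: \<nu>_def)
    also have "\<dots> = distr M borel (X i)"
      by (subst distr_distr[OF _ XY_measurable[OF i]]) (auto simp: comp_def)
    finally show ?thesis unfolding p_def by (simp add: measure_distr[OF X_measurable[OF i]])
  qed
  have "measure M {\<omega> \<in> space M. real n * q \<le> \<bar>(\<Sum>i\<in>{1..n}. indicator ?E (X i \<omega>)) - real (card {1..n}) * p\<bar>} \<le> real (card {1..n}) * p / (real n * q)\<^sup>2"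
    by (rule M.indep_count_second_moment[OF indep]) (use X_prob nq in auto)
  also have "\<dots> \<le> real n * q / (real n * q)\<^sup>2" using \<open>p \<le> q\<close> by (intro divide_right_mono) (auto intro: mult_left_mono)
  also have "\<dots> = 1 / (real n * q)" by (simp add: power2_eq_square)
  finally have cheb: "measure M {\<omega> \<in> space M. real n * q \<le> \<bar>(\<Sum>i\<in>{1..n}. indicator ?E (X i \<omega>)) - real (card {1..n}) * p\<bar>} \<le> 1 / (real n * q)" .
  have "measure M {\<omega> \<in> space M. 2 * real n * q < (\<Sum>i=1..n. indicator ?E (fst (\<pi> (Z \<omega>)) i))} \<le>
      measure M {\<omega> \<in> space M. real n * q \<le> \<bar>(\<Sum>i\<in>{1..n}. indicator ?E (X i \<omega>)) - real (card {1..n}) * p\<bar>}"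
  proof (rule M.finite_measure_mono)
    have np: "real n * p \<le> real n * q" using \<open>p \<le> q\<close> by (simp add: mult_left_mono)
    show "{\<omega> \<in> space M. 2 * real n * q < (\<Sum>i=1..n. indicator ?E (fst (\<pi> (Z \<omega>)) i))} \<subseteq>
      {\<omega> \<in> space M. real n * q \<le> \<bar>(\<Sum>i\<in>{1..n}. indicator ?E (X i \<omega>)) - real (card {1..n}) * p\<bar>}"
    proof safe
      fix \<omega> assume "2 * real n * q < (\<Sum>i=1..n. indicator ?E (fst (\<pi> (Z \<omega>)) i))"
      then have "2 * (real n * q) < (\<Sum>i=1..n. indicator ?E (X i \<omega>))" by (simp add: Z_simps)
      then show "real n * q \<le> \<bar>(\<Sum>i\<in>{1..n}. indicator ?E (X i \<omega>)) - real (card {1..n}) * p\<bar>" using np by simp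
    qed
    have "(\<lambda>\<omega>. indicator ?E (X i \<omega>) :: real) \<in> borel_measurable M" if "i \<in> {1..n}" for i
      by (rule measurable_compose[OF X_measurable[OF that]]) simp
    then show "{\<omega> \<in> space M. real n * q \<le> \<bar>(\<Sum>i\<in>{1..n}. indicator ?E (X i \<omega>)) - real (card {1..n}) * p\<bar>} \<in> sets M"
      by measurable
  qed
  with cheb show ?thesis by linarith
qed

end

section \<open>Normal approximation\<close>

lemma abs_prob_diff_le_1:
  assumes "prob_space M" "prob_space N"
  shows "\<bar>measure M S - measure N S'\<bar> \<le> 1"
  using prob_space.prob_le_1[OF assms(1), of S] prob_space.prob_le_1[OF assms(2), of S']
    measure_nonneg[of M S] measure_nonneg[of N S'] by linarith

context forest_experiment
begin

text \<open>\<open>C1\<close>, \<open>H\<close> and \<open>C2\<close> enter as assumptions so that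
  they can be fixed before the sample size. The error is 1 on the bad designs; on the others the
  conditional variance is at least a multiple of r.\<close>

lemma normal_approx:
  assumes d: "0 < d" "d \<le> 1" and C1: "0 < C1"
    and BE: "\<And>(m :: nat) s ys b v t. (\<forall>i\<in>{1..m}. \<bar>s i\<bar> \<le> b) \<Longrightarrow> v = (\<Sum>i=1..m. (s i)\<^sup>2 * \<sigma> (ys i)) \<Longrightarrow> 0 < v \<Longrightarrow>
      \<bar>measure (PiM {1..m} (\<lambda>_. U)) {u \<in> space (PiM {1..m} (\<lambda>_. U)).
         (\<Sum>i=1..m. s i * (\<psi> (ys i) (u i) - \<mu> (ys i))) / sqrt v \<le> t} - cdf std_normal_distribution t\<bar>
      \<le> C1 * (b / sqrt v) powr d"
    and H: "0 < H" "\<And>r. r \<le> J \<Longrightarrow> 4 * real CARD('d) / (a r * H) \<le> 1 / (8 * \<Omega>)"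
    and C2: "(\<Sum>r=0..J. \<bar>w r\<bar> * (6 / (real n * cf) * (\<Prod>j\<in>UNIV. 1 / (x $ j) + 1 / (1 - x $ j) + a r * lam)))
      \<le> C2 * (lam ^ CARD('d) / real n)" "0 \<le> C2"
    and r1: "lam ^ CARD('d) / real n \<le> 1"
  shows "\<bar>measure M {\<omega> \<in> space M. sqrt (real n / lam ^ CARD('d)) *
      ((est \<omega> - real_cond_exp M G est \<omega>) / sqrt (real n / lam ^ CARD('d) * cond_var M G est \<omega>)) \<le> t} - cdf std_normal_distribution t\<bar>
    \<le> (4 * C2 + 1 / (Cf * (2 * H) ^ CARD('d)) + real (Suc J) * (8 * \<Omega>)
        + C1 * (1 / sqrt (c0 / (8 * (Cf * (2 * H) ^ CARD('d))))) powr d * (1 + C2))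
      * ((lam ^ CARD('d) / real n) powr (d / 2) + 1 / real B)"
proof -
  define r where "r = lam ^ CARD('d) / real n"
  define Q0 where "Q0 = Cf * (2 * H) ^ CARD('d)"
  define \<kappa> where "\<kappa> = c0 / (8 * Q0)"
  define L where "L = (1 / sqrt \<kappa>) powr d"
  define h where "h = H / lam"
  define m where "m = 2 * real n * (Cf * (2 * h) ^ CARD('d))"
  have r: "0 < r" "r \<le> 1" using lam n r1 by (simp_all add: r_def)
  have Q0: "0 < Q0" using pos H by (simp add: Q0_def)
  have \<kappa>: "0 < \<kappa>" using pos Q0 by (simp add: \<kappa>_def)
  have h: "0 < h" using H lam by (simp add: h_def)
  \<comment> \<open>A cube of half-side H / lam contains of the order n / lam^D = 1 / r covariates,
    where D is the dimension.\<close>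
  have m_eq: "m = 2 * Q0 / r"
    using lam n by (simp add: m_def h_def Q0_def r_def power_divide power_mult_distrib)
  have m: "0 < m" using Q0 r by (simp add: m_eq)
  let ?esc = "\<lambda>z. tree_average B J (\<lambda>r. \<bar>w r\<bar>) (indicator (escaping_trees x h)) (snd z) :: real"
  let ?cnt = "\<lambda>z. (\<Sum>i=1..n. indicator (cube x h) (fst z i)) :: real"
  define Bad where "Bad = {z \<in> space A. 1 / 4 < max_weight z \<or> 1 / 4 < ?esc z \<or> m < ?cnt z}"
  \<comment> \<open>The trivial bound 1 on bad designs, plus the Berry-Esseen error on the others;
    the latter is affine in \<open>max_weight\<close>, so its expectation is accessible.\<close>
  define e where "e z = indicator Bad z + C1 * L * r powr (d / 2) * (1 + max_weight z / r)" for z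
  have esc_m [measurable]: "?esc \<in> borel_measurable A"
  proof (rule tree_average_measurable)
    fix b r assume "b \<in> {1..B}" "r \<le> J"
    then have "(b, r) \<in> {1..B} \<times> {0..J}" by auto
    then have "(\<lambda>z. snd z (b, r)) \<in> A \<rightarrow>\<^sub>M tree_space" by measurable
    then show "(\<lambda>z. indicator (escaping_trees x h) (snd z (b, r)) :: real) \<in> borel_measurable A"
      by (rule measurable_compose) simp
  qed
  have cnt_m [measurable]: "?cnt \<in> borel_measurable A"
  proof (rule borel_measurable_sum)
    fix i assume "i \<in> {1..n}"
    then have "(\<lambda>z. fst z i) \<in> A \<rightarrow>\<^sub>M borel" by measurable
    then show "(\<lambda>z. indicator (cube x h) (fst z i) :: real) \<in> borel_measurable A"
      by (rule measurable_compose) simp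
  qed
  have Bad_m [measurable]: "Bad \<in> sets A" unfolding Bad_def by measurable
  have \<pi>Z_m [measurable]: "(\<lambda>\<omega>. \<pi> (Z \<omega>)) \<in> M \<rightarrow>\<^sub>M A" by measurable
  have e_m: "e \<in> borel_measurable A" unfolding e_def[abs_def] by measurable
  have bd_i: "integrable M (\<lambda>\<omega>. max_weight (\<pi> (Z \<omega>)))"
    by (rule M.integrable_const_bound[where B=\<Omega>]) (use max_weight_bounds in \<open>auto simp: abs_of_nonneg\<close>)
  have Bad_i: "integrable M (\<lambda>\<omega>. indicator Bad (\<pi> (Z \<omega>)) :: real)"
    by (rule M.integrable_const_bound[where B=1]) auto
  have e_i: "integrable M (\<lambda>\<omega>. e (\<pi> (Z \<omega>)))" unfolding e_def using bd_i Bad_i by simp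
  have L0: "0 \<le> L" by (simp add: L_def)
  have c_pos: "0 \<le> C1 * L * r powr (d / 2) * (1 + max_weight z / r)" for z
    using C1 L0 r max_weight_bounds(1)[of z] by (intro mult_nonneg_nonneg add_nonneg_nonneg) auto
  have bound: "\<bar>measure V {v \<in> space V. (\<Sum>i=1..n. S z i * (\<psi> (fst z i) (v i) - \<mu> (fst z i))) / sqrt (cond_variance z) \<le> t}
      - cdf std_normal_distribution t\<bar> \<le> e z" if z: "z \<in> space A" for z
  proof (cases "z \<in> Bad")
    case True
    have "\<bar>measure V {v \<in> space V. (\<Sum>i=1..n. S z i * (\<psi> (fst z i) (v i) - \<mu> (fst z i))) / sqrt (cond_variance z) \<le> t}
      - cdf std_normal_distribution t\<bar> \<le> 1"
      unfolding cdf_def by (rule abs_prob_diff_le_1[OF V.prob_space_axioms prob_space_normal_density]) simp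
    then show ?thesis using True c_pos[of z] by (simp add: e_def)
  next
    case False
    have \<tau>: "snd z (b, r) \<in> space tree_space" if "b \<in> {1..B}" "r \<le> J" for b r
    proof -
      have "snd z \<in> space TT" using z unfolding A_def space_pair_measure Q_def by auto
      then show ?thesis using that by (auto simp: space_PiM PiE_def Pi_def)
    qed
    have good: "max_weight z \<le> 1 / 4" "?esc z \<le> 1 / 4" "?cnt z \<le> m" using False z by (auto simp: Bad_def not_less)
    have "1 / (4 * m) \<le> (\<Sum>i=1..n. (S z i)\<^sup>2)"
      unfolding S_def by (rule sum_weights_square_ge[where \<tau>="snd z" and h=h, OF w B \<tau>]) (use good m in \<open>auto simp: max_weight_def\<close>)
    then have "c0 * (1 / (4 * m)) \<le> c0 * (\<Sum>i=1..n. (S z i)\<^sup>2)" using pos by (intro mult_left_mono) auto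
    also have "\<dots> \<le> cond_variance z"
      unfolding cond_variance_def sum_distrib_left using \<sigma>_bounds(1) by (intro sum_mono) (simp add: mult.commute mult_right_mono)
    also have "c0 * (1 / (4 * m)) = \<kappa> * r" using Q0 r by (simp add: m_eq \<kappa>_def)
    finally have cond_variance: "\<kappa> * r \<le> cond_variance z" .
    have \<kappa>r: "0 < \<kappa> * r" using \<kappa> r by simp
    \<comment> \<open>linear in the weight, so that only its expectation is needed\<close>
    have y: "y powr d \<le> 1 + y" if "0 \<le> y" for y :: real
    proof (cases "y \<le> 1")
      case True
      then have "y powr d \<le> 1 powr d" using that d by (intro powr_mono2) auto
      then show ?thesis using that by simp
    next
      case False
      then have "y powr d \<le> y powr 1" using d by (intro powr_mono) auto
      then show ?thesis using False by simp
    qed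
    have "max_weight z / sqrt (cond_variance z) \<le> max_weight z / sqrt (\<kappa> * r)"
      using cond_variance \<kappa>r max_weight_bounds(1)[of z] by (intro divide_left_mono mult_pos_pos) auto
    \<comment> \<open>The factor \<open>max_weight z / r\<close> has a bounded mean, and sqrt r
      carries the rate.\<close>
    also have "\<dots> = max_weight z / r * (1 / sqrt \<kappa>) * sqrt r"
      using r \<kappa> by (simp add: real_sqrt_mult field_simps real_div_sqrt)
    finally have "(max_weight z / sqrt (cond_variance z)) powr d \<le> (max_weight z / r * (1 / sqrt \<kappa>) * sqrt r) powr d"
      using d max_weight_bounds(1)[of z] cond_variance \<kappa>r by (intro powr_mono2) auto
    also have "\<dots> = (max_weight z / r) powr d * L * r powr (d / 2)"
    proof -
      have pm: "(u * v * y) powr d = u powr d * v powr d * y powr d" if "0 \<le> u" "0 \<le> v" "0 \<le> y" for u v y :: real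
        using that by (simp add: powr_mult)
      have sq: "sqrt r powr d = r powr (d / 2)" using r by (simp add: powr_half_sqrt[symmetric] powr_powr)
      show ?thesis
        unfolding L_def sq[symmetric] by (rule pm) (use r \<kappa> max_weight_bounds(1)[of z] in auto)
    qed
    also have "\<dots> \<le> (1 + max_weight z / r) * L * r powr (d / 2)"
      using y[of "max_weight z / r"] max_weight_bounds(1)[of z] r L0 by (intro mult_right_mono) auto
    finally have p: "C1 * (max_weight z / sqrt (cond_variance z)) powr d \<le> C1 * ((1 + max_weight z / r) * L * r powr (d / 2))"
      using C1 by (intro mult_left_mono) auto
    have "\<bar>measure V {v \<in> space V. (\<Sum>i=1..n. S z i * (\<psi> (fst z i) (v i) - \<mu> (fst z i))) / sqrt (cond_variance z) \<le> t}
        - cdf std_normal_distribution t\<bar> \<le> C1 * (max_weight z / sqrt (cond_variance z)) powr d"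
      by (rule BE) (use S_bound cond_variance \<kappa>r in \<open>auto simp: cond_variance_def\<close>)
    also note p
    also have "C1 * ((1 + max_weight z / r) * L * r powr (d / 2)) = C1 * L * r powr (d / 2) * (1 + max_weight z / r)" by (simp only: mult_ac)
    finally show ?thesis using False by (simp add: e_def)
  qed
  have Ebd: "(\<integral>\<omega>. max_weight (\<pi> (Z \<omega>)) \<partial>M) \<le> C2 * r" using expectation_max_weight C2(1) unfolding r_def by linarith
  have P1: "measure M {\<omega> \<in> space M. 1 / 4 \<le> max_weight (\<pi> (Z \<omega>))} \<le> 4 * C2 * r"
  proof -
    have "measure M {\<omega> \<in> space M. 1 / 4 \<le> max_weight (\<pi> (Z \<omega>))} \<le> (\<integral>\<omega>. max_weight (\<pi> (Z \<omega>)) \<partial>M) / (1 / 4)"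
      by (rule integral_Markov_inequality_measure[OF bd_i, where A="{}"]) (use max_weight_bounds in auto)
    then show ?thesis using Ebd by simp
  qed
  define W where "W = real (Suc J) * (8 * \<Omega>)"
  have W0: "0 \<le> W" unfolding W_def by (intro mult_nonneg_nonneg sum_nonneg) auto
  have P2: "measure M {\<omega> \<in> space M. 1 / 4 < ?esc (\<pi> (Z \<omega>))} \<le> W * (1 / real B)"
  proof -
    have "measure M {\<omega> \<in> space M. 1 / 4 < ?esc (\<pi> (Z \<omega>))} \<le> real (Suc J) * (8 * \<Omega> / real B)"
      by (rule escape_fraction_probability[OF h]) (use H(2) lam in \<open>simp add: h_def\<close>)
    then show ?thesis by (simp only: W_def times_divide_eq_right mult_1_right)
  qed
  have P3: "measure M {\<omega> \<in> space M. m < ?cnt (\<pi> (Z \<omega>))} \<le> 1 / Q0 * r"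
  proof -
    have "measure M {\<omega> \<in> space M. m < ?cnt (\<pi> (Z \<omega>))} \<le> 1 / (real n * (Cf * (2 * h) ^ CARD('d)))"
      unfolding m_def by (rule cube_count_probability[OF h])
    also have "\<dots> = 2 / m" by (simp add: m_def)
    also have "\<dots> = 1 / Q0 * r" using Q0 r by (simp add: m_eq)
    finally show ?thesis .
  qed
  have m1: "{\<omega> \<in> space M. 1 / 4 \<le> max_weight (\<pi> (Z \<omega>))} \<in> sets M" by measurable
  have m2: "{\<omega> \<in> space M. 1 / 4 < ?esc (\<pi> (Z \<omega>))} \<in> sets M"
    using measurable_compose[OF \<pi>Z_m esc_m] by measurable
  have m3: "{\<omega> \<in> space M. m < ?cnt (\<pi> (Z \<omega>))} \<in> sets M"
    using measurable_compose[OF \<pi>Z_m cnt_m] by measurable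
  have "(\<integral>\<omega>. indicator Bad (\<pi> (Z \<omega>)) \<partial>M) = (\<integral>\<omega>. indicator ((\<lambda>\<omega>. \<pi> (Z \<omega>)) -` Bad \<inter> space M) \<omega> \<partial>M)"
    by (rule Bochner_Integration.integral_cong) (auto simp: indicator_def)
  also have "\<dots> = measure M ((\<lambda>\<omega>. \<pi> (Z \<omega>)) -` Bad \<inter> space M)" by simp
  also have "\<dots> \<le> measure M (({\<omega> \<in> space M. 1 / 4 \<le> max_weight (\<pi> (Z \<omega>))} \<union> {\<omega> \<in> space M. 1 / 4 < ?esc (\<pi> (Z \<omega>))}) \<union> {\<omega> \<in> space M. m < ?cnt (\<pi> (Z \<omega>))})"
    by (rule M.finite_measure_mono) (use m1 m2 m3 in \<open>auto simp: Bad_def\<close>)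
  also have "\<dots> \<le> measure M ({\<omega> \<in> space M. 1 / 4 \<le> max_weight (\<pi> (Z \<omega>))} \<union> {\<omega> \<in> space M. 1 / 4 < ?esc (\<pi> (Z \<omega>))}) + measure M {\<omega> \<in> space M. m < ?cnt (\<pi> (Z \<omega>))}"
    by (rule measure_Un_le[OF sets.Un[OF m1 m2] m3])
  also have "\<dots> \<le> (4 * C2 * r + W * (1 / real B)) + 1 / Q0 * r"
    using measure_Un_le[OF m1 m2] P1 P2 P3 by linarith
  finally have PBad: "(\<integral>\<omega>. indicator Bad (\<pi> (Z \<omega>)) \<partial>M) \<le> (4 * C2 + 1 / Q0) * r + W * (1 / real B)"
    by (simp add: algebra_simps)
  define CC where "CC = 4 * C2 + 1 / Q0 + W + C1 * L * (1 + C2)"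
  \<comment> \<open>The bad designs have a probability of order r + 1 / B; since r <= 1 and d / 2 <=
    1, the first term is absorbed by the rate.\<close>
  have rr: "r \<le> r powr (d / 2)" using powr_mono'[of "d / 2" 1 r] d r by simp
  have "(\<integral>\<omega>. e (\<pi> (Z \<omega>)) \<partial>M) = (\<integral>\<omega>. indicator Bad (\<pi> (Z \<omega>)) \<partial>M) + C1 * L * r powr (d / 2) * (1 + (\<integral>\<omega>. max_weight (\<pi> (Z \<omega>)) \<partial>M) / r)"
    unfolding e_def using bd_i Bad_i by (simp add: M.prob_space)
  also have "\<dots> \<le> ((4 * C2 + 1 / Q0) * r powr (d / 2) + W * (1 / real B)) + C1 * L * r powr (d / 2) * (1 + C2)"
  proof (intro add_mono mult_left_mono order.refl)
    show "(\<integral>\<omega>. indicator Bad (\<pi> (Z \<omega>)) \<partial>M) \<le> (4 * C2 + 1 / Q0) * r powr (d / 2) + W * (1 / real B)"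
      using PBad mult_left_mono[OF rr, of "4 * C2 + 1 / Q0"] C2(2) Q0 by simp
    show "(\<integral>\<omega>. max_weight (\<pi> (Z \<omega>)) \<partial>M) / r \<le> C2" using Ebd r by (simp add: pos_divide_le_eq)
    show "0 \<le> C1 * L * r powr (d / 2)" using C1 L0 by simp
  qed
  also have "\<dots> = (4 * C2 + 1 / Q0 + C1 * L * (1 + C2)) * r powr (d / 2) + W * (1 / real B)"
    by (simp add: algebra_simps)
  also have "\<dots> \<le> CC * r powr (d / 2) + CC * (1 / real B)"
  proof (rule add_mono)
    have L1: "0 \<le> C1 * L * (1 + C2)" using C1 L0 C2(2) by simp
    have "0 \<le> 1 / Q0" using Q0 by simp
    then have le: "4 * C2 + 1 / Q0 + C1 * L * (1 + C2) \<le> CC" "W \<le> CC" unfolding CC_def using W0 L1 C2(2) by linarith+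
    show "(4 * C2 + 1 / Q0 + C1 * L * (1 + C2)) * r powr (d / 2) \<le> CC * r powr (d / 2)" by (rule mult_right_mono[OF le(1)]) simp
    show "W * (1 / real B) \<le> CC * (1 / real B)" by (rule mult_right_mono[OF le(2)]) simp
  qed
  finally have fin: "(\<integral>\<omega>. e (\<pi> (Z \<omega>)) \<partial>M) \<le> CC * (r powr (d / 2) + 1 / real B)" by (simp only: distrib_left)
  have "0 < real n / lam ^ CARD('d)" using n lam by simp
  from order.trans[OF statistic_distribution[OF this e_m e_i bound] fin] show ?thesis unfolding CC_def W_def L_def \<kappa>_def Q0_def r_def .
qed

end

text \<open>For n >= 3 the logarithm is at least 1, and the growth condition bounds the lifetime
  from below. The sizes 1 and 2, where the logarithm is smaller, are covered by the values
  themselves.\<close>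

lemma lifetime_bounded_below:
  assumes "\<forall>n\<ge>1. 0 < lam n" "lesssim (\<lambda>n. ln (real n) ^ 3) lam"
  shows "\<exists>c>0. \<forall>n\<ge>1. c \<le> (lam n :: real)"
proof -
  obtain C where C: "\<And>n. 1 \<le> n \<Longrightarrow> ln (real n) ^ 3 \<le> C * lam n" using assms(2) unfolding lesssim_def by blast
  define D where "D = max C 1"
  have D: "1 \<le> D" by (simp add: D_def)
  define c where "c = min (1 / D) (min (lam 1) (lam 2))"
  have "0 < c" using D assms(1) by (simp add: c_def)
  moreover have "c \<le> lam n" if n: "1 \<le> n" for n
  proof (cases "n = 1 \<or> n = 2")
    case True
    then show ?thesis by (auto simp: c_def)
  next
    case False
    then have "3 \<le> real n" using n by simp
    then have "1 \<le> ln (real n)" using exp_le by (subst ln_ge_iff) auto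
    then have "1 \<le> ln (real n) ^ 3" by (rule one_le_power)
    also have "\<dots> \<le> C * lam n" by (rule C[OF n])
    also have "\<dots> \<le> D * lam n" using assms(1) n by (intro mult_right_mono) (auto simp: D_def less_imp_le)
    finally have "1 / D \<le> lam n" using D by (simp add: divide_le_eq mult.commute)
    then show ?thesis by (simp add: c_def min_le_iff_disj)
  qed
  ultimately show ?thesis by blast
qed

theorem theorem5:
  fixes P :: "((real ^ 'd) \<times> real) measure"
    and f \<mu> \<sigma>2 :: "real ^ 'd \<Rightarrow> real"
    and \<beta>\<^sub>f \<beta>\<^sub>\<mu> \<beta>\<^sub>\<sigma> \<delta> :: real
    and x :: "real ^ 'd"
    and J :: nat and a w :: "nat \<Rightarrow> real"
    and lam :: "nat \<Rightarrow> real" and B :: "nat \<Rightarrow> nat"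
    and M :: "nat \<Rightarrow> 'w measure"
    and X :: "nat \<Rightarrow> nat \<Rightarrow> 'w \<Rightarrow> real ^ 'd"
    and Y :: "nat \<Rightarrow> nat \<Rightarrow> 'w \<Rightarrow> real"
    and T :: "nat \<Rightarrow> nat \<Rightarrow> nat \<Rightarrow> 'w \<Rightarrow> 'd mondrian_tree"
  defines "G \<equiv> \<lambda>n. design_algebra (M n) n (B n) J (X n) (T n)"
    and "est \<equiv> \<lambda>n \<omega>. debiased_forest n (B n) J w (\<lambda>i. X n i \<omega>) (\<lambda>i. Y n i \<omega>) (\<lambda>b r. T n b r \<omega>) x"
  defines "Sig \<equiv> \<lambda>n \<omega>. real n / lam n ^ CARD('d) * cond_var (M n) (G n) (est n) \<omega>"
  assumes "regression_law P f \<mu> \<sigma>2 \<beta>\<^sub>f \<beta>\<^sub>\<mu> \<beta>\<^sub>\<sigma>"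
    and "\<delta> > 0" and "cond_abs_moment_bounded P (2 + \<delta>)"
    and "\<forall>r\<in>{0..J}. a r > 0" and "inj_on a {0..J}" and "debiasing_weights J a w"
    and "x \<in> box 0 1"
    and "\<forall>n\<ge>1. lam n > 0" and "\<forall>n\<ge>1. B n \<ge> 1"
    and "lesssim (\<lambda>n. ln (real n) ^ 3) lam"
    and "filterlim (\<lambda>n. real n / lam n ^ CARD('d)) at_top sequentially"
    and "lesssim (\<lambda>n. ln (real n) ^ CARD('d)) (\<lambda>n. real (B n))"
    and "\<forall>n\<ge>1. forest_sample (M n) P n (B n) J a (lam n) (X n) (Y n) (T n)"
  shows "lesssim
    (\<lambda>n. SUP t. \<bar>measure (M n) {\<omega> \<in> space (M n).
        sqrt (real n / lam n ^ CARD('d)) * ((est n \<omega> - real_cond_exp (M n) (G n) (est n) \<omega>) / sqrt (Sig n \<omega>)) \<le> t}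
      - cdf std_normal_distribution t\<bar>)
    (\<lambda>n. (lam n ^ CARD('d) / real n) powr (min 1 \<delta> / 2) + 1 / real (B n))"
proof -
  define d where "d = min 1 \<delta>"
  have d: "0 < d" "d \<le> 1" using \<open>\<delta> > 0\<close> by (auto simp: d_def)
  \<comment> \<open>The law of an observation is the same for every n, hence so are the quantile
    function and all the constants obtained from it.\<close>
  obtain \<psi> \<mu>' \<sigma>' C0 c0 cf Cf K where "regression_data P d \<psi> \<mu>' \<sigma>' C0 c0 cf Cf K"
    using regression_data_exists[OF assms(4-6)] unfolding d_def by blast
  from regression_model_exists[OF this] obtain \<psi> \<mu>' \<sigma>'
    where rm: "regression_model P \<psi> (distr P borel fst) (uniform_measure lborel {0..1}) d \<mu>' \<sigma>' C0 c0 cf Cf K"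
    by blast
  interpret R: regression_model P \<psi> "distr P borel fst" "uniform_measure lborel {0..1}" d \<mu>' \<sigma>' C0 c0 cf Cf K by (rule rm)
  obtain C1 where C1: "0 < C1" and BE: "\<And>(m :: nat) s ys b v t. (\<forall>i\<in>{1..m}. \<bar>s i\<bar> \<le> b) \<Longrightarrow> v = (\<Sum>i=1..m. (s i)\<^sup>2 * \<sigma>' (ys i)) \<Longrightarrow> 0 < v \<Longrightarrow>
      \<bar>measure (PiM {1..m} (\<lambda>_. uniform_measure lborel {0..1})) {u \<in> space (PiM {1..m} (\<lambda>_. uniform_measure lborel {0..1})).
         (\<Sum>i=1..m. s i * (\<psi> (ys i) (u i) - \<mu>' (ys i))) / sqrt v \<le> t} - cdf std_normal_distribution t\<bar>
      \<le> C1 * (b / sqrt v) powr d"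
    using R.weighted_residual_normal_approx[OF d] by blast
  obtain c where c: "0 < c" "\<And>n. 1 \<le> n \<Longrightarrow> c \<le> lam n" using lifetime_bounded_below[OF assms(11,13)] by blast
  have w: "(\<Sum>r=0..J. w r) = 1" using assms(9) by (simp add: debiasing_weights_def)
  have a: "0 < a r" if "r \<le> J" for r using assms(7) that by simp
  have xj: "0 < x $ j" "x $ j < 1" for j using assms(10) by (auto simp: mem_box_cart)
  let ?\<Omega> = "\<Sum>r=0..J. \<bar>w r\<bar>"
  have "1 \<le> \<bar>\<Sum>r=0..J. w r\<bar>" using w by simp
  also have "\<dots> \<le> ?\<Omega>" by (rule sum_abs)
  finally have \<Omega>1: "1 \<le> ?\<Omega>" .
  \<comment> \<open>The sum dominates each of its terms, so H works for all forests at once: 32 D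
    \<Omega> / a r <= H is the required bound for the escape probability, D being the
    dimension.\<close>
  define H where "H = (\<Sum>r=0..J. 32 * real CARD('d) * ?\<Omega> / a r)"
  have H_ge: "32 * real CARD('d) * ?\<Omega> / a r \<le> H" if "r \<le> J" for r
    unfolding H_def using that a \<Omega>1 by (intro member_le_sum) (auto simp: less_imp_le)
  have H0: "0 < H"
  proof -
    have "0 < 32 * real CARD('d) * ?\<Omega> / a 0" using a[of 0] \<Omega>1 by (intro divide_pos_pos mult_pos_pos) auto
    then show ?thesis using H_ge[of 0] by linarith
  qed
  have H: "4 * real CARD('d) / (a r * H) \<le> 1 / (8 * ?\<Omega>)" if r: "r \<le> J" for r
  proof -
    have "32 * real CARD('d) * ?\<Omega> \<le> a r * H" using H_ge[OF r] a[OF r] by (simp add: pos_divide_le_eq mult.commute)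
    then show ?thesis using a[OF r] H0 \<Omega>1 by (simp add: divide_le_eq le_divide_eq mult_ac)
  qed
  \<comment> \<open>The lower bound c of the lifetime lets the boundary terms 1 / x + 1 / (1 - x) be
    absorbed: each is at most its multiple by lam / c, so every coordinate contributes one factor
    lam.\<close>
  define C2 where "C2 = (\<Sum>r=0..J. \<bar>w r\<bar> * (6 / cf * (\<Prod>j\<in>UNIV. (1 / (x $ j) + 1 / (1 - x $ j)) / c + a r)))"
  have g0: "0 \<le> 1 / (x $ j) + 1 / (1 - x $ j)" for j using xj[of j] by simp
  have C2: "0 \<le> C2"
  proof -
    have "0 \<le> (1 / (x $ j) + 1 / (1 - x $ j)) / c + a r" if "r \<le> J" for r j
      by (rule add_nonneg_nonneg[OF divide_nonneg_nonneg[OF g0] less_imp_le[OF a[OF that]]]) (use c in simp)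
    then show ?thesis
      unfolding C2_def using R.pos by (intro sum_nonneg mult_nonneg_nonneg prod_nonneg) (auto simp: less_imp_le)
  qed
  have C2_bound: "(\<Sum>r=0..J. \<bar>w r\<bar> * (6 / (real n * cf) * (\<Prod>j\<in>UNIV. 1 / (x $ j) + 1 / (1 - x $ j) + a r * lam n)))
      \<le> C2 * (lam n ^ CARD('d) / real n)" if n: "1 \<le> n" for n
  proof -
    have "\<bar>w r\<bar> * (6 / (real n * cf) * (\<Prod>j\<in>UNIV. 1 / (x $ j) + 1 / (1 - x $ j) + a r * lam n)) \<le>
        \<bar>w r\<bar> * (6 / cf * (\<Prod>j\<in>UNIV. (1 / (x $ j) + 1 / (1 - x $ j)) / c + a r)) * (lam n ^ CARD('d) / real n)"
      if r: "r \<in> {0..J}" for r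
    proof -
      have l: "1 \<le> lam n / c" using c(1) c(2)[OF n] by simp
      have "(\<Prod>j\<in>UNIV. 1 / (x $ j) + 1 / (1 - x $ j) + a r * lam n) \<le> (\<Prod>j\<in>UNIV. ((1 / (x $ j) + 1 / (1 - x $ j)) / c + a r) * lam n)"
      proof (intro prod_mono conjI)
        fix j
        show "0 \<le> 1 / (x $ j) + 1 / (1 - x $ j) + a r * lam n"
          using a[of r] r c(1) c(2)[OF n] by (intro add_nonneg_nonneg[OF g0] mult_nonneg_nonneg) auto
        have "g + a r * l \<le> (g / c + a r) * l" if "g * 1 \<le> g * (l / c)" for g l :: real
          using that by (simp add: distrib_right)
        then show "1 / (x $ j) + 1 / (1 - x $ j) + a r * lam n \<le> ((1 / (x $ j) + 1 / (1 - x $ j)) / c + a r) * lam n"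
          using mult_left_mono[OF l g0] by blast
      qed
      also have "\<dots> = (\<Prod>j\<in>UNIV. (1 / (x $ j) + 1 / (1 - x $ j)) / c + a r) * lam n ^ CARD('d)" by (simp add: prod.distrib)
      finally have "\<bar>w r\<bar> * (6 / (real n * cf)) * (\<Prod>j\<in>UNIV. 1 / (x $ j) + 1 / (1 - x $ j) + a r * lam n) \<le>
          \<bar>w r\<bar> * (6 / (real n * cf)) * ((\<Prod>j\<in>UNIV. (1 / (x $ j) + 1 / (1 - x $ j)) / c + a r) * lam n ^ CARD('d))"
        using R.pos by (intro mult_left_mono) auto
      then show ?thesis by (simp add: mult_ac)
    qed
    then show ?thesis unfolding C2_def sum_distrib_right by (rule sum_mono)
  qed
  define C where "C = 4 * C2 + 1 / (Cf * (2 * H) ^ CARD('d)) + real (Suc J) * (8 * ?\<Omega>)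
        + C1 * (1 / sqrt (c0 / (8 * (Cf * (2 * H) ^ CARD('d))))) powr d * (1 + C2)"
  show ?thesis
    unfolding lesssim_def
  proof (intro exI[of _ "max 1 C"] allI impI cSUP_least)
    fix n :: nat and t :: real assume n: "1 \<le> n"
    \<comment> \<open>The experiment is instantiated at one n, after the constant has been
      fixed.\<close>
    interpret F: forest_experiment P \<psi> "distr P borel fst" "uniform_measure lborel {0..1}" d \<mu>' \<sigma>' C0 c0 cf Cf K
      "M n" n "B n" J a w "lam n" "X n" "Y n" "T n" x
      by unfold_locales (use assms(10-12,16) n a w in auto)
    let ?p = "measure (M n) {\<omega> \<in> space (M n).
        sqrt (real n / lam n ^ CARD('d)) * ((est n \<omega> - real_cond_exp (M n) (G n) (est n) \<omega>) / sqrt (Sig n \<omega>)) \<le> t}"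
    let ?r = "lam n ^ CARD('d) / real n"
    have r0: "0 < ?r" using F.lam n by simp
    show "\<bar>?p - cdf std_normal_distribution t\<bar> \<le> max 1 C * (?r powr (min 1 \<delta> / 2) + 1 / real (B n))"
    \<comment> \<open>For ?r > 1 the rate itself exceeds 1, the trivial bound for a difference of
      distribution functions; this is why the constant is at least 1.\<close>
    proof (cases "?r \<le> 1")
      case True
      have "\<bar>?p - cdf std_normal_distribution t\<bar> \<le> C * (?r powr (d / 2) + 1 / real (B n))"
        unfolding C_def Sig_def est_def G_def
        by (rule F.normal_approx[OF d C1 BE H0 H C2_bound[OF n] C2 True])
      also have "\<dots> \<le> max 1 C * (?r powr (d / 2) + 1 / real (B n))" by (intro mult_right_mono) auto
      finally show ?thesis unfolding d_def .
    next
      case False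
      have "\<bar>?p - cdf std_normal_distribution t\<bar> \<le> 1"
        unfolding cdf_def by (rule abs_prob_diff_le_1[OF F.M.prob_space_axioms prob_space_normal_density]) simp
      also have "1 \<le> ?r powr (d / 2)" using False d by (intro ge_one_powr_ge_zero) auto
      also have "\<dots> \<le> 1 * (?r powr (d / 2) + 1 / real (B n))" by simp
      also have "\<dots> \<le> max 1 C * (?r powr (d / 2) + 1 / real (B n))" by (intro mult_right_mono) auto
      finally show ?thesis unfolding d_def .
    qed
  qed simp
qed

end
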